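(* Let $d\in\{7,8\}$ and let $M$ be a smooth $d$-manifold with a $G_2$-structure $\Theta$ ($d=7$) or a $Spin(7)$-structure $\Phi$ ($d=8$), induced metric $g$, a smooth function $\phi$ (dilaton), a three-form $H$, a real vector bundle $E$ with fibre metric and a metric connection $A$ with curvature $F^A$, and a metric connection $\nabla$ on $TM$ with curvature $R$. Suppose that the heterotic Killing spinor equations hold (see context) and that the anomaly cancellation condition $$dH=2\pi^2\alpha'\big(p_1(\nabla)-p_1(A)\big),\qquad \alpha'>0,$$ holds. Put $\Psi=-*\Theta$ if $d=7$ and $\Psi=-\Phi$ if $d=8$. Then the Einstein equation of motion $$Ric^g_{ij}-\tfrac14H_{imn}H_j{}^{mn}+2\nabla^g_i\nabla^g_j\phi-\tfrac{\alpha'}{8}\Big[(F^A)_{imab}(F^A)_j{}^{mab}-R_{imnq}R_j{}^{mnq}\Big]=0$$ holds if and only if $$\frac16\Big[R_{mjab}R_{klab}+R_{mkab}R_{ljab}+R_{mlab}R_{jkab}\Big]\Psi_{jkln}=-R_{mpqr}R_n{}^{pqr}.$$ In particular, if $R$ is an instanton then the last identity holds.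
   Context: All indices are with respect to local orthonormal frames, and repeated indices are summed over their full range. $\nabla^g$ is the Levi-Civita connection, and $Ric^g$ its Ricci tensor. For a connection with curvature 2-forms $\Omega^i_j$, $R_{ijkl}=g(R(E_i,E_j)E_k,E_l)$, i.e. the first two indices are the 2-form indices. For a metric connection, $p_1=\frac{1}{8\pi^2}\sum_{i<j}\Omega^i_j\wedge\Omega^i_j$ (also for $A$, with respect to an orthonormal frame of $E$, the curvature components being $(F^A)_{mnab}$ with $m,n$ the 2-form indices and $a,b$ the bundle indices). $G_2$-structure: a 3-form $\Theta$ locally of the form $e^{127}-e^{236}+e^{347}+e^{567}-e^{146}-e^{245}+e^{135}$ in an oriented orthonormal coframe ($e^{ijk}=e^i\wedge e^j\wedge e^k$); $*\Theta=e^{3456}+e^{1457}+e^{1256}+e^{1234}+e^{2357}+e^{1367}-e^{2467}$; Lee form $\theta^7=-\frac13*( *d\Theta\wedge\Theta)$. $Spin(7)$-structure: a 4-form locally of the form $\Phi=e^{1238}-e^{1347}+e^{1458}+e^{1678}-e^{1257}-e^{1356}+e^{1246}+e^{4567}+e^{2568}+e^{2367}+e^{2345}+e^{3468}+e^{2478}-e^{3578}$; Lee form $\theta^8=-\frac17*( *d\Phi\wedge\Phi)$. The heterotic Killing spinor equations are: there is a nonzero real spinor $\epsilon$ (the one defining the $G_2$- or $Spin(7)$-structure) with $\nabla^+\epsilon=0$, $(d\phi-\frac12H)\cdot\epsilon=0$, $F^A\cdot\epsilon=0$, where $\nabla^+=\nabla^g+\frac12H$, i.e. $g(\nabla^+_XY,Z)=g(\nabla^g_XY,Z)+\frac12H(X,Y,Z)$.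 By known results they mean the following. For $d=7$: $d*\Theta=\theta^7\wedge*\Theta$, $d\Theta\wedge\Theta=0$, $\theta^7=2d\phi$, $H=-*d\Theta+2*(d\phi\wedge\Theta)$, and $A$ is a $G_2$-instanton. For $d=8$: $\theta^8=\frac{12}{7}d\phi$, $H=*d\Phi-2*(d\phi\wedge\Phi)$, and $A$ is a $Spin(7)$-instanton. A curvature $F$ (of $A$ or of $\nabla$) is an instanton if its 2-form part satisfies $F_{mn}=-\frac12F_{pq}( *\Theta)_{pqmn}$ ($d=7$), resp. $F_{mn}=-\frac12F_{pq}\Phi_{pqmn}$ ($d=8$). *)

theory Defs
  imports "HOL-Analysis.Analysis" "HOL-Combinatorics.Permutations"
begin

section \<open>Smooth manifolds\<close>

fun Ck_on :: "nat \<Rightarrow> ('a::euclidean_space \<Rightarrow> 'b::real_normed_vector) \<Rightarrow> 'a set \<Rightarrow> bool" where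
  "Ck_on 0 f S \<longleftrightarrow> continuous_on S f"
| "Ck_on (Suc k) f S \<longleftrightarrow>
     (\<forall>x\<in>S. f differentiable at x) \<and> (\<forall>v. Ck_on k (\<lambda>x. frechet_derivative f (at x) v) S)"

text \<open>Only meaningful on open sets.\<close>

definition smooth_on :: "('a::euclidean_space \<Rightarrow> 'b::real_normed_vector) \<Rightarrow> 'a set \<Rightarrow> bool" where
  "smooth_on f S \<longleftrightarrow> (\<forall>k. Ck_on k f S)"

text \<open>A chart is a pair of a domain and a coordinate map. The manifold is the type \<open>'m\<close>, its
  dimension is \<open>DIM('a)\<close>.\<close>

type_synonym ('m, 'a) chart = "'m set \<times> ('m \<Rightarrow> 'a)"

definition smooth_atlas ::
    "('m::{t2_space, second_countable_topology}, 'a::euclidean_space) chart set \<Rightarrow> bool" where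
  "smooth_atlas \<A> \<longleftrightarrow>
     (\<Union>\<kappa>\<in>\<A>. fst \<kappa>) = UNIV \<and>
     (\<forall>(U, x)\<in>\<A>. open U \<and> open (x ` U) \<and> inj_on x U \<and>
        continuous_on U x \<and> continuous_on (x ` U) (inv_into U x)) \<and>
     (\<forall>(U, x)\<in>\<A>. \<forall>(V, y)\<in>\<A>. smooth_on (y \<circ> inv_into U x) (x ` (U \<inter> V)))"

definition smooth_fun ::
    "('m, 'a::euclidean_space) chart set \<Rightarrow> 'm set \<Rightarrow> ('m \<Rightarrow> 'b::real_normed_vector) \<Rightarrow> bool" where
  "smooth_fun \<A> W f \<longleftrightarrow> (\<forall>(U, x)\<in>\<A>. smooth_on (f \<circ> inv_into U x) (x ` (U \<inter> W)))"

text \<open>A tangent vector at \<open>p\<close> is given by its components \<open>v :: 'a\<close> in a chart around \<open>p\<close>;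
  \<open>cderiv \<kappa> f p v\<close> is the derivative of \<open>f\<close> at \<open>p\<close> along the tangent vector with components
  \<open>v\<close> in \<open>\<kappa>\<close>, and \<open>jac \<kappa> \<kappa>'\<close> turns components in \<open>\<kappa>\<close> into components in \<open>\<kappa>'\<close>.\<close>

definition cderiv ::
    "('m, 'a::euclidean_space) chart \<Rightarrow> ('m \<Rightarrow> 'b::real_normed_vector) \<Rightarrow> 'm \<Rightarrow> 'a \<Rightarrow> 'b" where
  "cderiv \<kappa> f p v = frechet_derivative (f \<circ> inv_into (fst \<kappa>) (snd \<kappa>)) (at (snd \<kappa> p)) v"

definition jac ::
    "('m, 'a::euclidean_space) chart \<Rightarrow> ('m, 'a) chart \<Rightarrow> 'm \<Rightarrow> 'a \<Rightarrow> 'a" where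
  "jac \<kappa> \<kappa>' = cderiv \<kappa> (snd \<kappa>')"


section \<open>Vector bundles, fibre metrics and connections\<close>

text \<open>A real vector bundle of rank \<open>DIM('f)\<close> is presented by local trivialisations over the
  members \<open>U j\<close> (\<open>j \<in> J\<close>) of an open cover and its transition functions:
  the element with components \<open>s\<close> in the trivialisation \<open>j\<close> has components
  \<open>t j k p s\<close> in the trivialisation \<open>k\<close>. The tangent bundle is
  \<open>J = \<A>\<close>, \<open>U = fst\<close>, \<open>t = jac\<close>.\<close>

definition vector_bundle ::
    "('m::topological_space, 'a::euclidean_space) chart set \<Rightarrow> 'j set \<Rightarrow> ('j \<Rightarrow> 'm set) \<Rightarrow>
     ('j \<Rightarrow> 'j \<Rightarrow> 'm \<Rightarrow> 'f \<Rightarrow> 'f::euclidean_space) \<Rightarrow> bool" where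
  "vector_bundle \<A> J U t \<longleftrightarrow>
     (\<forall>j\<in>J. open (U j)) \<and> (\<Union>j\<in>J. U j) = UNIV \<and>
     (\<forall>j\<in>J. \<forall>k\<in>J. (\<forall>p\<in>U j \<inter> U k. linear (t j k p)) \<and>
        (\<forall>s. smooth_fun \<A> (U j \<inter> U k) (\<lambda>p. t j k p s))) \<and>
     (\<forall>j\<in>J. \<forall>p\<in>U j. \<forall>s. t j j p s = s) \<and>
     (\<forall>j\<in>J. \<forall>k\<in>J. \<forall>l\<in>J. \<forall>p\<in>U j \<inter> U k \<inter> U l. \<forall>s. t k l p (t j k p s) = t j l p s)"

definition fibre_metric ::
    "('m, 'a::euclidean_space) chart set \<Rightarrow> 'j set \<Rightarrow> ('j \<Rightarrow> 'm set) \<Rightarrow>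
     ('j \<Rightarrow> 'j \<Rightarrow> 'm \<Rightarrow> 'f \<Rightarrow> 'f::euclidean_space) \<Rightarrow> ('j \<Rightarrow> 'm \<Rightarrow> 'f \<Rightarrow> 'f \<Rightarrow> real) \<Rightarrow> bool" where
  "fibre_metric \<A> J U t h \<longleftrightarrow>
     (\<forall>j\<in>J. \<forall>p\<in>U j. bilinear (h j p) \<and> (\<forall>r s. h j p r s = h j p s r) \<and>
        (\<forall>s. s \<noteq> 0 \<longrightarrow> h j p s s > 0)) \<and>
     (\<forall>j\<in>J. \<forall>r s. smooth_fun \<A> (U j) (\<lambda>p. h j p r s)) \<and>
     (\<forall>j\<in>J. \<forall>k\<in>J. \<forall>p\<in>U j \<inter> U k. \<forall>r s. h k p (t j k p r) (t j k p s) = h j p r s)"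

text \<open>The local connection form \<open>A \<kappa> j\<close> of a connection refers to a chart \<open>\<kappa>\<close> for the
  direction \<open>v\<close> and to a trivialisation \<open>j\<close> for the section:
  \<open>\<nabla>\<^sub>v s = cderiv \<kappa> s p v + A \<kappa> j p v (s p)\<close>. The last clause says that these local
  formulas define the same covariant derivative.\<close>

definition bundle_connection ::
    "('m, 'a::euclidean_space) chart set \<Rightarrow> 'j set \<Rightarrow> ('j \<Rightarrow> 'm set) \<Rightarrow>
     ('j \<Rightarrow> 'j \<Rightarrow> 'm \<Rightarrow> 'f \<Rightarrow> 'f::euclidean_space) \<Rightarrow>
     (('m, 'a) chart \<Rightarrow> 'j \<Rightarrow> 'm \<Rightarrow> 'a \<Rightarrow> 'f \<Rightarrow> 'f) \<Rightarrow> bool" where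
  "bundle_connection \<A> J U t A \<longleftrightarrow>
     (\<forall>\<kappa>\<in>\<A>. \<forall>j\<in>J. (\<forall>p\<in>fst \<kappa> \<inter> U j. bilinear (A \<kappa> j p)) \<and>
        (\<forall>v s. smooth_fun \<A> (fst \<kappa> \<inter> U j) (\<lambda>p. A \<kappa> j p v s))) \<and>
     (\<forall>\<kappa>\<in>\<A>. \<forall>\<kappa>'\<in>\<A>. \<forall>j\<in>J. \<forall>k\<in>J. \<forall>p\<in>fst \<kappa> \<inter> fst \<kappa>' \<inter> U j \<inter> U k. \<forall>v s.
        t j k p (A \<kappa> j p v s) =
          cderiv \<kappa> (\<lambda>q. t j k q s) p v + A \<kappa>' k p (jac \<kappa> \<kappa>' p v) (t j k p s))"

definition metric_connection ::
    "('m, 'a::euclidean_space) chart set \<Rightarrow> 'j set \<Rightarrow> ('j \<Rightarrow> 'm set) \<Rightarrow>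
     ('j \<Rightarrow> 'j \<Rightarrow> 'm \<Rightarrow> 'f \<Rightarrow> 'f::euclidean_space) \<Rightarrow> ('j \<Rightarrow> 'm \<Rightarrow> 'f \<Rightarrow> 'f \<Rightarrow> real) \<Rightarrow>
     (('m, 'a) chart \<Rightarrow> 'j \<Rightarrow> 'm \<Rightarrow> 'a \<Rightarrow> 'f \<Rightarrow> 'f) \<Rightarrow> bool" where
  "metric_connection \<A> J U t h A \<longleftrightarrow> bundle_connection \<A> J U t A \<and>
     (\<forall>\<kappa>\<in>\<A>. \<forall>j\<in>J. \<forall>p\<in>fst \<kappa> \<inter> U j. \<forall>v r s.
        cderiv \<kappa> (\<lambda>q. h j q r s) p v = h j p (A \<kappa> j p v r) s + h j p r (A \<kappa> j p v s))"

text \<open>The curvature \<open>R(u, v) s\<close>, i.e. the commutator of the covariant derivatives along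
  coordinate-constant \<open>u\<close> and \<open>v\<close>.\<close>

definition curvature ::
    "('m, 'a::euclidean_space) chart \<Rightarrow> ('m \<Rightarrow> 'a \<Rightarrow> 'f \<Rightarrow> 'f::euclidean_space) \<Rightarrow>
     'm \<Rightarrow> 'a \<Rightarrow> 'a \<Rightarrow> 'f \<Rightarrow> 'f" where
  "curvature \<kappa> A p u v s =
     cderiv \<kappa> (\<lambda>q. A q v s) p u - cderiv \<kappa> (\<lambda>q. A q u s) p v + A p u (A p v s) - A p v (A p u s)"

abbreviation riemannian_metric ::
    "('m, 'a::euclidean_space) chart set \<Rightarrow> (('m, 'a) chart \<Rightarrow> 'm \<Rightarrow> 'a \<Rightarrow> 'a \<Rightarrow> real) \<Rightarrow> bool" where
  "riemannian_metric \<A> g \<equiv> fibre_metric \<A> \<A> fst jac g"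

abbreviation metric_connection_TM ::
    "('m, 'a::euclidean_space) chart set \<Rightarrow> (('m, 'a) chart \<Rightarrow> 'm \<Rightarrow> 'a \<Rightarrow> 'a \<Rightarrow> real) \<Rightarrow>
     (('m, 'a) chart \<Rightarrow> ('m, 'a) chart \<Rightarrow> 'm \<Rightarrow> 'a \<Rightarrow> 'a \<Rightarrow> 'a) \<Rightarrow> bool" where
  "metric_connection_TM \<A> g N \<equiv> metric_connection \<A> \<A> fst jac g N"

definition levi_civita ::
    "('m, 'a::euclidean_space) chart set \<Rightarrow> (('m, 'a) chart \<Rightarrow> 'm \<Rightarrow> 'a \<Rightarrow> 'a \<Rightarrow> real) \<Rightarrow>
     (('m, 'a) chart \<Rightarrow> ('m, 'a) chart \<Rightarrow> 'm \<Rightarrow> 'a \<Rightarrow> 'a \<Rightarrow> 'a) \<Rightarrow> bool" where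
  "levi_civita \<A> g N \<longleftrightarrow> metric_connection_TM \<A> g N \<and>
     (\<forall>\<kappa>\<in>\<A>. \<forall>p\<in>fst \<kappa>. \<forall>u v. N \<kappa> \<kappa> p u v = N \<kappa> \<kappa> p v u)"

text \<open>Frames are indexed by \<open>1, \<dots>, DIM('f)\<close>.\<close>

definition orthonormal :: "('f::euclidean_space \<Rightarrow> 'f \<Rightarrow> real) \<Rightarrow> (nat \<Rightarrow> 'f) \<Rightarrow> bool" where
  "orthonormal b e \<longleftrightarrow>
     (\<forall>i\<in>{1..DIM('f)}. \<forall>j\<in>{1..DIM('f)}. b (e i) (e j) = (if i = j then 1 else 0))"


section \<open>Differential forms\<close>

text \<open>A \<open>k\<close>-form at a point is a function on lists of tangent vectors of which only the values on
  lists of length \<open>k\<close> matter; in an orthonormal frame \<open>H\<^sub>i\<^sub>j\<^sub>k\<close> is \<open>H [e i, e j, e k]\<close>.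
  Exterior products are normalised so that \<open>(\<alpha> \<and> \<beta>)(u, v) = \<alpha>(u)\<beta>(v) - \<alpha>(v)\<beta>(u)\<close>
  for 1-forms.\<close>

definition alternating_form :: "nat \<Rightarrow> ('a::euclidean_space list \<Rightarrow> real) \<Rightarrow> bool" where
  "alternating_form k \<alpha> \<longleftrightarrow> (\<forall>vs. length vs = k \<longrightarrow>
     (\<forall>i<k. linear (\<lambda>v. \<alpha> (vs[i := v]))) \<and> (\<not> distinct vs \<longrightarrow> \<alpha> vs = 0))"

definition smooth_form ::
    "('m, 'a::euclidean_space) chart set \<Rightarrow> nat \<Rightarrow> (('m, 'a) chart \<Rightarrow> 'm \<Rightarrow> 'a list \<Rightarrow> real) \<Rightarrow> bool" where
  "smooth_form \<A> k \<alpha> \<longleftrightarrow>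
     (\<forall>\<kappa>\<in>\<A>. (\<forall>p\<in>fst \<kappa>. alternating_form k (\<alpha> \<kappa> p)) \<and>
        (\<forall>vs. length vs = k \<longrightarrow> smooth_fun \<A> (fst \<kappa>) (\<lambda>p. \<alpha> \<kappa> p vs))) \<and>
     (\<forall>\<kappa>\<in>\<A>. \<forall>\<kappa>'\<in>\<A>. \<forall>p\<in>fst \<kappa> \<inter> fst \<kappa>'. \<forall>vs. length vs = k \<longrightarrow>
        \<alpha> \<kappa>' p (map (jac \<kappa> \<kappa>' p) vs) = \<alpha> \<kappa> p vs)"

definition ext_d ::
    "('m, 'a::euclidean_space) chart \<Rightarrow> ('m \<Rightarrow> 'a list \<Rightarrow> real) \<Rightarrow> 'm \<Rightarrow> 'a list \<Rightarrow> real" where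
  "ext_d \<kappa> \<alpha> p vs =
     (\<Sum>i<length vs. (-1) ^ i * cderiv \<kappa> (\<lambda>q. \<alpha> q (take i vs @ drop (Suc i) vs)) p (vs ! i))"

definition d_fun ::
    "('m, 'a::euclidean_space) chart \<Rightarrow> ('m \<Rightarrow> real) \<Rightarrow> 'm \<Rightarrow> 'a list \<Rightarrow> real" where
  "d_fun \<kappa> \<phi> p vs = cderiv \<kappa> \<phi> p (hd vs)"

definition wedge ::
    "nat \<Rightarrow> nat \<Rightarrow> ('a list \<Rightarrow> real) \<Rightarrow> ('a list \<Rightarrow> real) \<Rightarrow> 'a list \<Rightarrow> real" where
  "wedge k l \<alpha> \<beta> vs = 1 / (fact k * fact l) *
     (\<Sum>\<sigma> | \<sigma> permutes {..<k + l}. of_int (sign \<sigma>) *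
        \<alpha> (map (\<lambda>i. vs ! \<sigma> i) [0..<k]) * \<beta> (map (\<lambda>i. vs ! \<sigma> i) [k..<k + l]))"

text \<open>\<open>cof b e [i, \<dots>, j]\<close> is \<open>e\<^sup>i \<and> \<dots> \<and> e\<^sup>j\<close>, where the dual coframe of the
  \<open>b\<close>-orthonormal frame \<open>e\<close> is \<open>e\<^sup>i = b(e i, \<cdot>)\<close>.\<close>

definition cof :: "('a \<Rightarrow> 'a \<Rightarrow> real) \<Rightarrow> (nat \<Rightarrow> 'a) \<Rightarrow> nat list \<Rightarrow> 'a list \<Rightarrow> real" where
  "cof b e I vs =
     (\<Sum>\<sigma> | \<sigma> permutes {..<length I}. of_int (sign \<sigma>) * (\<Prod>i<length I. b (e (I ! i)) (vs ! \<sigma> i)))"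

text \<open>The Hodge star of a \<open>k\<close>-form, for the orientation in which the orthonormal frame \<open>e\<close> is
  positive.\<close>

definition hodge ::
    "('a::euclidean_space \<Rightarrow> 'a \<Rightarrow> real) \<Rightarrow> (nat \<Rightarrow> 'a) \<Rightarrow> nat \<Rightarrow> ('a list \<Rightarrow> real) \<Rightarrow> 'a list \<Rightarrow> real" where
  "hodge b e k \<alpha> vs = 1 / fact k *
     (\<Sum>I | length I = k \<and> set I \<subseteq> {1..DIM('a)}.
        \<alpha> (map e I) * cof b e [1..<Suc (DIM('a))] (map e I @ vs))"


section \<open>\<open>G\<^sub>2\<close>- and \<open>Spin(7)\<close>-structures\<close>

definition G2_form :: "('a \<Rightarrow> 'a \<Rightarrow> real) \<Rightarrow> (nat \<Rightarrow> 'a) \<Rightarrow> 'a list \<Rightarrow> real" where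
  "G2_form b e vs =
     cof b e [1,2,7] vs - cof b e [2,3,6] vs + cof b e [3,4,7] vs + cof b e [5,6,7] vs
     - cof b e [1,4,6] vs - cof b e [2,4,5] vs + cof b e [1,3,5] vs"

definition Spin7_form :: "('a \<Rightarrow> 'a \<Rightarrow> real) \<Rightarrow> (nat \<Rightarrow> 'a) \<Rightarrow> 'a list \<Rightarrow> real" where
  "Spin7_form b e vs =
     cof b e [1,2,3,8] vs - cof b e [1,3,4,7] vs + cof b e [1,4,5,8] vs + cof b e [1,6,7,8] vs
     - cof b e [1,2,5,7] vs - cof b e [1,3,5,6] vs + cof b e [1,2,4,6] vs + cof b e [4,5,6,7] vs
     + cof b e [2,5,6,8] vs + cof b e [2,3,6,7] vs + cof b e [2,3,4,5] vs + cof b e [3,4,6,8] vs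
     + cof b e [2,4,7,8] vs - cof b e [3,5,7,8] vs"

text \<open>\<open>e\<close> is a smooth \<open>g\<close>-orthonormal local frame on \<open>V\<close> (given by its components in \<open>\<kappa>\<close>) in
  which the \<open>k\<close>-form \<open>S\<close> has the standard expression \<open>std\<close>. For \<open>std = G2_form\<close> and
  \<open>std = Spin7_form\<close> such frames determine \<open>g\<close> and an orientation, in which they are
  positive; hence \<open>hodge\<close> with respect to any of them is the Hodge star of the structure.\<close>

definition adapted_frame ::
    "(('a::euclidean_space \<Rightarrow> 'a \<Rightarrow> real) \<Rightarrow> (nat \<Rightarrow> 'a) \<Rightarrow> 'a list \<Rightarrow> real) \<Rightarrow> nat \<Rightarrow>
     ('m::topological_space, 'a) chart set \<Rightarrow> (('m, 'a) chart \<Rightarrow> 'm \<Rightarrow> 'a \<Rightarrow> 'a \<Rightarrow> real) \<Rightarrow>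
     (('m, 'a) chart \<Rightarrow> 'm \<Rightarrow> 'a list \<Rightarrow> real) \<Rightarrow>
     ('m, 'a) chart \<Rightarrow> 'm set \<Rightarrow> ('m \<Rightarrow> nat \<Rightarrow> 'a) \<Rightarrow> bool" where
  "adapted_frame std k \<A> g S \<kappa> V e \<longleftrightarrow> \<kappa> \<in> \<A> \<and> open V \<and> V \<subseteq> fst \<kappa> \<and>
     (\<forall>i\<in>{1..DIM('a)}. smooth_fun \<A> V (\<lambda>p. e p i)) \<and>
     (\<forall>p\<in>V. orthonormal (g \<kappa> p) (e p) \<and>
        (\<forall>vs. length vs = k \<longrightarrow> S \<kappa> p vs = std (g \<kappa> p) (e p) vs))"

abbreviation "G2_frame \<equiv> adapted_frame G2_form 3"
abbreviation "Spin7_frame \<equiv> adapted_frame Spin7_form 4"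

definition G2_structure ::
    "('m::topological_space, 'a::euclidean_space) chart set \<Rightarrow>
     (('m, 'a) chart \<Rightarrow> 'm \<Rightarrow> 'a \<Rightarrow> 'a \<Rightarrow> real) \<Rightarrow> (('m, 'a) chart \<Rightarrow> 'm \<Rightarrow> 'a list \<Rightarrow> real) \<Rightarrow> bool" where
  "G2_structure \<A> g \<Theta> \<longleftrightarrow> riemannian_metric \<A> g \<and> smooth_form \<A> 3 \<Theta> \<and>
     (\<forall>\<kappa>\<in>\<A>. \<forall>p\<in>fst \<kappa>. \<exists>V e. p \<in> V \<and> G2_frame \<A> g \<Theta> \<kappa> V e)"

definition Spin7_structure ::
    "('m::topological_space, 'a::euclidean_space) chart set \<Rightarrow>
     (('m, 'a) chart \<Rightarrow> 'm \<Rightarrow> 'a \<Rightarrow> 'a \<Rightarrow> real) \<Rightarrow> (('m, 'a) chart \<Rightarrow> 'm \<Rightarrow> 'a list \<Rightarrow> real) \<Rightarrow> bool" where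
  "Spin7_structure \<A> g \<Phi> \<longleftrightarrow> riemannian_metric \<A> g \<and> smooth_form \<A> 4 \<Phi> \<and>
     (\<forall>\<kappa>\<in>\<A>. \<forall>p\<in>fst \<kappa>. \<exists>V e. p \<in> V \<and> Spin7_frame \<A> g \<Phi> \<kappa> V e)"


section \<open>Instantons and the heterotic Killing spinor equations\<close>

text \<open>\<open>W\<close> is \<open>*\<Theta>\<close> resp. \<open>\<Phi>\<close>.\<close>

definition instanton_at ::
    "('a::euclidean_space list \<Rightarrow> real) \<Rightarrow> (nat \<Rightarrow> 'a) \<Rightarrow>
     ('a \<Rightarrow> 'a \<Rightarrow> 'f \<Rightarrow> 'f::real_vector) \<Rightarrow> bool" where
  "instanton_at W e F \<longleftrightarrow> (\<forall>m\<in>{1..DIM('a)}. \<forall>n\<in>{1..DIM('a)}. \<forall>s.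
     F (e m) (e n) s =
       - (1/2) *\<^sub>R (\<Sum>p=1..DIM('a). \<Sum>q=1..DIM('a). W [e p, e q, e m, e n] *\<^sub>R F (e p) (e q) s))"

definition G2_instanton ::
    "('m::topological_space, 'a::euclidean_space) chart set \<Rightarrow>
     (('m, 'a) chart \<Rightarrow> 'm \<Rightarrow> 'a \<Rightarrow> 'a \<Rightarrow> real) \<Rightarrow> (('m, 'a) chart \<Rightarrow> 'm \<Rightarrow> 'a list \<Rightarrow> real) \<Rightarrow>
     'j set \<Rightarrow> ('j \<Rightarrow> 'm set) \<Rightarrow>
     (('m, 'a) chart \<Rightarrow> 'j \<Rightarrow> 'm \<Rightarrow> 'a \<Rightarrow> 'f \<Rightarrow> 'f::euclidean_space) \<Rightarrow> bool" where
  "G2_instanton \<A> g \<Theta> J U A \<longleftrightarrow>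
     (\<forall>\<kappa> V e. G2_frame \<A> g \<Theta> \<kappa> V e \<longrightarrow> (\<forall>j\<in>J. \<forall>p\<in>V \<inter> U j.
        instanton_at (hodge (g \<kappa> p) (e p) 3 (\<Theta> \<kappa> p)) (e p) (curvature \<kappa> (A \<kappa> j) p)))"

definition Spin7_instanton ::
    "('m::topological_space, 'a::euclidean_space) chart set \<Rightarrow>
     (('m, 'a) chart \<Rightarrow> 'm \<Rightarrow> 'a \<Rightarrow> 'a \<Rightarrow> real) \<Rightarrow> (('m, 'a) chart \<Rightarrow> 'm \<Rightarrow> 'a list \<Rightarrow> real) \<Rightarrow>
     'j set \<Rightarrow> ('j \<Rightarrow> 'm set) \<Rightarrow>
     (('m, 'a) chart \<Rightarrow> 'j \<Rightarrow> 'm \<Rightarrow> 'a \<Rightarrow> 'f \<Rightarrow> 'f::euclidean_space) \<Rightarrow> bool" where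
  "Spin7_instanton \<A> g \<Phi> J U A \<longleftrightarrow>
     (\<forall>\<kappa> V e. Spin7_frame \<A> g \<Phi> \<kappa> V e \<longrightarrow> (\<forall>j\<in>J. \<forall>p\<in>V \<inter> U j.
        instanton_at (\<Phi> \<kappa> p) (e p) (curvature \<kappa> (A \<kappa> j) p)))"

abbreviation "G2_instanton_TM \<A> g \<Theta> N \<equiv> G2_instanton \<A> g \<Theta> \<A> fst N"
abbreviation "Spin7_instanton_TM \<A> g \<Phi> N \<equiv> Spin7_instanton \<A> g \<Phi> \<A> fst N"

text \<open>The Lee forms \<open>\<theta>\<^sup>7 = -1/3 *(*d\<Theta> \<and> \<Theta>)\<close> and \<open>\<theta>\<^sup>8 = -1/7 *(*d\<Phi> \<and> \<Phi>)\<close>; the frame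
  \<open>e\<close> serves only to express the Hodge star.\<close>

definition Lee7 ::
    "(('m, 'a::euclidean_space) chart \<Rightarrow> 'm \<Rightarrow> 'a \<Rightarrow> 'a \<Rightarrow> real) \<Rightarrow>
     (('m, 'a) chart \<Rightarrow> 'm \<Rightarrow> 'a list \<Rightarrow> real) \<Rightarrow> ('m, 'a) chart \<Rightarrow>
     ('m \<Rightarrow> nat \<Rightarrow> 'a) \<Rightarrow> 'm \<Rightarrow> 'a list \<Rightarrow> real" where
  "Lee7 g \<Theta> \<kappa> e p vs = - (1/3) * hodge (g \<kappa> p) (e p) 6
     (wedge 3 3 (hodge (g \<kappa> p) (e p) 4 (ext_d \<kappa> (\<Theta> \<kappa>) p)) (\<Theta> \<kappa> p)) vs"

definition Lee8 ::
    "(('m, 'a::euclidean_space) chart \<Rightarrow> 'm \<Rightarrow> 'a \<Rightarrow> 'a \<Rightarrow> real) \<Rightarrow>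
     (('m, 'a) chart \<Rightarrow> 'm \<Rightarrow> 'a list \<Rightarrow> real) \<Rightarrow> ('m, 'a) chart \<Rightarrow>
     ('m \<Rightarrow> nat \<Rightarrow> 'a) \<Rightarrow> 'm \<Rightarrow> 'a list \<Rightarrow> real" where
  "Lee8 g \<Phi> \<kappa> e p vs = - (1/7) * hodge (g \<kappa> p) (e p) 7
     (wedge 3 4 (hodge (g \<kappa> p) (e p) 5 (ext_d \<kappa> (\<Phi> \<kappa>) p)) (\<Phi> \<kappa> p)) vs"

text \<open>The Killing spinor equations \<open>\<nabla>\<^sup>+\<epsilon> = 0\<close>, \<open>(d\<phi> - 1/2 H)\<cdot>\<epsilon> = 0\<close>, \<open>F\<^sup>A\<cdot>\<epsilon> = 0\<close> for
  the spinor \<open>\<epsilon>\<close> defining the structure, expressed through the structure form; here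
  \<open>\<nabla>\<^sup>+ = \<nabla>\<^sup>g + 1/2 H\<close>. In dimension 7:
  \<open>d*\<Theta> = \<theta>\<^sup>7 \<and> *\<Theta>\<close>, \<open>d\<Theta> \<and> \<Theta> = 0\<close>, \<open>\<theta>\<^sup>7 = 2d\<phi>\<close>, \<open>H = -*d\<Theta> + 2*(d\<phi> \<and> \<Theta>)\<close>.
  In dimension 8: \<open>\<theta>\<^sup>8 = 12/7 d\<phi>\<close>, \<open>H = *d\<Phi> - 2*(d\<phi> \<and> \<Phi>)\<close>.\<close>

definition G2_Killing_spinor_equations ::
    "('m::topological_space, 'a::euclidean_space) chart set \<Rightarrow>
     (('m, 'a) chart \<Rightarrow> 'm \<Rightarrow> 'a \<Rightarrow> 'a \<Rightarrow> real) \<Rightarrow> (('m, 'a) chart \<Rightarrow> 'm \<Rightarrow> 'a list \<Rightarrow> real) \<Rightarrow>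
     ('m \<Rightarrow> real) \<Rightarrow> (('m, 'a) chart \<Rightarrow> 'm \<Rightarrow> 'a list \<Rightarrow> real) \<Rightarrow> 'j set \<Rightarrow> ('j \<Rightarrow> 'm set) \<Rightarrow>
     (('m, 'a) chart \<Rightarrow> 'j \<Rightarrow> 'm \<Rightarrow> 'a \<Rightarrow> 'f \<Rightarrow> 'f::euclidean_space) \<Rightarrow> bool" where
  "G2_Killing_spinor_equations \<A> g \<Theta> \<phi> H J U A \<longleftrightarrow>
     (\<forall>\<kappa> V e. G2_frame \<A> g \<Theta> \<kappa> V e \<longrightarrow> (\<forall>p\<in>V. \<forall>vs.
        (length vs = 5 \<longrightarrow>
           ext_d \<kappa> (\<lambda>q. hodge (g \<kappa> q) (e q) 3 (\<Theta> \<kappa> q)) p vs =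
             wedge 1 4 (Lee7 g \<Theta> \<kappa> e p) (hodge (g \<kappa> p) (e p) 3 (\<Theta> \<kappa> p)) vs) \<and>
        (length vs = 7 \<longrightarrow> wedge 4 3 (ext_d \<kappa> (\<Theta> \<kappa>) p) (\<Theta> \<kappa> p) vs = 0) \<and>
        (length vs = 1 \<longrightarrow> Lee7 g \<Theta> \<kappa> e p vs = 2 * d_fun \<kappa> \<phi> p vs) \<and>
        (length vs = 3 \<longrightarrow>
           H \<kappa> p vs = - hodge (g \<kappa> p) (e p) 4 (ext_d \<kappa> (\<Theta> \<kappa>) p) vs
             + 2 * hodge (g \<kappa> p) (e p) 4 (wedge 1 3 (d_fun \<kappa> \<phi> p) (\<Theta> \<kappa> p)) vs))) \<and>
     G2_instanton \<A> g \<Theta> J U A"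

definition Spin7_Killing_spinor_equations ::
    "('m::topological_space, 'a::euclidean_space) chart set \<Rightarrow>
     (('m, 'a) chart \<Rightarrow> 'm \<Rightarrow> 'a \<Rightarrow> 'a \<Rightarrow> real) \<Rightarrow> (('m, 'a) chart \<Rightarrow> 'm \<Rightarrow> 'a list \<Rightarrow> real) \<Rightarrow>
     ('m \<Rightarrow> real) \<Rightarrow> (('m, 'a) chart \<Rightarrow> 'm \<Rightarrow> 'a list \<Rightarrow> real) \<Rightarrow> 'j set \<Rightarrow> ('j \<Rightarrow> 'm set) \<Rightarrow>
     (('m, 'a) chart \<Rightarrow> 'j \<Rightarrow> 'm \<Rightarrow> 'a \<Rightarrow> 'f \<Rightarrow> 'f::euclidean_space) \<Rightarrow> bool" where
  "Spin7_Killing_spinor_equations \<A> g \<Phi> \<phi> H J U A \<longleftrightarrow>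
     (\<forall>\<kappa> V e. Spin7_frame \<A> g \<Phi> \<kappa> V e \<longrightarrow> (\<forall>p\<in>V. \<forall>vs.
        (length vs = 1 \<longrightarrow> Lee8 g \<Phi> \<kappa> e p vs = 12/7 * d_fun \<kappa> \<phi> p vs) \<and>
        (length vs = 3 \<longrightarrow>
           H \<kappa> p vs = hodge (g \<kappa> p) (e p) 5 (ext_d \<kappa> (\<Phi> \<kappa>) p) vs
             - 2 * hodge (g \<kappa> p) (e p) 5 (wedge 1 4 (d_fun \<kappa> \<phi> p) (\<Phi> \<kappa> p)) vs))) \<and>
     Spin7_instanton \<A> g \<Phi> J U A"


section \<open>Anomaly cancellation and the equations of motion\<close>

text \<open>\<open>8\<pi>\<^sup>2 p\<^sub>1 = \<Sum>\<^sub>i\<^sub><\<^sub>j \<Omega>\<^sup>i\<^sub>j \<and> \<Omega>\<^sup>i\<^sub>j\<close> with \<open>\<Omega>\<^sup>i\<^sub>j(u, v) = h(F(u, v) f\<^sub>j, f\<^sub>i)\<close>.\<close>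

definition p1_form ::
    "('f::euclidean_space \<Rightarrow> 'f \<Rightarrow> real) \<Rightarrow> (nat \<Rightarrow> 'f) \<Rightarrow>
     ('a::euclidean_space \<Rightarrow> 'a \<Rightarrow> 'f \<Rightarrow> 'f) \<Rightarrow> 'a list \<Rightarrow> real" where
  "p1_form h f F vs = 1 / (8 * pi\<^sup>2) *
     (\<Sum>i=1..DIM('f). \<Sum>j=Suc i..DIM('f).
        wedge 2 2 (\<lambda>us. h (F (us ! 0) (us ! 1) (f j)) (f i))
                  (\<lambda>us. h (F (us ! 0) (us ! 1) (f j)) (f i)) vs)"

definition anomaly_cancellation ::
    "('m, 'a::euclidean_space) chart set \<Rightarrow> (('m, 'a) chart \<Rightarrow> 'm \<Rightarrow> 'a \<Rightarrow> 'a \<Rightarrow> real) \<Rightarrow>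
     (('m, 'a) chart \<Rightarrow> 'm \<Rightarrow> 'a list \<Rightarrow> real) \<Rightarrow>
     (('m, 'a) chart \<Rightarrow> ('m, 'a) chart \<Rightarrow> 'm \<Rightarrow> 'a \<Rightarrow> 'a \<Rightarrow> 'a) \<Rightarrow>
     'j set \<Rightarrow> ('j \<Rightarrow> 'm set) \<Rightarrow> ('j \<Rightarrow> 'm \<Rightarrow> 'f \<Rightarrow> 'f::euclidean_space \<Rightarrow> real) \<Rightarrow>
     (('m, 'a) chart \<Rightarrow> 'j \<Rightarrow> 'm \<Rightarrow> 'a \<Rightarrow> 'f \<Rightarrow> 'f) \<Rightarrow> real \<Rightarrow> bool" where
  "anomaly_cancellation \<A> g H N J U h A \<alpha>' \<longleftrightarrow>
     (\<forall>\<kappa>\<in>\<A>. \<forall>j\<in>J. \<forall>p\<in>fst \<kappa> \<inter> U j. \<forall>e f. orthonormal (g \<kappa> p) e \<longrightarrow> orthonormal (h j p) f \<longrightarrow>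
        (\<forall>vs. length vs = 4 \<longrightarrow>
           ext_d \<kappa> (H \<kappa>) p vs = 2 * pi\<^sup>2 * \<alpha>' *
             (p1_form (g \<kappa> p) e (curvature \<kappa> (N \<kappa> \<kappa>) p) vs
              - p1_form (h j p) f (curvature \<kappa> (A \<kappa> j) p) vs)))"

text \<open>\<open>Ric(v, w)\<close> is the trace of \<open>u \<mapsto> R(u, v) w\<close>.\<close>

definition ricci ::
    "('a::euclidean_space \<Rightarrow> 'a \<Rightarrow> real) \<Rightarrow> (nat \<Rightarrow> 'a) \<Rightarrow> ('a \<Rightarrow> 'a \<Rightarrow> 'a \<Rightarrow> 'a) \<Rightarrow> 'a \<Rightarrow> 'a \<Rightarrow> real" where
  "ricci b e R v w = (\<Sum>k=1..DIM('a). b (R (e k) v w) (e k))"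

definition hessian ::
    "('m, 'a::euclidean_space) chart \<Rightarrow> ('m \<Rightarrow> 'a \<Rightarrow> 'a \<Rightarrow> 'a) \<Rightarrow> ('m \<Rightarrow> real) \<Rightarrow> 'm \<Rightarrow> 'a \<Rightarrow> 'a \<Rightarrow> real" where
  "hessian \<kappa> N \<phi> p u v = cderiv \<kappa> (\<lambda>q. cderiv \<kappa> \<phi> q v) p u - cderiv \<kappa> \<phi> p (N p u v)"

text \<open>\<open>comps b e f F i m a c\<close> is \<open>F\<^sub>i\<^sub>m\<^sub>a\<^sub>c\<close>: \<open>i, m\<close> are the 2-form indices, referring to the
  frame \<open>e\<close>, and \<open>a, c\<close> the bundle indices, referring to the \<open>b\<close>-orthonormal frame \<open>f\<close>.\<close>

definition comps ::
    "('f \<Rightarrow> 'f \<Rightarrow> real) \<Rightarrow> (nat \<Rightarrow> 'a) \<Rightarrow> (nat \<Rightarrow> 'f) \<Rightarrow> ('a \<Rightarrow> 'a \<Rightarrow> 'f \<Rightarrow> 'f) \<Rightarrow>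
     nat \<Rightarrow> nat \<Rightarrow> nat \<Rightarrow> nat \<Rightarrow> real" where
  "comps b e f F i m a c = b (F (e i) (e m) (f a)) (f c)"

definition Einstein_equation ::
    "('m, 'a::euclidean_space) chart set \<Rightarrow> (('m, 'a) chart \<Rightarrow> 'm \<Rightarrow> 'a \<Rightarrow> 'a \<Rightarrow> real) \<Rightarrow>
     (('m, 'a) chart \<Rightarrow> ('m, 'a) chart \<Rightarrow> 'm \<Rightarrow> 'a \<Rightarrow> 'a \<Rightarrow> 'a) \<Rightarrow> ('m \<Rightarrow> real) \<Rightarrow>
     (('m, 'a) chart \<Rightarrow> 'm \<Rightarrow> 'a list \<Rightarrow> real) \<Rightarrow>
     (('m, 'a) chart \<Rightarrow> ('m, 'a) chart \<Rightarrow> 'm \<Rightarrow> 'a \<Rightarrow> 'a \<Rightarrow> 'a) \<Rightarrow>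
     'j set \<Rightarrow> ('j \<Rightarrow> 'm set) \<Rightarrow> ('j \<Rightarrow> 'm \<Rightarrow> 'f \<Rightarrow> 'f::euclidean_space \<Rightarrow> real) \<Rightarrow>
     (('m, 'a) chart \<Rightarrow> 'j \<Rightarrow> 'm \<Rightarrow> 'a \<Rightarrow> 'f \<Rightarrow> 'f) \<Rightarrow> real \<Rightarrow> bool" where
  "Einstein_equation \<A> g LC \<phi> H N J U h A \<alpha>' \<longleftrightarrow>
     (\<forall>\<kappa>\<in>\<A>. \<forall>l\<in>J. \<forall>p\<in>fst \<kappa> \<inter> U l. \<forall>e f. orthonormal (g \<kappa> p) e \<longrightarrow> orthonormal (h l p) f \<longrightarrow>
       (\<forall>i\<in>{1..DIM('a)}. \<forall>j\<in>{1..DIM('a)}.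
          let F = comps (h l p) e f (curvature \<kappa> (A \<kappa> l) p);
              R = comps (g \<kappa> p) e e (curvature \<kappa> (N \<kappa> \<kappa>) p)
          in ricci (g \<kappa> p) e (curvature \<kappa> (LC \<kappa> \<kappa>) p) (e i) (e j)
             - 1/4 * (\<Sum>m=1..DIM('a). \<Sum>n=1..DIM('a).
                        H \<kappa> p [e i, e m, e n] * H \<kappa> p [e j, e m, e n])
             + 2 * hessian \<kappa> (LC \<kappa> \<kappa>) \<phi> p (e i) (e j)
             - \<alpha>'/8 *
                 ((\<Sum>m=1..DIM('a). \<Sum>a=1..DIM('f). \<Sum>b=1..DIM('f). F i m a b * F j m a b)
                  - (\<Sum>m=1..DIM('a). \<Sum>n=1..DIM('a). \<Sum>q=1..DIM('a). R i m n q * R j m n q))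
             = 0))"

text \<open>\<open>P\<close> is the 4-form \<open>\<Psi>\<close>, i.e. \<open>-*\<Theta>\<close> resp. \<open>-\<Phi>\<close>. Both sides are tensors in \<open>m, n\<close>, so it
  suffices to state the identity in adapted frames.\<close>

definition curvature_identity_at ::
    "('a::euclidean_space \<Rightarrow> 'a \<Rightarrow> real) \<Rightarrow> ('a list \<Rightarrow> real) \<Rightarrow> (nat \<Rightarrow> 'a) \<Rightarrow>
     ('a \<Rightarrow> 'a \<Rightarrow> 'a \<Rightarrow> 'a) \<Rightarrow> bool" where
  "curvature_identity_at b P e C \<longleftrightarrow>
     (let R = comps b e e C in
      \<forall>m\<in>{1..DIM('a)}. \<forall>n\<in>{1..DIM('a)}.
        1/6 * (\<Sum>j=1..DIM('a). \<Sum>k=1..DIM('a). \<Sum>l=1..DIM('a).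
                 (\<Sum>a=1..DIM('a). \<Sum>c=1..DIM('a).
                    R m j a c * R k l a c + R m k a c * R l j a c + R m l a c * R j k a c)
                 * P [e j, e k, e l, e n])
        = - (\<Sum>p=1..DIM('a). \<Sum>q=1..DIM('a). \<Sum>r=1..DIM('a). R m p q r * R n p q r))"

definition G2_curvature_identity ::
    "('m::topological_space, 'a::euclidean_space) chart set \<Rightarrow>
     (('m, 'a) chart \<Rightarrow> 'm \<Rightarrow> 'a \<Rightarrow> 'a \<Rightarrow> real) \<Rightarrow> (('m, 'a) chart \<Rightarrow> 'm \<Rightarrow> 'a list \<Rightarrow> real) \<Rightarrow>
     (('m, 'a) chart \<Rightarrow> ('m, 'a) chart \<Rightarrow> 'm \<Rightarrow> 'a \<Rightarrow> 'a \<Rightarrow> 'a) \<Rightarrow> bool" where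
  "G2_curvature_identity \<A> g \<Theta> N \<longleftrightarrow>
     (\<forall>\<kappa> V e. G2_frame \<A> g \<Theta> \<kappa> V e \<longrightarrow> (\<forall>p\<in>V.
        curvature_identity_at (g \<kappa> p) (\<lambda>vs. - hodge (g \<kappa> p) (e p) 3 (\<Theta> \<kappa> p) vs) (e p)
          (curvature \<kappa> (N \<kappa> \<kappa>) p)))"

definition Spin7_curvature_identity ::
    "('m::topological_space, 'a::euclidean_space) chart set \<Rightarrow>
     (('m, 'a) chart \<Rightarrow> 'm \<Rightarrow> 'a \<Rightarrow> 'a \<Rightarrow> real) \<Rightarrow> (('m, 'a) chart \<Rightarrow> 'm \<Rightarrow> 'a list \<Rightarrow> real) \<Rightarrow>
     (('m, 'a) chart \<Rightarrow> ('m, 'a) chart \<Rightarrow> 'm \<Rightarrow> 'a \<Rightarrow> 'a \<Rightarrow> 'a) \<Rightarrow> bool" where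
  "Spin7_curvature_identity \<A> g \<Phi> N \<longleftrightarrow>
     (\<forall>\<kappa> V e. Spin7_frame \<A> g \<Phi> \<kappa> V e \<longrightarrow> (\<forall>p\<in>V.
        curvature_identity_at (g \<kappa> p) (\<lambda>vs. - \<Phi> \<kappa> p vs) (e p) (curvature \<kappa> (N \<kappa> \<kappa>) p)))"

end

(* The Killing spinor equations determine the connection forms of the metric connection with torsion
   H so far that its holonomy lies in the stabiliser of the structure form. Hence its curvature is an
   instanton in the last two indices, and contracting the Bianchi identity with the 4-form W (= *Theta
   or Phi) expresses the Ricci tensor, so that the left-hand side of the Einstein equation without
   its alpha'-terms becomes -1/12 dH_(ivwx) W_(vwxj). By anomaly cancellation dH is quadratic in the
   curvatures; since F^A is an instanton, its part of the contraction is exactly the F^2-term of the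
   Einstein equation, and what remains is the stated identity for R. The contraction of dH is
   symmetric in i and j: for Spin(7) by an eigenvalue argument, for G2 since dH_(ivwx) Theta_(vwx) = 0. *)

theory Submission
  imports Defs "HOL-Combinatorics.Multiset_Permutations"
begin

subsection \<open>Skew-symmetric functions on lists\<close>

text \<open>The holonomy claim is proved without spinors: in an adapted frame the structure form has
  constant components, so its exterior derivative is linear in the connection forms, and the Killing
  equations become a linear system forcing the Lambda^2_7 part of omega + H/2 to vanish. The Hessian
  of phi comes from differentiating H_(vwx) W_(vwxk) = 12 d phi_k, which is the Lee form equation.
  The obstacle is that the Ricci tensor of nabla^+ is not symmetric, so the Bianchi identity gives
  the Einstein tensor only up to the antisymmetric part of the contraction of dH. As Lambda^4 has no
  adjoint constituent, this part lies in Lambda^2_7. In dimension 7 a contraction with Theta reaches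
  it; dimension 8 has no invariant 3-form, and a double contraction of R.Phi = 0 takes its place,
  combined with the eigenvalue 6 of Phi on Lambda^2_7 and a quadratic identity for the torsion. Such
  facts of representation theory are checked by evaluating component arrays on index lists. The
  constants match because the square of an instanton contracts with W to 6 F F, and 1/12 times
  alpha'/4 times 6 is alpha'/8.\<close>

abbreviation "swp \<equiv> Transposition.transpose"

text \<open>Unlike \<open>alternating_form\<close> this asks for no linear structure on the entries,
  so it covers component arrays on lists of indices as well as forms on lists of vectors.\<close>

definition skew :: "nat \<Rightarrow> ('a list \<Rightarrow> real) \<Rightarrow> bool" where
  "skew k \<alpha> \<longleftrightarrow> (\<forall>vs \<sigma>. length vs = k \<longrightarrow> \<sigma> permutes {..<k} \<longrightarrow>
     \<alpha> (permute_list \<sigma> vs) = of_int (sign \<sigma>) * \<alpha> vs)"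

lemma skewD:
  assumes "skew k \<alpha>" "length vs = k" "\<sigma> permutes {..<k}"
  shows "\<alpha> (permute_list \<sigma> vs) = of_int (sign \<sigma>) * \<alpha> vs"
  using assms by (auto simp: skew_def)

lemma permute_list_transpose:
  "permute_list (swp (length xs) (Suc (length xs))) (xs @ x # y # zs) = xs @ y # x # zs"
  (is "?l = ?r")
proof (rule nth_equalityI)
  fix i assume "i < length ?l"
  then have i: "i < length (xs @ x # y # zs)" by simp
  have "swp (length xs) (Suc (length xs)) permutes {..<length (xs @ x # y # zs)}"
    by (intro permutes_swap_id) auto
  then have "?l ! i = (xs @ x # y # zs) ! swp (length xs) (Suc (length xs)) i"
    using i by (simp add: permute_list_nth)
  also have "\<dots> = ?r ! i"
  proof -
    consider "i < length xs" | "i = length xs" | "i = Suc (length xs)"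
      | k where "i = length xs + Suc (Suc k)"
      by (metis Suc_lessI add_Suc_right less_natE linorder_less_linear)
    then show ?thesis
      by cases (auto simp: nth_append Transposition.transpose_def)
  qed
  finally show "?l ! i = ?r ! i" .
qed simp

lemma skew_swap:
  assumes "skew k \<alpha>" "Suc (Suc (length xs + length zs)) = k"
  shows "\<alpha> (xs @ y # x # zs) = - \<alpha> (xs @ x # y # zs)"
proof -
  have "swp (length xs) (Suc (length xs)) permutes {..<k}"
    using assms by (intro permutes_swap_id) auto
  from skewD[OF assms(1) _ this, of "xs @ x # y # zs"] assms(2) show ?thesis
    by (simp add: permute_list_transpose sign_swap_id)
qed

lemma skew_repeat:
  assumes sk: "skew k \<alpha>" and len: "length vs = k" and nd: "\<not> distinct vs"
  shows "\<alpha> vs = 0"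
proof -
  from nd obtain i j where ij: "i < k" "j < k" "i \<noteq> j" "vs ! i = vs ! j"
    using len by (auto simp: distinct_conv_nth)
  have p: "swp i j permutes {..<k}" using ij by (intro permutes_swap_id) auto
  have "permute_list (swp i j) vs = vs"
    by (rule nth_equalityI) (use p len ij in \<open>auto simp: permute_list_nth Transposition.transpose_def\<close>)
  with skewD[OF sk len p] ij show ?thesis by (simp add: sign_swap_id)
qed

text \<open>Transpositions generate the symmetric group, and the sign is multiplicative.\<close>

lemma skewI_swap:
  assumes "\<And>vs i j. length vs = k \<Longrightarrow> i < k \<Longrightarrow> j < k \<Longrightarrow> i \<noteq> j \<Longrightarrow>
    \<alpha> (permute_list (swp i j) vs) = - \<alpha> vs"
  shows "skew k \<alpha>"
  unfolding skew_def
proof (intro allI impI)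
  fix vs :: "'a list" and \<sigma> :: "nat \<Rightarrow> nat"
  assume len: "length vs = k" and "\<sigma> permutes {..<k}"
  have "finite {..<k}" by simp
  from this \<open>\<sigma> permutes {..<k}\<close>
  have "\<forall>vs. length vs = k \<longrightarrow> \<alpha> (permute_list \<sigma> vs) = of_int (sign \<sigma>) * \<alpha> vs"
  proof (induction \<sigma> rule: permutes_rev_induct)
    case id
    then show ?case by simp
  next
    case (swap a b p)
    show ?case
    proof (intro allI impI)
      fix vs :: "'a list" assume len: "length vs = k"
      have t: "swp a b permutes {..<k}" using swap by (intro permutes_swap_id) auto
      have "permute_list (p \<circ> swp a b) vs = permute_list (swp a b) (permute_list p vs)"
        using len t by (intro permute_list_compose) auto
      moreover have "permutation p" "permutation (swp a b)"
        using swap t by (auto intro: permutes_imp_permutation[OF finite_lessThan])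
      ultimately show "\<alpha> (permute_list (p \<circ> swp a b) vs) = of_int (sign (p \<circ> swp a b)) * \<alpha> vs"
        using swap len assms[of "permute_list p vs" a b]
        by (simp add: sign_compose sign_swap_id)
    qed
  qed
  with len show "\<alpha> (permute_list \<sigma> vs) = of_int (sign \<sigma>) * \<alpha> vs" by simp
qed

text \<open>Polarisation in two slots: 0 = F(a+b, a+b) = F(a,b) + F(b,a), as F vanishes on equal
  arguments.\<close>

lemma alternating_form_skew:
  assumes "alternating_form k \<alpha>"
  shows "skew k \<alpha>"
proof (rule skewI_swap)
  fix vs :: "'a list" and i j
  assume len: "length vs = k" and ij: "i < k" "j < k" "i \<noteq> j"
  have lin: "linear (\<lambda>v. \<alpha> (ws[l := v]))" if "length ws = k" "l < k" for ws l
    using assms that by (auto simp: alternating_form_def)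
  have zero: "\<alpha> (ws[i := v, j := v]) = 0" if "length ws = k" for ws v
  proof -
    have "\<not> distinct (ws[i := v, j := v])"
      using that ij nth_eq_iff_index_eq[of "ws[i := v, j := v]" i j] by auto
    then show ?thesis using assms that by (simp add: alternating_form_def)
  qed
  define F where "F a b = \<alpha> (vs[i := a, j := b])" for a b
  have F1: "F (a + a') b = F a b + F a' b" for a a' b
    using linear_add[OF lin[of "vs[j := b]" i]] ij len
    by (simp add: F_def list_update_swap[of i j])
  have F2: "F a (b + b') = F a b + F a b'" for a b b'
    using linear_add[OF lin[of "vs[i := a]" j]] ij len by (simp add: F_def)
  have F0: "F a a = 0" for a using zero[OF len] by (simp add: F_def)
  have "F (a + b) (a + b) = 0" for a b by (rule F0)
  then have "F (vs ! j) (vs ! i) = - F (vs ! i) (vs ! j)"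
    by (smt (verit) F0 F1 F2)
  moreover have "permute_list (swp i j) vs = vs[i := vs ! j, j := vs ! i]"
  proof (rule nth_equalityI)
    fix l assume l: "l < length (permute_list (swp i j) vs)"
    have "swp i j permutes {..<length vs}" using ij len by (intro permutes_swap_id) auto
    with l len ij show "permute_list (swp i j) vs ! l = vs[i := vs ! j, j := vs ! i] ! l"
      by (simp add: permute_list_nth nth_list_update Transposition.transpose_def)
  qed simp
  ultimately show "\<alpha> (permute_list (swp i j) vs) = - \<alpha> vs" by (simp add: F_def)
qed

text \<open>Substituting \<open>\<tau> \<circ> \<sigma>\<close> for \<open>\<sigma>\<close> in the
  sum over permutations produces the sign of \<open>\<tau>\<close>.\<close>

lemma cof_skew: "skew (length I) (cof b e I)"
  unfolding skew_def
proof (intro allI impI)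
  fix vs :: "'a list" and \<tau> assume len: "length vs = length I" and \<tau>: "\<tau> permutes {..<length I}"
  let ?P = "{\<sigma>. \<sigma> permutes {..<length I}}"
  have pm: "permutation \<sigma>" if "\<sigma> \<in> ?P" for \<sigma>
    using that by (auto intro: permutes_imp_permutation[OF finite_lessThan])
  have sq: "of_int (sign \<tau>) * of_int (sign \<tau>) = (1::real)"
    by (metis of_int_1 of_int_mult sign_idempotent)
  have "cof b e I (permute_list \<tau> vs) =
      (\<Sum>\<sigma>\<in>?P. of_int (sign \<sigma>) * (\<Prod>i<length I. b (e (I ! i)) (vs ! \<tau> (\<sigma> i))))"
    unfolding cof_def
  proof (intro sum.cong refl arg_cong2[where f = "(*)"] prod.cong)
    fix \<sigma> i assume "\<sigma> \<in> ?P" "i \<in> {..<length I}"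
    then have "\<sigma> i < length vs" using permutes_in_image[of \<sigma> "{..<length I}" i] len by auto
    then show "b (e (I ! i)) (permute_list \<tau> vs ! \<sigma> i) = b (e (I ! i)) (vs ! \<tau> (\<sigma> i))"
      using \<tau> len by (simp add: permute_list_nth)
  qed
  also have "\<dots> = (\<Sum>\<sigma>\<in>?P. of_int (sign \<tau>) * (of_int (sign (\<tau> \<circ> \<sigma>)) *
      (\<Prod>i<length I. b (e (I ! i)) (vs ! (\<tau> \<circ> \<sigma>) i))))"
    using \<tau> pm by (intro sum.cong) (auto simp: sign_compose mult.assoc[symmetric] sq)
  also have "\<dots> = of_int (sign \<tau>) * cof b e I vs"
    unfolding cof_def sum_distrib_left[symmetric]
    by (subst setum_permutations_compose_left[OF \<tau>]) (simp add: o_def)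
  finally show "cof b e I (permute_list \<tau> vs) = of_int (sign \<tau>) * cof b e I vs" .
qed

subsection \<open>Components of the $Spin(7)$-form\<close>

text \<open>With \<open>kd\<close> as inner product and \<open>id\<close> as frame, the indices
  themselves form an orthonormal frame; \<open>cof kd id I K\<close> is then the component of e^I at
  the indices K.\<close>

definition kd :: "nat \<Rightarrow> nat \<Rightarrow> real" where "kd i j = (if i = j then 1 else 0)"

lemma cof_kd_self: "distinct I \<Longrightarrow> cof kd id I I = 1"
proof -
  assume d: "distinct I"
  have "(\<Sum>\<sigma> | \<sigma> permutes {..<length I}. of_int (sign \<sigma>) * (\<Prod>i<length I. kd (id (I ! i)) (I ! \<sigma> i)))
    = (\<Sum>\<sigma> | \<sigma> permutes {..<length I}. if \<sigma> = id then 1 else (0::real))"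
  proof (rule sum.cong[OF refl])
    fix \<sigma> assume s: "\<sigma> \<in> {\<sigma>. \<sigma> permutes {..<length I}}"
    show "of_int (sign \<sigma>) * (\<Prod>i<length I. kd (id (I ! i)) (I ! \<sigma> i)) = (if \<sigma> = id then 1 else (0::real))"
    proof (cases "\<sigma> = id")
      case False
      then obtain i where i: "\<sigma> i \<noteq> i" by (auto simp: fun_eq_iff)
      with s have "i < length I" using permutes_not_in[of \<sigma> "{..<length I}" i] by auto
      moreover from this s have "\<sigma> i < length I" using permutes_in_image[of \<sigma> "{..<length I}" i] by auto
      ultimately have "kd (id (I ! i)) (I ! \<sigma> i) = 0"
        using d i by (simp add: kd_def nth_eq_iff_index_eq)
      then show ?thesis using \<open>i < length I\<close> False by (auto intro: prod_zero)
    qed (simp add: kd_def)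
  qed
  also have "\<dots> = 1" by (subst sum.delta) (simp_all add: permutes_id finite_permutations)
  finally show ?thesis unfolding cof_def .
qed

lemma cof_kd_zero:
  assumes "length K = length I" "\<not> set I \<subseteq> set K"
  shows "cof kd id I K = 0"
  unfolding cof_def
proof (rule sum.neutral, rule ballI)
  fix \<sigma> assume s: "\<sigma> \<in> {\<sigma>. \<sigma> permutes {..<length I}}"
  from assms obtain x where "x \<in> set I" "x \<notin> set K" by auto
  then obtain i where i: "i < length I" "I ! i \<notin> set K" by (auto simp: in_set_conv_nth[of x I])
  have "\<sigma> i < length K" using permutes_in_image[of \<sigma> "{..<length I}" i] s i assms by auto
  then have "kd (id (I ! i)) (K ! \<sigma> i) = 0" using i by (auto simp: kd_def)
  then show "of_int (sign \<sigma>) * (\<Prod>i<length I. kd (id (I ! i)) (K ! \<sigma> i)) = 0"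
    using i by (auto intro: prod_zero)
qed

definition Phi :: "nat list \<Rightarrow> real" where "Phi = Spin7_form kd id"

lemma skew_add: "skew k \<alpha> \<Longrightarrow> skew k \<beta> \<Longrightarrow> skew k (\<lambda>vs. \<alpha> vs + \<beta> vs)"
  and skew_diff: "skew k \<alpha> \<Longrightarrow> skew k \<beta> \<Longrightarrow> skew k (\<lambda>vs. \<alpha> vs - \<beta> vs)"
  by (auto simp: skew_def algebra_simps)

lemma cof_skew': "length I = k \<Longrightarrow> skew k (cof b e I)"
  using cof_skew by blast

lemma Spin7_form_skew: "skew 4 (Spin7_form b e)"
  unfolding Spin7_form_def[abs_def] by (intro skew_add skew_diff cof_skew') simp_all

text \<open>The inequalities orient these equations into rewrite rules that sort the indices.
  Together with the values on increasing lists they evaluate every component.\<close>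

lemma skew4_simps:
  fixes \<alpha> :: "nat list \<Rightarrow> real"
  assumes "skew 4 \<alpha>"
  shows "b < a \<Longrightarrow> \<alpha> [a,b,c,d] = - \<alpha> [b,a,c,d]"
    "c < b \<Longrightarrow> \<alpha> [a,b,c,d] = - \<alpha> [a,c,b,d]"
    "d < c \<Longrightarrow> \<alpha> [a,b,c,d] = - \<alpha> [a,b,d,c]"
    "\<alpha> [a,a,c,d] = 0" "\<alpha> [a,b,b,d] = 0" "\<alpha> [a,b,c,c] = 0"
  using skew_swap[OF assms, of "[]" "[c,d]" b a] skew_swap[OF assms, of "[a]" "[d]" c b]
    skew_swap[OF assms, of "[a,b]" "[]" d c] by (auto intro!: skew_repeat[OF assms])

lemmas Phi_skew = Spin7_form_skew[of kd id, folded Phi_def]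
lemmas Phi_simps = skew4_simps[OF Phi_skew]

lemma Phi_vals:
  "Phi [1,2,3,4] = 0" "Phi [1,2,3,5] = 0" "Phi [1,2,3,6] = 0" "Phi [1,2,3,7] = 0"
  "Phi [1,2,3,8] = 1" "Phi [1,2,4,5] = 0" "Phi [1,2,4,6] = 1" "Phi [1,2,4,7] = 0"
  "Phi [1,2,4,8] = 0" "Phi [1,2,5,6] = 0" "Phi [1,2,5,7] = -1" "Phi [1,2,5,8] = 0"
  "Phi [1,2,6,7] = 0" "Phi [1,2,6,8] = 0" "Phi [1,2,7,8] = 0" "Phi [1,3,4,5] = 0"
  "Phi [1,3,4,6] = 0" "Phi [1,3,4,7] = -1" "Phi [1,3,4,8] = 0" "Phi [1,3,5,6] = -1"
  "Phi [1,3,5,7] = 0" "Phi [1,3,5,8] = 0" "Phi [1,3,6,7] = 0" "Phi [1,3,6,8] = 0"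
  "Phi [1,3,7,8] = 0" "Phi [1,4,5,6] = 0" "Phi [1,4,5,7] = 0" "Phi [1,4,5,8] = 1"
  "Phi [1,4,6,7] = 0" "Phi [1,4,6,8] = 0" "Phi [1,4,7,8] = 0" "Phi [1,5,6,7] = 0"
  "Phi [1,5,6,8] = 0" "Phi [1,5,7,8] = 0" "Phi [1,6,7,8] = 1" "Phi [2,3,4,5] = 1"
  "Phi [2,3,4,6] = 0" "Phi [2,3,4,7] = 0" "Phi [2,3,4,8] = 0" "Phi [2,3,5,6] = 0"
  "Phi [2,3,5,7] = 0" "Phi [2,3,5,8] = 0" "Phi [2,3,6,7] = 1" "Phi [2,3,6,8] = 0"
  "Phi [2,3,7,8] = 0" "Phi [2,4,5,6] = 0" "Phi [2,4,5,7] = 0" "Phi [2,4,5,8] = 0"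
  "Phi [2,4,6,7] = 0" "Phi [2,4,6,8] = 0" "Phi [2,4,7,8] = 1" "Phi [2,5,6,7] = 0"
  "Phi [2,5,6,8] = 1" "Phi [2,5,7,8] = 0" "Phi [2,6,7,8] = 0" "Phi [3,4,5,6] = 0"
  "Phi [3,4,5,7] = 0" "Phi [3,4,5,8] = 0" "Phi [3,4,6,7] = 0" "Phi [3,4,6,8] = 1"
  "Phi [3,4,7,8] = 0" "Phi [3,5,6,7] = 0" "Phi [3,5,6,8] = 0" "Phi [3,5,7,8] = -1"
  "Phi [3,6,7,8] = 0" "Phi [4,5,6,7] = 1" "Phi [4,5,6,8] = 0" "Phi [4,5,7,8] = 0"
  "Phi [4,6,7,8] = 0" "Phi [5,6,7,8] = 0"
  by (simp_all add: Phi_def Spin7_form_def cof_kd_self cof_kd_zero)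

lemma sum_upto8: "(\<Sum>i=1..8. f i) = f 1 + f 2 + f 3 + f 4 + f 5 + f 6 + f 7 + f (8::nat)"
  for f :: "nat \<Rightarrow> real"
  by (simp add: numeral_eq_Suc)

text \<open>The action of a matrix as a derivation, and the exterior derivative of a form with constant
  components \<open>C\<close> in a frame whose torsion-free connection forms are \<open>om\<close>.\<close>

definition act :: "nat \<Rightarrow> (nat \<Rightarrow> nat \<Rightarrow> real) \<Rightarrow> (nat list \<Rightarrow> real) \<Rightarrow> nat list \<Rightarrow> real" where
  "act n A C K = (\<Sum>s<length K. \<Sum>i=1..n. A (K ! s) i * C (K[s := i]))"

lemma act4: "act n A C [a,b,c,d] = (\<Sum>i=1..n. A a i * C [i,b,c,d]) + (\<Sum>i=1..n. A b i * C [a,i,c,d])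
   + (\<Sum>i=1..n. A c i * C [a,b,i,d]) + (\<Sum>i=1..n. A d i * C [a,b,c,i])"
  by (simp add: act_def numeral_eq_Suc)

definition dform :: "nat \<Rightarrow> (nat \<Rightarrow> nat \<Rightarrow> nat \<Rightarrow> real) \<Rightarrow> (nat list \<Rightarrow> real) \<Rightarrow> nat list \<Rightarrow> real" where
  "dform n om C K = - (\<Sum>s<length K. (-1) ^ s * act n (om (K ! s)) C (take s K @ drop (Suc s) K))"

lemma dform5: "dform n om C [a,b,c,d,e] = - (act n (om a) C [b,c,d,e] - act n (om b) C [a,c,d,e]
   + act n (om c) C [a,b,d,e] - act n (om d) C [a,b,c,e] + act n (om e) C [a,b,c,d])"
  by (simp add: dform_def numeral_eq_Suc)

subsection \<open>Contractions of the Bianchi identity\<close>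

definition S3 :: "nat set \<Rightarrow> (nat \<Rightarrow> nat \<Rightarrow> nat \<Rightarrow> real) \<Rightarrow> (nat \<Rightarrow> nat \<Rightarrow> nat \<Rightarrow> real) \<Rightarrow> real" where
  "S3 I C f = (\<Sum>v\<in>I. \<Sum>w\<in>I. \<Sum>x\<in>I. f v w x * C v w x)"

lemma S3_add: "S3 I C (\<lambda>v w x. f v w x + f' v w x) = S3 I C f + S3 I C f'"
  and S3_diff: "S3 I C (\<lambda>v w x. f v w x - f' v w x) = S3 I C f - S3 I C f'"
  and S3_cmult: "S3 I C (\<lambda>v w x. c * f v w x) = c * S3 I C f"
  and S3_minus: "S3 I C (\<lambda>v w x. - f v w x) = - S3 I C f"
  by (simp_all add: S3_def sum.distrib sum_subtractf sum_distrib_left sum_negf algebra_simps)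

locale alt3 =
  fixes I :: "nat set" and C :: "nat \<Rightarrow> nat \<Rightarrow> nat \<Rightarrow> real"
  assumes C1: "C b a c = - C a b c" and C2: "C a c b = - C a b c"
begin

lemma swap12: "S3 I C (\<lambda>v w x. f w v x) = - S3 I C f"
proof -
  have "S3 I C (\<lambda>v w x. f w v x) = (\<Sum>w\<in>I. \<Sum>v\<in>I. \<Sum>x\<in>I. f w v x * C v w x)"
    unfolding S3_def by (rule sum.swap)
  also have "\<dots> = - S3 I C f" unfolding S3_def by (subst C1) (simp add: sum_negf)
  finally show ?thesis .
qed

lemma swap23: "S3 I C (\<lambda>v w x. f v x w) = - S3 I C f"
proof -
  have "S3 I C (\<lambda>v w x. f v x w) = (\<Sum>v\<in>I. \<Sum>x\<in>I. \<Sum>w\<in>I. f v x w * C v w x)"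
    unfolding S3_def by (intro sum.cong refl sum.swap)
  also have "\<dots> = - S3 I C f" unfolding S3_def by (subst C2) (simp add: sum_negf)
  finally show ?thesis .
qed

lemma cyc: "S3 I C (\<lambda>v w x. f w x v) = S3 I C f" "S3 I C (\<lambda>v w x. f x v w) = S3 I C f"
  using swap12[of "\<lambda>v w x. f v x w"] swap23[of f] swap23[of "\<lambda>v w x. f w v x"] swap12[of f] by simp_all

text \<open>An alternating \<open>C\<close> does not distinguish cyclic permutations, so the
  contraction of \<open>r\<close> is one third of that of its cyclic sum.\<close>

lemma bianchi_zero:
  assumes "\<And>v w x. r v w x + r w x v + r x v w = 0"
  shows "S3 I C r = 0"
proof -
  have "S3 I C (\<lambda>v w x. r v w x + r w x v + r x v w) = 3 * S3 I C r"
    by (simp add: S3_add cyc[of r])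
  moreover have "S3 I C (\<lambda>v w x. r v w x + r w x v + r x v w) = 0"
    unfolding assms by (simp add: S3_def)
  ultimately show ?thesis by simp
qed

text \<open>The arguments \<open>P\<close>, \<open>dH\<close>, \<open>R\<close> are the quadratic torsion terms, the components of \<open>dH\<close> and those
  of the curvature of \<open>\<nabla>\<^sup>+\<close>, with one index fixed to \<open>m\<close>.\<close>

lemma ricci_contraction:
  assumes D1: "\<And>u a b c. D u b a c = - D u a b c" and D2: "\<And>u a b c. D u a c b = - D u a b c"
    and H1: "\<And>a b c. H b a c = - (H a b c :: real)"
    and P: "\<And>a b c d. P a b c d = (\<Sum>s\<in>I. H a b s * H c d s)"
    and Rg: "\<And>v w x. Rg v w x + Rg w x v + Rg x v w = 0"
    and R: "\<And>v w x. R v w x = Rg v w x + 1/2 * (D m v w x - D v m w x) + 1/4 * (P v x m w - P m x v w)"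
    and dH: "\<And>v w x. dH v w x = D m v w x - D v m w x + D w m v x - D x m v w"
  shows "S3 I C R = 1/6 * S3 I C dH + 1/3 * (S3 I C (D m) - 3/2 * S3 I C (P m))"
proof -
  let ?E = "S3 I C (\<lambda>v w x. D v m w x)"
  have Pc: "P a b c d = P c d a b" "P b a c d = - P a b c d" for a b c d
    by (simp_all add: P H1[of b a] mult.commute sum_negf)
  have "S3 I C (\<lambda>v w x. D w m v x) = - ?E" using swap12[of "\<lambda>v w x. D v m w x"] .
  moreover have "S3 I C (\<lambda>v w x. D x m v w) = ?E" using cyc(2)[of "\<lambda>v w x. D v m w x"] .
  ultimately have h: "S3 I C dH = S3 I C (D m) - 3 * ?E"
    unfolding dH[abs_def] S3_add S3_diff by simp
  have 1: "S3 I C (\<lambda>v w x. P m x v w) = S3 I C (P m)" using cyc(2)[of "P m"] .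
  have 2: "S3 I C (\<lambda>v w x. P v x m w) = - S3 I C (P m)"
    using swap12[of "P m"] by (simp add: Pc(1)[of _ _ m])
  have "S3 I C R = S3 I C Rg + 1/2 * (S3 I C (D m) - ?E) + 1/4 * (- S3 I C (P m) - S3 I C (P m))"
    unfolding R[abs_def] S3_add S3_cmult S3_diff 1 2 ..
  then show ?thesis using h bianchi_zero[of Rg, OF Rg] by (simp add: field_simps)
qed

text \<open>The curvature of a connection with torsion need not have pair symmetry, so contracting
  the first three indices gives other coefficients than contracting the last three. This version
  supplies the terms of \<open>double_contraction\<close> in which R acts on the free slots of
  W.\<close>

lemma first_indices_contraction:
  assumes D1: "\<And>u a b c. D u b a c = - D u a b c" and D2: "\<And>u a b c. D u a c b = - D u a b c"
    and H1: "\<And>a b c. H b a c = - (H a b c :: real)"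
    and P: "\<And>a b c d. P a b c d = (\<Sum>s\<in>I. H a b s * H c d s)"
    and Rg: "\<And>v w x. Rg v w x + Rg w x v + Rg x v w = 0"
    and R: "\<And>v w x. R v w x = Rg v w x + 1/2 * (D v w x m - D w v x m) + 1/4 * (P w m v x - P v m w x)"
    and dH: "\<And>v w x. dH v w x = D m v w x - D v m w x + D w m v x - D x m v w"
  shows "S3 I C R = 1/3 * S3 I C (D m) - 1/3 * S3 I C dH + 1/2 * S3 I C (P m)"
proof -
  let ?E = "S3 I C (\<lambda>v w x. D v m w x)"
  have Pc: "P a b c d = P c d a b" "P b a c d = - P a b c d" for a b c d
    by (simp_all add: P H1[of b a] mult.commute sum_negf)
  have "S3 I C (\<lambda>v w x. D w m v x) = - ?E" using swap12[of "\<lambda>v w x. D v m w x"] .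
  moreover have "S3 I C (\<lambda>v w x. D x m v w) = ?E" using cyc(2)[of "\<lambda>v w x. D v m w x"] .
  ultimately have h: "S3 I C dH = S3 I C (D m) - 3 * ?E"
    unfolding dH[abs_def] S3_add S3_diff by simp
  have 1: "S3 I C (\<lambda>v w x. D v w x m) = ?E" by (subst D2, subst D1) simp
  have 2: "S3 I C (\<lambda>v w x. D w v x m) = - ?E"
    using swap12[of "\<lambda>v w x. D v w x m"] 1 by simp
  have 3: "S3 I C (\<lambda>v w x. P v m w x) = - S3 I C (P m)"
    by (subst Pc(2)) (simp add: S3_minus)
  have 4: "S3 I C (\<lambda>v w x. P w m v x) = S3 I C (P m)"
    using swap12[of "\<lambda>v w x. P v m w x"] 3 by simp
  have "S3 I C R = S3 I C Rg + 1/2 * (?E - - ?E) + 1/4 * (S3 I C (P m) - - S3 I C (P m))"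
    unfolding R[abs_def] S3_add S3_cmult S3_diff 1 2 3 4 ..
  then show ?thesis using h bianchi_zero[of Rg, OF Rg] by (simp add: field_simps)
qed

text \<open>Cyclicity makes the three products equal, the instanton equation replaces a double
  contraction by -2 F, and antisymmetry in the 2-form indices restores the sign: 3 times 2 is
  6.\<close>

lemma quadratic_contraction:
  assumes F1: "\<And>m n a b. F n m a b = - F m n a b"
    and F2: "\<And>j a b. j \<in> I \<Longrightarrow> a \<in> A \<Longrightarrow> b \<in> B \<Longrightarrow> (\<Sum>k\<in>I. \<Sum>l\<in>I. C k l j * F k l a b) = - 2 * F j n a b"
  shows "S3 I C (\<lambda>j k l. \<Sum>a\<in>A. \<Sum>b\<in>B. F m j a b * F k l a b + F m k a b * F l j a b + F m l a b * F j k a b)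
    = 6 * (\<Sum>j\<in>I. \<Sum>a\<in>A. \<Sum>b\<in>B. F m j a b * F n j a b)"
proof -
  define G where "G j k l = (\<Sum>a\<in>A. \<Sum>b\<in>B. F m j a b * F k l a b)" for j k l
  have "S3 I C (\<lambda>j k l. \<Sum>a\<in>A. \<Sum>b\<in>B. F m j a b * F k l a b + F m k a b * F l j a b + F m l a b * F j k a b)
    = 3 * S3 I C G"
    by (simp add: sum.distrib S3_add cyc[of G] flip: G_def)
  also have "S3 I C G = (\<Sum>j\<in>I. \<Sum>a\<in>A. \<Sum>b\<in>B. F m j a b * (\<Sum>k\<in>I. \<Sum>l\<in>I. C k l j * F k l a b))"
  proof (unfold S3_def, intro sum.cong refl)
    fix j
    have c: "C j k l = C k l j" for k l using C1[of k j l] C2[of k l j] by simp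
    have "(\<Sum>k\<in>I. \<Sum>l\<in>I. G j k l * C j k l) = (\<Sum>k\<in>I. \<Sum>l\<in>I. \<Sum>a\<in>A. \<Sum>b\<in>B. F m j a b * (C k l j * F k l a b))"
      by (simp add: G_def sum_distrib_left sum_distrib_right c mult_ac)
    also have "\<dots> = (\<Sum>k\<in>I. \<Sum>a\<in>A. \<Sum>l\<in>I. \<Sum>b\<in>B. F m j a b * (C k l j * F k l a b))"
      by (intro sum.cong refl sum.swap)
    also have "\<dots> = (\<Sum>a\<in>A. \<Sum>k\<in>I. \<Sum>b\<in>B. \<Sum>l\<in>I. F m j a b * (C k l j * F k l a b))"
      by (subst sum.swap) (intro sum.cong refl sum.swap)
    also have "\<dots> = (\<Sum>a\<in>A. \<Sum>b\<in>B. \<Sum>k\<in>I. \<Sum>l\<in>I. F m j a b * (C k l j * F k l a b))"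
      by (intro sum.cong refl sum.swap)
    finally show "(\<Sum>k\<in>I. \<Sum>l\<in>I. G j k l * C j k l) =
      (\<Sum>a\<in>A. \<Sum>b\<in>B. F m j a b * (\<Sum>k\<in>I. \<Sum>l\<in>I. C k l j * F k l a b))"
      by (simp add: sum_distrib_left)
  qed
  also have "\<dots> = (\<Sum>j\<in>I. \<Sum>a\<in>A. \<Sum>b\<in>B. F m j a b * (- 2 * F j n a b))"
    using F2 by (intro sum.cong refl) simp
  also have "\<dots> = 2 * (\<Sum>j\<in>I. \<Sum>a\<in>A. \<Sum>b\<in>B. F m j a b * F n j a b)"
    by (subst F1[of _ n]) (simp add: sum_distrib_left mult_ac)
  finally show ?thesis by simp
qed

end

section \<open>Skew-adjointness of the action of antisymmetric matrices\<close>

lemma antisym_pairing: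
  fixes p c :: "nat \<Rightarrow> real"
  assumes "\<And>i j. i \<in> I \<Longrightarrow> j \<in> I \<Longrightarrow> A j i = - A i j"
  shows "(\<Sum>v\<in>I. \<Sum>i\<in>I. A v i * p i * c v) = - (\<Sum>v\<in>I. \<Sum>i\<in>I. A v i * c i * p v)"
proof -
  have "(\<Sum>v\<in>I. \<Sum>i\<in>I. A v i * p i * c v) = (\<Sum>i\<in>I. \<Sum>v\<in>I. A v i * p i * c v)" by (rule sum.swap)
  also have "\<dots> = (\<Sum>i\<in>I. \<Sum>v\<in>I. - (A i v * c v * p i))"
  proof (intro sum.cong refl)
    fix i v assume "i \<in> I" "v \<in> I"
    then show "A v i * p i * c v = - (A i v * c v * p i)" using assms[of i v] by simp
  qed
  finally show ?thesis by (simp add: sum_negf)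
qed

lemma act3: "act n A C [a,b,c] = (\<Sum>i=1..n. A a i * C [i,b,c]) + (\<Sum>i=1..n. A b i * C [a,i,c])
   + (\<Sum>i=1..n. A c i * C [a,b,i])"
  by (simp add: act_def numeral_eq_Suc)

text \<open>An antisymmetric matrix is skew-adjoint in each slot, hence so is the derivation it
  induces. This moves connection forms from H to a form with constant components.\<close>

lemma S3_act:
  assumes A: "\<And>i j. i \<in> {1..n} \<Longrightarrow> j \<in> {1..n} \<Longrightarrow> A j i = - A i j"
  shows "S3 {1..n} (\<lambda>v w x. C [v,w,x]) (\<lambda>v w x. act n A H [v,w,x])
    = - S3 {1..n} (\<lambda>v w x. H [v,w,x]) (\<lambda>v w x. act n A C [v,w,x])"
proof -
  let ?I = "{1..n}"
  note ap = antisym_pairing[where I = ?I, OF A]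
  have 1: "(\<Sum>v\<in>?I. \<Sum>w\<in>?I. \<Sum>x\<in>?I. \<Sum>i\<in>?I. A v i * p [i,w,x] * c [v,w,x]) =
      (\<Sum>w\<in>?I. \<Sum>x\<in>?I. \<Sum>v\<in>?I. \<Sum>i\<in>?I. A v i * p [i,w,x] * c [v,w,x])" for p c :: "nat list \<Rightarrow> real"
    by (subst sum.swap) (rule sum.cong[OF refl], rule sum.swap)
  have 2: "(\<Sum>v\<in>?I. \<Sum>w\<in>?I. \<Sum>x\<in>?I. \<Sum>i\<in>?I. A w i * p [v,i,x] * c [v,w,x]) =
      (\<Sum>v\<in>?I. \<Sum>x\<in>?I. \<Sum>w\<in>?I. \<Sum>i\<in>?I. A w i * p [v,i,x] * c [v,w,x])" for p c :: "nat list \<Rightarrow> real"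
    by (rule sum.cong[OF refl], rule sum.swap)
  have e: "S3 ?I (\<lambda>v w x. c [v,w,x]) (\<lambda>v w x. act n A p [v,w,x]) =
      (\<Sum>w\<in>?I. \<Sum>x\<in>?I. \<Sum>v\<in>?I. \<Sum>i\<in>?I. A v i * p [i,w,x] * c [v,w,x]) +
      (\<Sum>v\<in>?I. \<Sum>x\<in>?I. \<Sum>w\<in>?I. \<Sum>i\<in>?I. A w i * p [v,i,x] * c [v,w,x]) +
      (\<Sum>v\<in>?I. \<Sum>w\<in>?I. \<Sum>x\<in>?I. \<Sum>i\<in>?I. A x i * p [v,w,i] * c [v,w,x])" for p c :: "nat list \<Rightarrow> real"
    unfolding S3_def act3 distrib_right sum_distrib_right sum.distrib
    by (simp only: 1[of p c] 2[of p c])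
  have p1: "(\<Sum>v\<in>?I. \<Sum>i\<in>?I. A v i * H [i,w,x] * C [v,w,x]) = - (\<Sum>v\<in>?I. \<Sum>i\<in>?I. A v i * C [i,w,x] * H [v,w,x])" for w x
    by (rule ap)
  have p2: "(\<Sum>w\<in>?I. \<Sum>i\<in>?I. A w i * H [v,i,x] * C [v,w,x]) = - (\<Sum>w\<in>?I. \<Sum>i\<in>?I. A w i * C [v,i,x] * H [v,w,x])" for v x
    by (rule ap)
  have p3: "(\<Sum>x\<in>?I. \<Sum>i\<in>?I. A x i * H [v,w,i] * C [v,w,x]) = - (\<Sum>x\<in>?I. \<Sum>i\<in>?I. A x i * C [v,w,i] * H [v,w,x])" for v w
    by (rule ap)
  show ?thesis unfolding e p1 p2 p3 sum_negf by simp
qed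

lemma alt3_skew4:
  assumes "skew 4 W" shows "alt3 (\<lambda>v w x. W [v, w, x, n])"
proof
  fix a b c
  show "W [b,a,c,n] = - W [a,b,c,n]" using skew_swap[OF assms, of "[]" "[c,n]" b a] by simp
  show "W [a,c,b,n] = - W [a,b,c,n]" using skew_swap[OF assms, of "[a]" "[n]" c b] by simp
qed

lemma alt3_skew3:
  assumes "skew 3 W" shows "alt3 (\<lambda>v w x. W [v, w, x])"
proof
  fix a b c
  show "W [b,a,c] = - W [a,b,c]" using skew_swap[OF assms, of "[]" "[c]" b a] by simp
  show "W [a,c,b] = - W [a,b,c]" using skew_swap[OF assms, of "[a]" "[]" c b] by simp
qed

text \<open>The components at a point, in an adapted frame, of the curvatures \<open>Rg\<close> of \<open>\<nabla>\<^sup>g\<close> and \<open>R\<close> of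
  \<open>\<nabla>\<^sup>+\<close>, of \<open>H\<close>, \<open>D = \<nabla>\<^sup>g H\<close>, \<open>f = d\<phi>\<close> and \<open>hs = \<nabla>\<^sup>g d\<phi>\<close>; \<open>W\<close> is \<open>*\<Theta>\<close> resp. \<open>\<Phi>\<close>.\<close>

locale heterotic_point =
  fixes n :: nat and W :: "nat list \<Rightarrow> real" and H :: "nat \<Rightarrow> nat \<Rightarrow> nat \<Rightarrow> real"
    and D Rg R :: "nat \<Rightarrow> nat \<Rightarrow> nat \<Rightarrow> nat \<Rightarrow> real" and f :: "nat \<Rightarrow> real" and hs :: "nat \<Rightarrow> nat \<Rightarrow> real"
    and I :: "nat set" and P dH :: "nat \<Rightarrow> nat \<Rightarrow> nat \<Rightarrow> nat \<Rightarrow> real" and h :: "nat \<Rightarrow> nat \<Rightarrow> real"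
  defines "I \<equiv> {1..n}"
    and "P \<equiv> \<lambda>a b c d. \<Sum>s\<in>I. H a b s * H c d s"
    and "dH \<equiv> \<lambda>m v w x. D m v w x - D v m w x + D w m v x - D x m v w"
    and "h \<equiv> \<lambda>m k. S3 I (\<lambda>v w x. W [v,w,x,k]) (dH m)"
  assumes W: "skew 4 W"
    and H1: "H b a c = - H a b c" and H2: "H a c b = - H a b c"
    and D1: "D u b a c = - D u a b c" and D2: "D u a c b = - D u a b c"
    and Rg1: "Rg j i k l = - Rg i j k l" and Rg2: "Rg i j l k = - Rg i j k l"
    and Rg3: "Rg i j k l + Rg j k i l + Rg k i j l = 0"
    and R: "R i j k l = Rg i j k l + 1/2 * (D i j k l - D j i k l) + 1/4 * (P j l i k - P i l j k)"
    and inst: "i \<in> I \<Longrightarrow> j \<in> I \<Longrightarrow> v \<in> I \<Longrightarrow> k \<in> I \<Longrightarrow>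
      (\<Sum>w\<in>I. \<Sum>x\<in>I. W [w,x,v,k] * R i j w x) = - 2 * R i j v k"
    and hs: "hs j i = hs i j"
    and dil: "m \<in> I \<Longrightarrow> k \<in> I \<Longrightarrow> S3 I (\<lambda>v w x. W [v,w,x,k]) (D m) - 3/2 * S3 I (\<lambda>v w x. W [v,w,x,k]) (P m)
      = 12 * (hs m k - 1/2 * (\<Sum>i\<in>I. H m k i * f i))"
begin

text \<open>The octahedron argument: the four Bianchi identities starting at the four indices in
  turn are combined, after the auxiliary equations have brought their terms to common index
  orders.\<close>

lemma Rg4: "Rg k l i j = Rg i j k l"
proof -
  have "Rg j k l i = - Rg j k i l" "Rg k l j i = - Rg k l i j" "Rg i k l j = Rg k i j l"
    "Rg l i j k = - Rg l i k j" "Rg i j l k = - Rg i j k l" "Rg j l i k = Rg l j k i"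
    using Rg2[of j k l i] Rg2[of k l j i] Rg2[of l i j k] Rg2[of i j l k]
      Rg1[of i k l j] Rg2[of k i l j] Rg1[of j l i k] Rg2[of l j i k] by simp_all
  then show ?thesis
    using Rg3[of i j k l] Rg3[of j k l i] Rg3[of k l i j] Rg3[of l i j k] by argo
qed

lemma Rg5: "Rg m v w x + Rg m w x v + Rg m x v w = 0"
  using Rg3[of v w x m] Rg4[of m v w x] Rg4[of m w x v] Rg4[of m x v w]
    Rg2[of w x m v] Rg2[of x v m w] Rg2[of v w m x] by argo

lemma P1: "P b a c d = - P a b c d" and P2: "P a b d c = - P a b c d" and P3: "P a b c d = P c d a b"
proof -
  show "P b a c d = - P a b c d" for a b c d unfolding P_def by (subst H1) (simp add: sum_negf)
  show "P a b d c = - P a b c d" for a b c d unfolding P_def by (subst (2) H1) (simp add: sum_negf)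
  show "P a b c d = P c d a b" for a b c d by (simp add: P_def mult.commute)
qed

lemma R1: "R j i k l = - R i j k l" by (simp add: R Rg1[of j i] algebra_simps)

lemma R2: "R i j l k = - R i j k l"
  using P3[of j l i k] P3[of i l j k] by (simp add: R Rg2[of i j l k] D2[of _ _ l k] algebra_simps)

text \<open>The Ricci tensor of nabla^+, in general not symmetric. As R_(mvvk) = R_(vmkv), the trace
  convention is that of \<open>ricci\<close>.\<close>

definition Ric where "Ric m k = (\<Sum>v\<in>I. R m v v k)"

text \<open>The contraction of R with W over its last three indices is computed in two ways: the
  instanton condition gives -2 Ric, and the Bianchi identity gives dH plus torsion terms, which
  \<open>dil\<close> turns into the Hessian.\<close>

lemma Ric_eq:
  assumes m: "m \<in> I" and k: "k \<in> I"
  shows "Ric m k = - 1/12 * h m k - 2 * (hs m k - 1/2 * (\<Sum>i\<in>I. H m k i * f i))"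
proof -
  interpret alt3 I "\<lambda>v w x. W [v,w,x,k]" by (rule alt3_skew4[OF W])
  have CC: "W [v,w,x,k] = W [w,x,v,k]" for v w x using C1[of v w x] C2[of w v x] by simp
  have "S3 I (\<lambda>v w x. W [v,w,x,k]) (R m) = (\<Sum>v\<in>I. \<Sum>w\<in>I. \<Sum>x\<in>I. W [w,x,v,k] * R m v w x)"
    unfolding S3_def by (intro sum.cong refl) (subst CC, rule mult.commute)
  also have "\<dots> = (\<Sum>v\<in>I. - 2 * R m v v k)" using inst[OF m _ _ k] by (intro sum.cong refl) simp
  finally have "S3 I (\<lambda>v w x. W [v,w,x,k]) (R m) = - 2 * Ric m k" by (simp add: Ric_def sum_distrib_left)
  moreover have "S3 I (\<lambda>v w x. W [v,w,x,k]) (R m) = 1/6 * h m k +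
      1/3 * (S3 I (\<lambda>v w x. W [v,w,x,k]) (D m) - 3/2 * S3 I (\<lambda>v w x. W [v,w,x,k]) (P m))"
    unfolding h_def
    by (rule ricci_contraction[where Rg = "Rg m" and D = D and H = H and P = P])
      (rule D1, rule D2, rule H1, simp add: P_def, rule Rg5, rule R, simp add: dH_def)
  ultimately show ?thesis using dil[OF m k] by argo
qed

text \<open>The divergence of H is antisymmetric and cancels, leaving the Levi-Civita Ricci tensor
  and the square of H.\<close>

lemma Ric_sym_part:
  shows "Ric m k + Ric k m = 2 * ((\<Sum>v\<in>I. Rg v m k v) - 1/4 * (\<Sum>a\<in>I. \<Sum>b\<in>I. H m a b * H k a b))"
proof -
  have Ric: "Ric m k = (\<Sum>v\<in>I. Rg v m k v) + 1/2 * (\<Sum>v\<in>I. D v m k v) - 1/4 * (\<Sum>a\<in>I. \<Sum>b\<in>I. H m a b * H k a b)" for m k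
  proof -
    have z: "D u a b a = 0" "D u a a b = 0" "P a a c d = 0" for u a b c d
      using D1[of u a a b] D2[of u b a a] D1[of u a b a] P1[of a a c d] by simp_all
    have "R m v v k = Rg v m k v + 1/2 * D v m k v - 1/4 * (\<Sum>b\<in>I. H m v b * H k v b)" for v
    proof -
      have "R m v v k = R v m k v" by (simp add: R1[of v m] R2[of m v k])
      also have "\<dots> = Rg v m k v + 1/2 * D v m k v + 1/4 * P m v v k" by (simp add: R z)
      also have "P m v v k = - (\<Sum>b\<in>I. H m v b * H k v b)" by (simp add: P_def H1[of v k] sum_negf)
      finally show ?thesis by simp
    qed
    then show ?thesis by (simp add: Ric_def sum.distrib sum_subtractf sum_distrib_left)
  qed
  have rs: "Rg v k m v = Rg v m k v" for v
    using Rg4[of v m k v] Rg1[of k v v m] Rg2[of v k v m] by simp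
  have d: "D v k m v = - D v m k v" for v by (rule D1)
  have hh: "H k a b * H m a b = H m a b * H k a b" for a b by simp
  show ?thesis unfolding Ric rs d hh by (simp add: sum_negf)
qed

text \<open>Averaging \<open>Ric_eq\<close> over the two index orders cancels the term in H and d
  phi; with \<open>h\<close> symmetric, the right-hand side becomes a multiple of
  \<open>h m k\<close>, and \<open>Ric_sym_part\<close> identifies the left-hand side.\<close>

lemma einstein:
  assumes "m \<in> I" "k \<in> I" and h: "h k m = h m k"
  shows "(\<Sum>v\<in>I. Rg v m k v) - 1/4 * (\<Sum>a\<in>I. \<Sum>b\<in>I. H m a b * H k a b) + 2 * hs m k = - 1/12 * h m k"
proof -
  have "(\<Sum>i\<in>I. H k m i * f i) = - (\<Sum>i\<in>I. H m k i * f i)" by (subst H1) (simp add: sum_negf)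
  then show ?thesis
    using Ric_eq[OF assms(1,2)] Ric_eq[OF assms(2,1)] Ric_sym_part[of m k] hs[of m k] h by argo
qed

text \<open>In dimension 7, contracting with \<open>\<Theta>\<close> instead of \<open>*\<Theta>\<close> shows that the 7-dimensional part of
  \<open>dH\<close> vanishes.\<close>

lemma dH_contraction_zero:
  assumes Th: "skew 3 Th" and m: "m \<in> I"
    and inst': "\<And>v. v \<in> I \<Longrightarrow> (\<Sum>w\<in>I. \<Sum>x\<in>I. Th [w,x,v] * R m v w x) = 0"
    and dil': "S3 I (\<lambda>v w x. Th [v,w,x]) (D m) - 3/2 * S3 I (\<lambda>v w x. Th [v,w,x]) (P m) = 0"
  shows "S3 I (\<lambda>v w x. Th [v,w,x]) (dH m) = 0"
proof -
  interpret alt3 I "\<lambda>v w x. Th [v,w,x]" by (rule alt3_skew3[OF Th])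
  have CC: "Th [v,w,x] = Th [w,x,v]" for v w x using C1[of v w x] C2[of w v x] by simp
  have "S3 I (\<lambda>v w x. Th [v,w,x]) (R m) = (\<Sum>v\<in>I. \<Sum>w\<in>I. \<Sum>x\<in>I. Th [w,x,v] * R m v w x)"
    unfolding S3_def by (intro sum.cong refl) (subst CC, rule mult.commute)
  also have "\<dots> = 0" using inst' by simp
  finally have "S3 I (\<lambda>v w x. Th [v,w,x]) (R m) = 0" .
  moreover have "S3 I (\<lambda>v w x. Th [v,w,x]) (R m) = 1/6 * S3 I (\<lambda>v w x. Th [v,w,x]) (dH m) +
      1/3 * (S3 I (\<lambda>v w x. Th [v,w,x]) (D m) - 3/2 * S3 I (\<lambda>v w x. Th [v,w,x]) (P m))"
    by (rule ricci_contraction[where Rg = "Rg m" and D = D and H = H and P = P])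
      (rule D1, rule D2, rule H1, simp add: P_def, rule Rg5, rule R, simp add: dH_def)
  ultimately show ?thesis using dil' by argo
qed

text \<open>In dimension 8, the double contraction of \<open>R \<cdot> \<Phi> = 0\<close> gives a second relation between
  \<open>dH\<close> and the torsion.\<close>

lemma double_contraction:
  assumes b: "b \<in> I" and c: "c \<in> I"
    and stab: "\<And>a v. a \<in> I \<Longrightarrow> v \<in> I \<Longrightarrow> act n (R a v) W [v,a,b,c] = 0"
  shows "2 * (\<Sum>a\<in>I. \<Sum>i\<in>I. Ric a i * W [i,a,b,c])
     - 4 * (\<Sum>i\<in>I. H b c i * f i) - 1/3 * (h b c - h c b)
     + (S3 I (\<lambda>v w x. W [v,w,x,c]) (P b) - S3 I (\<lambda>v w x. W [v,w,x,b]) (P c)) = 0"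
proof -
  have w: "W [y,x,z,u] = - W [x,y,z,u]" "W [x,z,y,u] = - W [x,y,z,u]" "W [x,y,u,z] = - W [x,y,z,u]" for x y z u
    using skew_swap[OF W, of "[]" "[z,u]" y x] skew_swap[OF W, of "[x]" "[u]" z y]
      skew_swap[OF W, of "[x,y]" "[]" u z] by simp_all
  have C: "S3 I (\<lambda>v w x. W [v,w,x,c]) (\<lambda>a v i. R a v i b) =
      4 * (hs b c - 1/2 * (\<Sum>i\<in>I. H b c i * f i)) - 1/3 * h b c + S3 I (\<lambda>v w x. W [v,w,x,c]) (P b)"
    if "b \<in> I" "c \<in> I" for b c
  proof -
    interpret alt3 I "\<lambda>v w x. W [v,w,x,c]" by (rule alt3_skew4[OF W])
    have "S3 I (\<lambda>v w x. W [v,w,x,c]) (\<lambda>a v i. R a v i b) = 1/3 * S3 I (\<lambda>v w x. W [v,w,x,c]) (D b)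
        - 1/3 * S3 I (\<lambda>v w x. W [v,w,x,c]) (dH b) + 1/2 * S3 I (\<lambda>v w x. W [v,w,x,c]) (P b)"
      by (rule first_indices_contraction[where Rg = "\<lambda>a v i. Rg a v i b" and D = D and H = H and P = P])
        (rule D1, rule D2, rule H1, simp add: P_def, rule Rg3, rule R, simp add: dH_def)
    then show ?thesis using dil[OF that] by (simp add: h_def)
  qed
  \<comment> \<open>Both 2-form indices of R are contracted with the first two slots. The action on
    these slots gives two equal Ricci terms; the action on b and on c gives contractions over the
    first three indices of R.\<close>
  have "0 = (\<Sum>a\<in>I. \<Sum>v\<in>I. act n (R a v) W [v,a,b,c])" using stab by simp
  also have "\<dots> = (\<Sum>a\<in>I. \<Sum>v\<in>I. \<Sum>i\<in>I. R a v v i * W [i,a,b,c]) + (\<Sum>a\<in>I. \<Sum>v\<in>I. \<Sum>i\<in>I. R a v a i * W [v,i,b,c])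
     + (\<Sum>a\<in>I. \<Sum>v\<in>I. \<Sum>i\<in>I. R a v b i * W [v,a,i,c]) + (\<Sum>a\<in>I. \<Sum>v\<in>I. \<Sum>i\<in>I. R a v c i * W [v,a,b,i])"
    by (simp add: act4 sum.distrib I_def)
  also have "(\<Sum>a\<in>I. \<Sum>v\<in>I. \<Sum>i\<in>I. R a v v i * W [i,a,b,c]) = (\<Sum>a\<in>I. \<Sum>i\<in>I. Ric a i * W [i,a,b,c])"
    by (rule sum.cong[OF refl], subst sum.swap) (simp add: Ric_def sum_distrib_right)
  also have "(\<Sum>a\<in>I. \<Sum>v\<in>I. \<Sum>i\<in>I. R a v a i * W [v,i,b,c]) = (\<Sum>a\<in>I. \<Sum>i\<in>I. Ric a i * W [i,a,b,c])"
  proof -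
    have "(\<Sum>a\<in>I. \<Sum>v\<in>I. \<Sum>i\<in>I. R a v a i * W [v,i,b,c]) = (\<Sum>v\<in>I. \<Sum>a\<in>I. \<Sum>i\<in>I. R a v a i * W [v,i,b,c])"
      by (rule sum.swap)
    also have "\<dots> = (\<Sum>v\<in>I. \<Sum>i\<in>I. \<Sum>a\<in>I. R v a a i * W [i,v,b,c])"
    proof (rule sum.cong[OF refl])
      fix v
      have "R a v a i * W [v,i,b,c] = R v a a i * W [i,v,b,c]" for a i
        by (subst R1, subst w(1)) simp
      then show "(\<Sum>a\<in>I. \<Sum>i\<in>I. R a v a i * W [v,i,b,c]) = (\<Sum>i\<in>I. \<Sum>a\<in>I. R v a a i * W [i,v,b,c])"
        by (simp only:) (rule sum.swap)
    qed
    also have "\<dots> = (\<Sum>a\<in>I. \<Sum>i\<in>I. Ric a i * W [i,a,b,c])" by (simp add: Ric_def sum_distrib_right)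
    finally show ?thesis .
  qed
  also have "(\<Sum>a\<in>I. \<Sum>v\<in>I. \<Sum>i\<in>I. R a v b i * W [v,a,i,c]) = S3 I (\<lambda>v w x. W [v,w,x,c]) (\<lambda>a v i. R a v i b)"
    unfolding S3_def by (intro sum.cong refl) (subst R2, subst w(1), simp)
  also have "(\<Sum>a\<in>I. \<Sum>v\<in>I. \<Sum>i\<in>I. R a v c i * W [v,a,b,i]) = - S3 I (\<lambda>v w x. W [v,w,x,b]) (\<lambda>a v i. R a v i c)"
    unfolding S3_def sum_negf[symmetric] by (intro sum.cong refl) (subst R2, subst w(1), subst w(3), simp)
  finally have "0 = (\<Sum>a\<in>I. \<Sum>i\<in>I. Ric a i * W [i,a,b,c]) + (\<Sum>a\<in>I. \<Sum>i\<in>I. Ric a i * W [i,a,b,c]) +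
     S3 I (\<lambda>v w x. W [v,w,x,c]) (\<lambda>a v i. R a v i b) + - S3 I (\<lambda>v w x. W [v,w,x,b]) (\<lambda>a v i. R a v i c)" .
  moreover have "(\<Sum>i\<in>I. H c b i * f i) = - (\<Sum>i\<in>I. H b c i * f i)" by (subst H1) (simp add: sum_negf)
  ultimately show ?thesis using C[OF b c] C[OF c b] hs[of b c] by argo
qed

end

subsection \<open>The stabiliser of the $Spin(7)$-form\<close>

text \<open>Otherwise simp would turn the index 1 into \<open>Suc 0\<close>, and the tables of
  components would no longer match.\<close>

declare One_nat_def [simp del]

lemma ball_upto8: "(\<forall>a\<in>{1..8::nat}. Q a) \<longleftrightarrow> Q 1 \<and> Q 2 \<and> Q 3 \<and> Q 4 \<and> Q 5 \<and> Q 6 \<and> Q 7 \<and> Q 8"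
proof -
  have "{1..8::nat} = {1,2,3,4,5,6,7,8}" by auto
  then show ?thesis by simp
qed

lemma permute_list_update:
  assumes \<sigma>: "\<sigma> permutes {..<length vs}" and s: "s < length vs"
  shows "(permute_list \<sigma> vs)[s := x] = permute_list \<sigma> (vs[\<sigma> s := x])"
proof (rule nth_equalityI)
  fix i assume i: "i < length ((permute_list \<sigma> vs)[s := x])"
  have "\<sigma> i = \<sigma> s \<longleftrightarrow> i = s" using permutes_inj[OF \<sigma>] by (simp add: inj_eq)
  moreover have "\<sigma> s < length vs" "\<sigma> i < length vs" using permutes_in_image[OF \<sigma>] s i by auto
  ultimately show "(permute_list \<sigma> vs)[s := x] ! i = permute_list \<sigma> (vs[\<sigma> s := x]) ! i"
    using i \<sigma> by (auto simp: nth_list_update permute_list_nth)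
qed simp

text \<open>A derivation treats all slots alike, so reordering the arguments permutes its summands
  and yields the sign in each.\<close>

lemma skew_act:
  assumes C: "skew k C"
  shows "skew k (act n A C)"
  unfolding skew_def
proof (intro allI impI)
  fix vs :: "nat list" and \<sigma> assume len: "length vs = k" and \<sigma>: "\<sigma> permutes {..<k}"
  have "act n A C (permute_list \<sigma> vs) = (\<Sum>s<k. \<Sum>i=1..n. A (vs ! \<sigma> s) i * (of_int (sign \<sigma>) * C (vs[\<sigma> s := i])))"
    unfolding act_def length_permute_list len
  proof (intro sum.cong refl)
    fix s i assume s: "s \<in> {..<k}"
    have "C ((permute_list \<sigma> vs)[s := i]) = of_int (sign \<sigma>) * C (vs[\<sigma> s := i])"
      using s \<sigma> len by (simp add: permute_list_update skewD[OF C])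
    then show "A (permute_list \<sigma> vs ! s) i * C ((permute_list \<sigma> vs)[s := i]) =
        A (vs ! \<sigma> s) i * (of_int (sign \<sigma>) * C (vs[\<sigma> s := i]))"
      using s \<sigma> len by (simp add: permute_list_nth)
  qed
  also have "\<dots> = (\<Sum>s<k. \<Sum>i=1..n. A (vs ! s) i * (of_int (sign \<sigma>) * C (vs[s := i])))"
    using sum.permute[OF \<sigma>, of "\<lambda>s. \<Sum>i=1..n. A (vs ! s) i * (of_int (sign \<sigma>) * C (vs[s := i]))"]
    by (simp add: o_def)
  finally show "act n A C (permute_list \<sigma> vs) = of_int (sign \<sigma>) * act n A C vs"
    by (simp add: act_def len sum_distrib_left mult_ac)
qed

text \<open>Sorting distinct indices costs a sign, and repeated indices give zero.\<close>

lemma skew_zero_sorted: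
  assumes F: "skew k F" and z: "\<And>K. length K = k \<Longrightarrow> sorted K \<Longrightarrow> distinct K \<Longrightarrow> set K \<subseteq> S \<Longrightarrow> F K = 0"
    and K: "length K = k" "set K \<subseteq> S"
  shows "F (K::nat list) = 0"
proof (cases "distinct K")
  case True
  obtain \<sigma> where \<sigma>: "\<sigma> permutes {..<length (sort K)}" "permute_list \<sigma> (sort K) = K"
    using mset_eq_permutation[of K "sort K"] by auto
  have "F (permute_list \<sigma> (sort K)) = of_int (sign \<sigma>) * F (sort K)"
    using \<sigma>(1) K by (intro skewD[OF F]) auto
  then show ?thesis using \<sigma>(2) z[of "sort K"] True K by simp
qed (use skew_repeat[OF F] K in blast)

lemma skew4_zero:
  assumes F: "skew 4 F" and z: "\<forall>a\<in>S. \<forall>b\<in>S. \<forall>c\<in>S. \<forall>d\<in>S. a < b \<longrightarrow> b < c \<longrightarrow> c < d \<longrightarrow> F [a,b,c,d] = 0"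
    and K: "length K = 4" "set K \<subseteq> S"
  shows "F (K::nat list) = 0"
proof (rule skew_zero_sorted[OF F _ K])
  fix L :: "nat list" assume L: "length L = 4" "sorted L" "distinct L" "set L \<subseteq> S"
  then obtain a b c d where "L = [a,b,c,d]"
    by (auto simp: numeral_eq_Suc length_Suc_conv)
  with L z show "F L = 0" by auto
qed

text \<open>The 7-dimensional part of a 2-form is determined by its components with first index 1.\<close>

definition spin7_eqs :: "(nat \<Rightarrow> nat \<Rightarrow> real) \<Rightarrow> nat \<Rightarrow> bool" where
  "spin7_eqs A n \<longleftrightarrow> A 1 n + (\<Sum>p=1..8. \<Sum>q=1..8. Phi [p,q,1,n] * A p q) / 2 = 0"

text \<open>A.Phi depends only on the Lambda^2_7 part of A, so each of its components is a linear
  combination of the seven equations; \<open>argo\<close> finds the combination.\<close>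

lemma spin7_eqs_stabilizer:
  assumes As: "\<And>a b. A b a = - A a b" and eqs: "\<And>n. n \<in> {2..8} \<Longrightarrow> spin7_eqs A n"
    and K: "length K = 4" "set K \<subseteq> {1..8}"
  shows "act 8 A Phi K = 0"
proof (rule skew4_zero[OF skew_act[OF Phi_skew] _ K])
  have As': "b < a \<Longrightarrow> A a b = - A b a" "A a a = 0" for a b using As[of b a] As[of a a] by auto
  note R = act4 sum_upto8 Phi_simps Phi_vals As'
  note e = eqs[unfolded spin7_eqs_def]
  note e7 = e[of 2, simplified R, simplified R, simplified] e[of 3, simplified R, simplified R, simplified]
    e[of 4, simplified R, simplified R, simplified] e[of 5, simplified R, simplified R, simplified]
    e[of 6, simplified R, simplified R, simplified] e[of 7, simplified R, simplified R, simplified]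
    e[of 8, simplified R, simplified R, simplified]
  \<comment> \<open>\<open>F\<close> hides the action while the index tuples are enumerated; it is
    expanded only for the 70 increasing ones.\<close>
  define F where "F a b c d = act 8 A Phi [a,b,c,d]" for a b c d
  have "\<forall>a\<in>{1..8}. \<forall>b\<in>{1..8}. \<forall>c\<in>{1..8}. \<forall>d\<in>{1..8}. a < b \<longrightarrow> b < c \<longrightarrow> c < d \<longrightarrow> F a b c d = 0"
    apply (simp add: ball_upto8)
    apply (unfold F_def)
    apply (simp only: R)
    apply (simp add: R)
    apply (insert e7)
    apply (intro conjI)
    apply argo+
    done
  then show "\<forall>a\<in>{1..8}. \<forall>b\<in>{1..8}. \<forall>c\<in>{1..8}. \<forall>d\<in>{1..8}. a < b \<longrightarrow> b < c \<longrightarrow> c < d \<longrightarrow> act 8 A Phi [a,b,c,d] = 0"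
    by (simp only: F_def)
qed

text \<open>Each of the seven chosen components of A.Phi contains exactly one entry A_(1n) of the
  first row and is, up to sign, the equation \<open>spin7_eqs A n\<close>. These equations cut out
  Lambda^2_21, on which contraction with Phi has eigenvalue -2.\<close>

lemma spin7_stabilizer_instanton:
  assumes As: "\<And>a b. A b a = - A a b" and st: "\<And>K. length K = 4 \<Longrightarrow> set K \<subseteq> {1..8} \<Longrightarrow> act 8 A Phi K = 0"
    and mk: "m \<in> {1..8}" "k \<in> {1..8}"
  shows "(\<Sum>w=1..8. \<Sum>x=1..8. Phi [w,x,m,k] * A w x) = - 2 * A m k"
proof -
  have As': "b < a \<Longrightarrow> A a b = - A b a" "A a a = 0" for a b using As[of b a] As[of a a] by auto
  note R = act4 sum_upto8 Phi_simps Phi_vals As'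
  have e2: "act 8 A Phi [1,3,4,5] = 0" by (rule st) auto
  have e3: "act 8 A Phi [1,2,4,5] = 0" by (rule st) auto
  have e4: "act 8 A Phi [1,2,3,5] = 0" by (rule st) auto
  have e5: "act 8 A Phi [1,2,3,4] = 0" by (rule st) auto
  have e6: "act 8 A Phi [1,2,3,7] = 0" by (rule st) auto
  have e7: "act 8 A Phi [1,2,3,6] = 0" by (rule st) auto
  have e8: "act 8 A Phi [1,2,4,7] = 0" by (rule st) auto
  note e7 = e2[simplified R, simplified R, simplified] e3[simplified R, simplified R, simplified] e4[simplified R, simplified R, simplified] e5[simplified R, simplified R, simplified] e6[simplified R, simplified R, simplified] e7[simplified R, simplified R, simplified] e8[simplified R, simplified R, simplified]
  define F where "F m k = (\<Sum>w=1..8. \<Sum>x=1..8. Phi [w,x,m,k] * A w x) + 2 * A m k" for m k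
  have "\<forall>m\<in>{1..8}. \<forall>k\<in>{1..8}. m < k \<longrightarrow> F m k = 0"
    apply (simp add: ball_upto8)
    apply (unfold F_def)
    apply (simp add: R)
    apply (insert e7)
    apply (intro conjI)
    apply argo+
    done
  moreover have "F k m = - F m k" for m k
  proof -
    have "Phi [w,x,k,m] = - Phi [w,x,m,k]" for w x
      using skew_swap[OF Phi_skew, of "[w,x]" "[]" k m] by simp
    then show ?thesis using As[of m k] by (simp add: F_def sum_negf)
  qed
  moreover have "F m m = 0" for m using As'(2) by (simp add: F_def Phi_simps)
  ultimately have "F m k = 0" using mk by (metis linorder_neqE_nat minus_equation_iff neg_0_equal_iff_equal)
  then show ?thesis by (simp add: F_def)
qed

text \<open>The Levi-Civita symbol on the indices 1, ..., n.\<close>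

definition eps :: "nat \<Rightarrow> nat list \<Rightarrow> real" where "eps n = cof kd id [1..<Suc n]"

lemma eps_skew: "skew n (eps n)"
  unfolding eps_def by (rule cof_skew') simp

section \<open>The torsion of a Spin(7)-structure as a linear system\<close>

lemma eps8_simps:
  "b < a \<Longrightarrow> eps 8 [a,b,c,d,e,f,g,h] = - eps 8 [b,a,c,d,e,f,g,h]"
  "c < b \<Longrightarrow> eps 8 [a,b,c,d,e,f,g,h] = - eps 8 [a,c,b,d,e,f,g,h]"
  "d < c \<Longrightarrow> eps 8 [a,b,c,d,e,f,g,h] = - eps 8 [a,b,d,c,e,f,g,h]"
  "e < d \<Longrightarrow> eps 8 [a,b,c,d,e,f,g,h] = - eps 8 [a,b,c,e,d,f,g,h]"
  "f < e \<Longrightarrow> eps 8 [a,b,c,d,e,f,g,h] = - eps 8 [a,b,c,d,f,e,g,h]"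
  "g < f \<Longrightarrow> eps 8 [a,b,c,d,e,f,g,h] = - eps 8 [a,b,c,d,e,g,f,h]"
  "h < g \<Longrightarrow> eps 8 [a,b,c,d,e,f,g,h] = - eps 8 [a,b,c,d,e,f,h,g]"
  "eps 8 [1,2,3,4,5,6,7,8] = 1"
proof -
  show "b < a \<Longrightarrow> eps 8 [a,b,c,d,e,f,g,h] = - eps 8 [b,a,c,d,e,f,g,h]"
    using skew_swap[OF eps_skew, of "[]" "[c,d,e,f,g,h]" 8 a b] by simp
  show "c < b \<Longrightarrow> eps 8 [a,b,c,d,e,f,g,h] = - eps 8 [a,c,b,d,e,f,g,h]"
    using skew_swap[OF eps_skew, of "[a]" "[d,e,f,g,h]" 8 b c] by simp
  show "d < c \<Longrightarrow> eps 8 [a,b,c,d,e,f,g,h] = - eps 8 [a,b,d,c,e,f,g,h]"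
    using skew_swap[OF eps_skew, of "[a,b]" "[e,f,g,h]" 8 c d] by simp
  show "e < d \<Longrightarrow> eps 8 [a,b,c,d,e,f,g,h] = - eps 8 [a,b,c,e,d,f,g,h]"
    using skew_swap[OF eps_skew, of "[a,b,c]" "[f,g,h]" 8 d e] by simp
  show "f < e \<Longrightarrow> eps 8 [a,b,c,d,e,f,g,h] = - eps 8 [a,b,c,d,f,e,g,h]"
    using skew_swap[OF eps_skew, of "[a,b,c,d]" "[g,h]" 8 e f] by simp
  show "g < f \<Longrightarrow> eps 8 [a,b,c,d,e,f,g,h] = - eps 8 [a,b,c,d,e,g,f,h]"
    using skew_swap[OF eps_skew, of "[a,b,c,d,e]" "[h]" 8 f g] by simp
  show "h < g \<Longrightarrow> eps 8 [a,b,c,d,e,f,g,h] = - eps 8 [a,b,c,d,e,f,h,g]"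
    using skew_swap[OF eps_skew, of "[a,b,c,d,e,f]" "[]" 8 g h] by simp
  show "eps 8 [1,2,3,4,5,6,7,8] = 1"
    by (simp add: eps_def upt_conv_Cons cof_kd_self)
qed

text \<open>The linear system is homogeneous for a grading by \<open>(\<int>/2)\<^sup>3\<close>, hence splits into the eight blocks of
  the proof; likewise in \<open>g2_torsion\<close>.\<close>

lemma spin7_torsion:
  assumes tri: "\<And>J a b c. length J = 5 \<Longrightarrow> distinct (J @ [a,b,c]) \<Longrightarrow> list_all (\<lambda>x. 1 \<le> x \<and> x \<le> 8) (J @ [a,b,c]) \<Longrightarrow>
      H a b c = eps 8 (J @ [a,b,c]) * dform 8 om Phi J - 2 * (\<Sum>x=1..8. f x * Phi [x,a,b,c])"
    and lee: "\<And>n. n \<in> {1..8} \<Longrightarrow> (\<Sum>a=1..8. \<Sum>b=1..8. \<Sum>c=1..8. H a b c * Phi [a,b,c,n]) = 12 * f n"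
    and H: "\<And>a b c. H b a c = - H a b c" "\<And>a b c. H a c b = - H a b c"
    and om: "\<And>v a b. om v b a = - om v a b"
  shows "v \<in> {1..8} \<Longrightarrow> n \<in> {2..8} \<Longrightarrow> spin7_eqs (\<lambda>a b. om v a b + H v a b / 2) n"
proof -
  have Hs: "b < a \<Longrightarrow> H a b c = - H b a c" "c < b \<Longrightarrow> H a b c = - H a c b" "H a a b = 0" "H a b b = 0" for a b c
    using H(1)[of a b c] H(2)[of a b c] H(1)[of a a b] H(2)[of a b b] by auto
  have oms: "b < a \<Longrightarrow> om v a b = - om v b a" "om v a a = 0" for v a b using om[of v a b] om[of v a a] by auto
  note R = dform5 act4 sum_upto8 Phi_simps Phi_vals Hs oms eps8_simps spin7_eqs_def
  note [simp] = R
  have s8: "{1..8::nat} = {1,2,3,4,5,6,7,8}" by auto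
  \<comment> \<open>Each block takes seven components of the formula for H and one Lee equation,
    which expresses the single component of d phi occurring there through H. Together they imply the
    seven equations of the block, and the eight blocks exhaust the 56 pairs (v, n).\<close>
  note E = tri[of "[4,5,6,7,8]" 1 2 3, simplified] tri[of "[2,3,6,7,8]" 1 4 5, simplified] tri[of "[2,3,4,5,8]" 1 6 7, simplified] tri[of "[1,3,5,6,8]" 2 4 7, simplified] tri[of "[1,3,4,7,8]" 2 5 6, simplified] tri[of "[1,2,5,7,8]" 3 4 6, simplified] tri[of "[1,2,4,6,8]" 3 5 7, simplified] lee[of 8, simplified]
  have B0: "spin7_eqs (\<lambda>a b. om 3 a b + H 3 a b / 2) 2" "spin7_eqs (\<lambda>a b. om 2 a b + H 2 a b / 2) 3" "spin7_eqs (\<lambda>a b. om 5 a b + H 5 a b / 2) 4" "spin7_eqs (\<lambda>a b. om 4 a b + H 4 a b / 2) 5" "spin7_eqs (\<lambda>a b. om 7 a b + H 7 a b / 2) 6" "spin7_eqs (\<lambda>a b. om 6 a b + H 6 a b / 2) 7" "spin7_eqs (\<lambda>a b. om 1 a b + H 1 a b / 2) 8"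
    apply simp_all
    apply (insert E)
    apply argo+
    done
  note E = tri[of "[1,4,5,6,7]" 2 3 8, simplified] tri[of "[1,3,5,7,8]" 2 4 6, simplified] tri[of "[1,3,4,6,8]" 2 5 7, simplified] tri[of "[1,2,5,6,8]" 3 4 7, simplified] tri[of "[1,2,4,7,8]" 3 5 6, simplified] tri[of "[1,2,3,6,7]" 4 5 8, simplified] tri[of "[1,2,3,4,5]" 6 7 8, simplified] lee[of 1, simplified]
  have B1: "spin7_eqs (\<lambda>a b. om 2 a b + H 2 a b / 2) 2" "spin7_eqs (\<lambda>a b. om 3 a b + H 3 a b / 2) 3" "spin7_eqs (\<lambda>a b. om 4 a b + H 4 a b / 2) 4" "spin7_eqs (\<lambda>a b. om 5 a b + H 5 a b / 2) 5" "spin7_eqs (\<lambda>a b. om 6 a b + H 6 a b / 2) 6" "spin7_eqs (\<lambda>a b. om 7 a b + H 7 a b / 2) 7" "spin7_eqs (\<lambda>a b. om 8 a b + H 8 a b / 2) 8"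
    apply simp_all
    apply (insert E)
    apply argo+
    done
  note E = tri[of "[2,4,5,6,7]" 1 3 8, simplified] tri[of "[2,3,5,7,8]" 1 4 6, simplified] tri[of "[2,3,4,6,8]" 1 5 7, simplified] tri[of "[1,2,6,7,8]" 3 4 5, simplified] tri[of "[1,2,4,5,8]" 3 6 7, simplified] tri[of "[1,2,3,5,6]" 4 7 8, simplified] tri[of "[1,2,3,4,7]" 5 6 8, simplified] lee[of 2, simplified]
  have B2: "spin7_eqs (\<lambda>a b. om 1 a b + H 1 a b / 2) 2" "spin7_eqs (\<lambda>a b. om 8 a b + H 8 a b / 2) 3" "spin7_eqs (\<lambda>a b. om 6 a b + H 6 a b / 2) 4" "spin7_eqs (\<lambda>a b. om 7 a b + H 7 a b / 2) 5" "spin7_eqs (\<lambda>a b. om 4 a b + H 4 a b / 2) 6" "spin7_eqs (\<lambda>a b. om 5 a b + H 5 a b / 2) 7" "spin7_eqs (\<lambda>a b. om 3 a b + H 3 a b / 2) 8"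
    apply simp_all
    apply (insert E)
    apply argo+
    done
  note E = tri[of "[3,4,5,6,7]" 1 2 8, simplified] tri[of "[2,3,5,6,8]" 1 4 7, simplified] tri[of "[2,3,4,7,8]" 1 5 6, simplified] tri[of "[1,3,6,7,8]" 2 4 5, simplified] tri[of "[1,3,4,5,8]" 2 6 7, simplified] tri[of "[1,2,3,5,7]" 4 6 8, simplified] tri[of "[1,2,3,4,6]" 5 7 8, simplified] lee[of 3, simplified]
  have B3: "spin7_eqs (\<lambda>a b. om 8 a b + H 8 a b / 2) 2" "spin7_eqs (\<lambda>a b. om 1 a b + H 1 a b / 2) 3" "spin7_eqs (\<lambda>a b. om 7 a b + H 7 a b / 2) 4" "spin7_eqs (\<lambda>a b. om 6 a b + H 6 a b / 2) 5" "spin7_eqs (\<lambda>a b. om 5 a b + H 5 a b / 2) 6" "spin7_eqs (\<lambda>a b. om 4 a b + H 4 a b / 2) 7" "spin7_eqs (\<lambda>a b. om 2 a b + H 2 a b / 2) 8"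
    apply simp_all
    apply (insert E)
    apply argo+
    done
  note E = tri[of "[3,4,5,7,8]" 1 2 6, simplified] tri[of "[2,4,5,6,8]" 1 3 7, simplified] tri[of "[2,3,4,6,7]" 1 5 8, simplified] tri[of "[1,4,6,7,8]" 2 3 5, simplified] tri[of "[1,3,4,5,6]" 2 7 8, simplified] tri[of "[1,2,4,5,7]" 3 6 8, simplified] tri[of "[1,2,3,4,8]" 5 6 7, simplified] lee[of 4, simplified]
  have B4: "spin7_eqs (\<lambda>a b. om 6 a b + H 6 a b / 2) 2" "spin7_eqs (\<lambda>a b. om 7 a b + H 7 a b / 2) 3" "spin7_eqs (\<lambda>a b. om 1 a b + H 1 a b / 2) 4" "spin7_eqs (\<lambda>a b. om 8 a b + H 8 a b / 2) 5" "spin7_eqs (\<lambda>a b. om 2 a b + H 2 a b / 2) 6" "spin7_eqs (\<lambda>a b. om 3 a b + H 3 a b / 2) 7" "spin7_eqs (\<lambda>a b. om 5 a b + H 5 a b / 2) 8"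
    apply simp_all
    apply (insert E)
    apply argo+
    done
  note E = tri[of "[3,4,5,6,8]" 1 2 7, simplified] tri[of "[2,4,5,7,8]" 1 3 6, simplified] tri[of "[2,3,5,6,7]" 1 4 8, simplified] tri[of "[1,5,6,7,8]" 2 3 4, simplified] tri[of "[1,3,4,5,7]" 2 6 8, simplified] tri[of "[1,2,4,5,6]" 3 7 8, simplified] tri[of "[1,2,3,5,8]" 4 6 7, simplified] lee[of 5, simplified]
  have B5: "spin7_eqs (\<lambda>a b. om 7 a b + H 7 a b / 2) 2" "spin7_eqs (\<lambda>a b. om 6 a b + H 6 a b / 2) 3" "spin7_eqs (\<lambda>a b. om 8 a b + H 8 a b / 2) 4" "spin7_eqs (\<lambda>a b. om 1 a b + H 1 a b / 2) 5" "spin7_eqs (\<lambda>a b. om 3 a b + H 3 a b / 2) 6" "spin7_eqs (\<lambda>a b. om 2 a b + H 2 a b / 2) 7" "spin7_eqs (\<lambda>a b. om 4 a b + H 4 a b / 2) 8"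
    apply simp_all
    apply (insert E)
    apply argo+
    done
  note E = tri[of "[3,4,6,7,8]" 1 2 5, simplified] tri[of "[2,5,6,7,8]" 1 3 4, simplified] tri[of "[2,3,4,5,7]" 1 6 8, simplified] tri[of "[1,4,5,7,8]" 2 3 6, simplified] tri[of "[1,3,5,6,7]" 2 4 8, simplified] tri[of "[1,2,4,6,7]" 3 5 8, simplified] tri[of "[1,2,3,7,8]" 4 5 6, simplified] lee[of 7, simplified]
  have B6: "spin7_eqs (\<lambda>a b. om 5 a b + H 5 a b / 2) 2" "spin7_eqs (\<lambda>a b. om 4 a b + H 4 a b / 2) 3" "spin7_eqs (\<lambda>a b. om 3 a b + H 3 a b / 2) 4" "spin7_eqs (\<lambda>a b. om 2 a b + H 2 a b / 2) 5" "spin7_eqs (\<lambda>a b. om 8 a b + H 8 a b / 2) 6" "spin7_eqs (\<lambda>a b. om 1 a b + H 1 a b / 2) 7" "spin7_eqs (\<lambda>a b. om 6 a b + H 6 a b / 2) 8"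
    apply simp_all
    apply (insert E)
    apply argo+
    done
  note E = tri[of "[3,5,6,7,8]" 1 2 4, simplified] tri[of "[2,4,6,7,8]" 1 3 5, simplified] tri[of "[2,3,4,5,6]" 1 7 8, simplified] tri[of "[1,4,5,6,8]" 2 3 7, simplified] tri[of "[1,3,4,6,7]" 2 5 8, simplified] tri[of "[1,2,5,6,7]" 3 4 8, simplified] tri[of "[1,2,3,6,8]" 4 5 7, simplified] lee[of 6, simplified]
  have B7: "spin7_eqs (\<lambda>a b. om 4 a b + H 4 a b / 2) 2" "spin7_eqs (\<lambda>a b. om 5 a b + H 5 a b / 2) 3" "spin7_eqs (\<lambda>a b. om 2 a b + H 2 a b / 2) 4" "spin7_eqs (\<lambda>a b. om 3 a b + H 3 a b / 2) 5" "spin7_eqs (\<lambda>a b. om 1 a b + H 1 a b / 2) 6" "spin7_eqs (\<lambda>a b. om 8 a b + H 8 a b / 2) 7" "spin7_eqs (\<lambda>a b. om 7 a b + H 7 a b / 2) 8"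
    apply simp_all
    apply (insert E)
    apply argo+
    done
  assume vn: "v \<in> {1..8}" "n \<in> {2..8}"
  have "v \<in> {1,2,3,4,5,6,7,8}" "n \<in> {2,3,4,5,6,7,8}" using vn by auto
  then show "spin7_eqs (\<lambda>a b. om v a b + H v a b / 2) n"
    by (elim insertE emptyE) (simp_all only: B0 B1 B2 B3 B4 B5 B6 B7)
qed

text \<open>The factor 6 counts the orderings of a triple, and each index meets seven triples. The
  explicit form spares the later polynomial identities the sums over 8^3 terms.\<close>

lemma Phi_S3:
  fixes G :: "nat \<Rightarrow> nat \<Rightarrow> nat \<Rightarrow> real"
  assumes "\<And>a b c. G b a c = - G a b c" "\<And>a b c. G a c b = - G a b c"
  shows
    "S3 {1..8} (\<lambda>v w x. Phi [v,w,x,1]) G = 6 * (- G 2 3 8 - G 2 4 6 + G 2 5 7 + G 3 4 7 + G 3 5 6 - G 4 5 8 - G 6 7 8)"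
    "S3 {1..8} (\<lambda>v w x. Phi [v,w,x,2]) G = 6 * (G 1 3 8 + G 1 4 6 - G 1 5 7 - G 3 4 5 - G 3 6 7 - G 4 7 8 - G 5 6 8)"
    "S3 {1..8} (\<lambda>v w x. Phi [v,w,x,3]) G = 6 * (- G 1 2 8 - G 1 4 7 - G 1 5 6 + G 2 4 5 + G 2 6 7 - G 4 6 8 + G 5 7 8)"
    "S3 {1..8} (\<lambda>v w x. Phi [v,w,x,4]) G = 6 * (- G 1 2 6 + G 1 3 7 + G 1 5 8 - G 2 3 5 + G 2 7 8 + G 3 6 8 - G 5 6 7)"
    "S3 {1..8} (\<lambda>v w x. Phi [v,w,x,5]) G = 6 * (G 1 2 7 + G 1 3 6 - G 1 4 8 + G 2 3 4 + G 2 6 8 - G 3 7 8 + G 4 6 7)"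
    "S3 {1..8} (\<lambda>v w x. Phi [v,w,x,6]) G = 6 * (G 1 2 4 - G 1 3 5 + G 1 7 8 - G 2 3 7 - G 2 5 8 - G 3 4 8 - G 4 5 7)"
    "S3 {1..8} (\<lambda>v w x. Phi [v,w,x,7]) G = 6 * (- G 1 2 5 - G 1 3 4 - G 1 6 8 + G 2 3 6 - G 2 4 8 + G 3 5 8 + G 4 5 6)"
    "S3 {1..8} (\<lambda>v w x. Phi [v,w,x,8]) G = 6 * (G 1 2 3 + G 1 4 5 + G 1 6 7 + G 2 4 7 + G 2 5 6 + G 3 4 6 - G 3 5 7)"
proof -
  have Gs: "b < a \<Longrightarrow> G a b c = - G b a c" "c < b \<Longrightarrow> G a b c = - G a c b" "G a a b = 0" "G a b b = 0" for a b c
    using assms(1)[of a b c] assms(2)[of a b c] assms(1)[of a a b] assms(2)[of a b b] by auto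
  note R = S3_def sum_upto8 Phi_simps Phi_vals Gs
  show "S3 {1..8} (\<lambda>v w x. Phi [v,w,x,1]) G = 6 * (- G 2 3 8 - G 2 4 6 + G 2 5 7 + G 3 4 7 + G 3 5 6 - G 4 5 8 - G 6 7 8)"
    by (simp add: R)
  show "S3 {1..8} (\<lambda>v w x. Phi [v,w,x,2]) G = 6 * (G 1 3 8 + G 1 4 6 - G 1 5 7 - G 3 4 5 - G 3 6 7 - G 4 7 8 - G 5 6 8)"
    by (simp add: R)
  show "S3 {1..8} (\<lambda>v w x. Phi [v,w,x,3]) G = 6 * (- G 1 2 8 - G 1 4 7 - G 1 5 6 + G 2 4 5 + G 2 6 7 - G 4 6 8 + G 5 7 8)"
    by (simp add: R)
  show "S3 {1..8} (\<lambda>v w x. Phi [v,w,x,4]) G = 6 * (- G 1 2 6 + G 1 3 7 + G 1 5 8 - G 2 3 5 + G 2 7 8 + G 3 6 8 - G 5 6 7)"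
    by (simp add: R)
  show "S3 {1..8} (\<lambda>v w x. Phi [v,w,x,5]) G = 6 * (G 1 2 7 + G 1 3 6 - G 1 4 8 + G 2 3 4 + G 2 6 8 - G 3 7 8 + G 4 6 7)"
    by (simp add: R)
  show "S3 {1..8} (\<lambda>v w x. Phi [v,w,x,6]) G = 6 * (G 1 2 4 - G 1 3 5 + G 1 7 8 - G 2 3 7 - G 2 5 8 - G 3 4 8 - G 4 5 7)"
    by (simp add: R)
  show "S3 {1..8} (\<lambda>v w x. Phi [v,w,x,7]) G = 6 * (- G 1 2 5 - G 1 3 4 - G 1 6 8 + G 2 3 6 - G 2 4 8 + G 3 5 8 + G 4 5 6)"
    by (simp add: R)
  show "S3 {1..8} (\<lambda>v w x. Phi [v,w,x,8]) G = 6 * (G 1 2 3 + G 1 4 5 + G 1 6 7 + G 2 4 7 + G 2 5 6 + G 3 4 6 - G 3 5 7)"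
    by (simp add: R)
qed

text \<open>Lambda^4 of R^8 splits as 1 + 7 + 27 + 35, so the antisymmetric part of \<open>h\<close>
  has no component in Lambda^2_21 and lies in Lambda^2_7. There contraction with Phi has eigenvalue
  6; antisymmetrising \<open>h\<close> contributes 1/2 and the index order i, a a sign, hence -3.
  The code checks the 28 pairs b < c.\<close>

lemma spin7_contraction_eigenvalue:
  fixes d :: "nat \<Rightarrow> nat \<Rightarrow> nat \<Rightarrow> nat \<Rightarrow> real"
  assumes d: "\<And>a b v w. d b a v w = - d a b v w" "\<And>a b v w. d a v b w = - d a b v w" "\<And>a b v w. d a b w v = - d a b v w"
    and h: "\<And>a k. h a k = S3 {1..8} (\<lambda>v w x. Phi [v,w,x,k]) (d a)"
    and bc: "b \<in> {1..8}" "c \<in> {1..8}"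
  shows "(\<Sum>a=1..8. \<Sum>i=1..8. h a i * Phi [i,a,b,c]) = - 3 * (h b c - h c b)"
proof -
  have ds: "b < a \<Longrightarrow> d a b v w = - d b a v w" "v < b \<Longrightarrow> d a b v w = - d a v b w" "w < v \<Longrightarrow> d a b v w = - d a b w v"
    "d a a v w = 0" "d a v v w = 0" "d a v w w = 0" for a b v w
    using d(1)[of a b v w] d(2)[of a b v w] d(3)[of a b v w] d(1)[of a a v w] d(2)[of a v v w] d(3)[of a v w w] by auto
  note hP = Phi_S3[of "d a" for a, OF d(2) d(3), folded h]
  define F where "F b c = (\<Sum>a=1..8. \<Sum>i=1..8. h a i * Phi [i,a,b,c]) + 3 * (h b c - h c b)" for b c
  have F0: "F 1 2 = 0" "F 1 3 = 0" "F 1 4 = 0" "F 1 5 = 0" "F 1 6 = 0" "F 1 7 = 0" "F 1 8 = 0"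
    "F 2 3 = 0" "F 2 4 = 0" "F 2 5 = 0" "F 2 6 = 0" "F 2 7 = 0" "F 2 8 = 0" "F 3 4 = 0" "F 3 5 = 0"
    "F 3 6 = 0" "F 3 7 = 0" "F 3 8 = 0" "F 4 5 = 0" "F 4 6 = 0" "F 4 7 = 0" "F 4 8 = 0" "F 5 6 = 0"
    "F 5 7 = 0" "F 5 8 = 0" "F 6 7 = 0" "F 6 8 = 0" "F 7 8 = 0"
    unfolding F_def
    by (simp add: sum_upto8 Phi_simps Phi_vals, simp only: hP, simp only: ds rel_simps simp_thms, algebra)+
  have "\<forall>b\<in>{1..8}. \<forall>c\<in>{1..8}. b < c \<longrightarrow> F b c = 0"
    by (simp add: ball_upto8 F0)
  moreover have "F c b = - F b c" for b c
  proof -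
    have "Phi [i,a,c,b] = - Phi [i,a,b,c]" for i a using skew_swap[OF Phi_skew, of "[i,a]" "[]" c b] by simp
    then show ?thesis by (simp add: F_def sum_negf)
  qed
  moreover have "F b b = 0" for b by (simp add: F_def Phi_simps)
  ultimately have "F b c = 0" using bc
    by (metis linorder_neqE_nat minus_equation_iff neg_0_equal_iff_equal)
  then show ?thesis by (simp add: F_def)
qed

text \<open>Since f is the contraction of H with Phi, this is an identity between quadratic
  polynomials in the 56 components of H. It makes the torsion terms of
  \<open>double_contraction\<close> cancel.\<close>

lemma spin7_torsion_square:
  fixes H :: "nat \<Rightarrow> nat \<Rightarrow> nat \<Rightarrow> real"
  assumes H: "\<And>a b c. H b a c = - H a b c" "\<And>a b c. H a c b = - H a b c"
    and f: "\<And>k. k \<in> {1..8} \<Longrightarrow> S3 {1..8} (\<lambda>v w x. Phi [v,w,x,k]) H = 12 * f k"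
    and P: "\<And>a b c d. P a b c d = (\<Sum>s=1..8. H a b s * H c d s)"
    and K: "\<And>a b. K a b = (\<Sum>j=1..8. H a b j * f j)"
    and bc: "b \<in> {1..8}" "c \<in> {1..8}"
  shows "S3 {1..8} (\<lambda>v w x. Phi [v,w,x,c]) (P b) - S3 {1..8} (\<lambda>v w x. Phi [v,w,x,b]) (P c)
    = 2 * (\<Sum>a=1..8. \<Sum>i=1..8. K i a * Phi [i,a,b,c]) + 4 * K b c"
proof -
  have Hs: "b < a \<Longrightarrow> H a b c = - H b a c" "c < b \<Longrightarrow> H a b c = - H a c b" "H a a b = 0" "H a b b = 0" for a b c
    using H(1)[of a b c] H(2)[of a b c] H(1)[of a a b] H(2)[of a b b] by auto
  \<comment> \<open>Twice f has integer coefficients in the components of H.\<close>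
  define g where "g k = 2 * f k" for k
  have gk: "g k = S3 {1..8} (\<lambda>v w x. Phi [v,w,x,k]) H / 6" if "k \<in> {1..8}" for k using f[OF that] by (simp add: g_def)
  have g8: "g 1 = - H 2 3 8 - H 2 4 6 + H 2 5 7 + H 3 4 7 + H 3 5 6 - H 4 5 8 - H 6 7 8"
    "g 2 = H 1 3 8 + H 1 4 6 - H 1 5 7 - H 3 4 5 - H 3 6 7 - H 4 7 8 - H 5 6 8"
    "g 3 = - H 1 2 8 - H 1 4 7 - H 1 5 6 + H 2 4 5 + H 2 6 7 - H 4 6 8 + H 5 7 8"
    "g 4 = - H 1 2 6 + H 1 3 7 + H 1 5 8 - H 2 3 5 + H 2 7 8 + H 3 6 8 - H 5 6 7"
    "g 5 = H 1 2 7 + H 1 3 6 - H 1 4 8 + H 2 3 4 + H 2 6 8 - H 3 7 8 + H 4 6 7"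
    "g 6 = H 1 2 4 - H 1 3 5 + H 1 7 8 - H 2 3 7 - H 2 5 8 - H 3 4 8 - H 4 5 7"
    "g 7 = - H 1 2 5 - H 1 3 4 - H 1 6 8 + H 2 3 6 - H 2 4 8 + H 3 5 8 + H 4 5 6"
    "g 8 = H 1 2 3 + H 1 4 5 + H 1 6 7 + H 2 4 7 + H 2 5 6 + H 3 4 6 - H 3 5 7"
    by (simp_all add: gk Phi_S3[OF H])
  define L where "L a b = (\<Sum>j=1..8. H a b j * g j)" for a b
  have KL: "K a b = L a b / 2" for a b unfolding K L_def g_def sum_divide_distrib by simp
  \<comment> \<open>Phi sees only the alternating part of P b. The cyclic sum is alternating in v,
    w, x, so \<open>Phi_S3\<close> applies to it, whereas P b itself need not be
    alternating.\<close>
  define G where "G b v w x = P b v w x + P b w x v + P b x v w" for b v w x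
  have P2: "P a b d c = - P a b c d" for a b c d unfolding P by (subst (2) H(1)) (simp add: sum_negf)
  have G: "G b w v x = - G b v w x" "G b v x w = - G b v w x" for b v w x
    using P2[of b v x w] P2[of b w v x] P2[of b x w v] by (simp_all add: G_def)
  have Q: "S3 {1..8} (\<lambda>v w x. Phi [v,w,x,c]) (P b) = S3 {1..8} (\<lambda>v w x. Phi [v,w,x,c]) (G b) / 3" for b c
  proof -
    interpret alt3 "{1..8}" "\<lambda>v w x. Phi [v,w,x,c]" by (rule alt3_skew4[OF Phi_skew])
    show ?thesis unfolding G_def[abs_def] S3_add using cyc[of "P b"] by simp
  qed
  note QP = Phi_S3[of "G b" for b, OF G]
  \<comment> \<open>Three times the claim, written with g = 2 f, so that no denominators
    remain.\<close>
  define F where "F b c = S3 {1..8} (\<lambda>v w x. Phi [v,w,x,c]) (G b) - S3 {1..8} (\<lambda>v w x. Phi [v,w,x,b]) (G c)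
    - 3 * (\<Sum>a=1..8. \<Sum>i=1..8. L i a * Phi [i,a,b,c]) - 6 * L b c" for b c
  have Ks: "L b a = - L a b" for a b unfolding L_def by (subst H(1)) (simp add: sum_negf)
  have F0: "F 1 2 = 0" "F 1 3 = 0" "F 1 4 = 0" "F 1 5 = 0" "F 1 6 = 0" "F 1 7 = 0" "F 1 8 = 0"
    "F 2 3 = 0" "F 2 4 = 0" "F 2 5 = 0" "F 2 6 = 0" "F 2 7 = 0" "F 2 8 = 0" "F 3 4 = 0" "F 3 5 = 0"
    "F 3 6 = 0" "F 3 7 = 0" "F 3 8 = 0" "F 4 5 = 0" "F 4 6 = 0" "F 4 7 = 0" "F 4 8 = 0" "F 5 6 = 0"
    "F 5 7 = 0" "F 5 8 = 0" "F 6 7 = 0" "F 6 8 = 0" "F 7 8 = 0"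
    unfolding F_def
    by (simp add: sum_upto8 Phi_simps Phi_vals, simp only: QP G_def L_def P sum_upto8,
        simp only: Hs rel_simps simp_thms mult_zero_left mult_zero_right add_0_left add_0_right minus_zero
          mult_minus_left mult_minus_right minus_minus,
        simp only: g8, algebra)+
  have "\<forall>b\<in>{1..8}. \<forall>c\<in>{1..8}. b < c \<longrightarrow> F b c = 0"
    by (simp add: ball_upto8 F0)
  moreover have "F c b = - F b c" for b c
  proof -
    have "Phi [i,a,c,b] = - Phi [i,a,b,c]" for i a using skew_swap[OF Phi_skew, of "[i,a]" "[]" c b] by simp
    then show ?thesis using Ks[of b c] by (simp add: F_def sum_negf)
  qed
  moreover have "F b b = 0" for b using Ks[of b b] by (simp add: F_def Phi_simps)
  ultimately have "F b c = 0" using bc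
    by (metis linorder_neqE_nat minus_equation_iff neg_0_equal_iff_equal)
  moreover have "2 * (\<Sum>a=1..8. \<Sum>i=1..8. K i a * Phi [i,a,b,c]) = (\<Sum>a=1..8. \<Sum>i=1..8. L i a * Phi [i,a,b,c])"
    unfolding KL sum_distrib_left by simp
  ultimately show ?thesis unfolding Q KL F_def by argo
qed

context heterotic_point
begin

text \<open>In \<open>double_contraction\<close> the Ricci terms contribute 1/2 of the antisymmetric
  part of \<open>h\<close> by the eigenvalue lemma, the explicit term contributes -1/3, and the
  torsion terms cancel by \<open>spin7_torsion_square\<close>. The Hessian drops out by symmetry.
  The coefficient 1/6 that remains is nonzero.\<close>

lemma spin7_h_symmetric:
  assumes n8: "n = 8" and W8: "W = Phi"
    and stab: "\<And>a v K. a \<in> I \<Longrightarrow> v \<in> I \<Longrightarrow> length K = 4 \<Longrightarrow> set K \<subseteq> {1..8} \<Longrightarrow> act 8 (R a v) Phi K = 0"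
    and f: "\<And>k. k \<in> {1..8} \<Longrightarrow> S3 {1..8} (\<lambda>v w x. Phi [v,w,x,k]) H = 12 * f k"
    and bc: "b \<in> I" "c \<in> I"
  shows "h c b = h b c"
proof -
  have I8: "I = {1..8}" using n8 by (simp add: I_def)
  define K where "K a b = (\<Sum>j=1..8. H a b j * f j)" for a b
  have dHalt: "dH b a v w = - dH a b v w" "dH a v b w = - dH a b v w" "dH a b w v = - dH a b v w" for a b v w
    unfolding dH_def
    subgoal using D1[of v b a w] D1[of w b a v] by argo
    subgoal using D1[of a v b w] D2[of w a v b] by argo
    subgoal using D2[of a b w v] D2[of b a w v] by argo
    done
  have h: "h a k = S3 {1..8} (\<lambda>v w x. Phi [v,w,x,k]) (dH a)" for a k by (simp add: h_def I8 W8)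
  have eig: "(\<Sum>a=1..8. \<Sum>i=1..8. h a i * Phi [i,a,b,c]) = - 3 * (h b c - h c b)"
    using spin7_contraction_eigenvalue[OF dHalt h] bc I8 by simp
  have sq: "S3 {1..8} (\<lambda>v w x. Phi [v,w,x,c]) (P b) - S3 {1..8} (\<lambda>v w x. Phi [v,w,x,b]) (P c)
    = 2 * (\<Sum>a=1..8. \<Sum>i=1..8. K i a * Phi [i,a,b,c]) + 4 * K b c"
    by (rule spin7_torsion_square[OF H1 H2 f _ K_def]) (use bc I8 in \<open>simp_all add: P_def\<close>)
  have dc: "2 * (\<Sum>a=1..8. \<Sum>i=1..8. Ric a i * Phi [i,a,b,c]) - 4 * K b c - 1/3 * (h b c - h c b)
     + (S3 {1..8} (\<lambda>v w x. Phi [v,w,x,c]) (P b) - S3 {1..8} (\<lambda>v w x. Phi [v,w,x,b]) (P c)) = 0"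
    using double_contraction[OF bc] stab bc n8 unfolding W8 I8 K_def[symmetric] by simp
  have R: "Ric a i = - 1/12 * h a i - 2 * hs a i + K a i" if "a \<in> I" "i \<in> I" for a i
    using Ric_eq[OF that] by (simp add: K_def I8)
  have pa: "(\<Sum>a=1..8. \<Sum>i=1..8. x a i * Phi [i,a,b,c]) = - (\<Sum>a=1..8. \<Sum>i=1..8. x i a * Phi [i,a,b,c])" for x :: "nat \<Rightarrow> nat \<Rightarrow> real"
  proof -
    have s: "Phi [a,i,b,c] = - Phi [i,a,b,c]" for a i using skew_swap[OF Phi_skew, of "[]" "[b,c]" a i] by simp
    have "(\<Sum>a=1..8. \<Sum>i=1..8. x a i * Phi [i,a,b,c]) = (\<Sum>a=1..8. \<Sum>i=1..8. x i a * Phi [a,i,b,c])" by (rule sum.swap)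
    then show ?thesis by (subst (asm) s) (simp add: sum_negf)
  qed
  have hs0: "(\<Sum>a=1..8. \<Sum>i=1..8. hs a i * Phi [i,a,b,c]) = 0"
  proof -
    have "(\<Sum>a=1..8. \<Sum>i=1..8. hs i a * Phi [i,a,b,c]) = (\<Sum>a=1..8. \<Sum>i=1..8. hs a i * Phi [i,a,b,c])"
      by (intro sum.cong refl) (subst hs, rule refl)
    then show ?thesis using pa[of hs] by linarith
  qed
  have "(\<Sum>a=1..8. \<Sum>i=1..8. Ric a i * Phi [i,a,b,c]) = (\<Sum>a=1..8. \<Sum>i=1..8. - 1/12 * (h a i * Phi [i,a,b,c])
      - 2 * (hs a i * Phi [i,a,b,c]) + K a i * Phi [i,a,b,c])"
  proof (intro sum.cong refl)
    fix a i :: nat assume "a \<in> {1..8}" "i \<in> {1..8}"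
    then have "Ric a i = - 1/12 * h a i - 2 * hs a i + K a i" by (intro R) (simp_all only: I8)
    then show "Ric a i * Phi [i,a,b,c] = - 1/12 * (h a i * Phi [i,a,b,c]) - 2 * (hs a i * Phi [i,a,b,c])
        + K a i * Phi [i,a,b,c]"
      by (simp only:) (simp add: algebra_simps)
  qed
  also have "\<dots> = - 1/12 * (\<Sum>a=1..8. \<Sum>i=1..8. h a i * Phi [i,a,b,c]) - 2 * (\<Sum>a=1..8. \<Sum>i=1..8. hs a i * Phi [i,a,b,c])
      + (\<Sum>a=1..8. \<Sum>i=1..8. K a i * Phi [i,a,b,c])"
    by (simp only: sum.distrib sum_subtractf sum_distrib_left)
  finally have "(\<Sum>a=1..8. \<Sum>i=1..8. Ric a i * Phi [i,a,b,c]) = 1/4 * (h b c - h c b) - (\<Sum>a=1..8. \<Sum>i=1..8. K i a * Phi [i,a,b,c])"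
    using eig hs0 pa[of K] by argo
  then show ?thesis using dc sq by argo
qed

end

subsection \<open>The stabiliser of the $G_2$-form\<close>

definition Th :: "nat list \<Rightarrow> real" where "Th = G2_form kd id"

text \<open>The components of \<open>*\<Theta>\<close>; \<open>W7_complement\<close> ties them to
  those of \<open>\<Theta>\<close>.\<close>

definition W7 :: "nat list \<Rightarrow> real" where
  "W7 K = cof kd id [3,4,5,6] K + cof kd id [1,4,5,7] K + cof kd id [1,2,5,6] K + cof kd id [1,2,3,4] K
     + cof kd id [2,3,5,7] K + cof kd id [1,3,6,7] K - cof kd id [2,4,6,7] K"

lemma G2_form_skew: "skew 3 (G2_form b e)"
  unfolding G2_form_def[abs_def] by (intro skew_add skew_diff cof_skew') simp_all

lemmas Th_skew = G2_form_skew[of kd id, folded Th_def]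

lemma W7_skew: "skew 4 W7"
  unfolding W7_def[abs_def] by (intro skew_add skew_diff cof_skew') simp_all

lemma skew3_simps:
  fixes \<alpha> :: "nat list \<Rightarrow> real"
  assumes "skew 3 \<alpha>"
  shows "b < a \<Longrightarrow> \<alpha> [a,b,c] = - \<alpha> [b,a,c]" "c < b \<Longrightarrow> \<alpha> [a,b,c] = - \<alpha> [a,c,b]"
    "\<alpha> [a,a,c] = 0" "\<alpha> [a,b,b] = 0"
  using skew_swap[OF assms, of "[]" "[c]" b a] skew_swap[OF assms, of "[a]" "[]" c b]
  by (auto intro!: skew_repeat[OF assms])

lemmas Th_simps = skew3_simps[OF Th_skew]
lemmas W7_simps = skew4_simps[OF W7_skew]

lemma Th_vals:
  "Th [1,2,3] = 0" "Th [1,2,4] = 0" "Th [1,2,5] = 0" "Th [1,2,6] = 0" "Th [1,2,7] = 1"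
  "Th [1,3,4] = 0" "Th [1,3,5] = 1" "Th [1,3,6] = 0" "Th [1,3,7] = 0" "Th [1,4,5] = 0"
  "Th [1,4,6] = -1" "Th [1,4,7] = 0" "Th [1,5,6] = 0" "Th [1,5,7] = 0" "Th [1,6,7] = 0"
  "Th [2,3,4] = 0" "Th [2,3,5] = 0" "Th [2,3,6] = -1" "Th [2,3,7] = 0" "Th [2,4,5] = -1"
  "Th [2,4,6] = 0" "Th [2,4,7] = 0" "Th [2,5,6] = 0" "Th [2,5,7] = 0" "Th [2,6,7] = 0"
  "Th [3,4,5] = 0" "Th [3,4,6] = 0" "Th [3,4,7] = 1" "Th [3,5,6] = 0" "Th [3,5,7] = 0"
  "Th [3,6,7] = 0" "Th [4,5,6] = 0" "Th [4,5,7] = 0" "Th [4,6,7] = 0" "Th [5,6,7] = 1"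
  by (simp_all add: Th_def G2_form_def cof_kd_self cof_kd_zero)

lemma W7_vals:
  "W7 [1,2,3,4] = 1" "W7 [1,2,3,5] = 0" "W7 [1,2,3,6] = 0" "W7 [1,2,3,7] = 0" "W7 [1,2,4,5] = 0"
  "W7 [1,2,4,6] = 0" "W7 [1,2,4,7] = 0" "W7 [1,2,5,6] = 1" "W7 [1,2,5,7] = 0" "W7 [1,2,6,7] = 0"
  "W7 [1,3,4,5] = 0" "W7 [1,3,4,6] = 0" "W7 [1,3,4,7] = 0" "W7 [1,3,5,6] = 0" "W7 [1,3,5,7] = 0"
  "W7 [1,3,6,7] = 1" "W7 [1,4,5,6] = 0" "W7 [1,4,5,7] = 1" "W7 [1,4,6,7] = 0" "W7 [1,5,6,7] = 0"
  "W7 [2,3,4,5] = 0" "W7 [2,3,4,6] = 0" "W7 [2,3,4,7] = 0" "W7 [2,3,5,6] = 0" "W7 [2,3,5,7] = 1"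
  "W7 [2,3,6,7] = 0" "W7 [2,4,5,6] = 0" "W7 [2,4,5,7] = 0" "W7 [2,4,6,7] = -1" "W7 [2,5,6,7] = 0"
  "W7 [3,4,5,6] = 1" "W7 [3,4,5,7] = 0" "W7 [3,4,6,7] = 0" "W7 [3,5,6,7] = 0" "W7 [4,5,6,7] = 0"
  by (simp_all add: W7_def cof_kd_self cof_kd_zero)

lemma sum_upto7: "(\<Sum>i=1..7. f i) = f 1 + f 2 + f 3 + f 4 + f 5 + f 6 + f (7::nat)"
  for f :: "nat \<Rightarrow> real"
  by (simp add: numeral_eq_Suc One_nat_def)

lemma ball_upto7: "(\<forall>a\<in>{1..7::nat}. Q a) \<longleftrightarrow> Q 1 \<and> Q 2 \<and> Q 3 \<and> Q 4 \<and> Q 5 \<and> Q 6 \<and> Q 7"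
proof -
  have "{1..7::nat} = {1,2,3,4,5,6,7}" by auto
  then show ?thesis by simp
qed

lemma dform4: "dform n om C [a,b,c,d] = - (act n (om a) C [b,c,d] - act n (om b) C [a,c,d]
   + act n (om c) C [a,b,d] - act n (om d) C [a,b,c])"
  by (simp add: dform_def numeral_eq_Suc One_nat_def)

lemma skew3_zero:
  assumes F: "skew 3 F" and z: "\<forall>a\<in>S. \<forall>b\<in>S. \<forall>c\<in>S. a < b \<longrightarrow> b < c \<longrightarrow> F [a,b,c] = 0"
    and K: "length K = 3" "set K \<subseteq> S"
  shows "F (K::nat list) = 0"
proof (rule skew_zero_sorted[OF F _ K])
  fix L :: "nat list" assume L: "length L = 3" "sorted L" "distinct L" "set L \<subseteq> S"
  then obtain a b c where "L = [a,b,c]"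
    by (auto simp: numeral_eq_Suc length_Suc_conv)
  with L z show "F L = 0" by auto
qed

text \<open>Contractions of Theta with vectors span Lambda^2_7. For antisymmetric A the seven
  equations therefore say that A lies in Lambda^2_14, the Lie algebra of G_2.\<close>

definition g2_eqs :: "(nat \<Rightarrow> nat \<Rightarrow> real) \<Rightarrow> nat \<Rightarrow> bool" where
  "g2_eqs A n \<longleftrightarrow> (\<Sum>p=1..7. \<Sum>q=1..7. Th [p,q,n] * A p q) = 0"

text \<open>The actions of A on Theta and on its star depend only on the Lambda^2_7 part of A, so
  their 35 components each are linear combinations of the seven equations.\<close>

lemma g2_eqs_stabilizer:
  assumes As: "\<And>a b. A b a = - A a b" and eqs: "\<And>n. n \<in> {1..7} \<Longrightarrow> g2_eqs A n"
  shows "length K = 3 \<Longrightarrow> set K \<subseteq> {1..7} \<Longrightarrow> act 7 A Th K = 0"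
    "length K = 4 \<Longrightarrow> set K \<subseteq> {1..7} \<Longrightarrow> act 7 A W7 K = 0"
proof -
  have As': "b < a \<Longrightarrow> A a b = - A b a" "A a a = 0" for a b using As[of b a] As[of a a] by auto
  note R = act3 act4 sum_upto7 Th_simps Th_vals W7_simps W7_vals As'
  note e = eqs[unfolded g2_eqs_def]
  note e7 = e[of 1, simplified R, simplified R, simplified] e[of 2, simplified R, simplified R, simplified] e[of 3, simplified R, simplified R, simplified] e[of 4, simplified R, simplified R, simplified] e[of 5, simplified R, simplified R, simplified] e[of 6, simplified R, simplified R, simplified] e[of 7, simplified R, simplified R, simplified]
  define F where "F a b c = act 7 A Th [a,b,c]" for a b c
  define F' where "F' a b c d = act 7 A W7 [a,b,c,d]" for a b c d
  have "\<forall>a\<in>{1..7}. \<forall>b\<in>{1..7}. \<forall>c\<in>{1..7}. a < b \<longrightarrow> b < c \<longrightarrow> F a b c = 0"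
    apply (simp add: ball_upto7)
    apply (unfold F_def)
    apply (simp only: R)
    apply (simp add: R)
    apply (insert e7)
    apply (intro conjI)
    apply argo+
    done
  then have "\<forall>a\<in>{1..7}. \<forall>b\<in>{1..7}. \<forall>c\<in>{1..7}. a < b \<longrightarrow> b < c \<longrightarrow> act 7 A Th [a,b,c] = 0"
    by (simp only: F_def)
  then show "length K = 3 \<Longrightarrow> set K \<subseteq> {1..7} \<Longrightarrow> act 7 A Th K = 0"
    by (rule skew3_zero[OF skew_act[OF Th_skew]])
  have "\<forall>a\<in>{1..7}. \<forall>b\<in>{1..7}. \<forall>c\<in>{1..7}. \<forall>d\<in>{1..7}. a < b \<longrightarrow> b < c \<longrightarrow> c < d \<longrightarrow> F' a b c d = 0"
    apply (simp add: ball_upto7)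
    apply (unfold F'_def)
    apply (simp only: R)
    apply (simp add: R)
    apply (insert e7)
    apply (intro conjI)
    apply argo+
    done
  then have "\<forall>a\<in>{1..7}. \<forall>b\<in>{1..7}. \<forall>c\<in>{1..7}. \<forall>d\<in>{1..7}. a < b \<longrightarrow> b < c \<longrightarrow> c < d \<longrightarrow> act 7 A W7 [a,b,c,d] = 0"
    by (simp only: F'_def)
  then show "length K = 4 \<Longrightarrow> set K \<subseteq> {1..7} \<Longrightarrow> act 7 A W7 K = 0"
    by (rule skew4_zero[OF skew_act[OF W7_skew]])
qed

text \<open>Up to sign, the seven chosen components of A.Theta are half of the left-hand sides in
  \<open>g2_eqs\<close>. On the solutions, the 14-dimensional Lie algebra, contraction with the star
  of Theta has eigenvalue -2.\<close>

lemma g2_stabilizer_instanton: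
  assumes As: "\<And>a b. A b a = - A a b" and st: "\<And>K. length K = 3 \<Longrightarrow> set K \<subseteq> {1..7} \<Longrightarrow> act 7 A Th K = 0"
  shows "m \<in> {1..7} \<Longrightarrow> k \<in> {1..7} \<Longrightarrow> (\<Sum>w=1..7. \<Sum>x=1..7. W7 [w,x,m,k] * A w x) = - 2 * A m k"
    "m \<in> {1..7} \<Longrightarrow> (\<Sum>w=1..7. \<Sum>x=1..7. Th [w,x,m] * A w x) = 0"
proof -
  have As': "b < a \<Longrightarrow> A a b = - A b a" "A a a = 0" for a b using As[of b a] As[of a a] by auto
  note R = act3 sum_upto7 Th_simps Th_vals W7_simps W7_vals As'
  have e1: "act 7 A Th [2,3,4] = 0" by (rule st) auto
  have e2: "act 7 A Th [1,3,4] = 0" by (rule st) auto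
  have e3: "act 7 A Th [1,2,4] = 0" by (rule st) auto
  have e4: "act 7 A Th [1,2,3] = 0" by (rule st) auto
  have e5: "act 7 A Th [1,2,6] = 0" by (rule st) auto
  have e6: "act 7 A Th [1,2,5] = 0" by (rule st) auto
  have e7: "act 7 A Th [1,3,6] = 0" by (rule st) auto
  note e7 = e1[simplified R, simplified R, simplified] e2[simplified R, simplified R, simplified] e3[simplified R, simplified R, simplified] e4[simplified R, simplified R, simplified] e5[simplified R, simplified R, simplified] e6[simplified R, simplified R, simplified] e7[simplified R, simplified R, simplified]
  define F where "F m k = (\<Sum>w=1..7. \<Sum>x=1..7. W7 [w,x,m,k] * A w x) + 2 * A m k" for m k
  define F' where "F' m = (\<Sum>w=1..7. \<Sum>x=1..7. Th [w,x,m] * A w x)" for m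
  have "\<forall>m\<in>{1..7}. F' m = 0"
    apply (simp add: ball_upto7)
    apply (unfold F'_def)
    apply (simp add: R)
    apply (insert e7)
    apply (intro conjI)
    apply argo+
    done
  then show "m \<in> {1..7} \<Longrightarrow> (\<Sum>w=1..7. \<Sum>x=1..7. Th [w,x,m] * A w x) = 0" by (simp add: F'_def)
  have "\<forall>m\<in>{1..7}. \<forall>k\<in>{1..7}. m < k \<longrightarrow> F m k = 0"
    apply (simp add: ball_upto7)
    apply (unfold F_def)
    apply (simp add: R)
    apply (insert e7)
    apply (intro conjI)
    apply argo+
    done
  moreover have "F k m = - F m k" for m k
  proof -
    have "W7 [w,x,k,m] = - W7 [w,x,m,k]" for w x
      using skew_swap[OF W7_skew, of "[w,x]" "[]" k m] by simp
    then show ?thesis using As[of m k] by (simp add: F_def sum_negf)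
  qed
  moreover have "F m m = 0" for m using As'(2) by (simp add: F_def W7_simps)
  ultimately have "F m k = 0" if "m \<in> {1..7}" "k \<in> {1..7}" using that
    by (metis linorder_neqE_nat minus_equation_iff neg_0_equal_iff_equal)
  then show "m \<in> {1..7} \<Longrightarrow> k \<in> {1..7} \<Longrightarrow> (\<Sum>w=1..7. \<Sum>x=1..7. W7 [w,x,m,k] * A w x) = - 2 * A m k"
    by (simp add: F_def)
qed

section \<open>The torsion of a G_2-structure as a linear system\<close>

lemma eps7_simps:
  "b < a \<Longrightarrow> eps 7 [a,b,c,d,e,f,g] = - eps 7 [b,a,c,d,e,f,g]"
  "c < b \<Longrightarrow> eps 7 [a,b,c,d,e,f,g] = - eps 7 [a,c,b,d,e,f,g]"
  "d < c \<Longrightarrow> eps 7 [a,b,c,d,e,f,g] = - eps 7 [a,b,d,c,e,f,g]"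
  "e < d \<Longrightarrow> eps 7 [a,b,c,d,e,f,g] = - eps 7 [a,b,c,e,d,f,g]"
  "f < e \<Longrightarrow> eps 7 [a,b,c,d,e,f,g] = - eps 7 [a,b,c,d,f,e,g]"
  "g < f \<Longrightarrow> eps 7 [a,b,c,d,e,f,g] = - eps 7 [a,b,c,d,e,g,f]"
  "eps 7 [1,2,3,4,5,6,7] = 1"
proof -
  show "b < a \<Longrightarrow> eps 7 [a,b,c,d,e,f,g] = - eps 7 [b,a,c,d,e,f,g]"
    using skew_swap[OF eps_skew, of "[]" "[c,d,e,f,g]" 7 a b] by simp
  show "c < b \<Longrightarrow> eps 7 [a,b,c,d,e,f,g] = - eps 7 [a,c,b,d,e,f,g]"
    using skew_swap[OF eps_skew, of "[a]" "[d,e,f,g]" 7 b c] by simp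
  show "d < c \<Longrightarrow> eps 7 [a,b,c,d,e,f,g] = - eps 7 [a,b,d,c,e,f,g]"
    using skew_swap[OF eps_skew, of "[a,b]" "[e,f,g]" 7 c d] by simp
  show "e < d \<Longrightarrow> eps 7 [a,b,c,d,e,f,g] = - eps 7 [a,b,c,e,d,f,g]"
    using skew_swap[OF eps_skew, of "[a,b,c]" "[f,g]" 7 d e] by simp
  show "f < e \<Longrightarrow> eps 7 [a,b,c,d,e,f,g] = - eps 7 [a,b,c,d,f,e,g]"
    using skew_swap[OF eps_skew, of "[a,b,c,d]" "[g]" 7 e f] by simp
  show "g < f \<Longrightarrow> eps 7 [a,b,c,d,e,f,g] = - eps 7 [a,b,c,d,e,g,f]"
    using skew_swap[OF eps_skew, of "[a,b,c,d,e]" "[]" 7 f g] by simp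
  show "eps 7 [1,2,3,4,5,6,7] = 1"
    by (simp add: eps_def upt_conv_Cons cof_kd_self)
qed

lemma g2_torsion:
  assumes tri: "\<And>J a b c. length J = 4 \<Longrightarrow> distinct (J @ [a,b,c]) \<Longrightarrow> list_all (\<lambda>x. 1 \<le> x \<and> x \<le> 7) (J @ [a,b,c]) \<Longrightarrow>
      H a b c = - (eps 7 (J @ [a,b,c]) * dform 7 om Th J) - 2 * (\<Sum>x=1..7. f x * W7 [x,a,b,c])"
    and two: "\<And>J a b. length J = 5 \<Longrightarrow> distinct (J @ [a,b]) \<Longrightarrow> list_all (\<lambda>x. 1 \<le> x \<and> x \<le> 7) (J @ [a,b]) \<Longrightarrow>
      eps 7 (J @ [a,b]) * dform 7 om W7 J = 2 * (\<Sum>x=1..7. f x * Th [x,a,b])"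
    and lee: "\<And>n. n \<in> {1..7} \<Longrightarrow> (\<Sum>a=1..7. \<Sum>b=1..7. \<Sum>c=1..7. H a b c * W7 [a,b,c,n]) = 12 * f n"
    and HTh: "(\<Sum>a=1..7. \<Sum>b=1..7. \<Sum>c=1..7. H a b c * Th [a,b,c]) = 0"
    and H: "\<And>a b c. H b a c = - H a b c" "\<And>a b c. H a c b = - H a b c"
    and om: "\<And>v a b. om v b a = - om v a b"
  shows "v \<in> {1..7} \<Longrightarrow> n \<in> {1..7} \<Longrightarrow> g2_eqs (\<lambda>a b. om v a b + H v a b / 2) n"
proof -
  have Hs: "b < a \<Longrightarrow> H a b c = - H b a c" "c < b \<Longrightarrow> H a b c = - H a c b" "H a a b = 0" "H a b b = 0" for a b c
    using H(1)[of a b c] H(2)[of a b c] H(1)[of a a b] H(2)[of a b b] by auto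
  have oms: "b < a \<Longrightarrow> om v a b = - om v b a" "om v a a = 0" for v a b using om[of v a b] om[of v a a] by auto
  note R = dform4 dform5 act3 act4 sum_upto7 Th_simps Th_vals W7_simps W7_vals Hs oms eps7_simps g2_eqs_def
  note [simp] = R
  \<comment> \<open>No component of d phi occurs in this block. Besides seven components of H it
    uses the scalar equation \<open>HTh\<close>, which stems from dTheta ^ Theta = 0.\<close>
  note E = tri[of "[3,4,5,6]" 1 2 7, simplified] tri[of "[2,4,6,7]" 1 3 5, simplified] tri[of "[2,3,5,7]" 1 4 6, simplified] tri[of "[1,4,5,7]" 2 3 6, simplified] tri[of "[1,3,6,7]" 2 4 5, simplified] tri[of "[1,2,5,6]" 3 4 7, simplified] tri[of "[1,2,3,4]" 5 6 7, simplified] HTh[simplified]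
  have B0: "g2_eqs (\<lambda>a b. om 1 a b + H 1 a b / 2) 1" "g2_eqs (\<lambda>a b. om 2 a b + H 2 a b / 2) 2" "g2_eqs (\<lambda>a b. om 3 a b + H 3 a b / 2) 3" "g2_eqs (\<lambda>a b. om 4 a b + H 4 a b / 2) 4" "g2_eqs (\<lambda>a b. om 5 a b + H 5 a b / 2) 5" "g2_eqs (\<lambda>a b. om 6 a b + H 6 a b / 2) 6" "g2_eqs (\<lambda>a b. om 7 a b + H 7 a b / 2) 7"
    apply simp_all
    apply (insert E)
    apply argo+
    done
  \<comment> \<open>Each of the other seven blocks contains one component of d phi: four equations
    come from H, three from the derivative of the star of Theta, and the Lee equation relates d phi
    to H.\<close>
  note E = tri[of "[1,5,6,7]" 2 3 4, simplified] tri[of "[1,3,4,7]" 2 5 6, simplified] tri[of "[1,2,4,5]" 3 6 7, simplified] tri[of "[1,2,3,6]" 4 5 7, simplified] two[of "[1,3,4,5,6]" 2 7, simplified] two[of "[1,2,4,6,7]" 3 5, simplified] two[of "[1,2,3,5,7]" 4 6, simplified] lee[of 1, simplified]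
  have B1: "g2_eqs (\<lambda>a b. om 7 a b + H 7 a b / 2) 2" "g2_eqs (\<lambda>a b. om 5 a b + H 5 a b / 2) 3" "g2_eqs (\<lambda>a b. om 6 a b + H 6 a b / 2) 4" "g2_eqs (\<lambda>a b. om 3 a b + H 3 a b / 2) 5" "g2_eqs (\<lambda>a b. om 4 a b + H 4 a b / 2) 6" "g2_eqs (\<lambda>a b. om 2 a b + H 2 a b / 2) 7"
    apply simp_all
    apply (insert E)
    apply argo+
    done
  note E = tri[of "[2,5,6,7]" 1 3 4, simplified] tri[of "[2,3,4,7]" 1 5 6, simplified] tri[of "[1,2,4,6]" 3 5 7, simplified] tri[of "[1,2,3,5]" 4 6 7, simplified] two[of "[2,3,4,5,6]" 1 7, simplified] two[of "[1,2,4,5,7]" 3 6, simplified] two[of "[1,2,3,6,7]" 4 5, simplified] lee[of 2, simplified]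
  have B2: "g2_eqs (\<lambda>a b. om 7 a b + H 7 a b / 2) 1" "g2_eqs (\<lambda>a b. om 6 a b + H 6 a b / 2) 3" "g2_eqs (\<lambda>a b. om 5 a b + H 5 a b / 2) 4" "g2_eqs (\<lambda>a b. om 4 a b + H 4 a b / 2) 5" "g2_eqs (\<lambda>a b. om 3 a b + H 3 a b / 2) 6" "g2_eqs (\<lambda>a b. om 1 a b + H 1 a b / 2) 7"
    apply simp_all
    apply (insert E)
    apply argo+
    done
  note E = tri[of "[2,4,5,7]" 1 3 6, simplified] tri[of "[2,3,6,7]" 1 4 5, simplified] tri[of "[1,4,6,7]" 2 3 5, simplified] tri[of "[1,3,5,7]" 2 4 6, simplified] two[of "[3,4,5,6,7]" 1 2, simplified] two[of "[1,2,5,6,7]" 3 4, simplified] two[of "[1,2,3,4,7]" 5 6, simplified] lee[of 7, simplified]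
  have B3: "g2_eqs (\<lambda>a b. om 2 a b + H 2 a b / 2) 1" "g2_eqs (\<lambda>a b. om 1 a b + H 1 a b / 2) 2" "g2_eqs (\<lambda>a b. om 4 a b + H 4 a b / 2) 3" "g2_eqs (\<lambda>a b. om 3 a b + H 3 a b / 2) 4" "g2_eqs (\<lambda>a b. om 6 a b + H 6 a b / 2) 5" "g2_eqs (\<lambda>a b. om 5 a b + H 5 a b / 2) 6"
    apply simp_all
    apply (insert E)
    apply argo+
    done
  note E = tri[of "[3,5,6,7]" 1 2 4, simplified] tri[of "[2,3,4,5]" 1 6 7, simplified] tri[of "[1,3,4,6]" 2 5 7, simplified] tri[of "[1,2,3,7]" 4 5 6, simplified] two[of "[2,3,4,6,7]" 1 5, simplified] two[of "[1,3,4,5,7]" 2 6, simplified] two[of "[1,2,3,5,6]" 4 7, simplified] lee[of 3, simplified]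
  have B4: "g2_eqs (\<lambda>a b. om 5 a b + H 5 a b / 2) 1" "g2_eqs (\<lambda>a b. om 6 a b + H 6 a b / 2) 2" "g2_eqs (\<lambda>a b. om 7 a b + H 7 a b / 2) 4" "g2_eqs (\<lambda>a b. om 1 a b + H 1 a b / 2) 5" "g2_eqs (\<lambda>a b. om 2 a b + H 2 a b / 2) 6" "g2_eqs (\<lambda>a b. om 4 a b + H 4 a b / 2) 7"
    apply simp_all
    apply (insert E)
    apply argo+
    done
  note E = tri[of "[3,4,5,7]" 1 2 6, simplified] tri[of "[2,3,5,6]" 1 4 7, simplified] tri[of "[1,4,5,6]" 2 3 7, simplified] tri[of "[1,2,5,7]" 3 4 6, simplified] two[of "[2,4,5,6,7]" 1 3, simplified] two[of "[1,3,5,6,7]" 2 4, simplified] two[of "[1,2,3,4,5]" 6 7, simplified] lee[of 5, simplified]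
  have B5: "g2_eqs (\<lambda>a b. om 3 a b + H 3 a b / 2) 1" "g2_eqs (\<lambda>a b. om 4 a b + H 4 a b / 2) 2" "g2_eqs (\<lambda>a b. om 1 a b + H 1 a b / 2) 3" "g2_eqs (\<lambda>a b. om 2 a b + H 2 a b / 2) 4" "g2_eqs (\<lambda>a b. om 7 a b + H 7 a b / 2) 6" "g2_eqs (\<lambda>a b. om 6 a b + H 6 a b / 2) 7"
    apply simp_all
    apply (insert E)
    apply argo+
    done
  note E = tri[of "[3,4,6,7]" 1 2 5, simplified] tri[of "[2,4,5,6]" 1 3 7, simplified] tri[of "[1,3,5,6]" 2 4 7, simplified] tri[of "[1,2,6,7]" 3 4 5, simplified] two[of "[2,3,5,6,7]" 1 4, simplified] two[of "[1,4,5,6,7]" 2 3, simplified] two[of "[1,2,3,4,6]" 5 7, simplified] lee[of 6, simplified]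
  have B6: "g2_eqs (\<lambda>a b. om 4 a b + H 4 a b / 2) 1" "g2_eqs (\<lambda>a b. om 3 a b + H 3 a b / 2) 2" "g2_eqs (\<lambda>a b. om 2 a b + H 2 a b / 2) 3" "g2_eqs (\<lambda>a b. om 1 a b + H 1 a b / 2) 4" "g2_eqs (\<lambda>a b. om 7 a b + H 7 a b / 2) 5" "g2_eqs (\<lambda>a b. om 5 a b + H 5 a b / 2) 7"
    apply simp_all
    apply (insert E)
    apply argo+
    done
  note E = tri[of "[4,5,6,7]" 1 2 3, simplified] tri[of "[2,3,4,6]" 1 5 7, simplified] tri[of "[1,3,4,5]" 2 6 7, simplified] tri[of "[1,2,4,7]" 3 5 6, simplified] two[of "[2,3,4,5,7]" 1 6, simplified] two[of "[1,3,4,6,7]" 2 5, simplified] two[of "[1,2,4,5,6]" 3 7, simplified] lee[of 4, simplified]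
  have B7: "g2_eqs (\<lambda>a b. om 6 a b + H 6 a b / 2) 1" "g2_eqs (\<lambda>a b. om 5 a b + H 5 a b / 2) 2" "g2_eqs (\<lambda>a b. om 7 a b + H 7 a b / 2) 3" "g2_eqs (\<lambda>a b. om 2 a b + H 2 a b / 2) 5" "g2_eqs (\<lambda>a b. om 1 a b + H 1 a b / 2) 6" "g2_eqs (\<lambda>a b. om 3 a b + H 3 a b / 2) 7"
    apply simp_all
    apply (insert E)
    apply argo+
    done
  assume vn: "v \<in> {1..7}" "n \<in> {1..7}"
  have "v \<in> {1,2,3,4,5,6,7}" "n \<in> {1,2,3,4,5,6,7}" using vn by auto
  then show "g2_eqs (\<lambda>a b. om v a b + H v a b / 2) n"
    by (elim insertE emptyE) (simp_all only: B0 B1 B2 B3 B4 B5 B6 B7)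
qed

text \<open>Lambda^4 of R^7 splits as 1 + 7 + 27, without the adjoint 14. Hence the antisymmetric
  part of the contraction with \<open>W7\<close> is the image under Theta of a vector, namely of the
  contraction with \<open>Th\<close>.\<close>

lemma contraction_antisym_part:
  assumes d: "\<And>m. skew 4 d"
  shows "b \<in> {1..7} \<Longrightarrow> c \<in> {1..7} \<Longrightarrow>
    S3 {1..7} (\<lambda>v w x. W7 [v,w,x,c]) (\<lambda>v w x. d [b,v,w,x]) - S3 {1..7} (\<lambda>v w x. W7 [v,w,x,b]) (\<lambda>v w x. d [c,v,w,x])
    = (\<Sum>i=1..7. S3 {1..7} (\<lambda>v w x. Th [v,w,x]) (\<lambda>v w x. d [i,v,w,x]) * Th [i,b,c])"
proof -
  note R = sum_upto7 Th_simps Th_vals W7_simps W7_vals skew4_simps[OF d]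
  define t where "t i = S3 {1..7} (\<lambda>v w x. Th [v,w,x]) (\<lambda>v w x. d [i,v,w,x])" for i
  define h where "h b c = S3 {1..7} (\<lambda>v w x. W7 [v,w,x,c]) (\<lambda>v w x. d [b,v,w,x])" for b c
  define F where "F b c = h b c - h c b - (\<Sum>i=1..7. t i * Th [i,b,c])" for b c
  have "\<forall>b\<in>{1..7}. \<forall>c\<in>{1..7}. b < c \<longrightarrow> F b c = 0"
    by (simp add: ball_upto7, simp add: F_def sum_upto7 Th_simps Th_vals, simp add: t_def h_def S3_def R)
  moreover have "F c b = - F b c" for b c
  proof -
    have "Th [i,c,b] = - Th [i,b,c]" for i using skew_swap[OF Th_skew, of "[i]" "[]" c b] by simp
    then show ?thesis by (simp add: F_def sum_negf)
  qed
  moreover have "F b b = 0" for b by (simp add: F_def Th_simps)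
  ultimately have "F b c = 0" if "b \<in> {1..7}" "c \<in> {1..7}" using that
    by (metis linorder_neqE_nat minus_equation_iff neg_0_equal_iff_equal)
  then show "b \<in> {1..7} \<Longrightarrow> c \<in> {1..7} \<Longrightarrow>
    S3 {1..7} (\<lambda>v w x. W7 [v,w,x,c]) (\<lambda>v w x. d [b,v,w,x]) - S3 {1..7} (\<lambda>v w x. W7 [v,w,x,b]) (\<lambda>v w x. d [c,v,w,x])
    = (\<Sum>i=1..7. S3 {1..7} (\<lambda>v w x. Th [v,w,x]) (\<lambda>v w x. d [i,v,w,x]) * Th [i,b,c])"
    by (simp add: F_def h_def t_def)
qed

section \<open>Contraction tables and Hodge duality of the structure forms\<close>

lemma W7_S3:
  fixes G :: "nat \<Rightarrow> nat \<Rightarrow> nat \<Rightarrow> real"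
  assumes "\<And>a b c. G b a c = - G a b c" "\<And>a b c. G a c b = - G a b c"
  shows
    "S3 {1..7} (\<lambda>v w x. W7 [v,w,x,1]) G = 6 * (- G 2 3 4 - G 2 5 6 - G 3 6 7 - G 4 5 7)"
    "S3 {1..7} (\<lambda>v w x. W7 [v,w,x,2]) G = 6 * (G 1 3 4 + G 1 5 6 - G 3 5 7 + G 4 6 7)"
    "S3 {1..7} (\<lambda>v w x. W7 [v,w,x,3]) G = 6 * (- G 1 2 4 + G 1 6 7 + G 2 5 7 - G 4 5 6)"
    "S3 {1..7} (\<lambda>v w x. W7 [v,w,x,4]) G = 6 * (G 1 2 3 + G 1 5 7 - G 2 6 7 + G 3 5 6)"
    "S3 {1..7} (\<lambda>v w x. W7 [v,w,x,5]) G = 6 * (- G 1 2 6 - G 1 4 7 - G 2 3 7 - G 3 4 6)"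
    "S3 {1..7} (\<lambda>v w x. W7 [v,w,x,6]) G = 6 * (G 1 2 5 - G 1 3 7 + G 2 4 7 + G 3 4 5)"
    "S3 {1..7} (\<lambda>v w x. W7 [v,w,x,7]) G = 6 * (G 1 3 6 + G 1 4 5 + G 2 3 5 - G 2 4 6)"
proof -
  have Gs: "b < a \<Longrightarrow> G a b c = - G b a c" "c < b \<Longrightarrow> G a b c = - G a c b" "G a a b = 0" "G a b b = 0" for a b c
    using assms(1)[of a b c] assms(2)[of a b c] assms(1)[of a a b] assms(2)[of a b b] by auto
  note R = S3_def sum_upto7 W7_simps W7_vals Gs
  show "S3 {1..7} (\<lambda>v w x. W7 [v,w,x,1]) G = 6 * (- G 2 3 4 - G 2 5 6 - G 3 6 7 - G 4 5 7)"
    by (simp add: R)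
  show "S3 {1..7} (\<lambda>v w x. W7 [v,w,x,2]) G = 6 * (G 1 3 4 + G 1 5 6 - G 3 5 7 + G 4 6 7)"
    by (simp add: R)
  show "S3 {1..7} (\<lambda>v w x. W7 [v,w,x,3]) G = 6 * (- G 1 2 4 + G 1 6 7 + G 2 5 7 - G 4 5 6)"
    by (simp add: R)
  show "S3 {1..7} (\<lambda>v w x. W7 [v,w,x,4]) G = 6 * (G 1 2 3 + G 1 5 7 - G 2 6 7 + G 3 5 6)"
    by (simp add: R)
  show "S3 {1..7} (\<lambda>v w x. W7 [v,w,x,5]) G = 6 * (- G 1 2 6 - G 1 4 7 - G 2 3 7 - G 3 4 6)"
    by (simp add: R)
  show "S3 {1..7} (\<lambda>v w x. W7 [v,w,x,6]) G = 6 * (G 1 2 5 - G 1 3 7 + G 2 4 7 + G 3 4 5)"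
    by (simp add: R)
  show "S3 {1..7} (\<lambda>v w x. W7 [v,w,x,7]) G = 6 * (G 1 3 6 + G 1 4 5 + G 2 3 5 - G 2 4 6)"
    by (simp add: R)
qed

lemma skew_tail:
  fixes \<alpha> :: "'b list \<Rightarrow> real"
  assumes "skew 4 \<alpha>"
  shows "\<alpha> [x,b,a,c] = - \<alpha> [x,a,b,c]" "\<alpha> [x,a,c,b] = - \<alpha> [x,a,b,c]"
  using skew_swap[OF assms, of "[x]" "[c]" b a] skew_swap[OF assms, of "[x,a]" "[]" c b] by simp_all

text \<open>Each index lies in seven of the fourteen monomials, which gives 7 times 6 = 42; moving
  an index past three others gives the sign.\<close>

lemma Phi_square:
  assumes "x \<in> {1..8}" "n \<in> {1..8}"
  shows "S3 {1..8} (\<lambda>a b c. Phi [a,b,c,n]) (\<lambda>a b c. Phi [x,a,b,c]) = (if x = n then - 42 else 0)"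
proof -
  have "\<forall>x\<in>{1..8}. \<forall>n\<in>{1..8}. S3 {1..8} (\<lambda>a b c. Phi [a,b,c,n]) (\<lambda>a b c. Phi [x,a,b,c]) = (if x = n then - 42 else 0)"
    by (simp add: ball_upto8 Phi_S3[of "\<lambda>a b c. Phi [x,a,b,c]" for x, OF skew_tail[OF Phi_skew]] Phi_simps Phi_vals)
  then show ?thesis using assms by blast
qed

text \<open>Each index lies in four of the seven monomials: 4 times 6 = 24, with the sign as for
  \<open>Phi_square\<close>.\<close>

lemma W7_square:
  assumes "x \<in> {1..7}" "n \<in> {1..7}"
  shows "S3 {1..7} (\<lambda>a b c. W7 [a,b,c,n]) (\<lambda>a b c. W7 [x,a,b,c]) = (if x = n then - 24 else 0)"
proof -
  have "\<forall>x\<in>{1..7}. \<forall>n\<in>{1..7}. S3 {1..7} (\<lambda>a b c. W7 [a,b,c,n]) (\<lambda>a b c. W7 [x,a,b,c]) = (if x = n then - 24 else 0)"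
    by (simp add: ball_upto7 W7_S3[of "\<lambda>a b c. W7 [x,a,b,c]" for x, OF skew_tail[OF W7_skew]] W7_simps W7_vals)
  then show ?thesis using assms by blast
qed

text \<open>The contraction is a G_2-invariant vector, and G_2 fixes only the zero vector.\<close>

lemma W7_Th_contraction:
  assumes "x \<in> {1..7}"
  shows "S3 {1..7} (\<lambda>a b c. Th [a,b,c]) (\<lambda>a b c. W7 [x,a,b,c]) = 0"
proof -
  have "\<forall>x\<in>{1..7}. S3 {1..7} (\<lambda>a b c. Th [a,b,c]) (\<lambda>a b c. W7 [x,a,b,c]) = 0"
    by (simp add: ball_upto7 S3_def sum_upto7 Th_simps Th_vals W7_simps W7_vals)
  then show ?thesis using assms by blast
qed

lemma list3E: "length L = 3 \<Longrightarrow> (\<And>a b c. L = [a,b,c] \<Longrightarrow> P) \<Longrightarrow> P"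
  by (auto simp: numeral_eq_Suc length_Suc_conv)

lemma list4E: "length L = 4 \<Longrightarrow> (\<And>a b c d. L = [a,b,c,d] \<Longrightarrow> P) \<Longrightarrow> P"
  by (auto simp: numeral_eq_Suc length_Suc_conv)

lemma upt8: "[1..<Suc 8] = [1,2,3,4,5,6,7,8::nat]" and upt7: "[1..<Suc 7] = [1,2,3,4,5,6,7::nat]"
  by (simp_all add: upt_conv_Cons)

text \<open>Self-duality of Phi in the form that \<open>hodge_star_eqI\<close> asks for, J being the
  increasing complement of L.\<close>

lemma Phi_complement:
  assumes L: "length L = 4" "sorted L" "distinct L" "set L \<subseteq> {1..8}"
  defines "J \<equiv> filter (\<lambda>x. x \<notin> set L) [1..<Suc 8]"
  shows "eps 8 (J @ L) * Phi J = Phi L"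
proof -
  obtain a b c d where abcd: "L = [a,b,c,d]" using L(1) by (rule list4E)
  define F where "F a b c d \<longleftrightarrow> (let J = filter (\<lambda>x. x \<notin> {a,b,c,d}) [1,2,3,4,5,6,7,8] in
      eps 8 (J @ [a,b,c,d]) * Phi J = Phi [a,b,c,d])" for a b c d
  have "\<forall>a\<in>{1..8}. \<forall>b\<in>{1..8}. \<forall>c\<in>{1..8}. \<forall>d\<in>{1..8}. a < b \<longrightarrow> b < c \<longrightarrow> c < d \<longrightarrow> F a b c d"
    by (simp add: ball_upto8) (simp add: F_def eps8_simps Phi_simps Phi_vals)
  then have "F a b c d" using L unfolding abcd by auto
  then show ?thesis by (simp only: J_def abcd upt8 F_def Let_def list.set)
qed

lemma W7_complement:
  assumes L: "length L = 4" "sorted L" "distinct L" "set L \<subseteq> {1..7}"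
  defines "J \<equiv> filter (\<lambda>x. x \<notin> set L) [1..<Suc 7]"
  shows "eps 7 (J @ L) * Th J = W7 L"
proof -
  obtain a b c d where abcd: "L = [a,b,c,d]" using L(1) by (rule list4E)
  define F where "F a b c d \<longleftrightarrow> (let J = filter (\<lambda>x. x \<notin> {a,b,c,d}) [1,2,3,4,5,6,7] in
      eps 7 (J @ [a,b,c,d]) * Th J = W7 [a,b,c,d])" for a b c d
  have "\<forall>a\<in>{1..7}. \<forall>b\<in>{1..7}. \<forall>c\<in>{1..7}. \<forall>d\<in>{1..7}. a < b \<longrightarrow> b < c \<longrightarrow> c < d \<longrightarrow> F a b c d"
    by (simp add: ball_upto7) (simp add: F_def eps7_simps Th_simps Th_vals W7_vals)
  then have "F a b c d" using L unfolding abcd by auto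
  then show ?thesis by (simp only: J_def abcd upt7 F_def Let_def list.set)
qed

lemma Th_complement:
  assumes L: "length L = 3" "sorted L" "distinct L" "set L \<subseteq> {1..7}"
  defines "J \<equiv> filter (\<lambda>x. x \<notin> set L) [1..<Suc 7]"
  shows "eps 7 (J @ L) * W7 J = Th L"
proof -
  obtain a b c where abc: "L = [a,b,c]" using L(1) by (rule list3E)
  define F where "F a b c \<longleftrightarrow> (let J = filter (\<lambda>x. x \<notin> {a,b,c}) [1,2,3,4,5,6,7] in
      eps 7 (J @ [a,b,c]) * W7 J = Th [a,b,c])" for a b c
  have "\<forall>a\<in>{1..7}. \<forall>b\<in>{1..7}. \<forall>c\<in>{1..7}. a < b \<longrightarrow> b < c \<longrightarrow> F a b c"
    by (simp add: ball_upto7) (simp add: F_def eps7_simps Th_vals W7_simps W7_vals)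
  then have "F a b c" using L unfolding abc by auto
  then show ?thesis by (simp only: J_def abc upt7 F_def Let_def list.set)
qed

declare One_nat_def [simp]

subsection \<open>Calculus in a chart\<close>

text \<open>The mean value theorem is applied to s |-> f(y + su + hv) - f(y + su). Its derivative is
  a difference of values of f' in direction u at two points near y, and each value is close to its
  linearisation L.\<close>

lemma mixed_difference_estimate:
  fixes f :: "'a::real_normed_vector \<Rightarrow> real"
  assumes f': "\<And>z. z \<in> ball y r \<Longrightarrow> (f has_derivative f' z) (at z)"
    and G: "\<And>z. norm (z - y) < r \<Longrightarrow> \<bar>f' z u - f' y u - L (z - y)\<bar> \<le> \<epsilon> * norm (z - y)"
    and L: "linear L" and h: "0 < h" "h * (norm u + norm v) < r" and \<epsilon>: "\<epsilon> \<ge> 0"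
  shows "\<bar>f (y + h *\<^sub>R u + h *\<^sub>R v) - f (y + h *\<^sub>R u) - f (y + h *\<^sub>R v) + f y - h\<^sup>2 * L v\<bar>
    \<le> h\<^sup>2 * (\<epsilon> * (2 * norm u + norm v))"
proof -
  define \<phi> where "\<phi> s = f (y + s *\<^sub>R u + h *\<^sub>R v) - f (y + s *\<^sub>R u)" for s
  have bnd: "norm (s *\<^sub>R u + h *\<^sub>R v) < r" "norm (s *\<^sub>R u) < r" if "0 \<le> s" "s \<le> h" for s
  proof -
    have 1: "norm (s *\<^sub>R u) \<le> h * norm u" using that by (simp add: mult_right_mono)
    have 2: "norm (s *\<^sub>R u + h *\<^sub>R v) \<le> norm (s *\<^sub>R u) + norm (h *\<^sub>R v)"
      by (rule norm_triangle_ineq)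
    have 3: "0 \<le> h * norm v" "norm (h *\<^sub>R v) = h * norm v" using h by simp_all
    have 4: "h * norm u + h * norm v < r" using h by (simp add: distrib_left)
    show "norm (s *\<^sub>R u + h *\<^sub>R v) < r" using 1 2 3 4 by linarith
    show "norm (s *\<^sub>R u) < r" using 1 3 4 by linarith
  qed
  have d\<phi>: "(\<phi> has_derivative (\<lambda>t. t * (f' (y + s *\<^sub>R u + h *\<^sub>R v) u - f' (y + s *\<^sub>R u) u))) (at s)"
    if s: "0 \<le> s" "s \<le> h" for s
  proof -
    have "dist (y + s *\<^sub>R u + h *\<^sub>R v) y < r" "dist (y + s *\<^sub>R u) y < r"
      using bnd[OF s] by (simp_all only: dist_norm add.assoc add_diff_cancel_left')
    then have 1: "y + s *\<^sub>R u + h *\<^sub>R v \<in> ball y r" "y + s *\<^sub>R u \<in> ball y r"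
      by (simp_all only: mem_ball dist_commute)
    have lin: "f' z (t *\<^sub>R u) = t * f' z u" if "z \<in> ball y r" for z t
      using has_derivative_bounded_linear[OF f'[OF that], THEN bounded_linear.linear]
      by (simp add: linear_cmul)
    have "((\<lambda>s. f (y + s *\<^sub>R u + h *\<^sub>R v)) has_derivative
        (\<lambda>t. f' (y + s *\<^sub>R u + h *\<^sub>R v) (t *\<^sub>R u))) (at s)"
      by (rule has_derivative_compose[where f = "\<lambda>s. y + s *\<^sub>R u + h *\<^sub>R v" and g = f, OF _ f'[OF 1(1)]])
        (auto intro!: derivative_eq_intros)
    moreover have "((\<lambda>s. f (y + s *\<^sub>R u)) has_derivative (\<lambda>t. f' (y + s *\<^sub>R u) (t *\<^sub>R u))) (at s)"
      by (rule has_derivative_compose[where f = "\<lambda>s. y + s *\<^sub>R u" and g = f, OF _ f'[OF 1(2)]])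
        (auto intro!: derivative_eq_intros)
    ultimately show ?thesis unfolding \<phi>_def
      by (auto intro!: derivative_eq_intros simp: lin[OF 1(1)] lin[OF 1(2)] right_diff_distrib)
  qed
  obtain \<xi> where \<xi>: "0 < \<xi>" "\<xi> < h"
    and mv: "\<phi> h - \<phi> 0 = h * (f' (y + \<xi> *\<^sub>R u + h *\<^sub>R v) u - f' (y + \<xi> *\<^sub>R u) u)"
  proof -
    have "\<exists>\<xi>. \<xi> > 0 \<and> \<xi> < h \<and> \<phi> h - \<phi> 0 =
        (h - 0) * (f' (y + \<xi> *\<^sub>R u + h *\<^sub>R v) u - f' (y + \<xi> *\<^sub>R u) u)"
      by (rule MVT2[OF h(1)])
        (use d\<phi> in \<open>simp_all add: has_field_derivative_def mult_commute_abs\<close>)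
    with that show thesis by auto
  qed
  let ?a = "\<xi> *\<^sub>R u + h *\<^sub>R v" and ?b = "\<xi> *\<^sub>R u"
  have na: "norm ?a < r" and nb: "norm ?b < r" using bnd[of \<xi>] \<xi> by auto
  have G': "\<bar>f' (y + w) u - f' y u - L w\<bar> \<le> \<epsilon> * norm w" if "norm w < r" for w
    using G[of "y + w"] that by simp
  have Lab: "L ?a - L ?b = h * L v"
    using linear_add[OF L, of ?b "h *\<^sub>R v"] linear_cmul[OF L, of h v] by simp
  have "\<bar>f' (y + ?a) u - f' (y + ?b) u - h * L v\<bar> \<le> \<epsilon> * norm ?a + \<epsilon> * norm ?b"
    using G'[OF na] G'[OF nb] Lab by linarith
  then have "\<bar>f' (y + ?a) u - f' (y + ?b) u - h * L v\<bar> \<le> \<epsilon> * (norm ?a + norm ?b)"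
    by (simp only: distrib_left)
  also have "\<dots> \<le> \<epsilon> * (h * (2 * norm u + norm v))"
  proof (rule mult_left_mono[OF _ \<epsilon>])
    have "norm ?b \<le> h * norm u" using \<xi> by (simp add: mult_right_mono)
    moreover have "norm ?a \<le> norm ?b + h * norm v"
      using norm_triangle_ineq[of ?b "h *\<^sub>R v"] h by simp
    ultimately show "norm ?a + norm ?b \<le> h * (2 * norm u + norm v)" by (simp add: algebra_simps)
  qed
  finally have "h * \<bar>f' (y + ?a) u - f' (y + ?b) u - h * L v\<bar> \<le> h * (\<epsilon> * (h * (2 * norm u + norm v)))"
    using h by (intro mult_left_mono) auto
  also have "h * \<bar>f' (y + ?a) u - f' (y + ?b) u - h * L v\<bar> = \<bar>h * (f' (y + ?a) u - f' (y + ?b) u - h * L v)\<bar>"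
    using h by (simp add: abs_mult)
  also have "h * (f' (y + ?a) u - f' (y + ?b) u - h * L v) = \<phi> h - \<phi> 0 - h\<^sup>2 * L v"
    by (simp add: mv power2_eq_square right_diff_distrib add.assoc)
  finally show ?thesis by (simp add: \<phi>_def power2_eq_square algebra_simps)
qed

text \<open>The second difference is symmetric in u and v and approximates h^2 times either value.
  Only differentiability of f' at the single point y enters, not continuity of second
  derivatives.\<close>

lemma second_derivative_symmetric:
  fixes f :: "'a::real_normed_vector \<Rightarrow> real"
  assumes S: "open S" "y \<in> S" and f': "\<And>z. z \<in> S \<Longrightarrow> (f has_derivative f' z) (at z)"
    and u: "((\<lambda>z. f' z u) has_derivative Lu) (at y)" and v: "((\<lambda>z. f' z v) has_derivative Lv) (at y)"
  shows "Lu v = Lv u"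
proof -
  obtain r0 where r0: "r0 > 0" "ball y r0 \<subseteq> S" using S openE by blast
  have est: "\<bar>Lu v - Lv u\<bar> \<le> \<epsilon> * (3 * norm u + 3 * norm v)" if \<epsilon>: "\<epsilon> > 0" for \<epsilon>
  proof -
    obtain ru where ru: "ru > 0" "\<And>z. norm (z - y) < ru \<Longrightarrow> \<bar>f' z u - f' y u - Lu (z - y)\<bar> \<le> \<epsilon> * norm (z - y)"
      using conjunct2[OF u[unfolded has_derivative_at_alt], rule_format, OF \<epsilon>] unfolding real_norm_def by blast
    obtain rv where rv: "rv > 0" "\<And>z. norm (z - y) < rv \<Longrightarrow> \<bar>f' z v - f' y v - Lv (z - y)\<bar> \<le> \<epsilon> * norm (z - y)"
      using conjunct2[OF v[unfolded has_derivative_at_alt], rule_format, OF \<epsilon>] unfolding real_norm_def by blast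
    define r where "r = min r0 (min ru rv)"
    have r: "r > 0" using r0 ru rv by (simp add: r_def)
    define h where "h = r / (norm u + norm v + 1)"
    have n: "norm u + norm v + 1 > 0" using norm_ge_zero[of u] norm_ge_zero[of v] by linarith
    have h: "0 < h" using r n by (simp add: h_def)
    have hr: "h * (norm u + norm v) < r"
    proof -
      have "h * (norm u + norm v) < h * (norm u + norm v + 1)" using h by simp
      also have "\<dots> = r" using n by (simp add: h_def)
      finally show ?thesis .
    qed
    have B: "(f has_derivative f' z) (at z)" if "z \<in> ball y r" for z
      using that r0 by (intro f') (auto simp: r_def)
    have 1: "\<bar>f (y + h *\<^sub>R u + h *\<^sub>R v) - f (y + h *\<^sub>R u) - f (y + h *\<^sub>R v) + f y - h\<^sup>2 * Lu v\<bar>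
      \<le> h\<^sup>2 * (\<epsilon> * (2 * norm u + norm v))"
      by (rule mixed_difference_estimate[where f' = f' and r = r])
        (use B ru \<epsilon> u h hr in \<open>auto simp: r_def has_derivative_def bounded_linear.linear\<close>)
    have 2: "\<bar>f (y + h *\<^sub>R v + h *\<^sub>R u) - f (y + h *\<^sub>R v) - f (y + h *\<^sub>R u) + f y - h\<^sup>2 * Lv u\<bar>
      \<le> h\<^sup>2 * (\<epsilon> * (2 * norm v + norm u))"
      by (rule mixed_difference_estimate[where f' = f' and r = r])
        (use B rv \<epsilon> v h hr in \<open>auto simp: r_def add.commute has_derivative_def bounded_linear.linear\<close>)
    have sw: "y + h *\<^sub>R v + h *\<^sub>R u = y + h *\<^sub>R u + h *\<^sub>R v" by simp
    have "\<bar>h\<^sup>2 * Lu v - h\<^sup>2 * Lv u\<bar> \<le> h\<^sup>2 * (\<epsilon> * (2 * norm u + norm v)) + h\<^sup>2 * (\<epsilon> * (2 * norm v + norm u))"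
      using 1 2 unfolding sw by linarith
    moreover have "\<bar>h\<^sup>2 * Lu v - h\<^sup>2 * Lv u\<bar> = h\<^sup>2 * \<bar>Lu v - Lv u\<bar>"
      by (simp add: abs_mult right_diff_distrib[symmetric])
    ultimately have "h\<^sup>2 * \<bar>Lu v - Lv u\<bar> \<le> h\<^sup>2 * (\<epsilon> * (3 * norm u + 3 * norm v))"
      by (simp add: algebra_simps)
    then show ?thesis using h by (simp add: mult_le_cancel_left)
  qed
  have "\<bar>Lu v - Lv u\<bar> \<le> 0"
  proof (rule field_le_epsilon)
    fix e :: real assume e: "e > 0"
    have n: "3 * norm u + 3 * norm v + 1 > 0" using norm_ge_zero[of u] norm_ge_zero[of v] by linarith
    have "\<bar>Lu v - Lv u\<bar> \<le> e / (3 * norm u + 3 * norm v + 1) * (3 * norm u + 3 * norm v)"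
      using e n by (intro est) simp
    also have "\<dots> \<le> e" using e n by (simp add: field_simps)
    finally show "\<bar>Lu v - Lv u\<bar> \<le> 0 + e" by simp
  qed
  then show ?thesis by simp
qed

section \<open>Locality and product rules for derivatives in a chart\<close>

definition cdiff ::
    "('m, 'a::euclidean_space) chart \<Rightarrow> ('m \<Rightarrow> 'b::real_normed_vector) \<Rightarrow> 'm \<Rightarrow> bool" where
  "cdiff \<kappa> f p \<longleftrightarrow> (f \<circ> inv_into (fst \<kappa>) (snd \<kappa>)) differentiable (at (snd \<kappa> p))"

lemma cderiv_works:
  "cdiff \<kappa> f p \<Longrightarrow> ((f \<circ> inv_into (fst \<kappa>) (snd \<kappa>)) has_derivative cderiv \<kappa> f p) (at (snd \<kappa> p))"
  unfolding cdiff_def cderiv_def[abs_def] by (simp add: frechet_derivative_works[symmetric])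

lemma cderivI:
  assumes "((f \<circ> inv_into (fst \<kappa>) (snd \<kappa>)) has_derivative D) (at (snd \<kappa> p))"
  shows "cdiff \<kappa> f p" "cderiv \<kappa> f p = D"
  using assms unfolding cdiff_def cderiv_def[abs_def]
  by (auto simp: differentiable_def frechet_derivative_at[OF assms, symmetric])

lemma cderiv_const: "cdiff \<kappa> (\<lambda>_. c) p" "cderiv \<kappa> (\<lambda>_. c) p u = 0"
proof -
  have "((\<lambda>_. c) \<circ> inv_into (fst \<kappa>) (snd \<kappa>) has_derivative (\<lambda>_. 0)) (at (snd \<kappa> p))"
    by (simp add: o_def)
  from cderivI[OF this] show "cdiff \<kappa> (\<lambda>_. c) p" "cderiv \<kappa> (\<lambda>_. c) p u = 0" by auto
qed

lemma cderiv_add: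
  assumes "cdiff \<kappa> f p" "cdiff \<kappa> f' p"
  shows "cdiff \<kappa> (\<lambda>q. f q + f' q) p" "cderiv \<kappa> (\<lambda>q. f q + f' q) p u = cderiv \<kappa> f p u + cderiv \<kappa> f' p u"
proof -
  have "((\<lambda>q. f q + f' q) \<circ> inv_into (fst \<kappa>) (snd \<kappa>) has_derivative
      (\<lambda>u. cderiv \<kappa> f p u + cderiv \<kappa> f' p u)) (at (snd \<kappa> p))"
    using has_derivative_add[OF cderiv_works[OF assms(1)] cderiv_works[OF assms(2)]] by (simp add: o_def)
  from cderivI[OF this] show "cdiff \<kappa> (\<lambda>q. f q + f' q) p"
    "cderiv \<kappa> (\<lambda>q. f q + f' q) p u = cderiv \<kappa> f p u + cderiv \<kappa> f' p u" by auto
qed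

lemma cderiv_linear_comp:
  assumes "bounded_linear L" "cdiff \<kappa> f p"
  shows "cdiff \<kappa> (\<lambda>q. L (f q)) p" "cderiv \<kappa> (\<lambda>q. L (f q)) p u = L (cderiv \<kappa> f p u)"
proof -
  have "((\<lambda>q. L (f q)) \<circ> inv_into (fst \<kappa>) (snd \<kappa>) has_derivative (\<lambda>u. L (cderiv \<kappa> f p u))) (at (snd \<kappa> p))"
    using bounded_linear.has_derivative[OF assms(1) cderiv_works[OF assms(2)]] by (simp add: o_def)
  from cderivI[OF this] show "cdiff \<kappa> (\<lambda>q. L (f q)) p"
    "cderiv \<kappa> (\<lambda>q. L (f q)) p u = L (cderiv \<kappa> f p u)" by auto
qed

lemma cderiv_minus:
  assumes "cdiff \<kappa> f p"
  shows "cdiff \<kappa> (\<lambda>q. - f q) p" "cderiv \<kappa> (\<lambda>q. - f q) p u = - cderiv \<kappa> f p u"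
  by (rule cderiv_linear_comp[OF bounded_linear_minus[OF bounded_linear_ident] assms])+

lemma cderiv_cmult:
  fixes f :: "'m \<Rightarrow> real"
  assumes "cdiff \<kappa> f p"
  shows "cdiff \<kappa> (\<lambda>q. c * f q) p" "cderiv \<kappa> (\<lambda>q. c * f q) p u = c * cderiv \<kappa> f p u"
  by (rule cderiv_linear_comp[OF bounded_linear_mult_right assms])+

lemma cderiv_scaleR_right:
  assumes "cdiff \<kappa> f p"
  shows "cdiff \<kappa> (\<lambda>q. c *\<^sub>R f q) p" "cderiv \<kappa> (\<lambda>q. c *\<^sub>R f q) p u = c *\<^sub>R cderiv \<kappa> f p u"
  by (rule cderiv_linear_comp[OF bounded_linear_scaleR_right assms])+

lemma cderiv_sum:
  assumes "\<And>i. i \<in> I \<Longrightarrow> cdiff \<kappa> (f i) p"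
  shows "cdiff \<kappa> (\<lambda>q. \<Sum>i\<in>I. f i q) p \<and> cderiv \<kappa> (\<lambda>q. \<Sum>i\<in>I. f i q) p u = (\<Sum>i\<in>I. cderiv \<kappa> (f i) p u)"
  using assms
proof (induction I rule: infinite_finite_induct)
  case (insert i I)
  then have 1: "cdiff \<kappa> (f i) p" and 2: "cdiff \<kappa> (\<lambda>q. \<Sum>i\<in>I. f i q) p"
    and 3: "cderiv \<kappa> (\<lambda>q. \<Sum>i\<in>I. f i q) p u = (\<Sum>i\<in>I. cderiv \<kappa> (f i) p u)" by auto
  show ?case
    using cderiv_add(1)[OF 1 2] cderiv_add(2)[OF 1 2, of u]
    by (simp only: sum.insert[OF insert(1,2)] 3)
qed (simp_all add: cderiv_const)

lemma cderiv_bilinear: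
  assumes op: "bounded_bilinear op" and f: "cdiff \<kappa> f p" and f': "cdiff \<kappa> f' p"
    and p: "p \<in> fst \<kappa>" and inj: "inj_on (snd \<kappa>) (fst \<kappa>)"
  shows "cdiff \<kappa> (\<lambda>q. op (f q) (f' q)) p"
    "cderiv \<kappa> (\<lambda>q. op (f q) (f' q)) p u = op (f p) (cderiv \<kappa> f' p u) + op (cderiv \<kappa> f p u) (f' p)"
proof -
  have "((\<lambda>q. op (f q) (f' q)) \<circ> inv_into (fst \<kappa>) (snd \<kappa>) has_derivative
      (\<lambda>u. op (f p) (cderiv \<kappa> f' p u) + op (cderiv \<kappa> f p u) (f' p))) (at (snd \<kappa> p))"
    using bounded_bilinear.FDERIV[OF op cderiv_works[OF f] cderiv_works[OF f']] p inj by (simp add: o_def)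
  from cderivI[OF this] show "cdiff \<kappa> (\<lambda>q. op (f q) (f' q)) p"
    "cderiv \<kappa> (\<lambda>q. op (f q) (f' q)) p u = op (f p) (cderiv \<kappa> f' p u) + op (cderiv \<kappa> f p u) (f' p)"
    by auto
qed

lemma linear_cderiv: "cdiff \<kappa> f p \<Longrightarrow> linear (cderiv \<kappa> f p)"
  by (rule has_derivative_linear[OF cderiv_works])

locale chart_at =
  fixes \<A> :: "('m::{t2_space, second_countable_topology}, 'a::euclidean_space) chart set"
    and \<kappa> :: "('m, 'a) chart"
  assumes atlas: "smooth_atlas \<A>" and chart: "\<kappa> \<in> \<A>"
begin

lemma chart_props: "open (fst \<kappa>)" "open (snd \<kappa> ` fst \<kappa>)" "inj_on (snd \<kappa>) (fst \<kappa>)"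
  "continuous_on (snd \<kappa> ` fst \<kappa>) (inv_into (fst \<kappa>) (snd \<kappa>))"
proof -
  have "\<forall>(U, x)\<in>\<A>. open U \<and> open (x ` U) \<and> inj_on x U \<and>
        continuous_on U x \<and> continuous_on (x ` U) (inv_into U x)"
    using atlas unfolding smooth_atlas_def by simp
  from bspec[OF this chart] show "open (fst \<kappa>)" "open (snd \<kappa> ` fst \<kappa>)" "inj_on (snd \<kappa>) (fst \<kappa>)"
    "continuous_on (snd \<kappa> ` fst \<kappa>) (inv_into (fst \<kappa>) (snd \<kappa>))" by (simp_all add: case_prod_beta)
qed

lemma open_image:
  assumes "open V"
  shows "open (snd \<kappa> ` (fst \<kappa> \<inter> V))"
proof -
  have "snd \<kappa> ` (fst \<kappa> \<inter> V) = inv_into (fst \<kappa>) (snd \<kappa>) -` V \<inter> snd \<kappa> ` fst \<kappa>"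
    using chart_props(3) by auto
  then show ?thesis
    using continuous_on_open_vimage[OF chart_props(2), THEN iffD1, OF chart_props(4)] assms by auto
qed

text \<open>The chart maps open sets to open sets, so a derivative does not see f outside V. The
  sets of possible derivatives coincide, hence the chosen values agree even where f is not
  differentiable.\<close>

lemma cderiv_cong:
  assumes "open V" "p \<in> V" "p \<in> fst \<kappa>" "\<And>q. q \<in> fst \<kappa> \<inter> V \<Longrightarrow> f q = f' q"
  shows "cderiv \<kappa> f p = cderiv \<kappa> f' p" "cdiff \<kappa> f p \<longleftrightarrow> cdiff \<kappa> f' p"
proof -
  let ?i = "inv_into (fst \<kappa>) (snd \<kappa>)"
  have eq: "(f \<circ> ?i) y = (f' \<circ> ?i) y" if "y \<in> snd \<kappa> ` (fst \<kappa> \<inter> V)" for y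
    using that assms(4) chart_props(3) by auto
  have p: "snd \<kappa> p \<in> snd \<kappa> ` (fst \<kappa> \<inter> V)" using assms by auto
  have "((f \<circ> ?i) has_derivative D) (at (snd \<kappa> p)) \<longleftrightarrow> ((f' \<circ> ?i) has_derivative D) (at (snd \<kappa> p))" for D
    using has_derivative_transform_within_open[OF _ open_image[OF assms(1)] p, of "f \<circ> ?i" D UNIV "f' \<circ> ?i"]
      has_derivative_transform_within_open[OF _ open_image[OF assms(1)] p, of "f' \<circ> ?i" D UNIV "f \<circ> ?i"]
      eq by (auto simp del: comp_apply)
  then have "(\<lambda>D. ((f \<circ> ?i) has_derivative D) (at (snd \<kappa> p))) = (\<lambda>D. ((f' \<circ> ?i) has_derivative D) (at (snd \<kappa> p)))"
    by blast
  then show "cderiv \<kappa> f p = cderiv \<kappa> f' p" "cdiff \<kappa> f p \<longleftrightarrow> cdiff \<kappa> f' p"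
    unfolding cderiv_def[abs_def] cdiff_def frechet_derivative_def differentiable_def by simp_all
qed

lemma smooth_fun_Ck:
  assumes "smooth_fun \<A> V f"
  shows "Ck_on k (f \<circ> inv_into (fst \<kappa>) (snd \<kappa>)) (snd \<kappa> ` (fst \<kappa> \<inter> V))"
  using bspec[OF assms[unfolded smooth_fun_def] chart] by (simp add: case_prod_beta smooth_on_def)

lemma smooth_fun_cdiff:
  assumes "smooth_fun \<A> V f" "p \<in> fst \<kappa>" "p \<in> V"
  shows "cdiff \<kappa> f p"
proof -
  have "\<forall>x\<in>snd \<kappa> ` (fst \<kappa> \<inter> V). (f \<circ> inv_into (fst \<kappa>) (snd \<kappa>)) differentiable (at x)"
    using smooth_fun_Ck[OF assms(1), of "Suc 0"] unfolding Ck_on.simps by blast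
  moreover have "snd \<kappa> p \<in> snd \<kappa> ` (fst \<kappa> \<inter> V)" using assms by blast
  ultimately show ?thesis unfolding cdiff_def by blast
qed

lemma smooth_fun_cdiff2:
  assumes f: "smooth_fun \<A> V f" and V: "open V" and p: "p \<in> fst \<kappa>" "p \<in> V"
  shows "cdiff \<kappa> (\<lambda>q. cderiv \<kappa> f q v) p"
proof -
  let ?i = "inv_into (fst \<kappa>) (snd \<kappa>)" and ?S = "snd \<kappa> ` (fst \<kappa> \<inter> V)"
  have "\<forall>y\<in>?S. (\<lambda>x. frechet_derivative (f \<circ> ?i) (at x) v) differentiable at y"
    using smooth_fun_Ck[OF f, of "Suc (Suc 0)"] unfolding Ck_on.simps by blast
  then have "(\<lambda>x. frechet_derivative (f \<circ> ?i) (at x) v) differentiable at (snd \<kappa> p)" using p by blast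
  moreover have "frechet_derivative (f \<circ> ?i) (at x) v = ((\<lambda>q. cderiv \<kappa> f q v) \<circ> ?i) x" if "x \<in> ?S" for x
    using that chart_props(3) by (auto simp: cderiv_def)
  moreover have "snd \<kappa> p \<in> ?S" using p by auto
  moreover have "open ?S" by (rule open_image[OF V])
  ultimately have "\<exists>D. (((\<lambda>q. cderiv \<kappa> f q v) \<circ> ?i) has_derivative D) (at (snd \<kappa> p))"
    unfolding differentiable_def
    using has_derivative_transform_within_open[where t = UNIV and s = ?S
        and f = "\<lambda>x. frechet_derivative (f \<circ> ?i) (at x) v" and g = "(\<lambda>q. cderiv \<kappa> f q v) \<circ> ?i"
        and x = "snd \<kappa> p"] by meson
  then show ?thesis unfolding cdiff_def differentiable_def by blast
qed

lemma cderiv_commute: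
  fixes f :: "'m \<Rightarrow> real"
  assumes f: "smooth_fun \<A> V f" and V: "open V" and p: "p \<in> fst \<kappa>" "p \<in> V"
  shows "cderiv \<kappa> (\<lambda>q. cderiv \<kappa> f q v) p u = cderiv \<kappa> (\<lambda>q. cderiv \<kappa> f q u) p v"
proof -
  let ?i = "inv_into (fst \<kappa>) (snd \<kappa>)" and ?S = "snd \<kappa> ` (fst \<kappa> \<inter> V)"
  let ?f' = "\<lambda>x. cderiv \<kappa> f (?i x)"
  have pS: "snd \<kappa> p \<in> ?S" using p by auto
  have 1: "(f \<circ> ?i has_derivative ?f' z) (at z)" if "z \<in> ?S" for z
  proof -
    from that obtain q where q: "q \<in> fst \<kappa>" "q \<in> V" "z = snd \<kappa> q" by auto
    have "?i z = q" using q chart_props(3) by simp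
    then show ?thesis using cderiv_works[OF smooth_fun_cdiff[OF f q(1,2)]] by (simp only: q(3))
  qed
  have 2: "((\<lambda>z. ?f' z w) has_derivative cderiv \<kappa> (\<lambda>q. cderiv \<kappa> f q w) p) (at (snd \<kappa> p))" for w
    by (rule cderiv_works[OF smooth_fun_cdiff2[OF f V p], unfolded o_def])
  show ?thesis
    by (rule second_derivative_symmetric[where f' = ?f' and f = "f \<circ> ?i" and u = v and v = u
          and Lu = "cderiv \<kappa> (\<lambda>q. cderiv \<kappa> f q v) p" and Lv = "cderiv \<kappa> (\<lambda>q. cderiv \<kappa> f q u) p",
          OF open_image[OF V] pS])
      (rule 1, assumption, rule 2, rule 2)
qed

end

section \<open>Derivatives of multilinear expressions\<close>

lemma linear_expand:
  fixes F :: "'c::euclidean_space \<Rightarrow> 'b::real_vector"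
  assumes "linear F" shows "F y = (\<Sum>b\<in>Basis. (y \<bullet> b) *\<^sub>R F b)"
proof -
  have "F y = F (\<Sum>b\<in>Basis. (y \<bullet> b) *\<^sub>R b)" by (simp only: euclidean_representation)
  also have "\<dots> = (\<Sum>b\<in>Basis. (y \<bullet> b) *\<^sub>R F b)"
    by (simp only: linear_sum[OF assms] linear_cmul[OF assms])
  finally show ?thesis .
qed

definition multilin :: "nat \<Rightarrow> ('a::real_vector list \<Rightarrow> real) \<Rightarrow> bool" where
  "multilin k \<alpha> \<longleftrightarrow> (\<forall>vs i. length vs = k \<longrightarrow> i < k \<longrightarrow> linear (\<lambda>v. \<alpha> (vs[i := v])))"

lemma multilinD: "multilin k \<alpha> \<Longrightarrow> length vs = k \<Longrightarrow> i < k \<Longrightarrow> linear (\<lambda>v. \<alpha> (vs[i := v]))"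
  by (simp add: multilin_def)

lemma alternating_form_multilin: "alternating_form k \<alpha> \<Longrightarrow> multilin k \<alpha>"
  by (simp add: multilin_def alternating_form_def)

context chart_at
begin

text \<open>Differentiability of F is known only for each fixed argument. Expanding Y in a basis
  reduces the claim to finitely many products of differentiable functions.\<close>

lemma cderiv_apply:
  fixes F :: "'m \<Rightarrow> 'c::euclidean_space \<Rightarrow> 'b::real_normed_vector"
  assumes V: "open V" "p \<in> V" "p \<in> fst \<kappa>"
    and lin: "\<And>q. q \<in> fst \<kappa> \<inter> V \<Longrightarrow> linear (F q)"
    and d: "\<And>y. cdiff \<kappa> (\<lambda>q. F q y) p" and Y: "cdiff \<kappa> Y p"
  shows "cdiff \<kappa> (\<lambda>q. F q (Y q)) p"
    "cderiv \<kappa> (\<lambda>q. F q (Y q)) p u = cderiv \<kappa> (\<lambda>q. F q (Y p)) p u + F p (cderiv \<kappa> Y p u)"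
proof -
  have Yb: "cdiff \<kappa> (\<lambda>q. Y q \<bullet> b) p" "cderiv \<kappa> (\<lambda>q. Y q \<bullet> b) p w = cderiv \<kappa> Y p w \<bullet> b" for b w
    by (rule cderiv_linear_comp[OF bounded_linear_inner_left Y])+
  have t: "cdiff \<kappa> (\<lambda>q. (Y q \<bullet> b) *\<^sub>R F q b) p"
    "cderiv \<kappa> (\<lambda>q. (Y q \<bullet> b) *\<^sub>R F q b) p u =
      (Y p \<bullet> b) *\<^sub>R cderiv \<kappa> (\<lambda>q. F q b) p u + (cderiv \<kappa> Y p u \<bullet> b) *\<^sub>R F p b" for b
    using cderiv_bilinear[OF bounded_bilinear_scaleR Yb(1)[of b] d[of b] V(3) chart_props(3)]
    by (simp_all only: Yb(2))
  have c: "cdiff \<kappa> (\<lambda>q. (y \<bullet> b) *\<^sub>R F q b) p"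
    "cderiv \<kappa> (\<lambda>q. (y \<bullet> b) *\<^sub>R F q b) p u = (y \<bullet> b) *\<^sub>R cderiv \<kappa> (\<lambda>q. F q b) p u" for b y
    by (rule cderiv_scaleR_right[OF d])+
  have e1: "F q (Y q) = (\<Sum>b\<in>Basis. (Y q \<bullet> b) *\<^sub>R F q b)" if "q \<in> fst \<kappa> \<inter> V" for q
    by (rule linear_expand[OF lin[OF that]])
  have e2: "F q (Y p) = (\<Sum>b\<in>Basis. (Y p \<bullet> b) *\<^sub>R F q b)" if "q \<in> fst \<kappa> \<inter> V" for q
    by (rule linear_expand[OF lin[OF that]])
  have s1: "cdiff \<kappa> (\<lambda>q. \<Sum>b\<in>Basis. (Y q \<bullet> b) *\<^sub>R F q b) p \<and>
     cderiv \<kappa> (\<lambda>q. \<Sum>b\<in>Basis. (Y q \<bullet> b) *\<^sub>R F q b) p u = (\<Sum>b\<in>Basis. cderiv \<kappa> (\<lambda>q. (Y q \<bullet> b) *\<^sub>R F q b) p u)"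
    by (rule cderiv_sum) (rule t)
  have s2: "cdiff \<kappa> (\<lambda>q. \<Sum>b\<in>Basis. (Y p \<bullet> b) *\<^sub>R F q b) p \<and>
     cderiv \<kappa> (\<lambda>q. \<Sum>b\<in>Basis. (Y p \<bullet> b) *\<^sub>R F q b) p u = (\<Sum>b\<in>Basis. cderiv \<kappa> (\<lambda>q. (Y p \<bullet> b) *\<^sub>R F q b) p u)"
    by (rule cderiv_sum) (rule c)
  have Fp: "F p (cderiv \<kappa> Y p u) = (\<Sum>b\<in>Basis. (cderiv \<kappa> Y p u \<bullet> b) *\<^sub>R F p b)"
    using V by (intro linear_expand lin) simp
  have c1: "cderiv \<kappa> (\<lambda>q. F q (Y q)) p = cderiv \<kappa> (\<lambda>q. \<Sum>b\<in>Basis. (Y q \<bullet> b) *\<^sub>R F q b) p"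
    "cdiff \<kappa> (\<lambda>q. F q (Y q)) p = cdiff \<kappa> (\<lambda>q. \<Sum>b\<in>Basis. (Y q \<bullet> b) *\<^sub>R F q b) p"
    by (rule cderiv_cong[OF V], rule e1, assumption)+
  have c2: "cderiv \<kappa> (\<lambda>q. F q (Y p)) p = cderiv \<kappa> (\<lambda>q. \<Sum>b\<in>Basis. (Y p \<bullet> b) *\<^sub>R F q b) p"
    by (rule cderiv_cong[OF V], rule e2, assumption)
  show "cdiff \<kappa> (\<lambda>q. F q (Y q)) p"
    unfolding c1(2) by (rule conjunct1[OF s1])
  show "cderiv \<kappa> (\<lambda>q. F q (Y q)) p u = cderiv \<kappa> (\<lambda>q. F q (Y p)) p u + F p (cderiv \<kappa> Y p u)"
    unfolding c1(1) c2 conjunct2[OF s1] conjunct2[OF s2] t(2) c(2) Fp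
    by (rule sum.distrib)
qed

text \<open>The fields \<open>Ys\<close> vary with the point, the vectors \<open>cs\<close> are
  constant. Induction from the right freezes the last field, so that the induction hypothesis
  applies with one more constant vector.\<close>

lemma cderiv_multilinear:
  fixes S :: "'m \<Rightarrow> 'c::euclidean_space list \<Rightarrow> real"
  assumes V: "open V" "p \<in> V" "p \<in> fst \<kappa>"
    and ml: "\<And>q. q \<in> fst \<kappa> \<inter> V \<Longrightarrow> multilin k (S q)"
    and d: "\<And>vs. length vs = k \<Longrightarrow> cdiff \<kappa> (\<lambda>q. S q vs) p"
    and len: "length Ys + length cs = k" and Ys: "\<And>Y. Y \<in> set Ys \<Longrightarrow> cdiff \<kappa> Y p"
  shows "cdiff \<kappa> (\<lambda>q. S q (map (\<lambda>Y. Y q) Ys @ cs)) p \<and>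
    cderiv \<kappa> (\<lambda>q. S q (map (\<lambda>Y. Y q) Ys @ cs)) p u =
      cderiv \<kappa> (\<lambda>q. S q (map (\<lambda>Y. Y p) Ys @ cs)) p u +
      (\<Sum>i<length Ys. S p ((map (\<lambda>Y. Y p) Ys @ cs)[i := cderiv \<kappa> (Ys ! i) p u]))"
  using len Ys
proof (induction Ys arbitrary: cs rule: rev_induct)
  case Nil
  then show ?case using d by simp
next
  case (snoc Y Ys)
  define F where "F q y = S q (map (\<lambda>Y. Y q) Ys @ y # cs)" for q y
  have IH: "cdiff \<kappa> (\<lambda>q. F q y) p \<and> cderiv \<kappa> (\<lambda>q. F q y) p u =
      cderiv \<kappa> (\<lambda>q. S q (map (\<lambda>Y. Y p) Ys @ y # cs)) p u +
      (\<Sum>i<length Ys. S p ((map (\<lambda>Y. Y p) Ys @ y # cs)[i := cderiv \<kappa> (Ys ! i) p u]))" for y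
    unfolding F_def by (rule snoc.IH) (use snoc.prems in auto)
  have lin: "linear (F q)" if "q \<in> fst \<kappa> \<inter> V" for q
  proof -
    have "linear (\<lambda>v. S q ((map (\<lambda>Y. Y q) Ys @ 0 # cs)[length Ys := v]))"
      by (rule multilinD[OF ml[OF that]]) (use snoc.prems in auto)
    then show ?thesis by (simp add: F_def[abs_def] list_update_append)
  qed
  have Y: "cdiff \<kappa> Y p" using snoc.prems by simp
  note A = cderiv_apply[OF V lin conjunct1[OF IH] Y]
  have eq: "S q (map (\<lambda>Y. Y q) (Ys @ [Y]) @ cs) = F q (Y q)" for q by (simp add: F_def)
  have "(\<Sum>i<length Ys. S p ((map (\<lambda>Y. Y p) Ys @ Y p # cs)[i := cderiv \<kappa> (Ys ! i) p u])) =
      (\<Sum>i<length Ys. S p ((map (\<lambda>Y. Y p) (Ys @ [Y]) @ cs)[i := cderiv \<kappa> ((Ys @ [Y]) ! i) p u]))"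
    by (intro sum.cong) (auto simp: nth_append)
  then show ?case
    unfolding eq using A(1) A(2)[of u] conjunct2[OF IH, of "Y p"]
    by (simp add: F_def list_update_append)
qed

text \<open>Second derivatives of the components of a parallel tensor commute. When the parallelism
  equation is differentiated again, the terms with connection forms in two different slots are
  symmetric in u and v; those in a single slot combine to the curvature.\<close>

lemma curvature_annihilates:
  fixes S :: "'m \<Rightarrow> 'c::euclidean_space list \<Rightarrow> real" and G :: "'m \<Rightarrow> 'a \<Rightarrow> 'c \<Rightarrow> 'c"
  assumes V: "open V" "p \<in> V" "V \<subseteq> fst \<kappa>"
    and G: "\<And>w y. cdiff \<kappa> (\<lambda>q. G q w y) p"
    and ml: "\<And>q. q \<in> V \<Longrightarrow> multilin k (S q)"
    and sm: "\<And>vs. length vs = k \<Longrightarrow> smooth_fun \<A> V (\<lambda>q. S q vs)"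
    and par: "\<And>q w vs. q \<in> V \<Longrightarrow> length vs = k \<Longrightarrow>
      cderiv \<kappa> (\<lambda>q. S q vs) q w = (\<Sum>i<k. S q (vs[i := G q w (vs ! i)]))"
    and len: "length vs = k"
  shows "(\<Sum>i<k. S p (vs[i := curvature \<kappa> G p u v (vs ! i)])) = 0"
proof -
  have p: "p \<in> fst \<kappa>" using V by auto
  \<comment> \<open>\<open>B\<close> is a term whose two derivatives hit different slots,
    \<open>C\<close> one where both hit the slot i.\<close>
  define B where "B w z i j = S p (vs[i := G p z (vs ! i), j := G p w (vs ! j)])" for w z i j
  define C where "C w z i = S p (vs[i := G p w (G p z (vs ! i))]) + S p (vs[i := cderiv \<kappa> (\<lambda>q. G q z (vs ! i)) p w])"
    for w z i
  have lin: "linear (\<lambda>y. S q (vs[i := y]))" if "q \<in> V" "i < k" for q i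
    by (rule multilinD[OF ml[OF that(1)] len that(2)])
  have A: "cderiv \<kappa> (\<lambda>q. cderiv \<kappa> (\<lambda>q. S q vs) q z) p w = (\<Sum>i<k. (\<Sum>j\<in>{..<k} - {i}. B w z i j) + C w z i)" for w z
  proof -
    have "cderiv \<kappa> (\<lambda>q. cderiv \<kappa> (\<lambda>q. S q vs) q z) p = cderiv \<kappa> (\<lambda>q. \<Sum>i<k. S q (vs[i := G q z (vs ! i)])) p"
      by (rule cderiv_cong[OF V(1,2) p]) (use par len in auto)
    moreover have 1: "cdiff \<kappa> (\<lambda>q. S q (vs[i := G q z (vs ! i)])) p \<and>
        cderiv \<kappa> (\<lambda>q. S q (vs[i := G q z (vs ! i)])) p w = (\<Sum>j\<in>{..<k} - {i}. B w z i j) + C w z i"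
      if i: "i < k" for i
    proof -
      have dS: "cdiff \<kappa> (\<lambda>q. S q (vs[i := y])) p" for y
        using len V by (intro smooth_fun_cdiff[OF sm p]) auto
      note a = cderiv_apply[OF V(1,2) p, where F = "\<lambda>q y. S q (vs[i := y])" and Y = "\<lambda>q. G q z (vs ! i)",
          OF lin[OF _ i] dS G]
      have "cderiv \<kappa> (\<lambda>q. S q (vs[i := G p z (vs ! i)])) p w =
          (\<Sum>j<k. S p (vs[i := G p z (vs ! i), j := G p w (vs[i := G p z (vs ! i)] ! j)]))"
        using par[OF V(2)] len by simp
      also have "\<dots> = (\<Sum>j\<in>{..<k} - {i}. S p (vs[i := G p z (vs ! i), j := G p w (vs[i := G p z (vs ! i)] ! j)])) +
          S p (vs[i := G p z (vs ! i), i := G p w (vs[i := G p z (vs ! i)] ! i)])"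
        using i by (subst sum.remove[of _ i]) (simp_all only: finite_lessThan lessThan_iff add.commute)
      also have "\<dots> = (\<Sum>j\<in>{..<k} - {i}. B w z i j) + S p (vs[i := G p w (G p z (vs ! i))])"
        using i len by (auto simp: B_def intro!: sum.cong)
      finally show ?thesis using a by (simp add: C_def)
    qed
    moreover have "cderiv \<kappa> (\<lambda>q. \<Sum>i<k. S q (vs[i := G q z (vs ! i)])) p w =
        (\<Sum>i<k. cderiv \<kappa> (\<lambda>q. S q (vs[i := G q z (vs ! i)])) p w)"
      by (rule conjunct2[OF cderiv_sum]) (use 1 in simp)
    ultimately show ?thesis by simp
  qed
  have sym: "cderiv \<kappa> (\<lambda>q. cderiv \<kappa> (\<lambda>q. S q vs) q v) p u = cderiv \<kappa> (\<lambda>q. cderiv \<kappa> (\<lambda>q. S q vs) q u) p v"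
    by (rule cderiv_commute[OF sm[OF len] V(1) p V(2)])
  have "(\<Sum>i<k. \<Sum>j\<in>{..<k} - {i}. B v u i j) = (\<Sum>j<k. \<Sum>i\<in>{..<k} - {j}. B v u i j)"
  proof -
    have "(\<Sum>i<k. \<Sum>j\<in>{..<k} - {i}. B v u i j) = (\<Sum>i<k. \<Sum>j<k. if i = j then 0 else B v u i j)"
      by (intro sum.cong refl sum.mono_neutral_cong_left) auto
    also have "\<dots> = (\<Sum>j<k. \<Sum>i<k. if i = j then 0 else B v u i j)" by (rule sum.swap)
    also have "\<dots> = (\<Sum>j<k. \<Sum>i\<in>{..<k} - {j}. B v u i j)"
      by (intro sum.cong refl sum.mono_neutral_cong_right) auto
    finally show ?thesis .
  qed
  also have "\<dots> = (\<Sum>i<k. \<Sum>j\<in>{..<k} - {i}. B u v i j)"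
    by (intro sum.cong refl) (auto simp: B_def list_update_swap)
  finally have BB: "(\<Sum>i<k. \<Sum>j\<in>{..<k} - {i}. B u v i j) = (\<Sum>i<k. \<Sum>j\<in>{..<k} - {i}. B v u i j)" ..
  have "(\<Sum>i<k. C u v i) = (\<Sum>i<k. C v u i)"
    using sym[unfolded A] BB by (simp add: sum.distrib)
  then have "(\<Sum>i<k. C u v i - C v u i) = 0" by (simp add: sum_subtractf)
  also have "(\<Sum>i<k. C u v i - C v u i) = (\<Sum>i<k. S p (vs[i := curvature \<kappa> G p u v (vs ! i)]))"
  proof (intro sum.cong refl)
    fix i assume "i \<in> {..<k}"
    then have l: "linear (\<lambda>y. S p (vs[i := y]))" using lin V by simp
    show "C u v i - C v u i = S p (vs[i := curvature \<kappa> G p u v (vs ! i)])"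
      using linear_add[OF l] linear_diff[OF l] by (simp add: C_def curvature_def)
  qed
  finally show ?thesis .
qed

end

subsection \<open>Orthonormal frames\<close>

lemma orthonormal_independent:
  fixes b :: "'f::euclidean_space \<Rightarrow> 'f \<Rightarrow> real"
  assumes b: "bilinear b" and o: "\<And>i j. i \<in> I \<Longrightarrow> j \<in> I \<Longrightarrow> b (e i) (e j) = (if i = j then 1 else 0)"
    and I: "finite I"
  shows "inj_on e I" "independent (e ` I)"
proof -
  show inj: "inj_on e I"
  proof (rule inj_onI)
    fix i j assume "i \<in> I" "j \<in> I" "e i = e j"
    then show "i = j" using o[of i j] o[of j j] by (simp split: if_splits)
  qed
  show "independent (e ` I)"
  proof (rule independent_if_scalars_zero)
    fix c :: "'f \<Rightarrow> real" and x assume z: "(\<Sum>y\<in>e ` I. c y *\<^sub>R y) = 0" and "x \<in> e ` I"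
    then obtain j where j: "j \<in> I" "x = e j" by auto
    have l: "linear (\<lambda>y. b y (e j))" using b by (simp add: bilinear_def)
    have "0 = b (\<Sum>i\<in>I. c (e i) *\<^sub>R e i) (e j)"
      using z linear_0[OF l] by (simp add: sum.reindex[OF inj])
    also have "\<dots> = (\<Sum>i\<in>I. c (e i) * b (e i) (e j))"
      by (simp add: linear_sum[OF l] linear_cmul[OF l])
    also have "\<dots> = (\<Sum>i\<in>I. if i = j then c (e i) else 0)" using o j by (intro sum.cong) auto
    also have "\<dots> = c x" using I j by (simp add: sum.delta)
    finally show "c x = 0" by simp
  qed (use I in simp)
qed

lemma orthonormal_expand:
  fixes b :: "'f::euclidean_space \<Rightarrow> 'f \<Rightarrow> real"
  assumes b: "bilinear b" and o: "orthonormal b e"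
  shows "w = (\<Sum>i=1..DIM('f). b w (e i) *\<^sub>R e i)"
proof -
  let ?I = "{1..DIM('f)}"
  have o': "b (e i) (e j) = (if i = j then 1 else 0)" if "i \<in> ?I" "j \<in> ?I" for i j
    using o that by (simp add: orthonormal_def)
  have ind: "inj_on e ?I" "independent (e ` ?I)"
    by (rule orthonormal_independent[OF b]; simp add: o')+
  have "card (e ` ?I) = DIM('f)" using card_image[OF ind(1)] by simp
  then have "UNIV \<subseteq> span (e ` ?I)"
    using card_ge_dim_independent[of "e ` ?I" UNIV] ind(2) by simp
  then have "w \<in> span (e ` ?I)" by auto
  then obtain c where "w = (\<Sum>y\<in>e ` ?I. c y *\<^sub>R y)" unfolding span_finite[OF finite_imageI[OF finite_atLeastAtMost]] by auto
  then have w: "w = (\<Sum>i\<in>?I. c (e i) *\<^sub>R e i)" by (simp only: sum.reindex[OF ind(1)] o_def)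
  have "b w (e j) = c (e j)" if j: "j \<in> ?I" for j
  proof -
    have l: "linear (\<lambda>y. b y (e j))" using b by (simp add: bilinear_def)
    have "b w (e j) = (\<Sum>i\<in>?I. c (e i) * b (e i) (e j))"
      by (subst w) (simp add: linear_sum[OF l] linear_cmul[OF l])
    also have "\<dots> = (\<Sum>i\<in>?I. if i = j then c (e i) else 0)" using o' j by (intro sum.cong) auto
    also have "\<dots> = c (e j)" using j by (simp add: sum.delta)
    finally show ?thesis .
  qed
  then show ?thesis using w by (metis (no_types, lifting) sum.cong)
qed

text \<open>Gram-Schmidt: a vector outside the span of the first n is projected to their complement
  and normalised.\<close>

lemma orthonormal_exists:
  fixes b :: "'f::euclidean_space \<Rightarrow> 'f \<Rightarrow> real"
  assumes b: "bilinear b" "\<And>r s. b r s = b s r" "\<And>s. s \<noteq> 0 \<Longrightarrow> b s s > 0"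
  shows "\<exists>e. orthonormal b e"
proof -
  have "\<exists>e. \<forall>i\<in>{1..n}. \<forall>j\<in>{1..n}. b (e i) (e j) = (if i = j then 1 else 0)" if "n \<le> DIM('f)" for n
    using that
  proof (induction n)
    case (Suc n)
    from Suc.IH[OF Suc_leD[OF Suc.prems]]
    obtain e where e: "\<And>i j. i \<in> {1..n} \<Longrightarrow> j \<in> {1..n} \<Longrightarrow> b (e i) (e j) = (if i = j then 1 else 0)" by blast
    have "dim (span (e ` {1..n})) \<le> card (e ` {1..n})" by (simp add: dim_le_card')
    also have "\<dots> < DIM('f)" using Suc.prems card_image_le[of "{1..n}" e] by simp
    finally have "span (e ` {1..n}) \<noteq> UNIV" by (metis dim_UNIV order_less_irrefl)
    then obtain x where x: "x \<notin> span (e ` {1..n})" by auto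
    define y where "y = x - (\<Sum>i=1..n. b x (e i) *\<^sub>R e i)"
    have "(\<Sum>i=1..n. b x (e i) *\<^sub>R e i) \<in> span (e ` {1..n})"
      by (intro span_sum span_scale span_base) auto
    then have "y \<noteq> 0" using x by (auto simp: y_def)
    then have py: "b y y > 0" by (rule b)
    have y0: "b y (e j) = 0" if j: "j \<in> {1..n}" for j
    proof -
      have l: "linear (\<lambda>y. b y (e j))" using b(1) unfolding bilinear_def by simp
      have "b y (e j) = b x (e j) - (\<Sum>i=1..n. b x (e i) * b (e i) (e j))"
        by (simp add: y_def linear_diff[OF l] linear_sum[OF l] linear_cmul[OF l])
      also have "(\<Sum>i=1..n. b x (e i) * b (e i) (e j)) = (\<Sum>i=1..n. if i = j then b x (e i) else 0)"
        using e j by (intro sum.cong) auto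
      also have "\<dots> = b x (e j)" using j by (simp add: sum.delta)
      finally show ?thesis by simp
    qed
    define z where "z = (1 / sqrt (b y y)) *\<^sub>R y"
    have "b z z = 1"
      using py b(1) by (simp add: z_def bilinear_lmul bilinear_rmul real_sqrt_mult_self flip: power2_eq_square)
    moreover have "b z (e j) = 0" "b (e j) z = 0" if "j \<in> {1..n}" for j
      using y0[OF that] b(1) b(2)[of "e j" z] by (simp_all add: z_def bilinear_lmul)
    ultimately have "\<forall>i\<in>{1..Suc n}. \<forall>j\<in>{1..Suc n}. b ((e(Suc n := z)) i) ((e(Suc n := z)) j) = (if i = j then 1 else 0)"
      using e by (auto simp: le_Suc_eq)
    then show ?case by blast
  qed simp
  from this[OF order_refl] show ?thesis by (simp add: orthonormal_def)
qed

lemma bilinear_sum_expand: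
  assumes "bilinear B" "finite I" "finite K"
  shows "B (\<Sum>i\<in>I. c i *\<^sub>R x i) (\<Sum>k\<in>K. d k *\<^sub>R y k) = (\<Sum>i\<in>I. \<Sum>k\<in>K. c i * d k * (B (x i) (y k) :: real))"
proof -
  have l: "linear (\<lambda>y. B y z)" "linear (\<lambda>z. B y z)" for y z using assms(1) by (simp_all add: bilinear_def)
  show ?thesis
    by (simp add: linear_sum[OF l(1)] linear_cmul[OF l(1)] linear_sum[OF l(2)] linear_cmul[OF l(2)]
        sum_distrib_left mult.assoc) (subst sum.swap, simp add: mult.left_commute)
qed

text \<open>The transition matrix between two orthonormal frames is orthogonal.\<close>

lemma orthonormal_trace:
  fixes b B :: "'f::euclidean_space \<Rightarrow> 'f \<Rightarrow> real"
  assumes b: "bilinear b" "\<And>r s. b r s = b s r" and e: "orthonormal b e" and e': "orthonormal b e'"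
    and B: "bilinear B"
  shows "(\<Sum>i=1..DIM('f). B (e' i) (e' i)) = (\<Sum>i=1..DIM('f). B (e i) (e i))"
proof -
  let ?I = "{1..DIM('f)}"
  have "b (e j) (e k) = (\<Sum>i\<in>?I. b (e j) (e' i) * b (e' i) (e k))" for j k
  proof -
    have l: "linear (\<lambda>y. b y (e k))" using b(1) unfolding bilinear_def by simp
    show ?thesis
      by (subst orthonormal_expand[OF b(1) e', of "e j"]) (simp add: linear_sum[OF l] linear_cmul[OF l])
  qed
  then have dl: "(\<Sum>i\<in>?I. b (e' i) (e j) * b (e' i) (e k)) = (if j = k then 1 else 0)"
    if "j \<in> ?I" "k \<in> ?I" for j k
    using e that b(2) by (simp add: orthonormal_def)
  have "(\<Sum>i\<in>?I. B (e' i) (e' i)) = (\<Sum>i\<in>?I. \<Sum>j\<in>?I. \<Sum>k\<in>?I. b (e' i) (e j) * b (e' i) (e k) * B (e j) (e k))"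
  proof (intro sum.cong refl)
    fix i
    show "B (e' i) (e' i) = (\<Sum>j\<in>?I. \<Sum>k\<in>?I. b (e' i) (e j) * b (e' i) (e k) * B (e j) (e k))"
      using bilinear_sum_expand[OF B, of ?I ?I "\<lambda>j. b (e' i) (e j)" e "\<lambda>j. b (e' i) (e j)" e]
      by (simp only: orthonormal_expand[OF b(1) e, symmetric] finite_atLeastAtMost)
  qed
  also have "\<dots> = (\<Sum>j\<in>?I. \<Sum>k\<in>?I. \<Sum>i\<in>?I. b (e' i) (e j) * b (e' i) (e k) * B (e j) (e k))"
    by (subst sum.swap) (intro sum.cong refl sum.swap)
  also have "\<dots> = (\<Sum>j\<in>?I. \<Sum>k\<in>?I. (if j = k then B (e j) (e k) else 0))"
    using dl by (intro sum.cong refl) (simp add: sum_distrib_right[symmetric])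
  also have "\<dots> = (\<Sum>j\<in>?I. B (e j) (e j))" by (simp add: sum.delta)
  finally show ?thesis .
qed

text \<open>Vectors are expanded in the frame one at a time, from the right.\<close>

lemma multilin_eqI:
  fixes \<alpha> \<beta> :: "'f::euclidean_space list \<Rightarrow> real"
  assumes b: "bilinear b" "orthonormal b e" and ml: "multilin k \<alpha>" "multilin k \<beta>"
    and eq: "\<And>K. length K = k \<Longrightarrow> set K \<subseteq> {1..DIM('f)} \<Longrightarrow> \<alpha> (map e K) = \<beta> (map e K)"
    and len: "length vs = k"
  shows "\<alpha> vs = \<beta> vs"
proof -
  have "\<alpha> (vs @ map e K) = \<beta> (vs @ map e K)" if "length vs + length K = k" "set K \<subseteq> {1..DIM('f)}" for vs K
    using that
  proof (induction vs arbitrary: K rule: rev_induct)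
    case (snoc v vs)
    have *: "\<gamma> (vs @ v # map e K) = (\<Sum>i=1..DIM('f). b v (e i) * \<gamma> (vs @ map e (i # K)))"
      if "multilin k \<gamma>" for \<gamma>
    proof -
      have "linear (\<lambda>v. \<gamma> ((vs @ 0 # map e K)[length vs := v]))"
        by (rule multilinD[OF that]) (use snoc.prems in auto)
      then have l: "linear (\<lambda>v. \<gamma> (vs @ v # map e K))" by (simp add: list_update_append)
      show ?thesis
        by (subst orthonormal_expand[OF b, of v]) (simp add: linear_sum[OF l] linear_cmul[OF l])
    qed
    have "\<alpha> (vs @ map e (i # K)) = \<beta> (vs @ map e (i # K))" if "i \<in> {1..DIM('f)}" for i
      by (rule snoc.IH) (use that snoc.prems in auto)
    then show ?case using *[OF ml(1)] *[OF ml(2)] by simp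
  qed (use eq in simp)
  from this[of vs "[]"] len show ?thesis by simp
qed

section \<open>Covariant derivatives, curvature symmetries and metric connections\<close>

definition nab ::
    "('m, 'a::euclidean_space) chart \<Rightarrow> ('m \<Rightarrow> 'a \<Rightarrow> 'a \<Rightarrow> 'a) \<Rightarrow> ('m \<Rightarrow> 'a list \<Rightarrow> real) \<Rightarrow> 'm \<Rightarrow> 'a \<Rightarrow> 'a list \<Rightarrow> real" where
  "nab \<kappa> G S p u vs = cderiv \<kappa> (\<lambda>q. S q vs) p u - (\<Sum>i<length vs. S p (vs[i := G p u (vs ! i)]))"

text \<open>By symmetry of the connection and skewness of the form, the Christoffel terms cancel in
  pairs.\<close>

lemma ext_d_nab4:
  fixes S :: "'m \<Rightarrow> 'a::euclidean_space list \<Rightarrow> real"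
  assumes G: "\<And>u v. G p u v = G p v u" and S: "skew 3 (S p)"
  shows "ext_d \<kappa> S p [a,b,c,d] = nab \<kappa> G S p a [b,c,d] - nab \<kappa> G S p b [a,c,d]
    + nab \<kappa> G S p c [a,b,d] - nab \<kappa> G S p d [a,b,c]"
proof -
  have m: "S p [x, G p u v, z] = - S p [G p u v, x, z]" "S p [x, z, G p u v] = S p [G p u v, x, z]" for x z u v
    using skew_swap[OF S, of "[]" "[z]" "G p u v" x] skew_swap[OF S, of "[x]" "[]" z "G p u v"] by simp_all
  show ?thesis
    by (simp add: ext_d_def nab_def numeral_eq_Suc m G[of b a] G[of c a] G[of c b] G[of d a] G[of d b] G[of d c])
qed

lemma ext_d_nab5:
  fixes S :: "'m \<Rightarrow> 'a::euclidean_space list \<Rightarrow> real"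
  assumes G: "\<And>u v. G p u v = G p v u" and S: "skew 4 (S p)"
  shows "ext_d \<kappa> S p [a,b,c,d,f] = nab \<kappa> G S p a [b,c,d,f] - nab \<kappa> G S p b [a,c,d,f]
    + nab \<kappa> G S p c [a,b,d,f] - nab \<kappa> G S p d [a,b,c,f] + nab \<kappa> G S p f [a,b,c,d]"
proof -
  have m: "S p [x, G p u v, z, w] = - S p [G p u v, x, z, w]"
    "S p [x, z, G p u v, w] = S p [G p u v, x, z, w]"
    "S p [x, z, w, G p u v] = - S p [G p u v, x, z, w]" for x z w u v
    using skew_swap[OF S, of "[]" "[z,w]" "G p u v" x] skew_swap[OF S, of "[x]" "[w]" z "G p u v"]
      skew_swap[OF S, of "[x,z]" "[]" w "G p u v"] by simp_all
  show ?thesis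
    by (simp add: ext_d_def nab_def numeral_eq_Suc m G[of b a] G[of c a] G[of c b] G[of d a] G[of d b] G[of d c]
       G[of f a] G[of f b] G[of f c] G[of f d])
qed

context chart_at
begin

lemma linear_cderiv_param:
  fixes F :: "'m \<Rightarrow> 'c::real_vector \<Rightarrow> 'b::real_normed_vector"
  assumes V: "open V" "p \<in> V" "p \<in> fst \<kappa>"
    and lin: "\<And>q. q \<in> fst \<kappa> \<inter> V \<Longrightarrow> linear (F q)" and d: "\<And>y. cdiff \<kappa> (\<lambda>q. F q y) p"
  shows "linear (\<lambda>y. cderiv \<kappa> (\<lambda>q. F q y) p u)"
proof (rule linearI)
  fix y z
  have "cderiv \<kappa> (\<lambda>q. F q (y + z)) p = cderiv \<kappa> (\<lambda>q. F q y + F q z) p"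
    by (rule cderiv_cong(1)[OF V]) (simp only: linear_add[OF lin])
  then show "cderiv \<kappa> (\<lambda>q. F q (y + z)) p u = cderiv \<kappa> (\<lambda>q. F q y) p u + cderiv \<kappa> (\<lambda>q. F q z) p u"
    by (simp only: cderiv_add(2)[OF d d])
next
  fix r y
  have "cderiv \<kappa> (\<lambda>q. F q (r *\<^sub>R y)) p = cderiv \<kappa> (\<lambda>q. r *\<^sub>R F q y) p"
    by (rule cderiv_cong(1)[OF V]) (simp only: linear_cmul[OF lin])
  then show "cderiv \<kappa> (\<lambda>q. F q (r *\<^sub>R y)) p u = r *\<^sub>R cderiv \<kappa> (\<lambda>q. F q y) p u"
    by (simp only: cderiv_scaleR_right(2)[OF d])
qed

lemma curvature_linear:
  fixes A :: "'m \<Rightarrow> 'a \<Rightarrow> 'f::euclidean_space \<Rightarrow> 'f"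
  assumes V: "open V" "p \<in> V" "p \<in> fst \<kappa>"
    and bil: "\<And>q. q \<in> fst \<kappa> \<inter> V \<Longrightarrow> bilinear (A q)" and d: "\<And>w y. cdiff \<kappa> (\<lambda>q. A q w y) p"
  shows "linear (\<lambda>s. curvature \<kappa> A p u v s)" "linear (\<lambda>v. curvature \<kappa> A p u v s)"
    "curvature \<kappa> A p u v s = - curvature \<kappa> A p v u s" "linear (\<lambda>u. curvature \<kappa> A p u v s)"
proof -
  have l: "linear (\<lambda>w. A q w y)" "linear (\<lambda>y. A q w y)" if "q \<in> fst \<kappa> \<inter> V" for q w y
    using bil[OF that] by (simp_all add: bilinear_def)
  have p: "p \<in> fst \<kappa> \<inter> V" using V by simp
  have c: "linear (\<lambda>s. cderiv \<kappa> (\<lambda>q. A q w s) p u)" "linear (\<lambda>w. cderiv \<kappa> (\<lambda>q. A q w s) p u)" for w u s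
    using linear_cderiv_param[OF V, where F = "\<lambda>q s. A q w s", OF l(2) d]
      linear_cderiv_param[OF V, where F = "\<lambda>q w. A q w s", OF l(1) d] by simp_all
  have c': "linear (\<lambda>u. cderiv \<kappa> (\<lambda>q. A q w s) p u)" for w s
    using linear_cderiv[OF d] by simp
  have ll: "linear (\<lambda>s. A p u (A p v s))" "linear (\<lambda>v. A p u (A p v s))" "linear (\<lambda>v. A p v (A p u s))" for u v s
    using linear_compose[OF l(2)[OF p] l(2)[OF p]] linear_compose[OF l(1)[OF p] l(2)[OF p]] l(1)[OF p]
    by (simp_all add: o_def)
  show "linear (\<lambda>s. curvature \<kappa> A p u v s)" unfolding curvature_def
    by (intro linear_compose_add linear_compose_sub c ll)
  show *: "linear (\<lambda>v. curvature \<kappa> A p u v s)" for u unfolding curvature_def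
    by (intro linear_compose_add linear_compose_sub c c' ll)
  show a: "curvature \<kappa> A p u v s = - curvature \<kappa> A p v u s" for u v
    by (simp add: curvature_def)
  show "linear (\<lambda>u. curvature \<kappa> A p u v s)"
    unfolding a[of _ v] by (rule linear_compose_neg[OF *])
qed

lemma Ck_on_subset: "Ck_on k f S \<Longrightarrow> T \<subseteq> S \<Longrightarrow> Ck_on k f T"
  by (induction k arbitrary: f) (auto intro: continuous_on_subset)

lemma smooth_fun_subset: "smooth_fun \<A> W f \<Longrightarrow> W' \<subseteq> W \<Longrightarrow> smooth_fun \<A> W' f"
  unfolding smooth_fun_def smooth_on_def case_prod_beta
  by (intro ballI allI, drule bspec, assumption, drule spec, erule Ck_on_subset) (intro image_mono Int_mono order_refl)

text \<open>Unpacks the bundle data in one trivialisation over the current chart. Taking the atlas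
  for \<open>J\<close> yields the same facts for the tangent bundle.\<close>

lemma bundle_facts:
  fixes h :: "'j \<Rightarrow> 'm \<Rightarrow> 'f::euclidean_space \<Rightarrow> 'f \<Rightarrow> real"
  assumes vb: "\<forall>j\<in>J. open (U j)" and fm: "fibre_metric \<A> J U t h" and mc: "metric_connection \<A> J U t h A"
    and j: "j \<in> J"
  shows "\<And>q. q \<in> fst \<kappa> \<inter> U j \<Longrightarrow> bilinear (h j q)" "\<And>q r s. q \<in> U j \<Longrightarrow> h j q r s = h j q s r"
    "\<And>q s. q \<in> U j \<Longrightarrow> s \<noteq> 0 \<Longrightarrow> h j q s s > 0"
    "\<And>r s. smooth_fun \<A> (fst \<kappa> \<inter> U j) (\<lambda>q. h j q r s)"
    "\<And>q. q \<in> fst \<kappa> \<inter> U j \<Longrightarrow> bilinear (A \<kappa> j q)"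
    "\<And>v s. smooth_fun \<A> (fst \<kappa> \<inter> U j) (\<lambda>q. A \<kappa> j q v s)"
    "\<And>q v r s. q \<in> fst \<kappa> \<inter> U j \<Longrightarrow>
       cderiv \<kappa> (\<lambda>q. h j q r s) q v = h j q (A \<kappa> j q v r) s + h j q r (A \<kappa> j q v s)"
    "open (fst \<kappa> \<inter> U j)"
proof -
  note fm' = fm[unfolded fibre_metric_def] and mc' = mc[unfolded metric_connection_def]
  note bc = conjunct1[OF mc', unfolded bundle_connection_def]
  note f1 = bspec[OF conjunct1[OF fm'] j]
  show "bilinear (h j q)" if "q \<in> fst \<kappa> \<inter> U j" for q using bspec[OF f1] that by simp
  show "h j q r s = h j q s r" if "q \<in> U j" for q r s
    using conjunct1[OF conjunct2[OF bspec[OF f1 that]], rule_format] .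
  show "h j q s s > 0" if "q \<in> U j" "s \<noteq> 0" for q s
    using conjunct2[OF conjunct2[OF bspec[OF f1 that(1)]], rule_format, OF that(2)] .
  show "smooth_fun \<A> (fst \<kappa> \<inter> U j) (\<lambda>q. h j q r s)" for r s
    by (rule smooth_fun_subset[OF bspec[OF conjunct1[OF conjunct2[OF fm']] j, rule_format]]) simp
  note b1 = bspec[OF bspec[OF conjunct1[OF bc] chart] j]
  show "bilinear (A \<kappa> j q)" if "q \<in> fst \<kappa> \<inter> U j" for q using bspec[OF conjunct1[OF b1] that] .
  show "smooth_fun \<A> (fst \<kappa> \<inter> U j) (\<lambda>q. A \<kappa> j q v s)" for v s
    using conjunct2[OF b1, rule_format] .
  show "cderiv \<kappa> (\<lambda>q. h j q r s) q v = h j q (A \<kappa> j q v r) s + h j q r (A \<kappa> j q v s)"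
    if "q \<in> fst \<kappa> \<inter> U j" for q v r s
    using bspec[OF bspec[OF bspec[OF conjunct2[OF mc'] chart] j] that, rule_format] .
  show "open (fst \<kappa> \<inter> U j)" using vb j chart_props(1) by auto
qed

text \<open>The fibre metric is a parallel 2-tensor, so \<open>curvature_annihilates\<close> applies
  to it.\<close>

lemma curvature_skew:
  fixes h :: "'j \<Rightarrow> 'm \<Rightarrow> 'f::euclidean_space \<Rightarrow> 'f \<Rightarrow> real"
  assumes vb: "\<forall>j\<in>J. open (U j)" and fm: "fibre_metric \<A> J U t h" and mc: "metric_connection \<A> J U t h A"
    and j: "j \<in> J" and p: "p \<in> fst \<kappa> \<inter> U j"
  shows "h j p (curvature \<kappa> (A \<kappa> j) p u v r) s = - h j p r (curvature \<kappa> (A \<kappa> j) p u v s)"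
proof -
  note F = bundle_facts[OF vb fm mc j]
  let ?S = "\<lambda>q vs. h j q (vs ! 0) (vs ! 1)"
  have ml: "multilin 2 (?S q)" if q: "q \<in> fst \<kappa> \<inter> U j" for q
    unfolding multilin_def
  proof (intro allI impI)
    fix vs :: "'f list" and i :: nat assume "length vs = 2" "i < 2"
    then have "i = 0 \<or> i = 1" and "length vs = 2" by auto
    then show "linear (\<lambda>v. h j q (vs[i := v] ! 0) (vs[i := v] ! 1))"
      using F(1)[OF q] by (auto simp: bilinear_def)
  qed
  have "(\<Sum>i<2. ?S p ([r, s][i := curvature \<kappa> (A \<kappa> j) p u v ([r, s] ! i)])) = 0"
  proof (rule curvature_annihilates[OF F(8) p])
    show "cdiff \<kappa> (\<lambda>q. A \<kappa> j q w y) p" for w y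
      using smooth_fun_cdiff[OF F(6) _ p] p by simp
    show "cderiv \<kappa> (\<lambda>q. ?S q vs) q w = (\<Sum>i<2. ?S q (vs[i := A \<kappa> j q w (vs ! i)]))"
      if "q \<in> fst \<kappa> \<inter> U j" "length vs = 2" for q w vs
      using F(7)[OF that(1)] that(2) by (simp add: numeral_2_eq_2)
  qed (use ml F(4) in auto)
  then show ?thesis by (simp add: numeral_2_eq_2)
qed

end

subsection \<open>The connection with torsion in a frame\<close>

lemma linear_scaleR_const:
  assumes "linear (f :: 'a::real_vector \<Rightarrow> real)" shows "linear (\<lambda>x. f x *\<^sub>R c)"
  by (rule linearI) (simp_all add: linear_add[OF assms] linear_cmul[OF assms] scaleR_add_left)

locale riem_frame = chart_at \<A> \<kappa>
  for \<A> :: "('m::{t2_space, second_countable_topology}, 'a::euclidean_space) chart set"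
    and \<kappa> :: "('m, 'a) chart" +
  fixes g :: "('m, 'a) chart \<Rightarrow> 'm \<Rightarrow> 'a \<Rightarrow> 'a \<Rightarrow> real"
    and LC :: "('m, 'a) chart \<Rightarrow> ('m, 'a) chart \<Rightarrow> 'm \<Rightarrow> 'a \<Rightarrow> 'a \<Rightarrow> 'a"
    and H :: "('m, 'a) chart \<Rightarrow> 'm \<Rightarrow> 'a list \<Rightarrow> real"
    and V :: "'m set" and e :: "'m \<Rightarrow> nat \<Rightarrow> 'a"
  assumes metric: "riemannian_metric \<A> g" and lc: "levi_civita \<A> g LC" and sH: "smooth_form \<A> 3 H"
    and V: "open V" "V \<subseteq> fst \<kappa>"
    and se: "\<And>i. i \<in> {1..DIM('a)} \<Longrightarrow> smooth_fun \<A> V (\<lambda>q. e q i)"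
    and oe: "\<And>q. q \<in> V \<Longrightarrow> orthonormal (g \<kappa> q) (e q)"
begin

abbreviation "gq \<equiv> g \<kappa>"
abbreviation "\<Gamma> \<equiv> LC \<kappa> \<kappa>"

lemma Vk: "q \<in> V \<Longrightarrow> q \<in> fst \<kappa>" using V by auto

lemma atlas_open: "\<forall>j\<in>\<A>. open (fst j)"
  using atlas unfolding smooth_atlas_def by (auto simp: case_prod_beta)

lemma lc_metric: "metric_connection_TM \<A> g LC" using lc by (simp add: levi_civita_def)

lemmas gfacts = bundle_facts[OF atlas_open metric lc_metric chart, simplified]

lemma g_bil: "q \<in> V \<Longrightarrow> bilinear (gq q)" and g_sym: "q \<in> V \<Longrightarrow> gq q r s = gq q s r"
  and \<Gamma>_bil: "q \<in> V \<Longrightarrow> bilinear (\<Gamma> q)"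
  and dg: "q \<in> V \<Longrightarrow> cderiv \<kappa> (\<lambda>q. gq q r s) q v = gq q (\<Gamma> q v r) s + gq q r (\<Gamma> q v s)"
  using gfacts Vk by auto

lemma \<Gamma>_sym: "q \<in> V \<Longrightarrow> \<Gamma> q u v = \<Gamma> q v u"
  using lc chart Vk unfolding levi_civita_def by blast

lemma cdiff_g: "q \<in> V \<Longrightarrow> cdiff \<kappa> (\<lambda>q. gq q r s) q"
  and cdiff_\<Gamma>: "q \<in> V \<Longrightarrow> cdiff \<kappa> (\<lambda>q. \<Gamma> q r s) q"
  and cdiff_e: "q \<in> V \<Longrightarrow> i \<in> {1..DIM('a)} \<Longrightarrow> cdiff \<kappa> (\<lambda>q. e q i) q"
  using smooth_fun_cdiff[OF gfacts(4)] smooth_fun_cdiff[OF gfacts(6)] smooth_fun_cdiff[OF se] Vk by auto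

lemma g_lin: "q \<in> V \<Longrightarrow> linear (\<lambda>x. gq q x y)" "q \<in> V \<Longrightarrow> linear (gq q x)"
  using g_bil[of q] by (auto simp: bilinear_def)

lemma \<Gamma>_lin: "q \<in> V \<Longrightarrow> linear (\<lambda>x. \<Gamma> q x y)" "q \<in> V \<Longrightarrow> linear (\<Gamma> q x)"
  using \<Gamma>_bil[of q] by (auto simp: bilinear_def)

lemma e_ortho: "q \<in> V \<Longrightarrow> i \<in> {1..DIM('a)} \<Longrightarrow> j \<in> {1..DIM('a)} \<Longrightarrow> gq q (e q i) (e q j) = (if i = j then 1 else 0)"
  using oe by (simp add: orthonormal_def)

lemma e_expand: "q \<in> V \<Longrightarrow> w = (\<Sum>i\<in>{1..DIM('a)}. gq q w (e q i) *\<^sub>R e q i)"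
  by (rule orthonormal_expand[OF g_bil oe])

lemma form_facts:
  assumes "smooth_form \<A> k S"
  shows "q \<in> V \<Longrightarrow> alternating_form k (S \<kappa> q)" "length vs = k \<Longrightarrow> smooth_fun \<A> (fst \<kappa>) (\<lambda>q. S \<kappa> q vs)"
    "q \<in> V \<Longrightarrow> multilin k (S \<kappa> q)" "q \<in> V \<Longrightarrow> skew k (S \<kappa> q)"
    "q \<in> V \<Longrightarrow> length vs = k \<Longrightarrow> cdiff \<kappa> (\<lambda>q. S \<kappa> q vs) q"
proof -
  note a = bspec[OF conjunct1[OF assms[unfolded smooth_form_def]] chart]
  show 1: "alternating_form k (S \<kappa> q)" if "q \<in> V" for q using a Vk[OF that] by blast
  show 2: "smooth_fun \<A> (fst \<kappa>) (\<lambda>q. S \<kappa> q vs)" if "length vs = k" for vs using a that by blast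
  show "multilin k (S \<kappa> q)" if "q \<in> V" for q by (rule alternating_form_multilin[OF 1[OF that]])
  show "skew k (S \<kappa> q)" if "q \<in> V" for q by (rule alternating_form_skew[OF 1[OF that]])
  show "cdiff \<kappa> (\<lambda>q. S \<kappa> q vs) q" if "q \<in> V" "length vs = k" for q
    by (rule smooth_fun_cdiff[OF 2[OF that(2)] Vk[OF that(1)] Vk[OF that(1)]])
qed

lemmas Hf = form_facts[OF sH]

lemma H_lin:
  assumes "q \<in> V"
  shows "linear (\<lambda>x. H \<kappa> q [x,v,w])" "linear (\<lambda>x. H \<kappa> q [v,x,w])" "linear (\<lambda>x. H \<kappa> q [v,w,x])"
  using multilinD[OF Hf(3)[OF assms], of "[0,v,w]" 0] multilinD[OF Hf(3)[OF assms], of "[v,0,w]" 1]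
    multilinD[OF Hf(3)[OF assms], of "[v,w,0]" 2] by (simp_all add: numeral_2_eq_2)

lemma H_alt:
  assumes "q \<in> V"
  shows "H \<kappa> q [b,a,c] = - H \<kappa> q [a,b,c]" "H \<kappa> q [a,c,b] = - H \<kappa> q [a,b,c]"
    "H \<kappa> q [a,a,c] = 0" "H \<kappa> q [a,b,b] = 0"
  using skew_swap[OF Hf(4)[OF assms], of "[]" "[c]" b a] skew_swap[OF Hf(4)[OF assms], of "[a]" "[]" c b]
  by (auto intro!: skew_repeat[OF Hf(4)[OF assms]])

text \<open>The torsion \<open>T\<close> of \<open>\<nabla>\<^sup>+\<close>, the connection form \<open>Gp\<close> of \<open>\<nabla>\<^sup>+\<close> with respect to the chart, and
  the connection forms of \<open>\<nabla>\<^sup>g\<close> and \<open>\<nabla>\<^sup>+\<close> with respect to the frame.\<close>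

definition T where "T q u v = (\<Sum>i\<in>{1..DIM('a)}. H \<kappa> q [u, v, e q i] *\<^sub>R e q i)"
definition Gp where "Gp q u v = \<Gamma> q u v + (1/2) *\<^sub>R T q u v"
definition ne where "ne q u i = cderiv \<kappa> (\<lambda>q. e q i) q u + \<Gamma> q u (e q i)"
definition om where "om q u i j = gq q (ne q u i) (e q j)"
definition omp where "omp q u i j = om q u i j + H \<kappa> q [u, e q i, e q j] / 2"

lemma g_T: assumes q: "q \<in> V" shows "gq q (T q u v) w = H \<kappa> q [u, v, w]"
proof -
  have "H \<kappa> q [u, v, w] = (\<Sum>i\<in>{1..DIM('a)}. gq q w (e q i) * H \<kappa> q [u, v, e q i])"
    by (subst e_expand[OF q, of w]) (simp only: linear_sum[OF H_lin(3)[OF q]] linear_cmul[OF H_lin(3)[OF q]] real_scaleR_def)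
  then show ?thesis
    by (simp add: T_def linear_sum[OF g_lin(1)[OF q]] linear_cmul[OF g_lin(1)[OF q]] g_sym[OF q, of "e q _"] mult.commute)
qed

lemma T_bil: assumes q: "q \<in> V" shows "linear (\<lambda>x. T q x y)" "linear (T q x)" "T q y x = - T q x y"
proof -
  show "linear (\<lambda>x. T q x y)" unfolding T_def
    using H_lin(1)[OF q] by (intro linear_compose_sum ballI linear_scaleR_const) auto
  show "linear (T q x)" unfolding T_def[abs_def]
    using H_lin(2)[OF q] by (intro linear_compose_sum ballI linear_scaleR_const) auto
  show "T q y x = - T q x y" unfolding T_def by (subst H_alt(1)[OF q]) (simp add: sum_negf)
qed

lemma Gp_bil: "q \<in> V \<Longrightarrow> linear (\<lambda>x. Gp q x y)" "q \<in> V \<Longrightarrow> linear (Gp q x)"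
  unfolding Gp_def[abs_def] by (intro linear_compose_add linear_compose_scale_right \<Gamma>_lin T_bil; assumption)+

lemma cderiv_ml:
  fixes S :: "'m \<Rightarrow> 'c::euclidean_space list \<Rightarrow> real"
  assumes q: "q \<in> V" and ml: "\<And>q. q \<in> V \<Longrightarrow> multilin k (S q)"
    and d: "\<And>vs. length vs = k \<Longrightarrow> cdiff \<kappa> (\<lambda>q. S q vs) q"
    and len: "length Ys + length cs = k" and Ys: "\<And>Y. Y \<in> set Ys \<Longrightarrow> cdiff \<kappa> Y q"
  shows "cdiff \<kappa> (\<lambda>q. S q (map (\<lambda>Y. Y q) Ys @ cs)) q"
   "cderiv \<kappa> (\<lambda>q. S q (map (\<lambda>Y. Y q) Ys @ cs)) q u =
      cderiv \<kappa> (\<lambda>x. S x (map (\<lambda>Y. Y q) Ys @ cs)) q u +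
      (\<Sum>i<length Ys. S q ((map (\<lambda>Y. Y q) Ys @ cs)[i := cderiv \<kappa> (Ys ! i) q u]))"
  using cderiv_multilinear[OF V(1) q Vk[OF q], of k S Ys cs u] ml d len Ys by auto

lemma cdiff_T: assumes q: "q \<in> V" shows "cdiff \<kappa> (\<lambda>q. T q u v) q"
proof -
  have 1: "cdiff \<kappa> (\<lambda>q. H \<kappa> q [u, v, e q i]) q" if i: "i \<in> {1..DIM('a)}" for i
  proof (rule cderiv_apply(1)[OF V(1) q Vk[OF q], where F = "\<lambda>q y. H \<kappa> q [u, v, y]" and Y = "\<lambda>q. e q i"])
    show "linear (\<lambda>y. H \<kappa> q [u, v, y])" if "q \<in> fst \<kappa> \<inter> V" for q using H_lin(3) that by auto
    show "cdiff \<kappa> (\<lambda>q. H \<kappa> q [u, v, y]) q" for y using Hf(5)[OF q] by simp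
  qed (rule cdiff_e[OF q i])
  have 2: "cdiff \<kappa> (\<lambda>q. H \<kappa> q [u, v, e q i] *\<^sub>R e q i) q" if i: "i \<in> {1..DIM('a)}" for i
    by (rule cderiv_bilinear(1)[OF bounded_bilinear_scaleR 1[OF i] cdiff_e[OF q i] Vk[OF q] chart_props(3)])
  show ?thesis unfolding T_def by (rule conjunct1[OF cderiv_sum]) (rule 2)
qed

lemma cdiff_Gp: "q \<in> V \<Longrightarrow> cdiff \<kappa> (\<lambda>q. Gp q u v) q"
  unfolding Gp_def by (intro cderiv_add cderiv_scaleR_right cdiff_\<Gamma> cdiff_T)

lemma ne_expand: "q \<in> V \<Longrightarrow> ne q u i = (\<Sum>j\<in>{1..DIM('a)}. om q u i j *\<^sub>R e q j)"
  unfolding om_def by (rule e_expand)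

text \<open>The function g(e_i, e_j) is constant; its derivative along u vanishes.\<close>

lemma om_antisym: assumes q: "q \<in> V" and i: "i \<in> {1..DIM('a)}" and j: "j \<in> {1..DIM('a)}" shows "om q u j i = - om q u i j"
proof -
  let ?S = "\<lambda>q vs. gq q (vs ! 0) (vs ! 1)"
  have ml: "multilin 2 (?S q)" if q: "q \<in> V" for q
    unfolding multilin_def
  proof (intro allI impI)
    fix vs :: "'a list" and i :: nat assume "length vs = 2" "i < 2"
    then have "i = 0 \<or> i = 1" and "length vs = 2" by auto
    then show "linear (\<lambda>v. gq q (vs[i := v] ! 0) (vs[i := v] ! 1))" using g_lin[OF q] by auto
  qed
  have "cderiv \<kappa> (\<lambda>q. ?S q (map (\<lambda>Y. Y q) [\<lambda>q. e q i, \<lambda>q. e q j] @ [])) q u =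
      cderiv \<kappa> (\<lambda>q'. ?S q' (map (\<lambda>Y. Y q) [\<lambda>q. e q i, \<lambda>q. e q j] @ [])) q u +
      (\<Sum>k<length [\<lambda>q. e q i, \<lambda>q. e q j]. ?S q ((map (\<lambda>Y. Y q) [\<lambda>q. e q i, \<lambda>q. e q j] @ [])
        [k := cderiv \<kappa> ([\<lambda>q. e q i, \<lambda>q. e q j] ! k) q u]))"
    by (rule cderiv_ml(2)[where k = 2 and S = ?S, OF q ml]) (use cdiff_g[OF q] cdiff_e[OF q] i j in auto)
  moreover have "cderiv \<kappa> (\<lambda>q. gq q (e q i) (e q j)) q = cderiv \<kappa> (\<lambda>q. if i = j then 1 else 0) q"
    by (rule cderiv_cong(1)[OF V(1) q Vk[OF q]]) (use e_ortho i j in auto)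
  ultimately have "0 = gq q (\<Gamma> q u (e q i)) (e q j) + gq q (e q i) (\<Gamma> q u (e q j)) +
      gq q (cderiv \<kappa> (\<lambda>q. e q i) q u) (e q j) + gq q (e q i) (cderiv \<kappa> (\<lambda>q. e q j) q u)"
    using dg[OF q] by (simp add: numeral_2_eq_2 cderiv_const)
  then show ?thesis
    using linear_add[OF g_lin(1)[OF q]] g_sym[OF q, of "e q i"] by (simp add: om_def ne_def)
qed

text \<open>The derivative of a frame component splits into the covariant derivative of the tensor
  and those of the frame vectors, which \<open>om\<close> expands in the frame.\<close>

lemma nab_frame:
  assumes q: "q \<in> V" and ml: "\<And>q. q \<in> V \<Longrightarrow> multilin k (S q)"
    and d: "\<And>vs. length vs = k \<Longrightarrow> cdiff \<kappa> (\<lambda>q. S q vs) q" and K: "length K = k" "set K \<subseteq> {1..DIM('a)}"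
  shows "cdiff \<kappa> (\<lambda>q. S q (map (e q) K)) q"
    "cderiv \<kappa> (\<lambda>q. S q (map (e q) K)) q u = nab \<kappa> \<Gamma> S q u (map (e q) K) +
     act DIM('a) (om q u) (\<lambda>K. S q (map (e q) K)) K"
proof -
  let ?Ys = "map (\<lambda>i q. e q i) K"
  have Ys: "cdiff \<kappa> Y q" if "Y \<in> set ?Ys" for Y using that K cdiff_e[OF q] by auto
  have m: "map (\<lambda>Y. Y q) ?Ys @ [] = map (e q) K" for q by (simp add: o_def)
  note A = cderiv_ml[where S = S and k = k, OF q ml d, of ?Ys "[]", unfolded m, OF _ _ _ Ys]
  show "cdiff \<kappa> (\<lambda>q. S q (map (e q) K)) q" using A(1) K by simp
  have lin: "linear (\<lambda>v. S q ((map (e q) K)[s := v]))" if "s < k" for s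
    by (rule multilinD[OF ml[OF q] _ that]) (simp add: K)
  have "S q ((map (e q) K)[s := cderiv \<kappa> (\<lambda>q. e q (K ! s)) q u]) =
      (\<Sum>i\<in>{1..DIM('a)}. om q u (K ! s) i * S q (map (e q) (K[s := i]))) - S q ((map (e q) K)[s := \<Gamma> q u (map (e q) K ! s)])"
    if s: "s < k" for s
  proof -
    have "S q ((map (e q) K)[s := ne q u (K ! s)]) = (\<Sum>i\<in>{1..DIM('a)}. om q u (K ! s) i * S q (map (e q) (K[s := i])))"
      by (subst ne_expand[OF q]) (simp add: linear_sum[OF lin[OF s]] linear_cmul[OF lin[OF s]] map_update)
    then show ?thesis using linear_add[OF lin[OF s]] s K by (simp add: ne_def)
  qed
  then have "(\<Sum>s<k. S q ((map (e q) K)[s := cderiv \<kappa> (\<lambda>q. e q (K ! s)) q u])) =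
     act DIM('a) (om q u) (\<lambda>K. S q (map (e q) K)) K - (\<Sum>s<k. S q ((map (e q) K)[s := \<Gamma> q u (map (e q) K ! s)]))"
    by (simp add: act_def K sum_subtractf)
  then show "cderiv \<kappa> (\<lambda>q. S q (map (e q) K)) q u = nab \<kappa> \<Gamma> S q u (map (e q) K) +
     act DIM('a) (om q u) (\<lambda>K. S q (map (e q) K)) K"
    using A(2)[of u] K by (simp add: nab_def)
qed

text \<open>With constant components the covariant derivative is minus the action of
  \<open>om\<close>; the torsion part of \<open>Gp\<close> completes \<open>om\<close> to
  \<open>omp\<close>, which annihilates C. An algebraic condition in the frame thus becomes the
  coordinate equation that \<open>curvature_annihilates\<close> asks for.\<close>

lemma parallel:
  assumes q: "q \<in> V" and ml: "\<And>q. q \<in> V \<Longrightarrow> multilin k (S q)"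
    and d: "\<And>vs. length vs = k \<Longrightarrow> cdiff \<kappa> (\<lambda>q. S q vs) q"
    and C: "\<And>q K. q \<in> V \<Longrightarrow> length K = k \<Longrightarrow> set K \<subseteq> {1..DIM('a)} \<Longrightarrow> S q (map (e q) K) = C K"
    and par: "\<And>K. length K = k \<Longrightarrow> set K \<subseteq> {1..DIM('a)} \<Longrightarrow> act DIM('a) (omp q u) C K = 0"
    and len: "length vs = k"
  shows "cderiv \<kappa> (\<lambda>q. S q vs) q u = (\<Sum>i<k. S q (vs[i := Gp q u (vs ! i)]))"
proof (rule multilin_eqI[OF g_bil[OF q] oe[OF q] _ _ _ len])
  show "multilin k (\<lambda>vs. cderiv \<kappa> (\<lambda>q. S q vs) q u)"
    unfolding multilin_def
  proof (intro allI impI)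
    fix vs :: "'a list" and i assume a: "length vs = k" "i < k"
    show "linear (\<lambda>v. cderiv \<kappa> (\<lambda>q. S q (vs[i := v])) q u)"
      by (rule linear_cderiv_param[OF V(1) q Vk[OF q]])
        (use multilinD[OF ml, of _ vs i] a d in auto)
  qed
  show "multilin k (\<lambda>vs. \<Sum>i<k. S q (vs[i := Gp q u (vs ! i)]))"
    unfolding multilin_def
  proof (intro allI impI linear_compose_sum ballI)
    fix vs :: "'a list" and i j assume a: "length vs = k" "i < k" "j \<in> {..<k}"
    show "linear (\<lambda>v. S q (vs[i := v, j := Gp q u (vs[i := v] ! j)]))"
    proof (cases "i = j")
      case True
      have "linear (\<lambda>v. S q (vs[i := Gp q u v]))"
        using linear_compose[OF Gp_bil(2)[OF q] multilinD[OF ml[OF q] a(1,2)]] by (simp add: o_def)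
      then show ?thesis using True a by simp
    next
      case False
      then have "S q (vs[i := v, j := Gp q u (vs[i := v] ! j)]) = S q (vs[j := Gp q u (vs ! j), i := v])" for v
        by (simp add: list_update_swap)
      then show ?thesis using multilinD[OF ml[OF q], of "vs[j := Gp q u (vs ! j)]" i] a by simp
    qed
  qed
  fix K assume K: "length K = k" "set K \<subseteq> {1..DIM('a)}"
  have lin: "linear (\<lambda>v. S q ((map (e q) K)[s := v]))" if "s < k" for s
    by (rule multilinD[OF ml[OF q] _ that]) (simp add: K)
  have upd: "length (K[s := i]) = k" "set (K[s := i]) \<subseteq> {1..DIM('a)}" if "i \<in> {1..DIM('a)}" for s i
    using K that set_update_subset_insert[of K s i] by auto
  have "cderiv \<kappa> (\<lambda>q. S q (map (e q) K)) q = cderiv \<kappa> (\<lambda>_. C K) q"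
    by (rule cderiv_cong(1)[OF V(1) q Vk[OF q]]) (use C K in auto)
  then have n: "nab \<kappa> \<Gamma> S q u (map (e q) K) = - act DIM('a) (om q u) (\<lambda>K. S q (map (e q) K)) K"
    using nab_frame(2)[OF q ml d K, of u] by (simp add: cderiv_const)
  have nabK: "nab \<kappa> \<Gamma> S q u (map (e q) K) = cderiv \<kappa> (\<lambda>x. S x (map (e q) K)) q u -
      (\<Sum>s<k. S q ((map (e q) K)[s := \<Gamma> q u (map (e q) K ! s)]))" by (simp add: nab_def K)
  have t: "S q ((map (e q) K)[s := Gp q u (e q (K ! s))]) = S q ((map (e q) K)[s := \<Gamma> q u (e q (K ! s))]) +
      (\<Sum>i\<in>{1..DIM('a)}. H \<kappa> q [u, e q (K ! s), e q i] / 2 * C (K[s := i]))" if s: "s < k" for s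
  proof -
    have "S q ((map (e q) K)[s := T q u (e q (K ! s))]) = (\<Sum>i\<in>{1..DIM('a)}. H \<kappa> q [u, e q (K ! s), e q i] * C (K[s := i]))"
      using C[OF q upd] by (simp add: T_def linear_sum[OF lin[OF s]] linear_cmul[OF lin[OF s]] map_update[symmetric])
    then show ?thesis
      unfolding Gp_def linear_add[OF lin[OF s]] linear_cmul[OF lin[OF s]]
      by (simp add: sum_distrib_left mult.assoc[symmetric])
  qed
  have F1: "(\<Sum>s<k. S q ((map (e q) K)[s := Gp q u (map (e q) K ! s)])) =
      (\<Sum>s<k. S q ((map (e q) K)[s := \<Gamma> q u (map (e q) K ! s)])) +
      (\<Sum>s<k. \<Sum>i\<in>{1..DIM('a)}. H \<kappa> q [u, e q (K ! s), e q i] / 2 * C (K[s := i]))"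
    unfolding sum.distrib[symmetric] by (intro sum.cong refl) (use t K in auto)
  have F2: "act DIM('a) (om q u) (\<lambda>K. S q (map (e q) K)) K +
      (\<Sum>s<k. \<Sum>i\<in>{1..DIM('a)}. H \<kappa> q [u, e q (K ! s), e q i] / 2 * C (K[s := i])) = act DIM('a) (omp q u) C K"
    unfolding act_def omp_def K(1) sum.distrib[symmetric]
    by (intro sum.cong refl) (use C[OF q upd] in \<open>auto simp: distrib_right\<close>)
  \<comment> \<open>The long sums become variables here, so that their linear combination can be
    formed without unfolding them.\<close>
  have aux: "A = P + Q \<Longrightarrow> a + Q = z \<Longrightarrow> b = - a \<Longrightarrow> z = 0 \<Longrightarrow> b = c - P \<Longrightarrow> c = A"
    for A P Q a z b c :: real by simp
  show "cderiv \<kappa> (\<lambda>x. S x (map (e q) K)) q u = (\<Sum>i<k. S q ((map (e q) K)[i := Gp q u (map (e q) K ! i)]))"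
    by (rule aux[OF F1 F2 n par[OF K] nabK])
qed

end

context riem_frame
begin

section \<open>Curvature of the connection with torsion\<close>

lemma cderiv_T:
  assumes q: "q \<in> V"
  shows "gq q (cderiv \<kappa> (\<lambda>q. T q v w) q u) x = cderiv \<kappa> (\<lambda>q. H \<kappa> q [v, w, x]) q u
    - gq q (\<Gamma> q u (T q v w)) x - gq q (T q v w) (\<Gamma> q u x)"
proof -
  have l: "linear (\<lambda>y. gq y' y x)" if "y' \<in> fst \<kappa> \<inter> V" for y' using g_lin(1) that by simp
  have "cderiv \<kappa> (\<lambda>q. gq q (T q v w) x) q u =
      cderiv \<kappa> (\<lambda>y. gq y (T q v w) x) q u + gq q (cderiv \<kappa> (\<lambda>q. T q v w) q u) x"
    by (rule cderiv_apply(2)[where F = "\<lambda>q y. gq q y x" and Y = "\<lambda>q. T q v w", OF V(1) q Vk[OF q] l cdiff_g[OF q] cdiff_T[OF q]])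
  moreover have "cderiv \<kappa> (\<lambda>q. gq q (T q v w) x) q = cderiv \<kappa> (\<lambda>q. H \<kappa> q [v, w, x]) q"
    by (rule cderiv_cong(1)[OF V(1) q Vk[OF q]]) (use g_T in auto)
  ultimately show ?thesis using dg[OF q, of "T q v w" x u] by simp
qed

lemma g_TT:
  assumes q: "q \<in> V"
  shows "gq q (T q a b) (T q c d) = (\<Sum>s\<in>{1..DIM('a)}. H \<kappa> q [a, b, e q s] * H \<kappa> q [c, d, e q s])"
proof -
  have "gq q (T q a b) (T q c d) = (\<Sum>s\<in>{1..DIM('a)}. H \<kappa> q [c, d, e q s] * gq q (T q a b) (e q s))"
    by (subst (2) T_def) (simp only: linear_sum[OF g_lin(2)[OF q]] linear_cmul[OF g_lin(2)[OF q]] real_scaleR_def)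
  then show ?thesis by (simp add: g_T[OF q] mult.commute)
qed

text \<open>The terms that mix \<open>\<Gamma>\<close> and \<open>T\<close> complete the coordinate
  derivatives of the torsion to covariant derivatives of H. The Christoffel term in the slot of the
  other direction is symmetric in u and v and drops out; T composed with T gives the quadratic terms
  with factor 1/4.\<close>

lemma curvature_plus:
  assumes q: "q \<in> V"
  shows "gq q (curvature \<kappa> Gp q u v w) x = gq q (curvature \<kappa> \<Gamma> q u v w) x
    + 1/2 * (nab \<kappa> \<Gamma> (H \<kappa>) q u [v, w, x] - nab \<kappa> \<Gamma> (H \<kappa>) q v [u, w, x])
    + 1/4 * ((\<Sum>s\<in>{1..DIM('a)}. H \<kappa> q [v, x, e q s] * H \<kappa> q [u, w, e q s])
           - (\<Sum>s\<in>{1..DIM('a)}. H \<kappa> q [u, x, e q s] * H \<kappa> q [v, w, e q s]))"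
proof -
  have d: "cderiv \<kappa> (\<lambda>q. Gp q v w) q u = cderiv \<kappa> (\<lambda>q. \<Gamma> q v w) q u + (1/2) *\<^sub>R cderiv \<kappa> (\<lambda>q. T q v w) q u" for u v
    unfolding Gp_def
    by (simp only: cderiv_add(2)[OF cdiff_\<Gamma>[OF q] cderiv_scaleR_right(1)[OF cdiff_T[OF q]]]
        cderiv_scaleR_right(2)[OF cdiff_T[OF q]])
  have G: "Gp q u (Gp q v w) = \<Gamma> q u (\<Gamma> q v w) + (1/2) *\<^sub>R \<Gamma> q u (T q v w) + (1/2) *\<^sub>R T q u (\<Gamma> q v w)
      + (1/4) *\<^sub>R T q u (T q v w)" for u v
    by (simp add: Gp_def linear_add[OF \<Gamma>_lin(2)[OF q]] linear_cmul[OF \<Gamma>_lin(2)[OF q]]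
        linear_add[OF T_bil(2)[OF q]] linear_cmul[OF T_bil(2)[OF q]] scaleR_add_right)
  note gl = linear_add[OF g_lin(1)[OF q]] linear_diff[OF g_lin(1)[OF q]] linear_cmul[OF g_lin(1)[OF q]] real_scaleR_def
  have tt: "gq q (T q u (T q v w)) x = - (\<Sum>s\<in>{1..DIM('a)}. H \<kappa> q [u, x, e q s] * H \<kappa> q [v, w, e q s])" for u v
  proof -
    have "gq q (T q u (T q v w)) x = - H \<kappa> q [u, x, T q v w]"
      unfolding g_T[OF q] by (rule H_alt(2)[OF q])
    also have "\<dots> = - gq q (T q u x) (T q v w)" by (simp add: g_T[OF q])
    finally show ?thesis by (simp only: g_TT[OF q])
  qed
  define c where "c u v = cderiv \<kappa> (\<lambda>q. \<Gamma> q v w) q u" for u v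
  have L: "gq q (curvature \<kappa> Gp q u v w) x =
    (gq q (c u v) x + 1/2 * gq q (cderiv \<kappa> (\<lambda>q. T q v w) q u) x)
    - (gq q (c v u) x + 1/2 * gq q (cderiv \<kappa> (\<lambda>q. T q u w) q v) x)
    + (gq q (\<Gamma> q u (\<Gamma> q v w)) x + 1/2 * gq q (\<Gamma> q u (T q v w)) x + 1/2 * gq q (T q u (\<Gamma> q v w)) x + 1/4 * gq q (T q u (T q v w)) x)
    - (gq q (\<Gamma> q v (\<Gamma> q u w)) x + 1/2 * gq q (\<Gamma> q v (T q u w)) x + 1/2 * gq q (T q v (\<Gamma> q u w)) x + 1/4 * gq q (T q v (T q u w)) x)"
    unfolding curvature_def d G gl c_def ..
  have Rr: "gq q (curvature \<kappa> \<Gamma> q u v w) x = gq q (c u v) x - gq q (c v u) x + gq q (\<Gamma> q u (\<Gamma> q v w)) x - gq q (\<Gamma> q v (\<Gamma> q u w)) x"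
    unfolding curvature_def gl c_def ..
  have n: "nab \<kappa> \<Gamma> (H \<kappa>) q u [v, w, x] = cderiv \<kappa> (\<lambda>q. H \<kappa> q [v,w,x]) q u - H \<kappa> q [\<Gamma> q u v, w, x]
     - H \<kappa> q [v, \<Gamma> q u w, x] - H \<kappa> q [v, w, \<Gamma> q u x]" for u v
    by (simp add: nab_def numeral_eq_Suc)
  show ?thesis
    unfolding L Rr n cderiv_T[OF q] tt
    unfolding g_T[OF q] \<Gamma>_sym[OF q, of v u] by argo
qed

lemma lc_curvature:
  assumes q: "q \<in> V"
  shows "gq q (curvature \<kappa> \<Gamma> q u v r) s = - gq q (curvature \<kappa> \<Gamma> q u v s) r"
    "gq q (curvature \<kappa> \<Gamma> q v u r) s = - gq q (curvature \<kappa> \<Gamma> q u v r) s"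
    "gq q (curvature \<kappa> \<Gamma> q u v w) r + gq q (curvature \<kappa> \<Gamma> q v w u) r + gq q (curvature \<kappa> \<Gamma> q w u v) r = 0"
proof -
  have q': "q \<in> fst \<kappa> \<inter> fst \<kappa>" using Vk[OF q] by simp
  show "gq q (curvature \<kappa> \<Gamma> q u v r) s = - gq q (curvature \<kappa> \<Gamma> q u v s) r"
    using curvature_skew[OF atlas_open metric lc_metric chart q', of u v r s] g_sym[OF q] by simp
  have "curvature \<kappa> \<Gamma> q v u r = - curvature \<kappa> \<Gamma> q u v r" by (simp add: curvature_def)
  then show "gq q (curvature \<kappa> \<Gamma> q v u r) s = - gq q (curvature \<kappa> \<Gamma> q u v r) s"
    using linear_neg[OF g_lin(1)[OF q]] by simp
  have c: "cderiv \<kappa> (\<lambda>q. \<Gamma> q v w) q = cderiv \<kappa> (\<lambda>q. \<Gamma> q w v) q" for v w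
    by (rule cderiv_cong(1)[OF V(1) q Vk[OF q]]) (use \<Gamma>_sym in auto)
  have "curvature \<kappa> \<Gamma> q u v w + curvature \<kappa> \<Gamma> q v w u + curvature \<kappa> \<Gamma> q w u v = 0"
    unfolding curvature_def c[of v u] c[of w u] c[of w v] \<Gamma>_sym[OF q, of v u] \<Gamma>_sym[OF q, of w u] \<Gamma>_sym[OF q, of w v]
    by (simp add: algebra_simps)
  then have "gq q (curvature \<kappa> \<Gamma> q u v w + curvature \<kappa> \<Gamma> q v w u + curvature \<kappa> \<Gamma> q w u v) r = 0"
    using linear_0[OF g_lin(1)[OF q]] by simp
  then show "gq q (curvature \<kappa> \<Gamma> q u v w) r + gq q (curvature \<kappa> \<Gamma> q v w u) r + gq q (curvature \<kappa> \<Gamma> q w u v) r = 0"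
    by (simp only: linear_add[OF g_lin(1)[OF q]])
qed

lemma ext_d_H:
  assumes q: "q \<in> V"
  shows "ext_d \<kappa> (H \<kappa>) q [a,b,c,d] = nab \<kappa> \<Gamma> (H \<kappa>) q a [b,c,d] - nab \<kappa> \<Gamma> (H \<kappa>) q b [a,c,d]
    + nab \<kappa> \<Gamma> (H \<kappa>) q c [a,b,d] - nab \<kappa> \<Gamma> (H \<kappa>) q d [a,b,c]"
  by (rule ext_d_nab4[where G = \<Gamma> and S = "H \<kappa>" and p = q, OF \<Gamma>_sym[OF q] Hf(4)[OF q]])

lemma nab_H_alt:
  assumes q: "q \<in> V"
  shows "nab \<kappa> \<Gamma> (H \<kappa>) q u [b,a,c] = - nab \<kappa> \<Gamma> (H \<kappa>) q u [a,b,c]"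
    "nab \<kappa> \<Gamma> (H \<kappa>) q u [a,c,b] = - nab \<kappa> \<Gamma> (H \<kappa>) q u [a,b,c]"
proof -
  have "cderiv \<kappa> (\<lambda>q. H \<kappa> q [b,a,c]) q u = - cderiv \<kappa> (\<lambda>q. H \<kappa> q [a,b,c]) q u"
    "cderiv \<kappa> (\<lambda>q. H \<kappa> q [a,c,b]) q u = - cderiv \<kappa> (\<lambda>q. H \<kappa> q [a,b,c]) q u"
  proof -
    have d: "cdiff \<kappa> (\<lambda>q. H \<kappa> q [a,b,c]) q" by (rule Hf(5)[OF q]) simp
    have "cderiv \<kappa> (\<lambda>q. H \<kappa> q [b,a,c]) q = cderiv \<kappa> (\<lambda>q. - H \<kappa> q [a,b,c]) q"
      by (rule cderiv_cong(1)[OF V(1) q Vk[OF q]]) (rule H_alt(1), simp)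
    then show "cderiv \<kappa> (\<lambda>q. H \<kappa> q [b,a,c]) q u = - cderiv \<kappa> (\<lambda>q. H \<kappa> q [a,b,c]) q u"
      by (simp only: cderiv_minus(2)[OF d])
    have "cderiv \<kappa> (\<lambda>q. H \<kappa> q [a,c,b]) q = cderiv \<kappa> (\<lambda>q. - H \<kappa> q [a,b,c]) q"
      by (rule cderiv_cong(1)[OF V(1) q Vk[OF q]]) (rule H_alt(2), simp)
    then show "cderiv \<kappa> (\<lambda>q. H \<kappa> q [a,c,b]) q u = - cderiv \<kappa> (\<lambda>q. H \<kappa> q [a,b,c]) q u"
      by (simp only: cderiv_minus(2)[OF d])
  qed
  then show "nab \<kappa> \<Gamma> (H \<kappa>) q u [b,a,c] = - nab \<kappa> \<Gamma> (H \<kappa>) q u [a,b,c]"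
    "nab \<kappa> \<Gamma> (H \<kappa>) q u [a,c,b] = - nab \<kappa> \<Gamma> (H \<kappa>) q u [a,b,c]"
    using H_alt(1)[OF q, of "\<Gamma> q u b" a c] H_alt(1)[OF q, of b "\<Gamma> q u a" c] H_alt(1)[OF q, of b a "\<Gamma> q u c"]
      H_alt(2)[OF q, of "\<Gamma> q u a" c b] H_alt(2)[OF q, of a "\<Gamma> q u c" b] H_alt(2)[OF q, of a c "\<Gamma> q u b"]
    by (simp_all add: nab_def numeral_eq_Suc)
qed

text \<open>The frame derivative acts on H through \<open>om\<close>, that is \<open>omp\<close>
  minus half of H in direction e_m. The \<open>omp\<close> part is moved onto \<open>C\<close> by
  \<open>S3_act\<close>. The action of H on itself is a cyclic sum of three quadratic terms with
  equal contractions, and 1/2 times 3 is the factor 3/2.\<close>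

lemma cderiv_contraction:
  assumes q: "q \<in> V" and m: "m \<in> {1..DIM('a)}" and C: "skew 3 C"
  shows "cderiv \<kappa> (\<lambda>q. S3 {1..DIM('a)} (\<lambda>v w x. C [v,w,x]) (\<lambda>v w x. H \<kappa> q [e q v, e q w, e q x])) q (e q m)
    = S3 {1..DIM('a)} (\<lambda>v w x. C [v,w,x]) (\<lambda>v w x. nab \<kappa> \<Gamma> (H \<kappa>) q (e q m) [e q v, e q w, e q x])
     - 3/2 * S3 {1..DIM('a)} (\<lambda>v w x. C [v,w,x]) (\<lambda>v w x. \<Sum>s\<in>{1..DIM('a)}. H \<kappa> q [e q m, e q v, e q s] * H \<kappa> q [e q w, e q x, e q s])
     - S3 {1..DIM('a)} (\<lambda>v w x. H \<kappa> q [e q v, e q w, e q x]) (\<lambda>v w x. act DIM('a) (omp q (e q m)) C [v,w,x])"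
proof -
  let ?I = "{1..DIM('a)}" and ?C = "\<lambda>v w x. C [v,w,x]" and ?u = "e q m"
  let ?Hl = "\<lambda>K. H \<kappa> q (map (e q) K)"
  interpret alt3 ?I ?C by (rule alt3_skew3[OF C])
  have nf: "cdiff \<kappa> (\<lambda>q. H \<kappa> q [e q v, e q w, e q x]) q"
    "cderiv \<kappa> (\<lambda>q. H \<kappa> q [e q v, e q w, e q x]) q ?u = nab \<kappa> \<Gamma> (H \<kappa>) q ?u [e q v, e q w, e q x]
      + act DIM('a) (om q ?u) ?Hl [v,w,x]" if "v \<in> ?I" "w \<in> ?I" "x \<in> ?I" for v w x
    using nab_frame[where k = 3 and S = "H \<kappa>" and K = "[v,w,x]", OF q Hf(3) Hf(5)[OF q]] that by simp_all
  have c: "cdiff \<kappa> (\<lambda>q. H \<kappa> q [e q v, e q w, e q x] * C [v,w,x]) q"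
    "cderiv \<kappa> (\<lambda>q. H \<kappa> q [e q v, e q w, e q x] * C [v,w,x]) q ?u =
      (nab \<kappa> \<Gamma> (H \<kappa>) q ?u [e q v, e q w, e q x] + act DIM('a) (om q ?u) ?Hl [v,w,x]) * C [v,w,x]"
    if "v \<in> ?I" "w \<in> ?I" "x \<in> ?I" for v w x
    using cderiv_cmult[OF nf(1)[OF that], of "C [v,w,x]"] nf(2)[OF that] by (simp_all only: mult.commute)
  have s1: "cdiff \<kappa> (\<lambda>q. \<Sum>x\<in>?I. H \<kappa> q [e q v, e q w, e q x] * C [v,w,x]) q \<and>
    cderiv \<kappa> (\<lambda>q. \<Sum>x\<in>?I. H \<kappa> q [e q v, e q w, e q x] * C [v,w,x]) q ?u =
      (\<Sum>x\<in>?I. cderiv \<kappa> (\<lambda>q. H \<kappa> q [e q v, e q w, e q x] * C [v,w,x]) q ?u)" if "v \<in> ?I" "w \<in> ?I" for v w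
    by (rule cderiv_sum) (rule c(1)[OF that])
  have s2: "cdiff \<kappa> (\<lambda>q. \<Sum>w\<in>?I. \<Sum>x\<in>?I. H \<kappa> q [e q v, e q w, e q x] * C [v,w,x]) q \<and>
    cderiv \<kappa> (\<lambda>q. \<Sum>w\<in>?I. \<Sum>x\<in>?I. H \<kappa> q [e q v, e q w, e q x] * C [v,w,x]) q ?u =
      (\<Sum>w\<in>?I. cderiv \<kappa> (\<lambda>q. \<Sum>x\<in>?I. H \<kappa> q [e q v, e q w, e q x] * C [v,w,x]) q ?u)" if "v \<in> ?I" for v
    by (rule cderiv_sum) (rule conjunct1[OF s1[OF that]])
  have s3: "cderiv \<kappa> (\<lambda>q. \<Sum>v\<in>?I. \<Sum>w\<in>?I. \<Sum>x\<in>?I. H \<kappa> q [e q v, e q w, e q x] * C [v,w,x]) q ?u =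
      (\<Sum>v\<in>?I. cderiv \<kappa> (\<lambda>q. \<Sum>w\<in>?I. \<Sum>x\<in>?I. H \<kappa> q [e q v, e q w, e q x] * C [v,w,x]) q ?u)"
    by (rule conjunct2[OF cderiv_sum]) (rule conjunct1[OF s2])
  have L: "cderiv \<kappa> (\<lambda>q. S3 ?I ?C (\<lambda>v w x. H \<kappa> q [e q v, e q w, e q x])) q ?u =
    S3 ?I ?C (\<lambda>v w x. nab \<kappa> \<Gamma> (H \<kappa>) q ?u [e q v, e q w, e q x]) + S3 ?I ?C (\<lambda>v w x. act DIM('a) (om q ?u) ?Hl [v,w,x])"
    unfolding S3_add[symmetric] unfolding S3_def s3
  proof (rule sum.cong[OF refl])
    fix v assume v: "v \<in> ?I"
    have "(\<Sum>w\<in>?I. cderiv \<kappa> (\<lambda>q. \<Sum>x\<in>?I. H \<kappa> q [e q v, e q w, e q x] * C [v,w,x]) q ?u) =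
      (\<Sum>w\<in>?I. \<Sum>x\<in>?I. (nab \<kappa> \<Gamma> (H \<kappa>) q ?u [e q v, e q w, e q x] + act DIM('a) (om q ?u) ?Hl [v,w,x]) * C [v,w,x])"
    proof (rule sum.cong[OF refl])
      fix w assume w: "w \<in> ?I"
      show "cderiv \<kappa> (\<lambda>q. \<Sum>x\<in>?I. H \<kappa> q [e q v, e q w, e q x] * C [v,w,x]) q ?u =
        (\<Sum>x\<in>?I. (nab \<kappa> \<Gamma> (H \<kappa>) q ?u [e q v, e q w, e q x] + act DIM('a) (om q ?u) ?Hl [v,w,x]) * C [v,w,x])"
        unfolding conjunct2[OF s1[OF v w]] by (rule sum.cong[OF refl]) (rule c(2)[OF v w])
    qed
    then show "cderiv \<kappa> (\<lambda>q. \<Sum>w\<in>?I. \<Sum>x\<in>?I. H \<kappa> q [e q v, e q w, e q x] * C [v,w,x]) q ?u =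
      (\<Sum>w\<in>?I. \<Sum>x\<in>?I. (nab \<kappa> \<Gamma> (H \<kappa>) q ?u [e q v, e q w, e q x] + act DIM('a) (om q ?u) ?Hl [v,w,x]) * C [v,w,x])"
      by (simp only: conjunct2[OF s2[OF v]])
  qed
  let ?B = "\<lambda>i j. H \<kappa> q [?u, e q i, e q j]"
  have om: "act DIM('a) (om q ?u) ?Hl [v,w,x] = act DIM('a) (omp q ?u) ?Hl [v,w,x] - 1/2 * act DIM('a) ?B ?Hl [v,w,x]" for v w x
    by (simp add: act3 omp_def sum.distrib sum_distrib_left algebra_simps add_divide_distrib)
  let ?P = "\<lambda>v w x. \<Sum>s\<in>?I. H \<kappa> q [?u, e q v, e q s] * H \<kappa> q [e q w, e q x, e q s]"
  have rot: "H \<kappa> q [a,b,c] = H \<kappa> q [b,c,a]" for a b c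
    using H_alt(1)[OF q, of a b c] H_alt(2)[OF q, of b c a] by simp
  have B: "act DIM('a) ?B ?Hl [v,w,x] = ?P v w x + ?P w x v + ?P x v w" for v w x
    unfolding act3 by (intro arg_cong2[where f = "(+)"] sum.cong refl)
      (simp_all add: rot[of "e q _" "e q w" "e q x"] rot[of "e q v" "e q w" "e q _"] flip: rot[of "e q x" "e q v"])
  have "S3 ?I ?C (\<lambda>v w x. act DIM('a) ?B ?Hl [v,w,x]) = 3 * S3 ?I ?C ?P"
    unfolding B S3_add using cyc[of ?P] by simp
  moreover have "S3 ?I ?C (\<lambda>v w x. act DIM('a) (omp q ?u) ?Hl [v,w,x]) =
      - S3 ?I (\<lambda>v w x. H \<kappa> q [e q v, e q w, e q x]) (\<lambda>v w x. act DIM('a) (omp q ?u) C [v,w,x])"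
  proof -
    have "omp q ?u j i = - omp q ?u i j" if "i \<in> ?I" "j \<in> ?I" for i j
      using om_antisym[OF q that, of ?u] H_alt(2)[OF q, of ?u "e q j" "e q i"] by (simp add: omp_def)
    from S3_act[OF this, where C = C and H = ?Hl] show ?thesis by simp
  qed
  ultimately show ?thesis unfolding L om S3_diff S3_cmult by simp
qed

end

subsection \<open>The Hodge star\<close>

definition idx :: "nat \<Rightarrow> nat \<Rightarrow> nat list set" where "idx n k = {I. length I = k \<and> set I \<subseteq> {1..n}}"

lemma finite_idx: "finite (idx n k)"
  using finite_lists_length_eq[of "{1..n}" k] by (simp add: idx_def conj_commute)

lemma sum_idx_0: "(\<Sum>I\<in>idx n 0. f I) = f []"
proof -
  have "idx n 0 = {[]}" by (auto simp: idx_def)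
  then show ?thesis by simp
qed

lemma sum_idx_append: "(\<Sum>I\<in>idx n (k + l). f I) = (\<Sum>A\<in>idx n k. \<Sum>B\<in>idx n l. f (A @ B))"
proof -
  have "(\<Sum>A\<in>idx n k. \<Sum>B\<in>idx n l. f (A @ B)) = (\<Sum>(A,B)\<in>idx n k \<times> idx n l. f (A @ B))"
    by (rule sum.cartesian_product)
  also have "\<dots> = (\<Sum>I\<in>idx n (k + l). f I)"
    by (rule sum.reindex_bij_witness[where i = "\<lambda>I. (take k I, drop k I)" and j = "\<lambda>(A,B). A @ B"])
      (auto simp: idx_def dest: in_set_takeD in_set_dropD)
  finally show ?thesis ..
qed

lemma sum_idx_Suc: "(\<Sum>I\<in>idx n (Suc k). f I) = (\<Sum>x=1..n. \<Sum>I\<in>idx n k. f (x # I))"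
proof -
  have "(\<Sum>I\<in>idx n 1. g I) = (\<Sum>x=1..n. g [x])" for g :: "nat list \<Rightarrow> 'a"
    by (rule sum.reindex_bij_witness[where i = "\<lambda>x. [x]" and j = hd])
      (auto simp: idx_def length_Suc_conv)
  then show ?thesis using sum_idx_append[of f n 1 k] by simp
qed

lemma skew_move: "skew k \<alpha> \<Longrightarrow> Suc (length xs + length B + length zs) = k \<Longrightarrow>
   \<alpha> (xs @ a # B @ zs) = (-1) ^ length B * \<alpha> (xs @ B @ a # zs)"
proof (induction B arbitrary: xs)
  case (Cons b B)
  have l: "Suc (length (xs @ [b]) + length B + length zs) = k" using Cons.prems(2) by simp
  have "\<alpha> (xs @ a # b # B @ zs) = - \<alpha> (xs @ b # a # B @ zs)"
    by (rule skew_swap[OF Cons.prems(1)]) (use Cons.prems(2) in simp)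
  also have "\<alpha> (xs @ b # a # B @ zs) = (-1) ^ length B * \<alpha> (xs @ b # B @ a # zs)"
    using Cons.IH[OF Cons.prems(1) l] by simp
  finally show ?case by simp
qed simp

lemma skew_rotate: "skew k \<alpha> \<Longrightarrow> length xs + length A + length B + length zs = k \<Longrightarrow>
   \<alpha> (xs @ A @ B @ zs) = (-1) ^ (length A * length B) * \<alpha> (xs @ B @ A @ zs)"
proof (induction A arbitrary: xs)
  case (Cons a A)
  have l: "length (xs @ [a]) + length A + length B + length zs = k" using Cons.prems(2) by simp
  have "\<alpha> (xs @ a # A @ B @ zs) = (-1) ^ (length A * length B) * \<alpha> (xs @ a # B @ A @ zs)"
    using Cons.IH[OF Cons.prems(1) l] by simp
  also have "\<alpha> (xs @ a # B @ A @ zs) = (-1) ^ length B * \<alpha> (xs @ B @ a # A @ zs)"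
    by (rule skew_move[OF Cons.prems(1)]) (use Cons.prems(2) in simp)
  finally show ?case by (simp add: power_add)
qed simp

lemma permute_list_append:
  assumes "\<sigma> permutes {..<length I}"
  shows "permute_list \<sigma> (I @ K) = permute_list \<sigma> I @ K"
proof (rule nth_equalityI)
  fix i assume i: "i < length (permute_list \<sigma> (I @ K))"
  have p: "\<sigma> permutes {..<length (I @ K)}" by (rule permutes_subset[OF assms]) auto
  show "permute_list \<sigma> (I @ K) ! i = (permute_list \<sigma> I @ K) ! i"
    using i p assms permutes_in_image[OF assms, of i] permutes_not_in[OF assms, of i]
    by (auto simp: permute_list_nth nth_append)
qed simp

lemma eps_permute:
  assumes "length (I @ K) = n" "\<sigma> permutes {..<length I}"
  shows "eps n (permute_list \<sigma> I @ K) = of_int (sign \<sigma>) * eps n (I @ K)"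
proof -
  have "\<sigma> permutes {..<n}" using assms by (intro permutes_subset[OF assms(2)]) auto
  from skewD[OF eps_skew assms(1) this] show ?thesis by (simp only: permute_list_append[OF assms(2)])
qed

lemma sign_square: "of_int (sign \<sigma>) * of_int (sign \<sigma>) = (1::real)"
  by (metis of_int_1 of_int_mult sign_idempotent)

locale frame =
  fixes b :: "'a::euclidean_space \<Rightarrow> 'a \<Rightarrow> real" and e :: "nat \<Rightarrow> 'a"
  assumes ortho: "orthonormal b e"
begin

lemma cof_frame:
  assumes "length K = length I" "set I \<subseteq> {1..DIM('a)}" "set K \<subseteq> {1..DIM('a)}"
  shows "cof b e I (map e K) = cof kd id I K"
  unfolding cof_def
proof (intro sum.cong refl arg_cong2[where f = "(*)"] prod.cong)
  fix \<sigma> i assume s: "\<sigma> \<in> {\<sigma>. \<sigma> permutes {..<length I}}" and i: "i \<in> {..<length I}"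
  have si: "\<sigma> i < length K" using permutes_in_image[of \<sigma> "{..<length I}" i] s i assms by auto
  have "I ! i \<in> {1..DIM('a)}" "K ! \<sigma> i \<in> {1..DIM('a)}" using i si assms(2,3) nth_mem[of i I] nth_mem[of "\<sigma> i" K] by blast+
  then show "b (e (I ! i)) (map e K ! \<sigma> i) = kd (id (I ! i)) (K ! \<sigma> i)"
    using ortho si unfolding orthonormal_def kd_def by simp
qed

lemma hodge_frame:
  assumes "k + length K = DIM('a)" "set K \<subseteq> {1..DIM('a)}"
  shows "hodge b e k \<alpha> (map e K) = 1 / fact k * (\<Sum>I\<in>idx DIM('a) k. \<alpha> (map e I) * eps DIM('a) (I @ K))"
proof -
  have "cof b e [1..<Suc DIM('a)] (map e I @ map e K) = eps DIM('a) (I @ K)" if "I \<in> idx DIM('a) k" for I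
    unfolding eps_def map_append[symmetric]
    by (rule cof_frame) (use that assms in \<open>auto simp: idx_def\<close>)
  then show ?thesis unfolding hodge_def idx_def by simp
qed

text \<open>The Levi-Civita symbol leaves only the k! orderings of J; they contribute equally and
  cancel the normalisation.\<close>

lemma hodge_complement:
  assumes sk: "skew k \<beta>" and \<beta>: "\<And>I. length I = k \<Longrightarrow> set I \<subseteq> {1..DIM('a)} \<Longrightarrow> \<alpha> (map e I) = \<beta> I"
    and J: "length J = k" "set (J @ K) = {1..DIM('a)}" and len: "k + length K = DIM('a)"
  shows "hodge b e k \<alpha> (map e K) = eps DIM('a) (J @ K) * \<beta> J"
proof -
  let ?n = "DIM('a)"
  have dJK: "distinct (J @ K)" by (rule card_distinct) (use J len in simp)
  have "(\<Sum>I\<in>idx ?n k. \<alpha> (map e I) * eps ?n (I @ K)) = (\<Sum>I\<in>idx ?n k. \<beta> I * eps ?n (I @ K))"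
    by (intro sum.cong refl) (simp add: idx_def \<beta>)
  also have "\<dots> = (\<Sum>I\<in>permutations_of_set (set J). \<beta> I * eps ?n (I @ K))"
  proof (rule sum.mono_neutral_right[OF finite_idx])
    show "permutations_of_set (set J) \<subseteq> idx ?n k"
    proof
      fix I assume "I \<in> permutations_of_set (set J)"
      then have I: "set I = set J" "distinct I" by (simp_all add: permutations_of_set_def)
      then have "length I = length J" using dJK by (metis distinct_append distinct_card)
      then show "I \<in> idx ?n k" using I J by (auto simp: idx_def)
    qed
    show "\<forall>I\<in>idx ?n k - permutations_of_set (set J). \<beta> I * eps ?n (I @ K) = 0"
    proof
      fix I assume I: "I \<in> idx ?n k - permutations_of_set (set J)"
      have "\<not> set [1..<Suc ?n] \<subseteq> set (I @ K)"
      proof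
        assume "set [1..<Suc ?n] \<subseteq> set (I @ K)"
        moreover have "set [1..<Suc ?n] = {1..?n}" by auto
        moreover have "set (I @ K) \<subseteq> {1..?n}" using I J by (auto simp: idx_def)
        ultimately have s: "set (I @ K) = {1..?n}" by blast
        have "distinct (I @ K)" by (rule card_distinct) (use s I len in \<open>simp add: idx_def\<close>)
        with s J dJK have "set I = set J" "distinct I" by auto
        with I show False by (simp add: permutations_of_set_def)
      qed
      then have "eps ?n (I @ K) = 0" unfolding eps_def
        by (intro cof_kd_zero) (use I len in \<open>auto simp: idx_def\<close>)
      then show "\<beta> I * eps ?n (I @ K) = 0" by simp
    qed
  qed
  also have "\<dots> = (\<Sum>I\<in>permutations_of_set (set J). \<beta> J * eps ?n (J @ K))"
  proof (rule sum.cong[OF refl])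
    fix I assume "I \<in> permutations_of_set (set J)"
    then have "mset I = mset J" using dJK by (simp add: permutations_of_set_def set_eq_iff_mset_eq_distinct[symmetric])
    then obtain \<sigma> where \<sigma>: "\<sigma> permutes {..<length J}" "permute_list \<sigma> J = I"
      using mset_eq_permutation by metis
    have "\<beta> I = of_int (sign \<sigma>) * \<beta> J"
      using skewD[OF sk J(1)] \<sigma> J by auto
    moreover have "eps ?n (I @ K) = of_int (sign \<sigma>) * eps ?n (J @ K)"
      using eps_permute[OF _ \<sigma>(1), of K ?n] \<sigma> J len by simp
    ultimately have "\<beta> I * eps ?n (I @ K) =
        (of_int (sign \<sigma>) * of_int (sign \<sigma>)) * (\<beta> J * eps ?n (J @ K))" by (simp add: mult_ac)
    then show "\<beta> I * eps ?n (I @ K) = \<beta> J * eps ?n (J @ K)" by (simp only: sign_square mult_1_left)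
  qed
  also have "\<dots> = fact k * (\<beta> J * eps ?n (J @ K))"
    using J dJK by (simp add: distinct_card)
  finally have "(\<Sum>I\<in>idx ?n k. \<alpha> (map e I) * eps ?n (I @ K)) = fact k * (\<beta> J * eps ?n (J @ K))" .
  moreover have "set K \<subseteq> {1..?n}" unfolding J(2)[symmetric] by simp
  ultimately show ?thesis using hodge_frame[OF len, of \<alpha>] by (simp add: mult.commute)
qed

text \<open>Reindexing the index lists makes all (k + l)! permutations of the wedge product
  contribute equally. Moving the block of \<open>\<beta>\<close> in front of that of
  \<open>\<alpha>\<close> gives (-1)^(kl), and the sum over the former is the star of
  \<open>\<beta>\<close>.\<close>

lemma hodge_wedge:
  assumes len: "k + l + length K = DIM('a)" and K: "set K \<subseteq> {1..DIM('a)}"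
  shows "hodge b e (k + l) (wedge k l \<alpha> \<beta>) (map e K) =
    (-1) ^ (k * l) / fact k * (\<Sum>A\<in>idx DIM('a) k. \<alpha> (map e A) * hodge b e l \<beta> (map e (A @ K)))"
proof -
  let ?n = "DIM('a)" and ?P = "{\<sigma>. \<sigma> permutes {..<k + l}}"
  define G where "G I = \<alpha> (map e (take k I)) * \<beta> (map e (drop k I)) * eps ?n (I @ K)" for I
  define T where "T \<sigma> I = of_int (sign \<sigma>) * \<alpha> (map (\<lambda>i. map e I ! \<sigma> i) [0..<k]) *
        \<beta> (map (\<lambda>i. map e I ! \<sigma> i) [k..<k + l]) * eps ?n (I @ K)" for \<sigma> I
  have t: "(\<Sum>I\<in>idx ?n (k + l). T \<sigma> I) = (\<Sum>I\<in>idx ?n (k + l). G I)" if \<sigma>: "\<sigma> permutes {..<k + l}" for \<sigma>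
  proof -
    have inv: "inv \<sigma> permutes {..<k + l}" by (rule permutes_inv[OF \<sigma>])
    have "(\<Sum>I\<in>idx ?n (k + l). T \<sigma> I) = (\<Sum>I\<in>idx ?n (k + l). G (permute_list \<sigma> I))"
    proof (rule sum.cong[OF refl])
      fix I assume "I \<in> idx ?n (k + l)"
      then have lI: "length I = k + l" by (simp add: idx_def)
      have m: "map e (permute_list \<sigma> I) ! i = map e I ! \<sigma> i" if "i < k + l" for i
        using permutes_in_image[OF \<sigma>, of i] lI that \<sigma> by (simp add: permute_list_nth)
      have 1: "map (\<lambda>i. map e I ! \<sigma> i) [0..<k] = map e (take k (permute_list \<sigma> I))"
        by (rule nth_equalityI) (use lI m[symmetric] in simp_all)
      have 2: "map (\<lambda>i. map e I ! \<sigma> i) [k..<k + l] = map e (drop k (permute_list \<sigma> I))"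
        by (rule nth_equalityI) (use lI m[symmetric] in simp_all)
      have 3: "eps ?n (permute_list \<sigma> I @ K) = of_int (sign \<sigma>) * eps ?n (I @ K)"
        by (rule eps_permute) (use lI len \<sigma> in simp_all)
      show "T \<sigma> I = G (permute_list \<sigma> I)"
        unfolding T_def G_def 1 2 3 by (simp only: mult_ac)
    qed
    also have "\<dots> = (\<Sum>I\<in>idx ?n (k + l). G I)"
    proof (rule sum.reindex_bij_witness[where j = "permute_list \<sigma>" and i = "permute_list (inv \<sigma>)"])
      fix I assume I: "I \<in> idx ?n (k + l)"
      then have lI: "length I = k + l" by (simp add: idx_def)
      have \<sigma>I: "\<sigma> permutes {..<length I}" "inv \<sigma> permutes {..<length I}" using \<sigma> inv lI by simp_all
      show "permute_list (inv \<sigma>) (permute_list \<sigma> I) = I"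
        using permute_list_compose[OF \<sigma>I(2), of \<sigma>] permutes_inv_o(1)[OF \<sigma>] by simp
      show "permute_list \<sigma> (permute_list (inv \<sigma>) I) = I"
        using permute_list_compose[OF \<sigma>I(1), of "inv \<sigma>"] permutes_inv_o(2)[OF \<sigma>] by simp
      show "permute_list \<sigma> I \<in> idx ?n (k + l)" "permute_list (inv \<sigma>) I \<in> idx ?n (k + l)"
        using I unfolding idx_def mem_Collect_eq set_permute_list[OF \<sigma>I(1)] set_permute_list[OF \<sigma>I(2)] length_permute_list
        by blast+
    qed (rule refl)
    finally show ?thesis .
  qed
  have w: "wedge k l \<alpha> \<beta> (map e I) * eps ?n (I @ K) = 1 / (fact k * fact l) * (\<Sum>\<sigma>\<in>?P. T \<sigma> I)" for I
    unfolding wedge_def T_def by (simp only: sum_distrib_right mult.assoc)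
  have "(\<Sum>\<sigma>\<in>?P. \<Sum>I\<in>idx ?n (k + l). T \<sigma> I) = (\<Sum>\<sigma>\<in>?P. \<Sum>I\<in>idx ?n (k + l). G I)"
    by (rule sum.cong[OF refl]) (simp only: mem_Collect_eq t)
  then have P: "(\<Sum>\<sigma>\<in>?P. \<Sum>I\<in>idx ?n (k + l). T \<sigma> I) = fact (k + l) * (\<Sum>I\<in>idx ?n (k + l). G I)"
    by (simp only: sum_constant card_permutations[OF card_lessThan finite_lessThan] of_nat_fact)
  have "(\<Sum>I\<in>idx ?n (k + l). wedge k l \<alpha> \<beta> (map e I) * eps ?n (I @ K)) =
      1 / (fact k * fact l) * (\<Sum>\<sigma>\<in>?P. \<Sum>I\<in>idx ?n (k + l). T \<sigma> I)"
    by (subst sum.swap) (simp only: w sum_distrib_left)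
  then have "hodge b e (k + l) (wedge k l \<alpha> \<beta>) (map e K) = 1 / (fact k * fact l) * (\<Sum>I\<in>idx ?n (k + l). G I)"
    using hodge_frame[OF len K, of "wedge k l \<alpha> \<beta>"] by (simp add: P)
  also have "(\<Sum>I\<in>idx ?n (k + l). G I) =
      (\<Sum>A\<in>idx ?n k. \<Sum>B\<in>idx ?n l. (-1) ^ (k * l) * (\<alpha> (map e A) * (\<beta> (map e B) * eps ?n (B @ A @ K))))"
    unfolding sum_idx_append
  proof (rule sum.cong[OF refl], rule sum.cong[OF refl])
    fix A B assume "A \<in> idx ?n k" "B \<in> idx ?n l"
    then have l: "length A = k" "length B = l" by (simp_all add: idx_def)
    have "eps ?n ([] @ A @ B @ K) = (-1) ^ (length A * length B) * eps ?n ([] @ B @ A @ K)"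
      by (rule skew_rotate[OF eps_skew]) (use l len in simp)
    then have r: "eps ?n (A @ B @ K) = (-1) ^ (k * l) * eps ?n (B @ A @ K)" using l by simp
    have d: "take k (A @ B) = A" "drop k (A @ B) = B" using l by simp_all
    show "G (A @ B) = (-1) ^ (k * l) * (\<alpha> (map e A) * (\<beta> (map e B) * eps ?n (B @ A @ K)))"
      unfolding G_def d append_assoc r by (simp only: mult_ac)
  qed
  also have "\<dots> = (\<Sum>A\<in>idx ?n k. (-1) ^ (k * l) * (\<alpha> (map e A) * (fact l * hodge b e l \<beta> (map e (A @ K)))))"
  proof (rule sum.cong[OF refl])
    fix A assume "A \<in> idx ?n k"
    then have "l + length (A @ K) = ?n" "set (A @ K) \<subseteq> {1..?n}" using len K by (auto simp: idx_def)
    from hodge_frame[OF this, of \<beta>]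
    have "(\<Sum>B\<in>idx ?n l. \<beta> (map e B) * eps ?n (B @ A @ K)) = fact l * hodge b e l \<beta> (map e (A @ K))" by simp
    then show "(\<Sum>B\<in>idx ?n l. (-1) ^ (k * l) * (\<alpha> (map e A) * (\<beta> (map e B) * eps ?n (B @ A @ K)))) =
        (-1) ^ (k * l) * (\<alpha> (map e A) * (fact l * hodge b e l \<beta> (map e (A @ K))))"
      by (simp only: sum_distrib_left[symmetric])
  qed
  also have "\<dots> = fact l * ((-1) ^ (k * l) * (\<Sum>A\<in>idx ?n k. \<alpha> (map e A) * hodge b e l \<beta> (map e (A @ K))))"
    by (simp only: sum_distrib_left mult_ac)
  finally show ?thesis by simp
qed

text \<open>The block of frame vectors is rotated to the end; a permutation of the remaining
  arguments then extends by the identity.\<close>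

lemma hodge_skew:
  assumes kl: "k + l = DIM('a)"
  shows "skew l (hodge b e k \<alpha>)"
  unfolding skew_def
proof (intro allI impI)
  let ?f = "cof b e [1..<Suc DIM('a)]"
  fix vs :: "'a list" and \<sigma> assume len: "length vs = l" and \<sigma>: "\<sigma> permutes {..<l}"
  have c: "?f (map e I @ permute_list \<sigma> vs) = of_int (sign \<sigma>) * ?f (map e I @ vs)" if I: "length I = k" for I
  proof -
    have sk: "skew DIM('a) ?f" by (rule cof_skew') simp
    have r: "?f (map e I @ ws) = (-1) ^ (k * l) * ?f (ws @ map e I)" if "length ws = l" for ws
      using skew_rotate[OF sk, of "[]" "map e I" ws "[]"] that I kl
      by (simp only: append_Nil append_Nil2 length_map list.size add_0_left add_0_right simp_thms)
    have l: "length (vs @ map e I) = DIM('a)" using len I kl by simp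
    have n: "\<sigma> permutes {..<DIM('a)}" by (rule permutes_subset[OF \<sigma>]) (use kl in auto)
    have p: "permute_list \<sigma> (vs @ map e I) = permute_list \<sigma> vs @ map e I"
      by (rule permute_list_append) (use len \<sigma> in simp)
    show ?thesis
      unfolding r[OF len] r[of "permute_list \<sigma> vs", unfolded length_permute_list, OF len]
        skewD[OF sk l n, unfolded p] by (simp only: mult_ac)
  qed
  show "hodge b e k \<alpha> (permute_list \<sigma> vs) = of_int (sign \<sigma>) * hodge b e k \<alpha> vs"
    unfolding hodge_def sum_distrib_left
  proof (rule sum.cong[OF refl])
    fix I assume "I \<in> {I. length I = k \<and> set I \<subseteq> {1..DIM('a)}}"
    then have I: "length I = k" by simp
    show "1 / fact k * (\<alpha> (map e I) * ?f (map e I @ permute_list \<sigma> vs)) =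
        of_int (sign \<sigma>) * (1 / fact k * (\<alpha> (map e I) * ?f (map e I @ vs)))"
      unfolding c[OF I] by (simp only: mult_ac)
  qed
qed

end

lemma linear_cmult: "linear f \<Longrightarrow> linear (\<lambda>v. c * f v :: real)"
  by (rule linear_compose[OF _ linear_times, unfolded o_def])

lemma cof_multilin:
  assumes b: "bilinear b"
  shows "multilin (length I) (cof b e I)"
  unfolding multilin_def cof_def
proof (intro allI impI linear_compose_sum ballI)
  fix vs :: "'a list" and j \<sigma> assume len: "length vs = length I" and j: "j < length I"
    and "\<sigma> \<in> {\<sigma>. \<sigma> permutes {..<length I}}"
  then have \<sigma>: "\<sigma> permutes {..<length I}" by simp
  \<comment> \<open>The position of the only factor in the product that involves the j-th
    argument.\<close>
  define m where "m = inv \<sigma> j"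
  have m: "m \<in> {..<length I}" "\<sigma> m = j"
    using permutes_in_image[OF permutes_inv[OF \<sigma>], of j] permutes_inverses(1)[OF \<sigma>] j by (auto simp: m_def)
  have inj: "\<sigma> i \<noteq> j" if "i \<noteq> m" for i
    using injD[OF permutes_inj[OF \<sigma>], of i m] m(2) that by auto
  have j': "j < length vs" using j len by simp
  have P: "(\<Prod>i<length I. b (e (I ! i)) (vs[j := v] ! \<sigma> i)) =
      b (e (I ! m)) v * (\<Prod>i\<in>{..<length I} - {m}. b (e (I ! i)) (vs ! \<sigma> i))" for v
  proof -
    have "(\<Prod>i\<in>{..<length I} - {m}. b (e (I ! i)) (vs[j := v] ! \<sigma> i)) =
        (\<Prod>i\<in>{..<length I} - {m}. b (e (I ! i)) (vs ! \<sigma> i))"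
    proof (rule prod.cong[OF refl])
      fix i assume "i \<in> {..<length I} - {m}"
      then have "\<sigma> i \<noteq> j" using inj by blast
      then show "b (e (I ! i)) (vs[j := v] ! \<sigma> i) = b (e (I ! i)) (vs ! \<sigma> i)" by simp
    qed
    then show ?thesis
      unfolding prod.remove[OF finite_lessThan m(1), of "\<lambda>i. b (e (I ! i)) (vs[j := v] ! \<sigma> i)"] m(2)
        nth_list_update_eq[OF j'] by (rule arg_cong)
  qed
  have eq: "(\<lambda>v. of_int (sign \<sigma>) * (\<Prod>i<length I. b (e (I ! i)) (vs[j := v] ! \<sigma> i))) =
      (\<lambda>v. of_int (sign \<sigma>) * (\<Prod>i\<in>{..<length I} - {m}. b (e (I ! i)) (vs ! \<sigma> i)) * b (e (I ! m)) v)"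
    unfolding P by (simp only: mult_ac)
  show "linear (\<lambda>v. of_int (sign \<sigma>) * (\<Prod>i<length I. b (e (I ! i)) (vs[j := v] ! \<sigma> i)))"
    unfolding eq by (rule linear_cmult) (use b in \<open>simp add: bilinear_def\<close>)
qed

lemma hodge_multilin:
  fixes b :: "'a::euclidean_space \<Rightarrow> 'a \<Rightarrow> real"
  assumes b: "bilinear b" and kl: "k + l = DIM('a)"
  shows "multilin l (hodge b e k \<alpha>)"
  unfolding multilin_def
proof (intro allI impI)
  fix vs :: "'a list" and j assume len: "length vs = l" and j: "j < l"
  have "linear (\<lambda>v. cof b e [1..<Suc DIM('a)] (map e I @ vs[j := v]))" if "length I = k" for I
  proof -
    have u: "map e I @ vs[j := v] = (map e I @ vs)[k + j := v]" for v using that by (simp add: list_update_append)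
    show ?thesis unfolding u
      by (rule multilinD[OF cof_multilin[OF b]]) (use that len j kl in \<open>simp_all del: upt_Suc\<close>)
  qed
  note lin = this
  show "linear (\<lambda>v. hodge b e k \<alpha> (vs[j := v]))"
    unfolding hodge_def
  proof (rule linear_cmult, rule linear_compose_sum, rule ballI, rule linear_cmult)
    fix I assume "I \<in> {I. length I = k \<and> set I \<subseteq> {1..DIM('a)}}"
    then have "length I = k" by simp
    then show "linear (\<lambda>v. cof b e [1..<Suc DIM('a)] (map e I @ vs[j := v]))" by (rule lin)
  qed
qed

text \<open>If a block B lies between two positions, exchanging them takes 2 |B| + 1 adjacent swaps,
  an odd number.\<close>

lemma skewI_adjacent:
  assumes adj: "\<And>xs y x zs. Suc (Suc (length xs + length zs)) = k \<Longrightarrow> \<alpha> (xs @ y # x # zs) = - \<alpha> (xs @ x # y # zs)"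
  shows "skew k \<alpha>"
proof (rule skewI_swap)
  have move: "Suc (length xs + length B + length zs) = k \<Longrightarrow>
      \<alpha> (xs @ a # B @ zs) = (-1) ^ length B * \<alpha> (xs @ B @ a # zs)" for xs B zs a
  proof (induction B arbitrary: xs)
    case (Cons b B)
    have "\<alpha> (xs @ a # b # B @ zs) = - \<alpha> (xs @ b # a # B @ zs)"
      using Cons.prems by (intro adj) auto
    also have "\<alpha> (xs @ b # a # B @ zs) = (-1) ^ length B * \<alpha> (xs @ b # B @ a # zs)"
      using Cons.IH[of "xs @ [b]"] Cons.prems by simp
    finally show ?case by simp
  qed simp
  have sw: "\<alpha> (permute_list (swp i j) vs) = - \<alpha> vs" if len: "length vs = k" and ij: "i < j" "j < k" for vs i j
  proof -
    define xs where "xs = take i vs"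
    define B where "B = take (j - Suc i) (drop (Suc i) vs)"
    define zs where "zs = drop (Suc j) vs"
    have lx: "length xs = i" "length B = j - Suc i" using len ij by (auto simp: xs_def B_def)
    have vs: "vs = xs @ vs ! i # B @ vs ! j # zs"
    proof -
      have "drop (Suc i) vs = B @ drop (j - Suc i) (drop (Suc i) vs)" by (simp only: B_def append_take_drop_id)
      also have "drop (j - Suc i) (drop (Suc i) vs) = drop j vs" using ij by simp
      also have "drop j vs = vs ! j # zs" using ij len by (simp add: zs_def Cons_nth_drop_Suc)
      finally show ?thesis using ij len id_take_nth_drop[of i vs] by (simp add: xs_def)
    qed
    have lz: "length zs = k - Suc j" using len by (simp add: zs_def)
    have p: "swp i j permutes {..<length vs}" using ij len by (intro permutes_swap_id) auto
    have "permute_list (swp i j) vs = xs @ vs ! j # B @ vs ! i # zs"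
    proof (rule nth_equalityI)
      show "length (permute_list (swp i j) vs) = length (xs @ vs ! j # B @ vs ! i # zs)"
        using lx lz ij len by simp
      fix l assume "l < length (permute_list (swp i j) vs)"
      then have l: "l < k" using len by simp
      have v: "vs ! l = (xs @ vs ! i # B @ vs ! j # zs) ! l" using vs by simp
      show "permute_list (swp i j) vs ! l = (xs @ vs ! j # B @ vs ! i # zs) ! l"
        using v l p ij len lx
        by (auto simp: permute_list_nth Transposition.transpose_def nth_append nth_Cons split: nat.splits if_splits)
    qed
    then have "\<alpha> (permute_list (swp i j) vs) = \<alpha> (xs @ vs ! j # B @ vs ! i # zs)" by simp
    also have "\<dots> = (-1) ^ length B * \<alpha> (xs @ B @ vs ! j # vs ! i # zs)"
      using move[of xs B "vs ! i # zs" "vs ! j"] lx lz ij by simp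
    also have "\<dots> = (-1) ^ Suc (length B) * \<alpha> (xs @ B @ vs ! i # vs ! j # zs)"
      using adj[of "xs @ B" zs "vs ! j" "vs ! i"] lx lz ij by simp
    also have "\<dots> = - \<alpha> (xs @ vs ! i # B @ vs ! j # zs)"
      using move[of xs B "vs ! j # zs" "vs ! i"] lx lz ij by simp
    finally show ?thesis using vs by simp
  qed
  fix vs :: "'a list" and i j assume "length vs = k" "i < k" "j < k" "i \<noteq> j"
  then show "\<alpha> (permute_list (swp i j) vs) = - \<alpha> vs"
    using sw[of vs i j] sw[of vs j i] by (cases "i < j") (auto simp: transpose_commute)
qed

lemma dform_skew5:
  assumes C: "skew 4 C" shows "skew 5 (dform n om C)"
proof (rule skewI_adjacent)
  fix xs zs :: "nat list" and y x assume l: "Suc (Suc (length xs + length zs)) = 5"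
  have s: "act n A C [q,p,r,t] = - act n A C [p,q,r,t]" "act n A C [p,r,q,t] = - act n A C [p,q,r,t]"
    "act n A C [p,q,t,r] = - act n A C [p,q,r,t]" for A p q r t
    using skew_swap[OF skew_act[OF C], of "[]" "[r,t]" n A q p] skew_swap[OF skew_act[OF C], of "[p]" "[t]" n A r q]
      skew_swap[OF skew_act[OF C], of "[p,q]" "[]" n A t r] by simp_all
  consider a b c where "xs = []" "zs = [a,b,c]" | a b c where "xs = [a]" "zs = [b,c]"
    | a b c where "xs = [a,b]" "zs = [c]" | a b c where "xs = [a,b,c]" "zs = []"
  proof -
    have "length xs = 0 \<and> length zs = 3 \<or> length xs = 1 \<and> length zs = 2 \<or> length xs = 2 \<and> length zs = 1 \<or> length xs = 3 \<and> length zs = 0"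
      using l by arith
    then show thesis using that by (auto simp: numeral_eq_Suc length_Suc_conv)
  qed
  then show "dform n om C (xs @ y # x # zs) = - dform n om C (xs @ x # y # zs)"
  proof cases
    case 1 then show ?thesis using s(1)[of _ y x] by (simp add: dform5 s(1)[of _ y x])
  next
    case 2 then show ?thesis by (simp add: dform5 s(1)[of _ y x] s(2)[of _ _ y x])
  next
    case 3 then show ?thesis by (simp add: dform5 s(2)[of _ _ y x] s(3)[of _ _ _ y x])
  next
    case 4 then show ?thesis by (simp add: dform5 s(3)[of _ _ _ y x])
  qed
qed

lemma dform_skew4:
  assumes C: "skew 3 C" shows "skew 4 (dform n om C)"
proof (rule skewI_adjacent)
  fix xs zs :: "nat list" and y x assume l: "Suc (Suc (length xs + length zs)) = 4"
  have s: "act n A C [q,p,r] = - act n A C [p,q,r]" "act n A C [p,r,q] = - act n A C [p,q,r]" for A p q r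
    using skew_swap[OF skew_act[OF C], of "[]" "[r]" n A q p] skew_swap[OF skew_act[OF C], of "[p]" "[]" n A r q]
    by simp_all
  consider a b where "xs = []" "zs = [a,b]" | a b where "xs = [a]" "zs = [b]" | a b where "xs = [a,b]" "zs = []"
  proof -
    have "length xs = 0 \<and> length zs = 2 \<or> length xs = 1 \<and> length zs = 1 \<or> length xs = 2 \<and> length zs = 0"
      using l by arith
    then show thesis using that by (auto simp: numeral_eq_Suc length_Suc_conv)
  qed
  then show "dform n om C (xs @ y # x # zs) = - dform n om C (xs @ x # y # zs)"
  proof cases
    case 1 then show ?thesis by (simp add: dform4 s(1)[of _ y x])
  next
    case 2 then show ?thesis by (simp add: dform4 s(1)[of _ y x] s(2)[of _ _ y x])
  next
    case 3 then show ?thesis by (simp add: dform4 s(2)[of _ _ y x])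
  qed
qed

lemma act_cong:
  assumes "\<And>i j. i \<in> {1..n} \<Longrightarrow> j \<in> {1..n} \<Longrightarrow> A i j = A' i j" and "set K \<subseteq> {1..n}"
  shows "act n A C K = act n A' C K"
  unfolding act_def using assms by (intro sum.cong refl arg_cong2[where f = "(*)"]) (auto dest: nth_mem)

lemma dform_cong:
  assumes "\<And>v i j. v \<in> {1..n} \<Longrightarrow> i \<in> {1..n} \<Longrightarrow> j \<in> {1..n} \<Longrightarrow> om v i j = om' v i j" and K: "set K \<subseteq> {1..n}"
  shows "dform n om C K = dform n om' C K"
  unfolding dform_def
proof (intro arg_cong[where f = uminus] sum.cong refl arg_cong2[where f = "(*)"] act_cong)
  fix s i j assume "s \<in> {..<length K}" "i \<in> {1..n}" "j \<in> {1..n}"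
  then show "om (K ! s) i j = om' (K ! s) i j" using assms by (auto dest: nth_mem)
next
  fix s show "set (take s K @ drop (Suc s) K) \<subseteq> {1..n}"
    using K by (auto dest: in_set_takeD in_set_dropD)
qed

subsection \<open>Curvature squares\<close>

text \<open>Each of the three pairings arises from 8 of the 24 permutations; the normalisation 1/(2!
  2!) leaves the factor 2.\<close>

lemma wedge22:
  assumes "\<And>u v. \<alpha> [v,u] = - \<alpha> [u,v]"
  shows "wedge 2 2 \<alpha> \<alpha> [u,v,w,x] = 2 * (\<alpha> [u,v] * \<alpha> [w,x] + \<alpha> [u,w] * \<alpha> [x,v] + \<alpha> [u,x] * \<alpha> [v,w])"
proof -
  have f: "finite {Suc 0, 2, 3}" "0 \<notin> {Suc 0, 2, 3}" "finite {2::nat, 3}" "Suc 0 \<notin> {2, 3}"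
    "finite {3::nat}" "(2::nat) \<notin> {3}" by auto
  have e: "{..<2 + 2} = {0::nat, Suc 0, 2, 3}" by auto
  have s: "\<alpha> [v,u] = - \<alpha> [u,v]" "\<alpha> [w,u] = - \<alpha> [u,w]" "\<alpha> [x,u] = - \<alpha> [u,x]"
    "\<alpha> [w,v] = - \<alpha> [v,w]" "\<alpha> [v,x] = - \<alpha> [x,v]" "\<alpha> [x,w] = - \<alpha> [w,x]" using assms by blast+
  show ?thesis
    unfolding wedge_def e sum_over_permutations_insert[OF f(1,2)] sum_over_permutations_insert[OF f(3,4)]
      sum_over_permutations_insert[OF f(5,6)] permutes_sing
    by (simp add: sign_swap_id sign_compose permutation_swap_id permutation_compose Transposition.transpose_def
        numeral_eq_Suc s fact_numeral)
qed

lemma sum_upper_triangle: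
  fixes X :: "nat \<Rightarrow> nat \<Rightarrow> real"
  assumes "\<And>a b. X b a = X a b" "\<And>a. X a a = 0"
  shows "(\<Sum>a=1..n. \<Sum>b=Suc a..n. X a b) = 1/2 * (\<Sum>a=1..n. \<Sum>b=1..n. X a b)"
proof (induction n)
  case (Suc n)
  have "(\<Sum>a=1..Suc n. \<Sum>b=Suc a..Suc n. X a b) = (\<Sum>a=1..n. \<Sum>b=Suc a..n. X a b) + (\<Sum>a=1..n. X a (Suc n))"
    by (simp add: sum.distrib)
  also have "\<dots> = 1/2 * (\<Sum>a=1..n. \<Sum>b=1..n. X a b) + (\<Sum>a=1..n. X a (Suc n))" by (simp only: Suc.IH)
  also have "\<dots> = 1/2 * (\<Sum>a=1..Suc n. \<Sum>b=1..Suc n. X a b)"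
    by (simp add: sum.distrib assms(2) assms(1)[of "Suc n"])
  finally show ?case .
qed simp

text \<open>The factor 2 of \<open>wedge22\<close> cancels the 1/2 that arises when the sum over i <
  j is extended to all pairs. The summand is symmetric in the bundle indices because both of its
  factors change sign.\<close>

lemma p1_form_expand:
  fixes h :: "'f::euclidean_space \<Rightarrow> 'f \<Rightarrow> real" and F :: "'a::euclidean_space \<Rightarrow> 'a \<Rightarrow> 'f \<Rightarrow> 'f"
    and f :: "nat \<Rightarrow> 'f"
  assumes F1: "\<And>u v r s. h (F v u r) s = - h (F u v r) s" and F2: "\<And>u v r s. h (F u v s) r = - h (F u v r) s"
  defines "G \<equiv> \<lambda>u v a b. h (F u v (f a)) (f b)"
  shows "p1_form h f F [u,v,w,x] = 1 / (8 * pi\<^sup>2) * (\<Sum>a=1..DIM('f). \<Sum>b=1..DIM('f).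
     G u v a b * G w x a b + G u w a b * G x v a b + G u x a b * G v w a b)"
proof -
  define X where "X a b = G u v a b * G w x a b + G u w a b * G x v a b + G u x a b * G v w a b" for a b
  have Gs: "G u v b a = - G u v a b" for u v a b unfolding G_def by (rule F2)
  have w: "wedge 2 2 (\<lambda>us. h (F (us ! 0) (us ! 1) (f b)) (f a)) (\<lambda>us. h (F (us ! 0) (us ! 1) (f b)) (f a)) [u,v,w,x]
      = 2 * X a b" for a b
  proof -
    let ?\<alpha> = "\<lambda>us. G (us ! 0) (us ! 1) b a"
    have \<alpha>: "?\<alpha> [u,v] = G u v b a" for u v by simp
    have "?\<alpha> [v,u] = - ?\<alpha> [u,v]" for u v unfolding \<alpha> unfolding G_def by (rule F1)
    note wedge22[of ?\<alpha>, OF this, of u v w x, unfolded \<alpha>]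
    then have "wedge 2 2 ?\<alpha> ?\<alpha> [u,v,w,x] = 2 * X a b" by (simp add: X_def Gs[of u _ b a] Gs[of v _ b a] Gs[of w _ b a] Gs[of x _ b a])
    then show ?thesis unfolding G_def .
  qed
  have "X b a = X a b" "X a a = 0" for a b
    using Gs[of _ _ a a] by (simp_all add: X_def Gs[of _ _ b a])
  note S = sum_upper_triangle[of X "DIM('f)", OF this]
  show ?thesis unfolding p1_form_def w sum_distrib_left[symmetric] X_def[symmetric] S by simp
qed

context riem_frame
begin

section \<open>Consequences of a structure form parallel for the connection with torsion\<close>

lemma curvature_plus_skew:
  assumes q: "q \<in> V"
  shows "gq q (curvature \<kappa> Gp q u v x) w = - gq q (curvature \<kappa> Gp q u v w) x"
proof -
  have n: "nab \<kappa> \<Gamma> (H \<kappa>) q a [b,x,w] = - nab \<kappa> \<Gamma> (H \<kappa>) q a [b,w,x]" for a b by (rule nab_H_alt(2)[OF q])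
  show ?thesis
    unfolding curvature_plus[OF q] n lc_curvature(1)[OF q, of u v x w]
    by (simp add: mult.commute algebra_simps)
qed

lemma nab_const:
  assumes q: "q \<in> V" and ml: "\<And>q. q \<in> V \<Longrightarrow> multilin k (S q)"
    and d: "\<And>vs. length vs = k \<Longrightarrow> cdiff \<kappa> (\<lambda>q. S q vs) q"
    and C: "\<And>q K. q \<in> V \<Longrightarrow> length K = k \<Longrightarrow> set K \<subseteq> {1..DIM('a)} \<Longrightarrow> S q (map (e q) K) = C K"
    and K: "length K = k" "set K \<subseteq> {1..DIM('a)}"
  shows "nab \<kappa> \<Gamma> S q u (map (e q) K) = - act DIM('a) (om q u) C K"
proof -
  have "cderiv \<kappa> (\<lambda>q. S q (map (e q) K)) q = cderiv \<kappa> (\<lambda>_. C K) q"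
    by (rule cderiv_cong(1)[OF V(1) q Vk[OF q]]) (use C K in auto)
  moreover have "act DIM('a) (om q u) (\<lambda>K. S q (map (e q) K)) K = act DIM('a) (om q u) C K"
    unfolding act_def
  proof (intro sum.cong refl arg_cong2[where f = "(*)"])
    fix s i assume "i \<in> {1..DIM('a)}"
    then show "S q (map (e q) (K[s := i])) = C (K[s := i])"
      using K set_update_subset_insert[of K s i] by (intro C[OF q]) auto
  qed
  ultimately show ?thesis using nab_frame(2)[OF q ml d K, of u] by (simp add: cderiv_const)
qed

text \<open>The infinitesimal form of the holonomy reduction: \<open>parallel\<close> feeds
  \<open>curvature_annihilates\<close>, and expanding the curvature in the frame turns the result
  into \<open>act\<close>.\<close>

lemma curvature_plus_stab:
  assumes q: "q \<in> V" and S: "smooth_form \<A> k S"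
    and C: "\<And>q K. q \<in> V \<Longrightarrow> length K = k \<Longrightarrow> set K \<subseteq> {1..DIM('a)} \<Longrightarrow> S \<kappa> q (map (e q) K) = C K"
    and par: "\<And>q u K. q \<in> V \<Longrightarrow> length K = k \<Longrightarrow> set K \<subseteq> {1..DIM('a)} \<Longrightarrow> act DIM('a) (omp q u) C K = 0"
    and K: "length K = k" "set K \<subseteq> {1..DIM('a)}"
  shows "act DIM('a) (\<lambda>a b. gq q (curvature \<kappa> Gp q u v (e q a)) (e q b)) C K = 0"
proof -
  note Sf = form_facts[OF S]
  have z: "(\<Sum>i<k. S \<kappa> q ((map (e q) K)[i := curvature \<kappa> Gp q u v (map (e q) K ! i)])) = 0"
  proof (rule curvature_annihilates[OF V(1) q V(2)])
    show "cdiff \<kappa> (\<lambda>q. Gp q w y) q" for w y by (rule cdiff_Gp[OF q])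
    show "multilin k (S \<kappa> q)" if "q \<in> V" for q by (rule Sf(3)[OF that])
    show "smooth_fun \<A> V (\<lambda>q. S \<kappa> q vs)" if "length vs = k" for vs
      by (rule smooth_fun_subset[OF Sf(2)[OF that] V(2)])
    show "cderiv \<kappa> (\<lambda>q. S \<kappa> q vs) q w = (\<Sum>i<k. S \<kappa> q (vs[i := Gp q w (vs ! i)]))"
      if "q \<in> V" "length vs = k" for q w vs
      by (rule parallel[where S = "S \<kappa>" and C = C, OF that(1) Sf(3) Sf(5)[OF that(1)] C par[OF that(1)] that(2)])
  qed (simp add: K)
  have "S \<kappa> q ((map (e q) K)[i := curvature \<kappa> Gp q u v (map (e q) K ! i)]) =
      (\<Sum>j=1..DIM('a). gq q (curvature \<kappa> Gp q u v (e q (K ! i))) (e q j) * C (K[i := j]))" if i: "i < k" for i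
  proof -
    have lin: "linear (\<lambda>v. S \<kappa> q ((map (e q) K)[i := v]))"
      by (rule multilinD[OF Sf(3)[OF q] _ i]) (simp add: K)
    have "S \<kappa> q (map (e q) (K[i := j])) = C (K[i := j])" if "j \<in> {1..DIM('a)}" for j
      using K that set_update_subset_insert[of K i j] by (intro C[OF q]) auto
    then show ?thesis
      by (subst e_expand[OF q, of "curvature \<kappa> Gp q u v (map (e q) K ! i)"])
        (use i K in \<open>simp add: linear_sum[OF lin] linear_cmul[OF lin] map_update[symmetric]\<close>)
  qed
  then show ?thesis using z unfolding act_def K(1) by simp
qed

lemma hodge_frame_at: "q \<in> V \<Longrightarrow> frame (gq q) (e q)"
  by (rule frame.intro[OF oe])

text \<open>Antisymmetry of \<open>om\<close> holds for indices within the frame, while the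
  algebraic lemmas ask for it at all natural numbers. The skew part has it everywhere and agrees
  with \<open>om\<close> on the frame.\<close>

lemma om_skew_part:
  assumes q: "q \<in> V"
  defines "oA \<equiv> \<lambda>v i j. (om q (e q v) i j - om q (e q v) j i) / 2"
  shows "oA v j i = - oA v i j"
    "i \<in> {1..DIM('a)} \<Longrightarrow> j \<in> {1..DIM('a)} \<Longrightarrow> om q (e q v) i j = oA v i j"
  using om_antisym[OF q, of i j "e q v"] by (auto simp: oA_def field_simps)

lemma dphi_expand:
  assumes q: "q \<in> V" and \<phi>: "cdiff \<kappa> \<phi> q"
  shows "cderiv \<kappa> \<phi> q (ne q u k) = (\<Sum>j=1..DIM('a). om q u k j * cderiv \<kappa> \<phi> q (e q j))"
  by (subst ne_expand[OF q]) (simp add: linear_sum[OF linear_cderiv[OF \<phi>]] linear_cmul[OF linear_cderiv[OF \<phi>]])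

lemma cderiv_dphi:
  assumes q: "q \<in> V" and s: "smooth_fun \<A> UNIV \<phi>" and k: "k \<in> {1..DIM('a)}"
  shows "cdiff \<kappa> (\<lambda>q. cderiv \<kappa> \<phi> q (e q k)) q"
   "cderiv \<kappa> (\<lambda>q. cderiv \<kappa> \<phi> q (e q k)) q u = hessian \<kappa> \<Gamma> \<phi> q u (e q k) + (\<Sum>j=1..DIM('a). om q u k j * cderiv \<kappa> \<phi> q (e q j))"
proof -
  have d: "cdiff \<kappa> \<phi> q" if "q \<in> V" for q by (rule smooth_fun_cdiff[OF s Vk[OF that] UNIV_I])
  have lin: "linear (cderiv \<kappa> \<phi> q')" if "q' \<in> fst \<kappa> \<inter> V" for q' by (rule linear_cderiv) (use d that in simp)
  have d2: "cdiff \<kappa> (\<lambda>q. cderiv \<kappa> \<phi> q y) q" for y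
    by (rule smooth_fun_cdiff2[OF s open_UNIV Vk[OF q] UNIV_I])
  note a = cderiv_apply[where F = "\<lambda>q y. cderiv \<kappa> \<phi> q y" and Y = "\<lambda>q. e q k", OF V(1) q Vk[OF q] lin d2 cdiff_e[OF q k]]
  show "cdiff \<kappa> (\<lambda>q. cderiv \<kappa> \<phi> q (e q k)) q" using a(1) .
  show "cderiv \<kappa> (\<lambda>q. cderiv \<kappa> \<phi> q (e q k)) q u = hessian \<kappa> \<Gamma> \<phi> q u (e q k) + (\<Sum>j=1..DIM('a). om q u k j * cderiv \<kappa> \<phi> q (e q j))"
    using a(2)[of u] unfolding dphi_expand[OF q d[OF q], symmetric] ne_def hessian_def
      linear_add[OF linear_cderiv[OF d[OF q]]] by simp
qed

lemma hessian_sym: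
  assumes q: "q \<in> V" and s: "smooth_fun \<A> UNIV \<phi>"
  shows "hessian \<kappa> \<Gamma> \<phi> q u v = hessian \<kappa> \<Gamma> \<phi> q v u"
  unfolding hessian_def \<Gamma>_sym[OF q, of u v] using cderiv_commute[OF s open_UNIV Vk[OF q] UNIV_I, of v u] by simp

text \<open>Differentiates the hypothesis \<open>HW\<close> along e_m. As \<open>omp\<close>
  annihilates W, its action on the three contracted slots is minus its action on the slot k, where
  contraction with H gives 12 d phi again. The connection forms cancel against those from
  differentiating d phi(e_k), and half of H remains.\<close>

lemma dilaton:
  assumes q: "q \<in> V" and s: "smooth_fun \<A> UNIV \<phi>" and W: "skew 4 W"
    and par: "\<And>K. length K = 4 \<Longrightarrow> set K \<subseteq> {1..DIM('a)} \<Longrightarrow> act DIM('a) (omp q (e q m)) W K = 0"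
    and HW: "\<And>q k. q \<in> V \<Longrightarrow> k \<in> {1..DIM('a)} \<Longrightarrow>
      S3 {1..DIM('a)} (\<lambda>v w x. W [v,w,x,k]) (\<lambda>v w x. H \<kappa> q [e q v, e q w, e q x]) = 12 * cderiv \<kappa> \<phi> q (e q k)"
    and m: "m \<in> {1..DIM('a)}" and k: "k \<in> {1..DIM('a)}"
  shows "S3 {1..DIM('a)} (\<lambda>v w x. W [v,w,x,k]) (\<lambda>v w x. nab \<kappa> \<Gamma> (H \<kappa>) q (e q m) [e q v, e q w, e q x])
     - 3/2 * S3 {1..DIM('a)} (\<lambda>v w x. W [v,w,x,k]) (\<lambda>v w x. \<Sum>s\<in>{1..DIM('a)}. H \<kappa> q [e q m, e q v, e q s] * H \<kappa> q [e q w, e q x, e q s])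
     = 12 * (hessian \<kappa> \<Gamma> \<phi> q (e q m) (e q k) - 1/2 * (\<Sum>i\<in>{1..DIM('a)}. H \<kappa> q [e q m, e q k, e q i] * cderiv \<kappa> \<phi> q (e q i)))"
proof -
  let ?I = "{1..DIM('a)}" and ?u = "e q m" and ?H = "\<lambda>v w x. H \<kappa> q [e q v, e q w, e q x]"
  define C where "C K = W (K @ [k])" for K
  have C: "skew 3 C"
  proof (rule skewI_adjacent)
    fix xs zs :: "nat list" and y x assume "Suc (Suc (length xs + length zs)) = 3"
    then show "C (xs @ y # x # zs) = - C (xs @ x # y # zs)"
      using skew_swap[OF W, of xs "zs @ [k]" y x] by (simp add: C_def)
  qed
  let ?f = "\<lambda>i. cderiv \<kappa> \<phi> q (e q i)"
  have "cderiv \<kappa> (\<lambda>q. S3 ?I (\<lambda>v w x. C [v,w,x]) (\<lambda>v w x. H \<kappa> q [e q v, e q w, e q x])) q =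
      cderiv \<kappa> (\<lambda>q. 12 * cderiv \<kappa> \<phi> q (e q k)) q"
    by (rule cderiv_cong(1)[OF V(1) q Vk[OF q]]) (use HW k in \<open>auto simp: C_def\<close>)
  then have L: "cderiv \<kappa> (\<lambda>q. S3 ?I (\<lambda>v w x. C [v,w,x]) (\<lambda>v w x. H \<kappa> q [e q v, e q w, e q x])) q ?u =
      12 * (hessian \<kappa> \<Gamma> \<phi> q ?u (e q k) + (\<Sum>j\<in>?I. om q ?u k j * ?f j))"
    by (simp only: cderiv_cmult(2)[OF cderiv_dphi(1)[OF q s k]] cderiv_dphi(2)[OF q s k])
  have a: "act DIM('a) (omp q ?u) C [v,w,x] = - (\<Sum>i\<in>?I. omp q ?u k i * W [v,w,x,i])"
    if "v \<in> ?I" "w \<in> ?I" "x \<in> ?I" for v w x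
    using par[of "[v,w,x,k]"] that k by (simp add: act4 act3 C_def)
  have "S3 ?I ?H (\<lambda>v w x. act DIM('a) (omp q ?u) C [v,w,x]) =
      - (\<Sum>v\<in>?I. \<Sum>w\<in>?I. \<Sum>x\<in>?I. \<Sum>i\<in>?I. omp q ?u k i * (?H v w x * W [v,w,x,i]))"
    unfolding S3_def sum_negf[symmetric]
    by (rule sum.cong[OF refl], rule sum.cong[OF refl], rule sum.cong[OF refl])
      (simp only: a sum_distrib_left mult_minus_right sum_negf mult_ac)
  also have "(\<Sum>v\<in>?I. \<Sum>w\<in>?I. \<Sum>x\<in>?I. \<Sum>i\<in>?I. omp q ?u k i * (?H v w x * W [v,w,x,i])) =
      (\<Sum>v\<in>?I. \<Sum>w\<in>?I. \<Sum>i\<in>?I. \<Sum>x\<in>?I. omp q ?u k i * (?H v w x * W [v,w,x,i]))"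
    by (rule sum.cong[OF refl], rule sum.cong[OF refl], rule sum.swap)
  also have "\<dots> = (\<Sum>v\<in>?I. \<Sum>i\<in>?I. \<Sum>w\<in>?I. \<Sum>x\<in>?I. omp q ?u k i * (?H v w x * W [v,w,x,i]))"
    by (rule sum.cong[OF refl], rule sum.swap)
  also have "\<dots> = (\<Sum>i\<in>?I. \<Sum>v\<in>?I. \<Sum>w\<in>?I. \<Sum>x\<in>?I. omp q ?u k i * (?H v w x * W [v,w,x,i]))"
    by (rule sum.swap)
  also have "\<dots> = (\<Sum>i\<in>?I. omp q ?u k i * S3 ?I (\<lambda>v w x. W [v,w,x,i]) ?H)"
    by (simp add: S3_def sum_distrib_left)
  also have "\<dots> = (\<Sum>i\<in>?I. 12 * (om q ?u k i * ?f i) + 6 * (H \<kappa> q [?u, e q k, e q i] * ?f i))"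
    using HW[OF q] by (intro sum.cong refl) (simp add: omp_def algebra_simps)
  also have "\<dots> = 12 * (\<Sum>i\<in>?I. om q ?u k i * ?f i) + 6 * (\<Sum>i\<in>?I. H \<kappa> q [?u, e q k, e q i] * ?f i)"
    by (simp only: sum.distrib sum_distrib_left)
  finally have A: "S3 ?I ?H (\<lambda>v w x. act DIM('a) (omp q ?u) C [v,w,x]) =
     - (12 * (\<Sum>i\<in>?I. om q ?u k i * ?f i) + 6 * (\<Sum>i\<in>?I. H \<kappa> q [?u, e q k, e q i] * ?f i))" .
  have CW: "C [v,w,x] = W [v,w,x,k]" for v w x by (simp add: C_def)
  show ?thesis using cderiv_contraction[OF q m C] unfolding L A unfolding CW by argo
qed

text \<open>The same differentiation for an annihilated 3-form whose contraction with H is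
  zero.\<close>

lemma no_dilaton:
  assumes q: "q \<in> V" and Th: "skew 3 C"
    and par: "\<And>K. length K = 3 \<Longrightarrow> set K \<subseteq> {1..DIM('a)} \<Longrightarrow> act DIM('a) (omp q (e q m)) C K = 0"
    and HTh: "\<And>q. q \<in> V \<Longrightarrow> S3 {1..DIM('a)} (\<lambda>v w x. C [v,w,x]) (\<lambda>v w x. H \<kappa> q [e q v, e q w, e q x]) = 0"
    and m: "m \<in> {1..DIM('a)}"
  shows "S3 {1..DIM('a)} (\<lambda>v w x. C [v,w,x]) (\<lambda>v w x. nab \<kappa> \<Gamma> (H \<kappa>) q (e q m) [e q v, e q w, e q x])
     - 3/2 * S3 {1..DIM('a)} (\<lambda>v w x. C [v,w,x]) (\<lambda>v w x. \<Sum>s\<in>{1..DIM('a)}. H \<kappa> q [e q m, e q v, e q s] * H \<kappa> q [e q w, e q x, e q s])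
     = 0"
proof -
  have "cderiv \<kappa> (\<lambda>q. S3 {1..DIM('a)} (\<lambda>v w x. C [v,w,x]) (\<lambda>v w x. H \<kappa> q [e q v, e q w, e q x])) q = cderiv \<kappa> (\<lambda>_. 0) q"
    by (rule cderiv_cong(1)[OF V(1) q Vk[OF q]]) (use HTh in auto)
  moreover have "S3 {1..DIM('a)} (\<lambda>v w x. H \<kappa> q [e q v, e q w, e q x]) (\<lambda>v w x. act DIM('a) (omp q (e q m)) C [v,w,x]) = 0"
    unfolding S3_def by (intro sum.neutral ballI) (simp add: par)
  ultimately show ?thesis using cderiv_contraction[OF q m Th] by (simp add: cderiv_const)
qed

lemma heterotic_pointI:
  assumes q: "q \<in> V" and s: "smooth_fun \<A> UNIV \<phi>" and W: "skew 4 W"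
    and par: "\<And>u K. length K = 4 \<Longrightarrow> set K \<subseteq> {1..DIM('a)} \<Longrightarrow> act DIM('a) (omp q u) W K = 0"
    and HW: "\<And>q k. q \<in> V \<Longrightarrow> k \<in> {1..DIM('a)} \<Longrightarrow>
      S3 {1..DIM('a)} (\<lambda>v w x. W [v,w,x,k]) (\<lambda>v w x. H \<kappa> q [e q v, e q w, e q x]) = 12 * cderiv \<kappa> \<phi> q (e q k)"
    and inst: "\<And>u v a b. a \<in> {1..DIM('a)} \<Longrightarrow> b \<in> {1..DIM('a)} \<Longrightarrow>
      (\<Sum>w\<in>{1..DIM('a)}. \<Sum>x\<in>{1..DIM('a)}. W [w,x,a,b] * gq q (curvature \<kappa> Gp q u v (e q w)) (e q x))
        = - 2 * gq q (curvature \<kappa> Gp q u v (e q a)) (e q b)"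
  shows "heterotic_point DIM('a) W (\<lambda>a b c. H \<kappa> q [e q a, e q b, e q c])
    (\<lambda>u a b c. nab \<kappa> \<Gamma> (H \<kappa>) q (e q u) [e q a, e q b, e q c])
    (\<lambda>i j k l. gq q (curvature \<kappa> \<Gamma> q (e q i) (e q j) (e q k)) (e q l))
    (\<lambda>i j k l. gq q (curvature \<kappa> Gp q (e q i) (e q j) (e q k)) (e q l))
    (\<lambda>i. cderiv \<kappa> \<phi> q (e q i)) (\<lambda>i j. hessian \<kappa> \<Gamma> \<phi> q (e q i) (e q j))"
  apply unfold_locales
             apply (rule W)
            apply (rule H_alt(1)[OF q])
           apply (rule H_alt(2)[OF q])
          apply (rule nab_H_alt(1)[OF q])
         apply (rule nab_H_alt(2)[OF q])
        apply (rule lc_curvature(2)[OF q])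
       apply (rule lc_curvature(1)[OF q])
      apply (rule lc_curvature(3)[OF q])
     apply (rule curvature_plus[OF q])
    apply (rule inst, assumption, assumption)
   apply (rule hessian_sym[OF q s])
  apply (rule dilaton[OF q s W par HW]; assumption)
  done

end

subsection \<open>Change of orthonormal frame\<close>

lemma bilinear_prod: "linear X \<Longrightarrow> linear Y \<Longrightarrow> bilinear (\<lambda>u v. X u * Y v :: real)"
  unfolding bilinear_def
proof (intro conjI allI)
  assume X: "linear X" and Y: "linear Y"
  show "linear (\<lambda>y. X x * Y y)" for x by (rule linear_cmult[OF Y])
  show "linear (\<lambda>x. X x * Y y)" for y using linear_cmult[OF X, of "Y y"] by (simp only: mult.commute)
qed

lemma bilinear_plus: "bilinear X \<Longrightarrow> bilinear Y \<Longrightarrow> bilinear (\<lambda>u v. X u v + Y u v :: real)"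
  by (simp add: bilinear_def linear_compose_add)

lemma bilinear_minus: "bilinear X \<Longrightarrow> bilinear Y \<Longrightarrow> bilinear (\<lambda>u v. X u v - Y u v :: real)"
  by (simp add: bilinear_def linear_compose_sub)

lemma bilinear_cmult: "bilinear X \<Longrightarrow> bilinear (\<lambda>u v. c * X u v :: real)"
  by (simp add: bilinear_def linear_cmult)

lemma bilinear_sumI: "(\<And>i. bilinear (X i)) \<Longrightarrow> bilinear (\<lambda>u v. \<Sum>i\<in>I. X i u v :: real)"
  unfolding bilinear_def by (auto intro!: linear_compose_sum)

lemma sum_rotate3: "(\<Sum>m\<in>I. \<Sum>n\<in>J. \<Sum>q\<in>K. G m n q) = (\<Sum>n\<in>J. \<Sum>q\<in>K. \<Sum>m\<in>I. (G m n q :: real))"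
  by (subst sum.swap, rule sum.cong[OF refl], rule sum.swap)

context
  fixes b :: "'a::euclidean_space \<Rightarrow> 'a \<Rightarrow> real" and e e' :: "nat \<Rightarrow> 'a"
  assumes b: "bilinear b" "\<And>r s. b r s = b s r" and e: "orthonormal b e" and e': "orthonormal b e'"
begin

lemma trace1:
  assumes "linear X" "linear (Y :: 'a \<Rightarrow> real)"
  shows "(\<Sum>i=1..DIM('a). X (e' i) * Y (e' i)) = (\<Sum>i=1..DIM('a). X (e i) * Y (e i))"
  by (rule orthonormal_trace[OF b e e' bilinear_prod[OF assms]])

lemma trace2:
  fixes X Y :: "'a \<Rightarrow> 'a \<Rightarrow> real"
  assumes X: "\<And>y. linear (\<lambda>x. X x y)" "\<And>x. linear (X x)" and Y: "\<And>y. linear (\<lambda>x. Y x y)" "\<And>x. linear (Y x)"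
  shows "(\<Sum>m=1..DIM('a). \<Sum>n=1..DIM('a). X (e' m) (e' n) * Y (e' m) (e' n)) =
    (\<Sum>m=1..DIM('a). \<Sum>n=1..DIM('a). X (e m) (e n) * Y (e m) (e n))"
proof -
  have "(\<Sum>m=1..DIM('a). \<Sum>n=1..DIM('a). X (e' m) (e' n) * Y (e' m) (e' n)) =
      (\<Sum>m=1..DIM('a). \<Sum>n=1..DIM('a). X (e' m) (e n) * Y (e' m) (e n))"
    by (rule sum.cong[OF refl], rule trace1[OF X(2) Y(2)])
  also have "\<dots> = (\<Sum>n=1..DIM('a). \<Sum>m=1..DIM('a). X (e' m) (e n) * Y (e' m) (e n))" by (rule sum.swap)
  also have "\<dots> = (\<Sum>n=1..DIM('a). \<Sum>m=1..DIM('a). X (e m) (e n) * Y (e m) (e n))"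
    by (rule sum.cong[OF refl], rule trace1[OF X(1) Y(1)])
  also have "\<dots> = (\<Sum>m=1..DIM('a). \<Sum>n=1..DIM('a). X (e m) (e n) * Y (e m) (e n))" by (rule sum.swap)
  finally show ?thesis .
qed

lemma trace3:
  fixes X Y :: "'a \<Rightarrow> 'a \<Rightarrow> 'a \<Rightarrow> real"
  assumes X: "\<And>y z. linear (\<lambda>x. X x y z)" "\<And>x z. linear (\<lambda>y. X x y z)" "\<And>x y. linear (X x y)"
    and Y: "\<And>y z. linear (\<lambda>x. Y x y z)" "\<And>x z. linear (\<lambda>y. Y x y z)" "\<And>x y. linear (Y x y)"
  shows "(\<Sum>m=1..DIM('a). \<Sum>n=1..DIM('a). \<Sum>q=1..DIM('a). X (e' m) (e' n) (e' q) * Y (e' m) (e' n) (e' q)) =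
    (\<Sum>m=1..DIM('a). \<Sum>n=1..DIM('a). \<Sum>q=1..DIM('a). X (e m) (e n) (e q) * Y (e m) (e n) (e q))"
proof -
  have "(\<Sum>m=1..DIM('a). \<Sum>n=1..DIM('a). \<Sum>q=1..DIM('a). X (e' m) (e' n) (e' q) * Y (e' m) (e' n) (e' q)) =
      (\<Sum>m=1..DIM('a). \<Sum>n=1..DIM('a). \<Sum>q=1..DIM('a). X (e' m) (e n) (e q) * Y (e' m) (e n) (e q))"
    by (rule sum.cong[OF refl], rule trace2[OF X(2) X(3) Y(2) Y(3)])
  also have "\<dots> = (\<Sum>n=1..DIM('a). \<Sum>q=1..DIM('a). \<Sum>m=1..DIM('a). X (e' m) (e n) (e q) * Y (e' m) (e n) (e q))"
    by (rule sum_rotate3)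
  also have "\<dots> = (\<Sum>n=1..DIM('a). \<Sum>q=1..DIM('a). \<Sum>m=1..DIM('a). X (e m) (e n) (e q) * Y (e m) (e n) (e q))"
    by (rule sum.cong[OF refl], rule sum.cong[OF refl], rule trace1[OF X(1) Y(1)])
  also have "\<dots> = (\<Sum>m=1..DIM('a). \<Sum>n=1..DIM('a). \<Sum>q=1..DIM('a). X (e m) (e n) (e q) * Y (e m) (e n) (e q))"
    by (rule sum_rotate3[symmetric])
  finally show ?thesis .
qed

end

text \<open>\<open>Z\<close>, \<open>X\<close> and \<open>Y\<close> stand for \<open>g(R\<^sup>g(u, v)w, x)\<close>, \<open>(F\<^sup>A(u, v))\<^sub>a\<^sub>b\<close> and \<open>g(R(u, v)w, x)\<close>.\<close>

definition Einstein_tensor where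
  "Einstein_tensor N (e :: nat \<Rightarrow> 'a::euclidean_space) Z H hs X Y c u v =
     (\<Sum>k=1..DIM('a). Z (e k) u v (e k))
     - 1/4 * (\<Sum>m=1..DIM('a). \<Sum>n=1..DIM('a). H [u, e m, e n] * H [v, e m, e n]) + 2 * hs u v
     - c * ((\<Sum>m=1..DIM('a). \<Sum>a=1..N. \<Sum>b=1..N. X u (e m) a b * X v (e m) a b)
        - (\<Sum>m=1..DIM('a). \<Sum>n=1..DIM('a). \<Sum>q=1..DIM('a). Y u (e m) (e n) (e q) * Y v (e m) (e n) (e q)) :: real)"

text \<open>The Einstein equation is required in every orthonormal frame, while the computation
  takes place in adapted ones. The traces do not depend on the frame and the tensor is bilinear, so
  its vanishing transfers.\<close>

lemma Einstein_tensor_zero: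
  fixes b :: "'a::euclidean_space \<Rightarrow> 'a \<Rightarrow> real" and X :: "'a \<Rightarrow> 'a \<Rightarrow> nat \<Rightarrow> nat \<Rightarrow> real"
  assumes b: "bilinear b" "\<And>r s. b r s = b s r" and e: "orthonormal b e" and e': "orthonormal b e'"
    and Z: "\<And>v w. bilinear (\<lambda>x y. Z x v w y)" "\<And>x y. bilinear (\<lambda>v w. Z x v w y)"
    and H: "\<And>v w. linear (\<lambda>x. H [x,v,w])" "\<And>v w. linear (\<lambda>x. H [v,x,w])" "\<And>v w. linear (\<lambda>x. H [v,w,x])"
    and hs: "bilinear hs"
    and X: "\<And>v a c. linear (\<lambda>u. X u v a c)" "\<And>u a c. linear (\<lambda>v. X u v a c)"
    and Y: "\<And>v w x. linear (\<lambda>u. Y u v w x)" "\<And>u w x. linear (\<lambda>v. Y u v w x)" "\<And>u v x. linear (\<lambda>w. Y u v w x)"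
      "\<And>u v w. linear (\<lambda>x. Y u v w x)"
    and zero: "\<And>i j. i \<in> {1..DIM('a)} \<Longrightarrow> j \<in> {1..DIM('a)} \<Longrightarrow> Einstein_tensor N e Z H hs X Y c (e i) (e j) = 0"
  shows "Einstein_tensor N e' Z H hs X Y c u v = 0"
proof -
  note fr = b e e'
  have 1: "(\<Sum>k=1..DIM('a). Z (e' k) u v (e' k)) = (\<Sum>k=1..DIM('a). Z (e k) u v (e k))"
    by (rule orthonormal_trace[OF fr Z(1)])
  have 2: "(\<Sum>m=1..DIM('a). \<Sum>n=1..DIM('a). H [u, e' m, e' n] * H [v, e' m, e' n]) =
      (\<Sum>m=1..DIM('a). \<Sum>n=1..DIM('a). H [u, e m, e n] * H [v, e m, e n])"
    by (rule trace2[OF fr H(2) H(3) H(2) H(3)])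
  have "(\<Sum>m=1..DIM('a). \<Sum>a=1..N. \<Sum>b=1..N. X u (e' m) a b * X v (e' m) a b) =
      (\<Sum>a=1..N. \<Sum>b=1..N. \<Sum>m=1..DIM('a). X u (e' m) a b * X v (e' m) a b)" by (rule sum_rotate3)
  also have "\<dots> = (\<Sum>a=1..N. \<Sum>b=1..N. \<Sum>m=1..DIM('a). X u (e m) a b * X v (e m) a b)"
    by (rule sum.cong[OF refl], rule sum.cong[OF refl], rule trace1[OF fr X(2) X(2)])
  also have "\<dots> = (\<Sum>m=1..DIM('a). \<Sum>a=1..N. \<Sum>b=1..N. X u (e m) a b * X v (e m) a b)"
    by (rule sum_rotate3[symmetric])
  finally have 3: "(\<Sum>m=1..DIM('a). \<Sum>a=1..N. \<Sum>b=1..N. X u (e' m) a b * X v (e' m) a b) = \<dots>" .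
  have 4: "(\<Sum>m=1..DIM('a). \<Sum>n=1..DIM('a). \<Sum>q=1..DIM('a). Y u (e' m) (e' n) (e' q) * Y v (e' m) (e' n) (e' q)) =
      (\<Sum>m=1..DIM('a). \<Sum>n=1..DIM('a). \<Sum>q=1..DIM('a). Y u (e m) (e n) (e q) * Y v (e m) (e n) (e q))"
    by (rule trace3[OF fr Y(2) Y(3) Y(4) Y(2) Y(3) Y(4)])
  let ?E = "Einstein_tensor N e Z H hs X Y c"
  have b1: "bilinear (\<lambda>u v. \<Sum>k=1..DIM('a). Z (e k) u v (e k))"
    by (rule bilinear_sumI, rule Z(2))
  have b2: "bilinear (\<lambda>u v. \<Sum>m=1..DIM('a). \<Sum>n=1..DIM('a). H [u, e m, e n] * H [v, e m, e n])"
    by (rule bilinear_sumI, rule bilinear_sumI, rule bilinear_prod[OF H(1) H(1)])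
  have b3: "bilinear (\<lambda>u v. \<Sum>m=1..DIM('a). \<Sum>a=1..N. \<Sum>b=1..N. X u (e m) a b * X v (e m) a b)"
    by (rule bilinear_sumI, rule bilinear_sumI, rule bilinear_sumI, rule bilinear_prod[OF X(1) X(1)])
  have b4: "bilinear (\<lambda>u v. \<Sum>m=1..DIM('a). \<Sum>n=1..DIM('a). \<Sum>q=1..DIM('a). Y u (e m) (e n) (e q) * Y v (e m) (e n) (e q))"
    by (rule bilinear_sumI, rule bilinear_sumI, rule bilinear_sumI, rule bilinear_prod[OF Y(1) Y(1)])
  have bil: "bilinear ?E"
    unfolding Einstein_tensor_def[abs_def]
    by (rule bilinear_minus[OF bilinear_plus[OF bilinear_minus[OF b1 bilinear_cmult[OF b2]] bilinear_cmult[OF hs]]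
          bilinear_cmult[OF bilinear_minus[OF b3 b4]]])
  have "?E (\<Sum>i=1..DIM('a). b u (e i) *\<^sub>R e i) (\<Sum>i=1..DIM('a). b v (e i) *\<^sub>R e i) =
      (\<Sum>i=1..DIM('a). \<Sum>j=1..DIM('a). b u (e i) * b v (e j) * ?E (e i) (e j))"
    by (rule bilinear_sum_expand[OF bil]) simp_all
  also have "\<dots> = 0" by (intro sum.neutral ballI) (simp add: zero)
  finally have "?E u v = 0" by (simp only: orthonormal_expand[OF b(1) e, symmetric])
  then show ?thesis unfolding Einstein_tensor_def 1 2 3 4 .
qed

subsection \<open>The Einstein tensor in an adapted frame\<close>

lemma instanton_comp:
  assumes ia: "instanton_at w e F" and lin: "linear (\<lambda>z. b z y :: real)"
    and W: "\<And>K. length K = 4 \<Longrightarrow> set K \<subseteq> {1..DIM('a)} \<Longrightarrow> w (map e K) = W K"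
    and mn: "m \<in> {1..DIM('a)}" "n \<in> {1..DIM('a)}"
  shows "(\<Sum>k\<in>{1..DIM('a)}. \<Sum>l\<in>{1..DIM('a)}. W [k,l,m,n] * b (F (e k) (e l) s) y) = - 2 * b (F (e m) (e (n::nat) :: 'a::euclidean_space) s) y"
proof -
  have "F (e m) (e n) s = - (1/2) *\<^sub>R (\<Sum>p=1..DIM('a). \<Sum>q=1..DIM('a). w [e p, e q, e m, e n] *\<^sub>R F (e p) (e q) s)"
    using ia mn unfolding instanton_at_def by blast
  also have "b \<dots> y = - (1/2) * (\<Sum>p=1..DIM('a). \<Sum>q=1..DIM('a). w [e p, e q, e m, e n] * b (F (e p) (e q) s) y)"
    unfolding linear_cmul[OF lin] linear_sum[OF lin] by simp
  also have "(\<Sum>p=1..DIM('a). \<Sum>q=1..DIM('a). w [e p, e q, e m, e n] * b (F (e p) (e q) s) y) =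
      (\<Sum>k\<in>{1..DIM('a)}. \<Sum>l\<in>{1..DIM('a)}. W [k,l,m,n] * b (F (e k) (e l) s) y)"
    by (rule sum.cong[OF refl], rule sum.cong[OF refl]) (use W[of "[p,q,m,n]" for p q] mn in simp)
  finally show ?thesis by simp
qed

text \<open>The components of 8 pi^2 p_1, by \<open>p1_form_expand\<close>.\<close>

definition cyclic_square :: "nat \<Rightarrow> ('a \<Rightarrow> 'a \<Rightarrow> nat \<Rightarrow> nat \<Rightarrow> real) \<Rightarrow> 'a \<Rightarrow> 'a \<Rightarrow> 'a \<Rightarrow> 'a \<Rightarrow> real" where
  "cyclic_square N X u v w x = (\<Sum>a=1..N. \<Sum>b=1..N. X u v a b * X w x a b + X u w a b * X x v a b + X u x a b * X v w a b)"

lemma cyclic_square_contraction: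
  fixes e :: "nat \<Rightarrow> 'a"
  assumes W: "skew 4 W" and X1: "\<And>u v a b. X v u a b = - X u v a b"
    and F2: "\<And>j k a b. j \<in> I \<Longrightarrow> k \<in> I \<Longrightarrow> a \<in> {1..N} \<Longrightarrow> b \<in> {1..N} \<Longrightarrow>
      (\<Sum>l\<in>I. \<Sum>m\<in>I. W [l,m,j,k] * X (e l) (e m) a b) = - 2 * X (e j) (e k) a b"
    and n: "n \<in> I"
  shows "S3 I (\<lambda>j k l. W [j,k,l,n]) (\<lambda>j k l. cyclic_square N X (e m) (e j) (e k) (e l)) =
    6 * (\<Sum>j\<in>I. \<Sum>a=1..N. \<Sum>b=1..N. X (e m) (e j) a b * X (e n) (e j) a b)"
proof -
  interpret alt3 I "\<lambda>v w x. W [v,w,x,n]" by (rule alt3_skew4[OF W])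
  show ?thesis unfolding cyclic_square_def
    by (rule quadratic_contraction[where F = "\<lambda>m n a b. X (e m) (e n) a b"]) (rule X1, rule F2[OF _ n])
qed

lemma S3_cmult_diff: "S3 I C (\<lambda>v w x. c * (f v w x - f' v w x)) = c * (S3 I C f - S3 I C f')"
  by (simp add: S3_def sum_subtractf right_diff_distrib left_diff_distrib sum_distrib_left mult_ac)

context riem_frame
begin

text \<open>Multiplying the contraction of dH by -1/12 gives c times the gauge square, because 2 c
  times 6/12 is c, minus c/6 times the contraction of the square of R. The gauge square cancels
  against the corresponding term of the Einstein tensor.\<close>

lemma einstein_residual:
  fixes Y :: "'a \<Rightarrow> 'a \<Rightarrow> 'a \<Rightarrow> 'a \<Rightarrow> real"
  assumes q: "q \<in> V" and hp: "heterotic_point DIM('a) W (\<lambda>a b c. H \<kappa> q [e q a, e q b, e q c])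
      (\<lambda>u a b c. nab \<kappa> \<Gamma> (H \<kappa>) q (e q u) [e q a, e q b, e q c])
      (\<lambda>i j k l. gq q (curvature \<kappa> \<Gamma> q (e q i) (e q j) (e q k)) (e q l)) R f
      (\<lambda>i j. hessian \<kappa> \<Gamma> \<phi> q (e q i) (e q j))"
    and W: "skew 4 W"
    and hsym: "\<And>b c. b \<in> {1..DIM('a)} \<Longrightarrow> c \<in> {1..DIM('a)} \<Longrightarrow>
      S3 {1..DIM('a)} (\<lambda>v w x. W [v,w,x,b]) (\<lambda>v w x. ext_d \<kappa> (H \<kappa>) q [e q c, e q v, e q w, e q x]) =
      S3 {1..DIM('a)} (\<lambda>v w x. W [v,w,x,c]) (\<lambda>v w x. ext_d \<kappa> (H \<kappa>) q [e q b, e q v, e q w, e q x])"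
    and dH: "\<And>u v w x. ext_d \<kappa> (H \<kappa>) q [u,v,w,x] =
      2 * c * (cyclic_square DIM('a) (\<lambda>u v a b. Y u v (e q a) (e q b)) u v w x - cyclic_square N X u v w x)"
    and X1: "\<And>u v a b. X v u a b = - X u v a b"
    and F2: "\<And>j k a b. j \<in> {1..DIM('a)} \<Longrightarrow> k \<in> {1..DIM('a)} \<Longrightarrow> a \<in> {1..N} \<Longrightarrow> b \<in> {1..N} \<Longrightarrow>
      (\<Sum>l\<in>{1..DIM('a)}. \<Sum>m\<in>{1..DIM('a)}. W [l,m,j,k] * X (e q l) (e q m) a b) = - 2 * X (e q j) (e q k) a b"
    and i: "i \<in> {1..DIM('a)}" and j: "j \<in> {1..DIM('a)}"
  shows "Einstein_tensor N (e q) (\<lambda>x u v y. gq q (curvature \<kappa> \<Gamma> q x u v) y) (H \<kappa> q) (hessian \<kappa> \<Gamma> \<phi> q) X Y c (e q i) (e q j) =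
    c * ((\<Sum>m=1..DIM('a). \<Sum>n=1..DIM('a). \<Sum>r=1..DIM('a). Y (e q i) (e q m) (e q n) (e q r) * Y (e q j) (e q m) (e q n) (e q r))
      - 1/6 * S3 {1..DIM('a)} (\<lambda>v w x. W [v,w,x,j])
          (\<lambda>v w x. cyclic_square DIM('a) (\<lambda>u v a b. Y u v (e q a) (e q b)) (e q i) (e q v) (e q w) (e q x)))"
proof -
  have 1: "(\<Sum>v\<in>{1..DIM('a)}. gq q (curvature \<kappa> \<Gamma> q (e q v) (e q i) (e q j)) (e q v))
      - 1/4 * (\<Sum>a\<in>{1..DIM('a)}. \<Sum>b\<in>{1..DIM('a)}. H \<kappa> q [e q i, e q a, e q b] * H \<kappa> q [e q j, e q a, e q b])
      + 2 * hessian \<kappa> \<Gamma> \<phi> q (e q i) (e q j) =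
      - 1/12 * S3 {1..DIM('a)} (\<lambda>v w x. W [v,w,x,j]) (\<lambda>v w x. ext_d \<kappa> (H \<kappa>) q [e q i, e q v, e q w, e q x])"
    unfolding ext_d_H[OF q]
    by (rule heterotic_point.einstein[OF hp i j hsym[OF i j, unfolded ext_d_H[OF q]]])
  have 2: "S3 {1..DIM('a)} (\<lambda>v w x. W [v,w,x,j]) (\<lambda>v w x. cyclic_square N X (e q i) (e q v) (e q w) (e q x)) =
      6 * (\<Sum>k\<in>{1..DIM('a)}. \<Sum>a=1..N. \<Sum>b=1..N. X (e q i) (e q k) a b * X (e q j) (e q k) a b)"
    by (rule cyclic_square_contraction[where X = X and e = "e q" and W = W and I = "{1..DIM('a)}" and N = N and n = j and m = i,
          OF W X1 F2 j])
  show ?thesis using 1 unfolding Einstein_tensor_def dH S3_cmult_diff 2 by algebra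
qed

lemma hessian_bilinear:
  assumes q: "q \<in> V" and s: "smooth_fun \<A> UNIV \<phi>"
  shows "bilinear (hessian \<kappa> \<Gamma> \<phi> q)"
proof -
  have d: "cdiff \<kappa> \<phi> q" by (rule smooth_fun_cdiff[OF s Vk[OF q] UNIV_I])
  have d2: "cdiff \<kappa> (\<lambda>q. cderiv \<kappa> \<phi> q y) q" for y by (rule smooth_fun_cdiff2[OF s open_UNIV Vk[OF q] UNIV_I])
  have l: "linear (\<lambda>u. hessian \<kappa> \<Gamma> \<phi> q u v)" for v
    unfolding hessian_def
    by (rule linear_compose_sub[OF linear_cderiv[OF d2] linear_compose[OF \<Gamma>_lin(1)[OF q] linear_cderiv[OF d], unfolded o_def]])
  have "linear (\<lambda>v. hessian \<kappa> \<Gamma> \<phi> q u v)" for u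
  proof -
    have e: "(\<lambda>v. hessian \<kappa> \<Gamma> \<phi> q u v) = (\<lambda>v. hessian \<kappa> \<Gamma> \<phi> q v u)"
      by (rule ext) (rule hessian_sym[OF q s])
    show ?thesis by (subst e) (rule l)
  qed
  with l show ?thesis unfolding bilinear_def by blast
qed

end

lemma (in chart_at) curvature_scalar_linear:
  fixes A :: "'m \<Rightarrow> 'a \<Rightarrow> 'f::euclidean_space \<Rightarrow> 'f"
  assumes V: "open V" "p \<in> V" "p \<in> fst \<kappa>"
    and bil: "\<And>q. q \<in> fst \<kappa> \<inter> V \<Longrightarrow> bilinear (A q)" and d: "\<And>w y. cdiff \<kappa> (\<lambda>q. A q w y) p"
    and b: "bilinear b"
  shows "linear (\<lambda>u. b (curvature \<kappa> A p u v s) y)" "linear (\<lambda>v. b (curvature \<kappa> A p u v s) y)"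
    "linear (\<lambda>s. b (curvature \<kappa> A p u v s) y)" "linear (\<lambda>y. b (curvature \<kappa> A p u v s) y :: real)"
    "b (curvature \<kappa> A p v u s) y = - b (curvature \<kappa> A p u v s) y"
proof -
  have l: "linear (\<lambda>z. b z y)" using b by (simp add: bilinear_def)
  note c = curvature_linear[OF V bil d]
  show "linear (\<lambda>u. b (curvature \<kappa> A p u v s) y)" by (rule linear_compose[OF c(4) l, unfolded o_def])
  show "linear (\<lambda>v. b (curvature \<kappa> A p u v s) y)" by (rule linear_compose[OF c(2) l, unfolded o_def])
  show "linear (\<lambda>s. b (curvature \<kappa> A p u v s) y)" by (rule linear_compose[OF c(1) l, unfolded o_def])
  show "linear (\<lambda>y. b (curvature \<kappa> A p u v s) y)" using b by (simp add: bilinear_def)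
  show "b (curvature \<kappa> A p v u s) y = - b (curvature \<kappa> A p u v s) y"
  proof -
    have "curvature \<kappa> A p v u s = - curvature \<kappa> A p u v s" by (rule c(3))
    then show ?thesis by (simp add: linear_neg[OF l])
  qed
qed

section \<open>From pointwise identities to statements on the manifold\<close>

locale heterotic =
  fixes \<A> :: "('m::{t2_space, second_countable_topology}, 'a::euclidean_space) chart set"
    and g :: "('m, 'a) chart \<Rightarrow> 'm \<Rightarrow> 'a \<Rightarrow> 'a \<Rightarrow> real"
    and H :: "('m, 'a) chart \<Rightarrow> 'm \<Rightarrow> 'a list \<Rightarrow> real"
    and \<phi> :: "'m \<Rightarrow> real"
    and J :: "'j set" and U :: "'j \<Rightarrow> 'm set"
    and t :: "'j \<Rightarrow> 'j \<Rightarrow> 'm \<Rightarrow> 'f \<Rightarrow> 'f::euclidean_space"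
    and h :: "'j \<Rightarrow> 'm \<Rightarrow> 'f \<Rightarrow> 'f \<Rightarrow> real"
    and A :: "('m, 'a) chart \<Rightarrow> 'j \<Rightarrow> 'm \<Rightarrow> 'a \<Rightarrow> 'f \<Rightarrow> 'f"
    and LC N :: "('m, 'a) chart \<Rightarrow> ('m, 'a) chart \<Rightarrow> 'm \<Rightarrow> 'a \<Rightarrow> 'a \<Rightarrow> 'a"
    and \<alpha>' :: real
  assumes atlas: "smooth_atlas \<A>"
    and metric: "riemannian_metric \<A> g"
    and lc: "levi_civita \<A> g LC"
    and phi: "smooth_fun \<A> UNIV \<phi>"
    and sH: "smooth_form \<A> 3 H"
    and vb: "vector_bundle \<A> J U t"
    and fm: "fibre_metric \<A> J U t h"
    and mc: "metric_connection \<A> J U t h A"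
    and N: "metric_connection_TM \<A> g N"
    and \<alpha>': "\<alpha>' > 0"
    and anomaly: "anomaly_cancellation \<A> g H N J U h A \<alpha>'"
begin

lemma chart_atI: "\<kappa> \<in> \<A> \<Longrightarrow> chart_at \<A> \<kappa>"
  using atlas by (simp add: chart_at_def)

lemma riem_frameI: "adapted_frame std k \<A> g S \<kappa> V e \<Longrightarrow> riem_frame \<A> \<kappa> g LC H V e"
  using chart_atI[of \<kappa>] metric lc sH by (simp add: adapted_frame_def riem_frame_def riem_frame_axioms_def)

lemma U_open: "\<forall>j\<in>J. open (U j)" using vb by (simp add: vector_bundle_def)

lemma atlas_open: "\<forall>\<kappa>\<in>\<A>. open (fst \<kappa>)"
  using atlas unfolding smooth_atlas_def by auto

lemma gauge_curvature:
  assumes \<kappa>: "\<kappa> \<in> \<A>" and j: "j \<in> J" and p: "p \<in> fst \<kappa> \<inter> U j"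
  shows "linear (\<lambda>u. h j p (curvature \<kappa> (A \<kappa> j) p u v s) y)" "linear (\<lambda>v. h j p (curvature \<kappa> (A \<kappa> j) p u v s) y)"
    "h j p (curvature \<kappa> (A \<kappa> j) p v u s) y = - h j p (curvature \<kappa> (A \<kappa> j) p u v s) y"
    "h j p (curvature \<kappa> (A \<kappa> j) p u v y) s = - h j p (curvature \<kappa> (A \<kappa> j) p u v s) y"
    "bilinear (h j p)" "h j p y s = h j p s y" "s \<noteq> 0 \<Longrightarrow> h j p s s > 0"
proof -
  interpret chart_at \<A> \<kappa> by (rule chart_atI[OF \<kappa>])
  note f = bundle_facts[OF U_open fm mc j]
  have bil: "bilinear (A \<kappa> j q)" if "q \<in> fst \<kappa> \<inter> (fst \<kappa> \<inter> U j)" for q using f(5) that by simp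
  have d: "cdiff \<kappa> (\<lambda>q. A \<kappa> j q w y) p" for w y by (rule smooth_fun_cdiff[OF f(6)]) (use p in simp_all)
  show b: "bilinear (h j p)" by (rule f(1)[OF p])
  show sy: "h j p y s = h j p s y" for y s using f(2)[of p] p by simp
  show "s \<noteq> 0 \<Longrightarrow> h j p s s > 0" using f(3)[of p] p by simp
  note c = curvature_scalar_linear[OF f(8) p _ bil d b]
  show "linear (\<lambda>u. h j p (curvature \<kappa> (A \<kappa> j) p u v s) y)" by (rule c(1)) (use p in simp_all)
  show "linear (\<lambda>v. h j p (curvature \<kappa> (A \<kappa> j) p u v s) y)" by (rule c(2)) (use p in simp_all)
  show "h j p (curvature \<kappa> (A \<kappa> j) p v u s) y = - h j p (curvature \<kappa> (A \<kappa> j) p u v s) y" by (rule c(5)) (use p in simp_all)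
  show "h j p (curvature \<kappa> (A \<kappa> j) p u v y) s = - h j p (curvature \<kappa> (A \<kappa> j) p u v s) y"
    using curvature_skew[OF U_open fm mc j p, of u v y s] sy[of y] by simp
qed

lemma tangent_curvature:
  assumes \<kappa>: "\<kappa> \<in> \<A>" and p: "p \<in> fst \<kappa>" and M: "metric_connection_TM \<A> g M"
  shows "linear (\<lambda>u. g \<kappa> p (curvature \<kappa> (M \<kappa> \<kappa>) p u v s) y)" "linear (\<lambda>v. g \<kappa> p (curvature \<kappa> (M \<kappa> \<kappa>) p u v s) y)"
    "linear (\<lambda>s. g \<kappa> p (curvature \<kappa> (M \<kappa> \<kappa>) p u v s) y)" "linear (\<lambda>y. g \<kappa> p (curvature \<kappa> (M \<kappa> \<kappa>) p u v s) y)"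
    "g \<kappa> p (curvature \<kappa> (M \<kappa> \<kappa>) p v u s) y = - g \<kappa> p (curvature \<kappa> (M \<kappa> \<kappa>) p u v s) y"
    "g \<kappa> p (curvature \<kappa> (M \<kappa> \<kappa>) p u v y) s = - g \<kappa> p (curvature \<kappa> (M \<kappa> \<kappa>) p u v s) y"
    "bilinear (g \<kappa> p)" "g \<kappa> p y s = g \<kappa> p s y"
proof -
  interpret chart_at \<A> \<kappa> by (rule chart_atI[OF \<kappa>])
  note f = bundle_facts[OF atlas_open metric M \<kappa>]
  have p2: "p \<in> fst \<kappa> \<inter> fst \<kappa>" using p by simp
  have bil: "bilinear (M \<kappa> \<kappa> q)" if "q \<in> fst \<kappa> \<inter> (fst \<kappa> \<inter> fst \<kappa>)" for q using f(5) that by simp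
  have d: "cdiff \<kappa> (\<lambda>q. M \<kappa> \<kappa> q w y) p" for w y by (rule smooth_fun_cdiff[OF f(6)]) (use p in simp_all)
  show b: "bilinear (g \<kappa> p)" by (rule f(1)[OF p2])
  show sy: "g \<kappa> p y s = g \<kappa> p s y" for y s using f(2)[of p] p by simp
  note c = curvature_scalar_linear[OF f(8) p2 p bil d b]
  show "linear (\<lambda>u. g \<kappa> p (curvature \<kappa> (M \<kappa> \<kappa>) p u v s) y)" by (rule c(1)) simp_all
  show "linear (\<lambda>v. g \<kappa> p (curvature \<kappa> (M \<kappa> \<kappa>) p u v s) y)" by (rule c(2)) simp_all
  show "linear (\<lambda>s. g \<kappa> p (curvature \<kappa> (M \<kappa> \<kappa>) p u v s) y)" by (rule c(3)) simp_all
  show "linear (\<lambda>y. g \<kappa> p (curvature \<kappa> (M \<kappa> \<kappa>) p u v s) y)" by (rule c(4)) simp_all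
  show "g \<kappa> p (curvature \<kappa> (M \<kappa> \<kappa>) p v u s) y = - g \<kappa> p (curvature \<kappa> (M \<kappa> \<kappa>) p u v s) y" by (rule c(5)) simp_all
  show "g \<kappa> p (curvature \<kappa> (M \<kappa> \<kappa>) p u v y) s = - g \<kappa> p (curvature \<kappa> (M \<kappa> \<kappa>) p u v s) y"
    using curvature_skew[OF atlas_open metric M \<kappa> p2, of u v y s] sy[of y] by simp
qed

abbreviation "gaugeF \<kappa> l p f \<equiv> (\<lambda>u v a b. h l p (curvature \<kappa> (A \<kappa> l) p u v (f a)) (f b))"
abbreviation "tangentR \<kappa> p \<equiv> (\<lambda>u v w x. g \<kappa> p (curvature \<kappa> (N \<kappa> \<kappa>) p u v w) x)"
abbreviation "Einstein_at \<kappa> l p e f \<equiv> Einstein_tensor DIM('f) e (\<lambda>x u v y. g \<kappa> p (curvature \<kappa> (LC \<kappa> \<kappa>) p x u v) y) (H \<kappa> p)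
  (hessian \<kappa> (LC \<kappa> \<kappa>) \<phi> p) (gaugeF \<kappa> l p f) (tangentR \<kappa> p) (\<alpha>'/8)"

lemma Einstein_equation_iff:
  "Einstein_equation \<A> g LC \<phi> H N J U h A \<alpha>' \<longleftrightarrow>
     (\<forall>\<kappa>\<in>\<A>. \<forall>l\<in>J. \<forall>p\<in>fst \<kappa> \<inter> U l. \<forall>e f. orthonormal (g \<kappa> p) e \<longrightarrow> orthonormal (h l p) f \<longrightarrow>
       (\<forall>i\<in>{1..DIM('a)}. \<forall>j\<in>{1..DIM('a)}. Einstein_at \<kappa> l p e f (e i) (e j) = 0))"
  unfolding Einstein_equation_def Einstein_tensor_def comps_def ricci_def Let_def ..

text \<open>The constants combine as 2 pi^2 alpha' / (8 pi^2) = alpha'/4 = 2 (alpha'/8).\<close>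

lemma anomaly_at:
  assumes \<kappa>: "\<kappa> \<in> \<A>" and j: "j \<in> J" and p: "p \<in> fst \<kappa> \<inter> U j"
    and e: "orthonormal (g \<kappa> p) e" and f: "orthonormal (h j p) f"
  shows "ext_d \<kappa> (H \<kappa>) p [u,v,w,x] = 2 * (\<alpha>'/8) * (cyclic_square DIM('a) (\<lambda>u v a b. tangentR \<kappa> p u v (e a) (e b)) u v w x
    - cyclic_square DIM('f) (gaugeF \<kappa> j p f) u v w x)"
proof -
  have p': "p \<in> fst \<kappa>" using p by simp
  have "ext_d \<kappa> (H \<kappa>) p [u,v,w,x] = 2 * pi\<^sup>2 * \<alpha>' *
      (p1_form (g \<kappa> p) e (curvature \<kappa> (N \<kappa> \<kappa>) p) [u,v,w,x] - p1_form (h j p) f (curvature \<kappa> (A \<kappa> j) p) [u,v,w,x])"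
    using anomaly \<kappa> j p e f unfolding anomaly_cancellation_def by simp
  also have "p1_form (g \<kappa> p) e (curvature \<kappa> (N \<kappa> \<kappa>) p) [u,v,w,x] =
      1 / (8 * pi\<^sup>2) * cyclic_square DIM('a) (\<lambda>u v a b. tangentR \<kappa> p u v (e a) (e b)) u v w x"
    unfolding cyclic_square_def
    by (rule p1_form_expand) (rule tangent_curvature(5)[OF \<kappa> p' N], rule tangent_curvature(6)[OF \<kappa> p' N])
  also have "p1_form (h j p) f (curvature \<kappa> (A \<kappa> j) p) [u,v,w,x] =
      1 / (8 * pi\<^sup>2) * cyclic_square DIM('f) (gaugeF \<kappa> j p f) u v w x"
    unfolding cyclic_square_def
    by (rule p1_form_expand) (rule gauge_curvature(3)[OF \<kappa> j p], rule gauge_curvature(4)[OF \<kappa> j p])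
  also have "2 * pi\<^sup>2 * \<alpha>' * (1 / (8 * pi\<^sup>2) * y - 1 / (8 * pi\<^sup>2) * x) = 2 * (\<alpha>'/8) * (y - x)" for x y
  proof -
    have "2 * k * \<alpha>' * (1 / (8 * k) * y - 1 / (8 * k) * x) = 2 * (\<alpha>'/8) * (y - x)" if "k \<noteq> 0" for k :: real
      using that by (simp add: field_simps)
    then show ?thesis by simp
  qed
  finally show ?thesis .
qed

text \<open>The sign in \<Psi> = -W cancels the minus sign on the other side of the curvature
  identity.\<close>

lemma curvature_identity_iff:
  assumes W: "\<forall>K. length K = 4 \<longrightarrow> set K \<subseteq> {1..DIM('a)} \<longrightarrow> w (map e K) = W K"
  shows "curvature_identity_at (g \<kappa> p) (\<lambda>vs. - w vs) e (curvature \<kappa> (N \<kappa> \<kappa>) p) \<longleftrightarrow>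
    (\<forall>i\<in>{1..DIM('a)}. \<forall>j\<in>{1..DIM('a)}.
      (\<Sum>m=1..DIM('a). \<Sum>n=1..DIM('a). \<Sum>r=1..DIM('a). tangentR \<kappa> p (e i) (e m) (e n) (e r) * tangentR \<kappa> p (e j) (e m) (e n) (e r))
      = 1/6 * S3 {1..DIM('a)} (\<lambda>v w x. W [v,w,x,j])
          (\<lambda>v w x. cyclic_square DIM('a) (\<lambda>u v a b. tangentR \<kappa> p u v (e a) (e b)) (e i) (e v) (e w) (e x)))"
proof -
  let ?R = "comps (g \<kappa> p) e e (curvature \<kappa> (N \<kappa> \<kappa>) p)"
  have 1: "(\<Sum>j=1..DIM('a). \<Sum>k=1..DIM('a). \<Sum>l=1..DIM('a).
      (\<Sum>a=1..DIM('a). \<Sum>c=1..DIM('a). ?R i j a c * ?R k l a c + ?R i k a c * ?R l j a c + ?R i l a c * ?R j k a c)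
        * - w [e j, e k, e l, e n]) =
      - S3 {1..DIM('a)} (\<lambda>v w x. W [v,w,x,n])
          (\<lambda>v w x. cyclic_square DIM('a) (\<lambda>u v a b. tangentR \<kappa> p u v (e a) (e b)) (e i) (e v) (e w) (e x))"
    if n: "n \<in> {1..DIM('a)}" for i n
    unfolding S3_def sum_negf[symmetric]
  proof (rule sum.cong[OF refl], rule sum.cong[OF refl], rule sum.cong[OF refl])
    fix j k l assume jkl: "j \<in> {1..DIM('a)}" "k \<in> {1..DIM('a)}" "l \<in> {1..DIM('a)}"
    have "w (map e [j,k,l,n]) = W [j,k,l,n]" by (rule W[rule_format]) (use jkl n in simp_all)
    then have wW: "w [e j, e k, e l, e n] = W [j,k,l,n]" by (simp only: list.map)
    show "(\<Sum>a=1..DIM('a). \<Sum>c=1..DIM('a). ?R i j a c * ?R k l a c + ?R i k a c * ?R l j a c + ?R i l a c * ?R j k a c)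
        * - w [e j, e k, e l, e n] =
      - (cyclic_square DIM('a) (\<lambda>u v a b. tangentR \<kappa> p u v (e a) (e b)) (e i) (e j) (e k) (e l) * W [j,k,l,n])"
      unfolding wW cyclic_square_def comps_def by (rule mult_minus_right)
  qed
  show ?thesis
    unfolding curvature_identity_at_def Let_def
    by (rule ball_cong[OF refl], rule ball_cong[OF refl], simp only: 1, unfold comps_def, argo)
qed

text \<open>Both geometries enter only through these data: the adapted frames \<open>Fr\<close>, the
  structure 4-form \<open>w\<close>, its constant components \<open>W\<close>, and the pointwise
  facts about them.\<close>

context
  fixes Fr :: "('m, 'a) chart \<Rightarrow> 'm set \<Rightarrow> ('m \<Rightarrow> nat \<Rightarrow> 'a) \<Rightarrow> bool"
    and w :: "('m, 'a) chart \<Rightarrow> ('m \<Rightarrow> nat \<Rightarrow> 'a) \<Rightarrow> 'm \<Rightarrow> 'a list \<Rightarrow> real" and W :: "nat list \<Rightarrow> real"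
  assumes cover: "\<And>\<kappa> p. \<kappa> \<in> \<A> \<Longrightarrow> p \<in> fst \<kappa> \<Longrightarrow> \<exists>V e. p \<in> V \<and> Fr \<kappa> V e"
    and fr: "\<And>\<kappa> V e. Fr \<kappa> V e \<Longrightarrow> riem_frame \<A> \<kappa> g LC H V e"
    and w: "\<And>\<kappa> V e q K. Fr \<kappa> V e \<Longrightarrow> q \<in> V \<Longrightarrow> length K = 4 \<Longrightarrow> set K \<subseteq> {1..DIM('a)} \<Longrightarrow> w \<kappa> e q (map (e q) K) = W K"
    and W: "skew 4 W"
    and inst: "\<And>\<kappa> V e j q. Fr \<kappa> V e \<Longrightarrow> j \<in> J \<Longrightarrow> q \<in> V \<inter> U j \<Longrightarrow> instanton_at (w \<kappa> e q) (e q) (curvature \<kappa> (A \<kappa> j) q)"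
    and hp: "\<And>\<kappa> V e q. Fr \<kappa> V e \<Longrightarrow> q \<in> V \<Longrightarrow> \<exists>R. heterotic_point DIM('a) W (\<lambda>a b c. H \<kappa> q [e q a, e q b, e q c])
      (\<lambda>u a b c. nab \<kappa> (LC \<kappa> \<kappa>) (H \<kappa>) q (e q u) [e q a, e q b, e q c])
      (\<lambda>i j k l. g \<kappa> q (curvature \<kappa> (LC \<kappa> \<kappa>) q (e q i) (e q j) (e q k)) (e q l)) R (\<lambda>i. cderiv \<kappa> \<phi> q (e q i))
      (\<lambda>i j. hessian \<kappa> (LC \<kappa> \<kappa>) \<phi> q (e q i) (e q j))"
    and hsym: "\<And>\<kappa> V e q b c. Fr \<kappa> V e \<Longrightarrow> q \<in> V \<Longrightarrow> b \<in> {1..DIM('a)} \<Longrightarrow> c \<in> {1..DIM('a)} \<Longrightarrow>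
      S3 {1..DIM('a)} (\<lambda>v w x. W [v,w,x,b]) (\<lambda>v w x. ext_d \<kappa> (H \<kappa>) q [e q c, e q v, e q w, e q x]) =
      S3 {1..DIM('a)} (\<lambda>v w x. W [v,w,x,c]) (\<lambda>v w x. ext_d \<kappa> (H \<kappa>) q [e q b, e q v, e q w, e q x])"
begin

lemma w': "Fr \<kappa> V e \<Longrightarrow> q \<in> V \<Longrightarrow> \<forall>K. length K = 4 \<longrightarrow> set K \<subseteq> {1..DIM('a)} \<longrightarrow> w \<kappa> e q (map (e q) K) = W K"
  by (intro allI impI) (rule w)

lemma Einstein_residual:
  assumes F: "Fr \<kappa> V e" and q: "q \<in> V" and l: "l \<in> J" "q \<in> U l" and f: "orthonormal (h l q) f"
    and i: "i \<in> {1..DIM('a)}" and j: "j \<in> {1..DIM('a)}"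
  shows "Einstein_at \<kappa> l q (e q) f (e q i) (e q j) =
    \<alpha>'/8 * ((\<Sum>m=1..DIM('a). \<Sum>n=1..DIM('a). \<Sum>r=1..DIM('a).
        tangentR \<kappa> q (e q i) (e q m) (e q n) (e q r) * tangentR \<kappa> q (e q j) (e q m) (e q n) (e q r))
      - 1/6 * S3 {1..DIM('a)} (\<lambda>v w x. W [v,w,x,j])
          (\<lambda>v w x. cyclic_square DIM('a) (\<lambda>u v a b. tangentR \<kappa> q u v (e q a) (e q b)) (e q i) (e q v) (e q w) (e q x)))"
proof -
  interpret riem_frame \<A> \<kappa> g LC H V e by (rule fr[OF F])
  have \<kappa>: "\<kappa> \<in> \<A>" by (rule chart)
  have p: "q \<in> fst \<kappa> \<inter> U l" using Vk[OF q] l by simp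
  obtain R where R: "heterotic_point DIM('a) W (\<lambda>a b c. H \<kappa> q [e q a, e q b, e q c])
      (\<lambda>u a b c. nab \<kappa> (LC \<kappa> \<kappa>) (H \<kappa>) q (e q u) [e q a, e q b, e q c])
      (\<lambda>i j k l. g \<kappa> q (curvature \<kappa> (LC \<kappa> \<kappa>) q (e q i) (e q j) (e q k)) (e q l)) R (\<lambda>i. cderiv \<kappa> \<phi> q (e q i))
      (\<lambda>i j. hessian \<kappa> (LC \<kappa> \<kappa>) \<phi> q (e q i) (e q j))" using hp[OF F q] by (rule exE)
  have lin: "linear (\<lambda>z. h l q z y)" for y using gauge_curvature(5)[OF \<kappa> l(1) p] by (simp add: bilinear_def)
  have ia: "instanton_at (w \<kappa> e q) (e q) (curvature \<kappa> (A \<kappa> l) q)" by (rule inst[OF F l(1)]) (use q l in simp)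
  show ?thesis
    by (rule einstein_residual[where W = W and X = "gaugeF \<kappa> l q f" and Y = "tangentR \<kappa> q" and N = "DIM('f)" and c = "\<alpha>'/8",
          OF q R W hsym[OF F q] anomaly_at[OF \<kappa> l(1) p oe[OF q] f] gauge_curvature(3)[OF \<kappa> l(1) p]
          instanton_comp[where w = "w \<kappa> e q" and e = "e q" and F = "curvature \<kappa> (A \<kappa> l) q" and b = "h l q" and W = W,
            OF ia lin w[OF F q]] i j])
qed

text \<open>In adapted frames the Einstein tensor is alpha'/8 times the defect of the curvature
  identity, and alpha' is positive.\<close>

lemma heterotic_equivalence:
  "Einstein_equation \<A> g LC \<phi> H N J U h A \<alpha>' \<longleftrightarrow> (\<forall>\<kappa> V e. Fr \<kappa> V e \<longrightarrow> (\<forall>p\<in>V.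
     curvature_identity_at (g \<kappa> p) (\<lambda>vs. - w \<kappa> e p vs) (e p) (curvature \<kappa> (N \<kappa> \<kappa>) p)))" (is "?E \<longleftrightarrow> ?I")
proof
  assume E: ?E
  show ?I
  proof (intro allI impI ballI)
    fix \<kappa> V e p assume F: "Fr \<kappa> V e" and p: "p \<in> V"
    interpret riem_frame \<A> \<kappa> g LC H V e by (rule fr[OF F])
    have "p \<in> (\<Union>j\<in>J. U j)" using vb by (simp add: vector_bundle_def)
    then obtain l where l: "l \<in> J" "p \<in> U l" by blast
    have pl: "p \<in> fst \<kappa> \<inter> U l" using Vk[OF p] l by simp
    note gc = gauge_curvature(5-7)[OF chart l(1) pl]
    \<comment> \<open>The Einstein equation is quantified over fibre frames, so one must exist
      before anything can be extracted from it.\<close>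
    obtain f where f: "orthonormal (h l p) f" using orthonormal_exists[OF gc] by (rule exE)
    show "curvature_identity_at (g \<kappa> p) (\<lambda>vs. - w \<kappa> e p vs) (e p) (curvature \<kappa> (N \<kappa> \<kappa>) p)"
    proof (rule curvature_identity_iff[THEN iffD2, OF w'[OF F p]], intro ballI)
      fix i j assume ij: "i \<in> {1..DIM('a)}" "j \<in> {1..DIM('a)}"
      have "Einstein_at \<kappa> l p (e p) f (e p i) (e p j) = 0"
        using E[unfolded Einstein_equation_iff] chart l(1) pl oe[OF p] f ij by blast
      then show "(\<Sum>m=1..DIM('a). \<Sum>n=1..DIM('a). \<Sum>r=1..DIM('a).
          tangentR \<kappa> p (e p i) (e p m) (e p n) (e p r) * tangentR \<kappa> p (e p j) (e p m) (e p n) (e p r))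
        = 1/6 * S3 {1..DIM('a)} (\<lambda>v w x. W [v,w,x,j])
          (\<lambda>v w x. cyclic_square DIM('a) (\<lambda>u v a b. tangentR \<kappa> p u v (e p a) (e p b)) (e p i) (e p v) (e p w) (e p x))"
        unfolding Einstein_residual[OF F p l f ij] using \<alpha>' by simp
    qed
  qed
next
  assume I: ?I
  show ?E
    unfolding Einstein_equation_iff
  proof (intro ballI allI impI)
    fix \<kappa> l p e' f i j
    assume \<kappa>: "\<kappa> \<in> \<A>" and l: "l \<in> J" and pl: "p \<in> fst \<kappa> \<inter> U l" and e': "orthonormal (g \<kappa> p) e'" and f: "orthonormal (h l p) f"
    obtain V e where p: "p \<in> V" and F: "Fr \<kappa> V e" using cover[OF \<kappa>, of p] pl by blast
    interpret riem_frame \<A> \<kappa> g LC H V e by (rule fr[OF F])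
    have pk: "p \<in> fst \<kappa>" "p \<in> U l" using pl by simp_all
    have "curvature_identity_at (g \<kappa> p) (\<lambda>vs. - w \<kappa> e p vs) (e p) (curvature \<kappa> (N \<kappa> \<kappa>) p)" using I F p by blast
    note id = curvature_identity_iff[THEN iffD1, OF w'[OF F p] this, rule_format]
    have zero: "Einstein_at \<kappa> l p (e p) f (e p i) (e p j) = 0" if "i \<in> {1..DIM('a)}" "j \<in> {1..DIM('a)}" for i j
      unfolding Einstein_residual[OF F p l pk(2) f that] id[OF that] by simp
    note r = tangent_curvature[OF \<kappa> pk(1) N] and z = tangent_curvature[OF \<kappa> pk(1) lc_metric]
    have Z: "bilinear (\<lambda>x y. g \<kappa> p (curvature \<kappa> (LC \<kappa> \<kappa>) p x v w) y)"
      "bilinear (\<lambda>v w. g \<kappa> p (curvature \<kappa> (LC \<kappa> \<kappa>) p x v w) y)" for v w x y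
      unfolding bilinear_def by (intro conjI allI z)+
    show "Einstein_at \<kappa> l p e' f (e' i) (e' j) = 0"
      by (rule Einstein_tensor_zero[OF g_bil[OF p] g_sym[OF p] oe[OF p] e' Z H_lin[OF p] hessian_bilinear[OF p phi]
            gauge_curvature(1,2)[OF \<kappa> l pl] r(1,2,3,4) zero])
  qed
qed

text \<open>For an instanton R the contraction of its square is 6 R R, just as for the gauge
  field.\<close>

lemma instanton_curvature_identity:
  assumes RI: "\<And>\<kappa> V e p. Fr \<kappa> V e \<Longrightarrow> p \<in> V \<Longrightarrow> instanton_at (w \<kappa> e p) (e p) (curvature \<kappa> (N \<kappa> \<kappa>) p)"
    and F: "Fr \<kappa> V e" and p: "p \<in> V"
  shows "curvature_identity_at (g \<kappa> p) (\<lambda>vs. - w \<kappa> e p vs) (e p) (curvature \<kappa> (N \<kappa> \<kappa>) p)"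
proof (rule curvature_identity_iff[THEN iffD2, OF w'[OF F p]], intro ballI)
  fix i j assume ij: "i \<in> {1..DIM('a)}" "j \<in> {1..DIM('a)}"
  interpret riem_frame \<A> \<kappa> g LC H V e by (rule fr[OF F])
  have lin: "linear (\<lambda>z. g \<kappa> p z y)" for y by (rule g_lin(1)[OF p])
  note r = tangent_curvature[OF chart Vk[OF p] N]
  show "(\<Sum>m=1..DIM('a). \<Sum>n=1..DIM('a). \<Sum>r=1..DIM('a).
      tangentR \<kappa> p (e p i) (e p m) (e p n) (e p r) * tangentR \<kappa> p (e p j) (e p m) (e p n) (e p r))
    = 1/6 * S3 {1..DIM('a)} (\<lambda>v w x. W [v,w,x,j])
      (\<lambda>v w x. cyclic_square DIM('a) (\<lambda>u v a b. tangentR \<kappa> p u v (e p a) (e p b)) (e p i) (e p v) (e p w) (e p x))"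
    by (subst cyclic_square_contraction[where X = "\<lambda>u v a b. tangentR \<kappa> p u v (e p a) (e p b)" and e = "e p" and W = W and I = "{1..DIM('a)}",
          OF W r(5) instanton_comp[where w = "w \<kappa> e p" and e = "e p" and F = "curvature \<kappa> (N \<kappa> \<kappa>) p" and b = "g \<kappa> p" and W = W,
            OF RI[OF F p] lin w[OF F p]] ij(2)]) simp_all
qed

end

end

subsection \<open>Hodge stars in adapted frames\<close>

lemma sum_idx1: "(\<Sum>I\<in>idx n 1. f I) = (\<Sum>x=1..n. f [x])"
  by (simp add: sum_idx_Suc sum_idx_0)

lemma sum_idx3: "(\<Sum>I\<in>idx n 3. f I) = (\<Sum>x=1..n. \<Sum>y=1..n. \<Sum>z=1..n. f [x,y,z])"
  by (simp add: numeral_3_eq_3 sum_idx_Suc sum_idx_0)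

context frame
begin

text \<open>Both sides are skew, so increasing lists suffice; there the star is the single term
  belonging to the increasing complement.\<close>

lemma hodge_star_eqI:
  assumes kl: "k + l = DIM('a)" and \<beta>: "skew k \<beta>" "\<And>I. length I = k \<Longrightarrow> set I \<subseteq> {1..DIM('a)} \<Longrightarrow> \<alpha> (map e I) = \<beta> I"
    and \<delta>: "skew l \<delta>"
    and c: "\<And>L. length L = l \<Longrightarrow> sorted L \<Longrightarrow> distinct L \<Longrightarrow> set L \<subseteq> {1..DIM('a)} \<Longrightarrow>
      eps DIM('a) (filter (\<lambda>x. x \<notin> set L) [1..<Suc DIM('a)] @ L) * \<beta> (filter (\<lambda>x. x \<notin> set L) [1..<Suc DIM('a)]) = \<delta> L"
    and L: "length L = l" "set L \<subseteq> {1..DIM('a)}"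
  shows "hodge b e k \<alpha> (map e L) = \<delta> L"
proof -
  have hs: "skew l (\<lambda>L. hodge b e k \<alpha> (map e L))"
  proof (rule skewI_adjacent)
    fix xs zs :: "nat list" and y x assume "Suc (Suc (length xs + length zs)) = l"
    then show "hodge b e k \<alpha> (map e (xs @ y # x # zs)) = - hodge b e k \<alpha> (map e (xs @ x # y # zs))"
      using skew_swap[OF hodge_skew[OF kl], of "map e xs" "map e zs" \<alpha> "e y" "e x"] by simp
  qed
  have "hodge b e k \<alpha> (map e L) - \<delta> L = 0"
  proof (rule skew_zero_sorted[OF skew_diff[OF hs \<delta>] _ L])
    fix L :: "nat list" assume L: "length L = l" "sorted L" "distinct L" "set L \<subseteq> {1..DIM('a)}"
    let ?J = "filter (\<lambda>x. x \<notin> set L) [1..<Suc DIM('a)]"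
    have sJ: "set ?J = {1..DIM('a)} - set L" by (auto simp del: upt_Suc)
    then have s: "set (?J @ L) = {1..DIM('a)}" using L(4) unfolding set_append by blast
    have "length ?J = card (set ?J)" by (rule distinct_card[symmetric]) (rule distinct_filter, rule distinct_upt)
    also have "\<dots> = DIM('a) - l"
      unfolding sJ using L by (subst card_Diff_subset) (simp_all add: distinct_card)
    finally have len: "length ?J = k" using kl by simp
    show "hodge b e k \<alpha> (map e L) - \<delta> L = 0"
      using hodge_complement[where \<alpha> = \<alpha>, OF \<beta> len s] c[OF L] kl L(1) by simp
  qed
  then show ?thesis by simp
qed

lemma hodge_wedge1:
  assumes "m = 1 + l" and "1 + l + length K = DIM('a)" and "set K \<subseteq> {1..DIM('a)}"
  shows "hodge b e m (wedge 1 l \<alpha> \<beta>) (map e K) = (-1) ^ l * (\<Sum>x=1..DIM('a). \<alpha> [e x] * hodge b e l \<beta> (map e (x # K)))"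
  using hodge_wedge[OF assms(2,3), of \<alpha> \<beta>, unfolded sum_idx1] unfolding assms(1) by simp

lemma hodge_wedge3:
  assumes "m = 3 + l" and "3 + l + length K = DIM('a)" and "set K \<subseteq> {1..DIM('a)}"
  shows "hodge b e m (wedge 3 l \<alpha> \<beta>) (map e K) = (-1) ^ (3 * l) / 6 *
    (\<Sum>x=1..DIM('a). \<Sum>y=1..DIM('a). \<Sum>z=1..DIM('a). \<alpha> [e x, e y, e z] * hodge b e l \<beta> (map e (x # y # z # K)))"
  using hodge_wedge[OF assms(2,3), of \<alpha> \<beta>, unfolded sum_idx3] unfolding assms(1) by (simp add: fact_numeral)

text \<open>Both sides contract \<open>\<alpha>\<close>, \<open>\<beta>\<close> and the Levi-Civita
  symbol; the sign (-1)^(kl) enters twice and cancels. It reads the vanishing of a top-degree wedge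
  product as an orthogonality.\<close>

lemma hodge_pairing:
  assumes kl: "k + l = DIM('a)"
  shows "(\<Sum>K\<in>idx DIM('a) l. hodge b e k \<alpha> (map e K) * \<beta> (map e K)) = fact l * hodge b e (k + l) (wedge k l \<alpha> \<beta>) []"
proof -
  let ?n = "DIM('a)"
  have e: "eps ?n (B @ A) = (-1) ^ (k * l) * eps ?n (A @ B)" if "A \<in> idx ?n k" "B \<in> idx ?n l" for A B
    using skew_rotate[OF eps_skew, of "[]" B A "[]" ?n] that kl by (simp add: idx_def mult.commute add.commute)
  have s: "(-1) ^ (k * l) * (-1) ^ (k * l) = (1::real)" by (simp flip: power_mult_distrib)
  have 1: "hodge b e k \<alpha> (map e K) = 1 / fact k * (\<Sum>I\<in>idx ?n k. \<alpha> (map e I) * eps ?n (I @ K))" if "K \<in> idx ?n l" for K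
    by (rule hodge_frame) (use that kl in \<open>simp_all add: idx_def\<close>)
  have 2: "hodge b e l \<beta> (map e A) = 1 / fact l * (\<Sum>I\<in>idx ?n l. \<beta> (map e I) * eps ?n (I @ A))" if "A \<in> idx ?n k" for A
    by (rule hodge_frame) (use that kl in \<open>simp_all add: idx_def\<close>)
  have "(\<Sum>K\<in>idx ?n l. hodge b e k \<alpha> (map e K) * \<beta> (map e K)) =
      (\<Sum>K\<in>idx ?n l. \<Sum>A\<in>idx ?n k. 1 / fact k * (\<alpha> (map e A) * (\<beta> (map e K) * eps ?n (A @ K))))"
    by (rule sum.cong[OF refl]) (simp add: 1 sum_distrib_left sum_distrib_right mult_ac)
  also have "\<dots> = (\<Sum>A\<in>idx ?n k. \<Sum>K\<in>idx ?n l. 1 / fact k * (\<alpha> (map e A) * (\<beta> (map e K) * eps ?n (A @ K))))"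
    by (rule sum.swap)
  also have "\<dots> = (\<Sum>A\<in>idx ?n k. fact l * ((-1) ^ (k * l) / fact k * (\<alpha> (map e A) * hodge b e l \<beta> (map e (A @ [])))))"
  proof (rule sum.cong[OF refl])
    fix A assume A: "A \<in> idx ?n k"
    have "(\<Sum>I\<in>idx ?n l. \<beta> (map e I) * eps ?n (I @ A)) = (-1) ^ (k * l) * (\<Sum>I\<in>idx ?n l. \<beta> (map e I) * eps ?n (A @ I))"
      unfolding sum_distrib_left by (rule sum.cong[OF refl]) (simp add: e[OF A])
    then have "fact l * hodge b e l \<beta> (map e A) = (-1) ^ (k * l) * (\<Sum>I\<in>idx ?n l. \<beta> (map e I) * eps ?n (A @ I))"
      using 2[OF A] by simp
    then have S: "(-1) ^ (k * l) * (fact l * hodge b e l \<beta> (map e A)) = (\<Sum>I\<in>idx ?n l. \<beta> (map e I) * eps ?n (A @ I))"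
      by (simp only: mult.assoc[symmetric] s mult_1_left)
    have "(\<Sum>K\<in>idx ?n l. 1 / fact k * (\<alpha> (map e A) * (\<beta> (map e K) * eps ?n (A @ K)))) =
        1 / fact k * (\<alpha> (map e A) * (\<Sum>K\<in>idx ?n l. \<beta> (map e K) * eps ?n (A @ K)))"
      by (simp only: sum_distrib_left)
    then show "(\<Sum>K\<in>idx ?n l. 1 / fact k * (\<alpha> (map e A) * (\<beta> (map e K) * eps ?n (A @ K)))) =
        fact l * ((-1) ^ (k * l) / fact k * (\<alpha> (map e A) * hodge b e l \<beta> (map e (A @ []))))"
      unfolding S[symmetric] append_Nil2 by (simp add: divide_inverse mult_ac)
  qed
  also have "\<dots> = fact l * hodge b e (k + l) (wedge k l \<alpha> \<beta>) []"
    using hodge_wedge[of k l "[]" \<alpha> \<beta>] kl by (simp add: sum_distrib_left)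
  finally show ?thesis .
qed

end

lemma act_skew_ext: "act n (\<lambda>i j. \<Sum>v\<in>I. c v * A v i j) C K = (\<Sum>v\<in>I. c v * act n (A v) C K)"
proof -
  have "act n (\<lambda>i j. \<Sum>v\<in>I. c v * A v i j) C K = (\<Sum>s<length K. \<Sum>i=1..n. \<Sum>v\<in>I. c v * (A v (K ! s) i * C (K[s := i])))"
    unfolding act_def by (simp only: sum_distrib_right mult.assoc)
  also have "\<dots> = (\<Sum>v\<in>I. \<Sum>s<length K. \<Sum>i=1..n. c v * (A v (K ! s) i * C (K[s := i])))"
    by (rule sum_rotate3[symmetric])
  finally show ?thesis unfolding act_def sum_distrib_left .
qed

context riem_frame
begin

text \<open>\<open>omp\<close> is linear in the direction, so the frame directions suffice.\<close>

lemma act_omp_zero: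
  assumes q: "q \<in> V" and z: "\<And>v. v \<in> {1..DIM('a)} \<Longrightarrow> act DIM('a) (omp q (e q v)) C K = 0" and K: "set K \<subseteq> {1..DIM('a)}"
  shows "act DIM('a) (omp q u) C K = 0"
proof -
  have lin: "linear (\<lambda>u. omp q u i j)" if i: "i \<in> {1..DIM('a)}" for i j
  proof -
    have n: "linear (\<lambda>u. ne q u i)"
      unfolding ne_def by (rule linear_compose_add[OF linear_cderiv[OF cdiff_e[OF q i]] \<Gamma>_lin(1)[OF q]])
    have "linear (\<lambda>u. gq q (ne q u i) (e q j) + 1/2 * H \<kappa> q [u, e q i, e q j])"
      by (rule linear_compose_add[OF linear_compose[OF n g_lin(1)[OF q], unfolded o_def] linear_cmult[OF H_lin(1)[OF q]]])
    then show ?thesis by (simp add: omp_def[abs_def] om_def)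
  qed
  have "act DIM('a) (omp q u) C K = act DIM('a) (\<lambda>i j. \<Sum>v\<in>{1..DIM('a)}. gq q u (e q v) * omp q (e q v) i j) C K"
  proof (rule act_cong[OF _ K])
    fix i j assume i: "i \<in> {1..DIM('a)}"
    have "omp q (\<Sum>v\<in>{1..DIM('a)}. gq q u (e q v) *\<^sub>R e q v) i j = (\<Sum>v\<in>{1..DIM('a)}. gq q u (e q v) * omp q (e q v) i j)"
      by (simp add: linear_sum[OF lin[OF i]] linear_cmul[OF lin[OF i]])
    then show "omp q u i j = (\<Sum>v\<in>{1..DIM('a)}. gq q u (e q v) * omp q (e q v) i j)"
      by (simp only: e_expand[OF q, symmetric])
  qed
  also have "\<dots> = 0" unfolding act_skew_ext by (intro sum.neutral ballI) (simp add: z)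
  finally show ?thesis .
qed

lemma ext_d_frame5:
  assumes q: "q \<in> V" and ml: "\<And>q. q \<in> V \<Longrightarrow> multilin 4 (S q)"
    and d: "\<And>vs. length vs = 4 \<Longrightarrow> cdiff \<kappa> (\<lambda>q. S q vs) q" and sk: "skew 4 (S q)"
    and C: "\<And>q K. q \<in> V \<Longrightarrow> length K = 4 \<Longrightarrow> set K \<subseteq> {1..DIM('a)} \<Longrightarrow> S q (map (e q) K) = C K"
    and J: "length J = 5" "set J \<subseteq> {1..DIM('a)}"
  shows "ext_d \<kappa> S q (map (e q) J) = dform DIM('a) (\<lambda>v. om q (e q v)) C J"
proof -
  obtain a b c r f where J': "J = [a,b,c,r,f]" using J(1) by (auto simp: numeral_eq_Suc length_Suc_conv)
  note n = nab_const[OF q ml d C]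
  have "nab \<kappa> \<Gamma> S q (e q a) (map (e q) [b,c,r,f]) = - act DIM('a) (om q (e q a)) C [b,c,r,f]"
    "nab \<kappa> \<Gamma> S q (e q b) (map (e q) [a,c,r,f]) = - act DIM('a) (om q (e q b)) C [a,c,r,f]"
    "nab \<kappa> \<Gamma> S q (e q c) (map (e q) [a,b,r,f]) = - act DIM('a) (om q (e q c)) C [a,b,r,f]"
    "nab \<kappa> \<Gamma> S q (e q r) (map (e q) [a,b,c,f]) = - act DIM('a) (om q (e q r)) C [a,b,c,f]"
    "nab \<kappa> \<Gamma> S q (e q f) (map (e q) [a,b,c,r]) = - act DIM('a) (om q (e q f)) C [a,b,c,r]"
    by (rule n; use J(2) J' in simp)+
  then show ?thesis
    using ext_d_nab5[of \<Gamma> q S \<kappa> "e q a" "e q b" "e q c" "e q r" "e q f", OF \<Gamma>_sym[OF q] sk]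
    unfolding J' dform5 by simp
qed

lemma ext_d_frame4:
  assumes q: "q \<in> V" and ml: "\<And>q. q \<in> V \<Longrightarrow> multilin 3 (S q)"
    and d: "\<And>vs. length vs = 3 \<Longrightarrow> cdiff \<kappa> (\<lambda>q. S q vs) q" and sk: "skew 3 (S q)"
    and C: "\<And>q K. q \<in> V \<Longrightarrow> length K = 3 \<Longrightarrow> set K \<subseteq> {1..DIM('a)} \<Longrightarrow> S q (map (e q) K) = C K"
    and J: "length J = 4" "set J \<subseteq> {1..DIM('a)}"
  shows "ext_d \<kappa> S q (map (e q) J) = dform DIM('a) (\<lambda>v. om q (e q v)) C J"
proof -
  obtain a b c r where J': "J = [a,b,c,r]" using J(1) by (auto simp: numeral_eq_Suc length_Suc_conv)
  note n = nab_const[OF q ml d C]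
  have "nab \<kappa> \<Gamma> S q (e q a) (map (e q) [b,c,r]) = - act DIM('a) (om q (e q a)) C [b,c,r]"
    "nab \<kappa> \<Gamma> S q (e q b) (map (e q) [a,c,r]) = - act DIM('a) (om q (e q b)) C [a,c,r]"
    "nab \<kappa> \<Gamma> S q (e q c) (map (e q) [a,b,r]) = - act DIM('a) (om q (e q c)) C [a,b,r]"
    "nab \<kappa> \<Gamma> S q (e q r) (map (e q) [a,b,c]) = - act DIM('a) (om q (e q r)) C [a,b,c]"
    by (rule n; use J(2) J' in simp)+
  then show ?thesis
    using ext_d_nab4[of \<Gamma> q S \<kappa> "e q a" "e q b" "e q c" "e q r", OF \<Gamma>_sym[OF q] sk]
    unfolding J' dform4 by simp
qed

end

subsection \<open>The $Spin(7)$ case\<close>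

context riem_frame
begin

context
  fixes \<phi> \<Phi>
  assumes n8: "DIM('a) = 8" and s: "smooth_fun \<A> UNIV \<phi>" and S: "smooth_form \<A> 4 \<Phi>"
    and ad: "\<And>q vs. q \<in> V \<Longrightarrow> length vs = 4 \<Longrightarrow> \<Phi> \<kappa> q vs = Spin7_form (gq q) (e q) vs"
    and Lee: "\<And>q vs. q \<in> V \<Longrightarrow> length vs = 1 \<Longrightarrow> Lee8 g \<Phi> \<kappa> e q vs = 12/7 * d_fun \<kappa> \<phi> q vs"
    and HK: "\<And>q vs. q \<in> V \<Longrightarrow> length vs = 3 \<Longrightarrow> H \<kappa> q vs = hodge (gq q) (e q) 5 (ext_d \<kappa> (\<Phi> \<kappa>) q) vs
             - 2 * hodge (gq q) (e q) 5 (wedge 1 4 (d_fun \<kappa> \<phi> q) (\<Phi> \<kappa> q)) vs"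
begin

lemma spin7_comp:
  assumes q: "q \<in> V" and K: "length K = 4" "set K \<subseteq> {1..8}"
  shows "\<Phi> \<kappa> q (map (e q) K) = Phi K"
proof -
  interpret fr: frame "gq q" "e q" by (rule hodge_frame_at[OF q])
  show ?thesis using K by (simp add: ad[OF q] Spin7_form_def Phi_def fr.cof_frame n8)
qed

lemma spin7_star:
  assumes q: "q \<in> V" and L: "length L = 4" "set L \<subseteq> {1..8}"
  shows "hodge (gq q) (e q) 4 (\<Phi> \<kappa> q) (map (e q) L) = Phi L"
proof -
  interpret fr: frame "gq q" "e q" by (rule hodge_frame_at[OF q])
  show ?thesis
    by (rule fr.hodge_star_eqI[where \<beta> = Phi and \<delta> = Phi and l = 4, unfolded n8, OF _ Phi_skew spin7_comp[OF q] Phi_skew Phi_complement L]) simp_all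
qed

lemma spin7_H:
  assumes q: "q \<in> V" and K: "length K = 3" "set K \<subseteq> {1..8}"
  shows "H \<kappa> q (map (e q) K) = hodge (gq q) (e q) 5 (ext_d \<kappa> (\<Phi> \<kappa>) q) (map (e q) K)
    - 2 * (\<Sum>x=1..8. cderiv \<kappa> \<phi> q (e q x) * Phi (x # K))"
proof -
  interpret fr: frame "gq q" "e q" by (rule hodge_frame_at[OF q])
  have "hodge (gq q) (e q) 5 (wedge 1 4 (d_fun \<kappa> \<phi> q) (\<Phi> \<kappa> q)) (map (e q) K) =
      (-1) ^ 4 * (\<Sum>x=1..8. d_fun \<kappa> \<phi> q [e q x] * hodge (gq q) (e q) 4 (\<Phi> \<kappa> q) (map (e q) (x # K)))"
    by (rule fr.hodge_wedge1[unfolded n8]) (use K in simp_all)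
  also have "(\<Sum>x=1..8. d_fun \<kappa> \<phi> q [e q x] * hodge (gq q) (e q) 4 (\<Phi> \<kappa> q) (map (e q) (x # K))) =
      (\<Sum>x=1..8. cderiv \<kappa> \<phi> q (e q x) * Phi (x # K))"
  proof (rule sum.cong[OF refl])
    fix x :: nat assume "x \<in> {1..8}"
    then have "hodge (gq q) (e q) 4 (\<Phi> \<kappa> q) (map (e q) (x # K)) = Phi (x # K)"
      by (intro spin7_star[OF q]) (use K in simp_all)
    then show "d_fun \<kappa> \<phi> q [e q x] * hodge (gq q) (e q) 4 (\<Phi> \<kappa> q) (map (e q) (x # K)) = cderiv \<kappa> \<phi> q (e q x) * Phi (x # K)"
      by (simp add: d_fun_def)
  qed
  finally show ?thesis using HK[OF q, of "map (e q) K"] K by simp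
qed

text \<open>The Lee form is a contraction of the star of dPhi with Phi, and that star is H plus 2 d
  phi contracted with Phi. With S the contraction of H this gives 12/7 d phi = -1/42 (S - 84 d phi),
  where 84 = 2 times 42, hence S = 12 d phi.\<close>

lemma spin7_lee:
  assumes q: "q \<in> V" and n: "n \<in> {1..8}"
  shows "S3 {1..8} (\<lambda>a b c. Phi [a,b,c,n]) (\<lambda>a b c. H \<kappa> q [e q a, e q b, e q c]) = 12 * cderiv \<kappa> \<phi> q (e q n)"
proof -
  interpret fr: frame "gq q" "e q" by (rule hodge_frame_at[OF q])
  let ?f = "\<lambda>x. cderiv \<kappa> \<phi> q (e q x)" and ?G = "\<lambda>a b c. H \<kappa> q [e q a, e q b, e q c]"
  let ?\<gamma> = "hodge (gq q) (e q) 5 (ext_d \<kappa> (\<Phi> \<kappa>) q)"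
  have g: "?\<gamma> [e q a, e q b, e q c] * hodge (gq q) (e q) 4 (\<Phi> \<kappa> q) (map (e q) (a # b # c # [n])) =
      ?G a b c * Phi [a,b,c,n] + (\<Sum>x=1..8. 2 * ?f x * (Phi [x,a,b,c] * Phi [a,b,c,n]))"
    if abc: "a \<in> {1..8}" "b \<in> {1..8}" "c \<in> {1..8}" for a b c
  proof -
    have "hodge (gq q) (e q) 4 (\<Phi> \<kappa> q) (map (e q) (a # b # c # [n])) = Phi [a,b,c,n]"
      by (rule spin7_star[OF q]) (use abc n in simp_all)
    moreover have "?\<gamma> [e q a, e q b, e q c] = ?G a b c + 2 * (\<Sum>x=1..8. ?f x * Phi [x,a,b,c])"
      using spin7_H[OF q, of "[a,b,c]"] abc by simp
    ultimately show ?thesis by (simp only: distrib_right sum_distrib_left sum_distrib_right mult.assoc)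
  qed
  have "12/7 * ?f n = Lee8 g \<Phi> \<kappa> e q (map (e q) [n])" using Lee[OF q, of "[e q n]"] by (simp add: d_fun_def)
  also have "\<dots> = - (1/7) * ((-1) ^ (3 * 4) / 6 * (\<Sum>a=1..8. \<Sum>b=1..8. \<Sum>c=1..8.
      ?\<gamma> [e q a, e q b, e q c] * hodge (gq q) (e q) 4 (\<Phi> \<kappa> q) (map (e q) (a # b # c # [n]))))"
    unfolding Lee8_def by (subst fr.hodge_wedge3[unfolded n8]) (use n in simp_all)
  also have "(\<Sum>a=1..8. \<Sum>b=1..8. \<Sum>c=1..8. ?\<gamma> [e q a, e q b, e q c] * hodge (gq q) (e q) 4 (\<Phi> \<kappa> q) (map (e q) (a # b # c # [n]))) =
      (\<Sum>a=1..8. \<Sum>b=1..8. \<Sum>c=1..8. ?G a b c * Phi [a,b,c,n] + (\<Sum>x=1..8. 2 * ?f x * (Phi [x,a,b,c] * Phi [a,b,c,n])))"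
    by (rule sum.cong[OF refl], rule sum.cong[OF refl], rule sum.cong[OF refl], rule g)
  also have "\<dots> = S3 {1..8} (\<lambda>a b c. Phi [a,b,c,n]) ?G +
      (\<Sum>a=1..8. \<Sum>b=1..8. \<Sum>c=1..8. \<Sum>x=1..8. 2 * ?f x * (Phi [x,a,b,c] * Phi [a,b,c,n]))"
    by (simp only: sum.distrib S3_def)
  also have "(\<Sum>a=1..8. \<Sum>b=1..8. \<Sum>c=1..8. \<Sum>x=1..8. 2 * ?f x * (Phi [x,a,b,c] * Phi [a,b,c,n])) =
      (\<Sum>x=1..8. \<Sum>a=1..8. \<Sum>b=1..8. \<Sum>c=1..8. 2 * ?f x * (Phi [x,a,b,c] * Phi [a,b,c,n]))"
    by (subst sum_rotate3[symmetric], rule sum.swap)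
  also have "\<dots> = (\<Sum>x=1..8. 2 * ?f x * S3 {1..8} (\<lambda>a b c. Phi [a,b,c,n]) (\<lambda>a b c. Phi [x,a,b,c]))"
    by (simp only: S3_def sum_distrib_left)
  also have "\<dots> = (\<Sum>x=1..8. if x = n then - 84 * ?f n else 0)"
  proof (rule sum.cong[OF refl])
    fix x :: nat assume x: "x \<in> {1..8}"
    show "2 * ?f x * S3 {1..8} (\<lambda>a b c. Phi [a,b,c,n]) (\<lambda>a b c. Phi [x,a,b,c]) = (if x = n then - 84 * ?f n else 0)"
      unfolding Phi_square[OF x n] by simp
  qed
  also have "\<dots> = - 84 * ?f n" using n by simp
  finally have "12/7 * ?f n = - (1/7) * (1 / 6 * (S3 {1..8} (\<lambda>a b c. Phi [a,b,c,n]) ?G + - 84 * ?f n))"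
    by (simp del: One_nat_def)
  then show ?thesis by argo
qed

text \<open>For constant components, dPhi is the expression \<open>dform\<close> in the connection
  forms. The formula for H and the Lee equation then become the hypotheses of
  \<open>spin7_torsion\<close>.\<close>

lemma spin7_parallel:
  assumes q: "q \<in> V" and K: "length K = 4" "set K \<subseteq> {1..8}"
  shows "act 8 (omp q u) Phi K = 0"
proof -
  interpret fr: frame "gq q" "e q" by (rule hodge_frame_at[OF q])
  define oA where "oA v i j = (om q (e q v) i j - om q (e q v) j i) / 2" for v i j
  note oA = om_skew_part[OF q, folded oA_def, unfolded n8]
  let ?f = "\<lambda>x. cderiv \<kappa> \<phi> q (e q x)"
  note Sf = form_facts[OF S]
  have ext: "ext_d \<kappa> (\<Phi> \<kappa>) q (map (e q) J) = dform 8 oA Phi J" if J: "length J = 5" "set J \<subseteq> {1..8}" for J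
  proof -
    have "ext_d \<kappa> (\<Phi> \<kappa>) q (map (e q) J) = dform 8 (\<lambda>v. om q (e q v)) Phi J"
      by (rule ext_d_frame5[OF q, unfolded n8, OF Sf(3) Sf(5)[OF q] Sf(4)[OF q] spin7_comp J])
    also have "\<dots> = dform 8 oA Phi J" by (rule dform_cong[OF oA(2) J(2)])
    finally show ?thesis .
  qed
  have as: "oA v b a + H \<kappa> q [e q v, e q b, e q a] / 2 = - (oA v a b + H \<kappa> q [e q v, e q a, e q b] / 2)" for v a b
    unfolding oA(1)[of v b a] H_alt(2)[OF q, of "e q v" "e q a" "e q b"] by simp
  have eqs: "spin7_eqs (\<lambda>a b. oA v a b + H \<kappa> q [e q v, e q a, e q b] / 2) n" if v: "v \<in> {1..8}" and n: "n \<in> {2..8}" for v n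
  proof (rule spin7_torsion[where H = "\<lambda>a b c. H \<kappa> q [e q a, e q b, e q c]" and f = ?f, OF _ _ H_alt(1,2)[OF q] oA(1) v n])
    fix J and a b c :: nat
    assume J: "length J = 5" "distinct (J @ [a,b,c])" "list_all (\<lambda>x. 1 \<le> x \<and> x \<le> 8) (J @ [a,b,c])"
    have sub: "set (J @ [a,b,c]) \<subseteq> {1..8}" using J(3) by (auto simp: list_all_iff)
    have s: "set (J @ [a,b,c]) = {1..8}"
      by (rule card_subset_eq[OF _ sub]) (use J(1) distinct_card[OF J(2)] in simp_all)
    have "hodge (gq q) (e q) 5 (ext_d \<kappa> (\<Phi> \<kappa>) q) (map (e q) [a,b,c]) = eps 8 (J @ [a,b,c]) * dform 8 oA Phi J"
      by (rule fr.hodge_complement[unfolded n8, OF dform_skew5[OF Phi_skew] ext J(1) s]) simp_all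
    then show "H \<kappa> q [e q a, e q b, e q c] = eps 8 (J @ [a,b,c]) * dform 8 oA Phi J - 2 * (\<Sum>x=1..8. ?f x * Phi [x,a,b,c])"
      using spin7_H[OF q, of "[a,b,c]"] sub by simp
  next
    fix n :: nat assume "n \<in> {1..8}"
    from spin7_lee[OF q this] show "(\<Sum>a=1..8. \<Sum>b=1..8. \<Sum>c=1..8. H \<kappa> q [e q a, e q b, e q c] * Phi [a,b,c,n]) = 12 * ?f n"
      by (simp only: S3_def)
  qed
  have "act 8 (omp q (e q v)) Phi K = 0" if v: "v \<in> {1..8}" for v
  proof -
    have "act 8 (\<lambda>a b. oA v a b + H \<kappa> q [e q v, e q a, e q b] / 2) Phi K = 0"
      by (rule spin7_eqs_stabilizer[OF as eqs[OF v] K])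
    moreover have "act 8 (omp q (e q v)) Phi K = act 8 (\<lambda>a b. oA v a b + H \<kappa> q [e q v, e q a, e q b] / 2) Phi K"
      by (rule act_cong[OF _ K(2)]) (simp only: omp_def oA(2))
    ultimately show ?thesis by simp
  qed
  then show ?thesis by (rule act_omp_zero[OF q, unfolded n8, OF _ K(2)])
qed

lemma spin7_stab:
  assumes q: "q \<in> V" and K: "length K = 4" "set K \<subseteq> {1..8}"
  shows "act 8 (\<lambda>a b. gq q (curvature \<kappa> Gp q u v (e q a)) (e q b)) Phi K = 0"
  by (rule curvature_plus_stab[OF q S, unfolded n8, OF spin7_comp spin7_parallel K])

lemma spin7_heterotic_point:
  assumes q: "q \<in> V"
  shows "heterotic_point DIM('a) Phi (\<lambda>a b c. H \<kappa> q [e q a, e q b, e q c])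
    (\<lambda>u a b c. nab \<kappa> \<Gamma> (H \<kappa>) q (e q u) [e q a, e q b, e q c])
    (\<lambda>i j k l. gq q (curvature \<kappa> \<Gamma> q (e q i) (e q j) (e q k)) (e q l))
    (\<lambda>i j k l. gq q (curvature \<kappa> Gp q (e q i) (e q j) (e q k)) (e q l))
    (\<lambda>i. cderiv \<kappa> \<phi> q (e q i)) (\<lambda>i j. hessian \<kappa> \<Gamma> \<phi> q (e q i) (e q j))"
proof (rule heterotic_pointI[OF q s Phi_skew], unfold n8)
  show "act 8 (omp q u) Phi K = 0" if "length K = 4" "set K \<subseteq> {1..8}" for u K by (rule spin7_parallel[OF q that])
  show "S3 {1..8} (\<lambda>v w x. Phi [v,w,x,k]) (\<lambda>v w x. H \<kappa> q [e q v, e q w, e q x]) = 12 * cderiv \<kappa> \<phi> q (e q k)"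
    if "q \<in> V" "k \<in> {1..8}" for q k by (rule spin7_lee[OF that])
  show "(\<Sum>w\<in>{1..8}. \<Sum>x\<in>{1..8}. Phi [w,x,a,b] * gq q (curvature \<kappa> Gp q u v (e q w)) (e q x))
      = - 2 * gq q (curvature \<kappa> Gp q u v (e q a)) (e q b)" if "a \<in> {1..8}" "b \<in> {1..8}" for u v a b
    by (rule spin7_stabilizer_instanton[OF curvature_plus_skew[OF q] spin7_stab[OF q] that])
qed

lemma spin7_dH_symmetric:
  assumes q: "q \<in> V" and b: "b \<in> {1..8}" and c: "c \<in> {1..8}"
  shows "S3 {1..8} (\<lambda>v w x. Phi [v,w,x,b]) (\<lambda>v w x. ext_d \<kappa> (H \<kappa>) q [e q c, e q v, e q w, e q x]) =
    S3 {1..8} (\<lambda>v w x. Phi [v,w,x,c]) (\<lambda>v w x. ext_d \<kappa> (H \<kappa>) q [e q b, e q v, e q w, e q x])"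
  unfolding ext_d_H[OF q]
  by (rule heterotic_point.spin7_h_symmetric[OF spin7_heterotic_point[OF q], unfolded n8, OF refl refl spin7_stab[OF q] spin7_lee[OF q] b c])

end

end

subsection \<open>The $G_2$ case\<close>

context chart_at
begin

lemma cdiff_prod:
  fixes f :: "'i \<Rightarrow> 'm \<Rightarrow> real"
  assumes p: "p \<in> fst \<kappa>" and I: "finite I" and f: "\<And>i. i \<in> I \<Longrightarrow> cdiff \<kappa> (f i) p"
  shows "cdiff \<kappa> (\<lambda>q. \<Prod>i\<in>I. f i q) p"
  using I f
proof (induction I rule: finite_induct)
  case empty
  show ?case unfolding prod.empty by (rule cderiv_const(1))
next
  case (insert i I)
  have "cdiff \<kappa> (\<lambda>q. f i q * (\<Prod>i\<in>I. f i q)) p"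
    by (rule cderiv_bilinear(1)[OF bounded_bilinear_mult _ _ p chart_props(3)]) (use insert in auto)
  then show ?case using insert.hyps by simp
qed

end

context riem_frame
begin

text \<open>The star of Theta is given through frames; its differentiability, on which its exterior
  derivative relies, is derived from that of the metric, the frame and the form.\<close>

lemma cdiff_hodge:
  assumes q: "q \<in> V" and S: "smooth_form \<A> k S" and len: "k + length vs = DIM('a)"
  shows "cdiff \<kappa> (\<lambda>q. hodge (gq q) (e q) k (S \<kappa> q) vs) q"
proof -
  note Sf = form_facts[OF S]
  have ml2: "multilin 2 (\<lambda>ws. gq q (ws ! 0) (ws ! 1))" if "q \<in> V" for q
    unfolding multilin_def
  proof (intro allI impI)
    fix ws :: "'a list" and i :: nat assume l: "length ws = 2" and i: "i < 2"
    from i consider "i = 0" | "i = 1" by linarith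
    then show "linear (\<lambda>v. gq q (ws[i := v] ! 0) (ws[i := v] ! 1))"
      using l g_lin[OF that] by cases simp_all
  qed
  have gg: "cdiff \<kappa> (\<lambda>q. gq q (Y q) (Z q)) q" if "cdiff \<kappa> Y q" "cdiff \<kappa> Z q" for Y Z
  proof -
    have "cdiff \<kappa> (\<lambda>q. gq q ((map (\<lambda>Y. Y q) [Y,Z] @ []) ! 0) ((map (\<lambda>Y. Y q) [Y,Z] @ []) ! 1)) q"
      by (rule cderiv_ml(1)[where S = "\<lambda>q ws. gq q (ws ! 0) (ws ! 1)" and k = 2 and Ys = "[Y,Z]" and cs = "[]", OF q ml2])
        (assumption, rule cdiff_g[OF q], simp, use that in auto)
    then show ?thesis by simp
  qed
  have c: "cdiff \<kappa> (\<lambda>q. cof (gq q) (e q) [1..<Suc DIM('a)] (map (e q) I @ vs)) q"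
    if I: "length I = k" "set I \<subseteq> {1..DIM('a)}" for I
    unfolding cof_def
  proof (rule cderiv_sum[THEN conjunct1], rule cderiv_cmult(1), rule cdiff_prod[OF Vk[OF q] finite_lessThan])
    fix \<sigma> i assume \<sigma>: "\<sigma> \<in> {\<sigma>. \<sigma> permutes {..<length [1..<Suc DIM('a)]}}" and i: "i \<in> {..<length [1..<Suc DIM('a)]}"
    have si: "\<sigma> i < k + length vs" using permutes_in_image[of \<sigma> "{..<length [1..<Suc DIM('a)]}" i] \<sigma> i len by (simp del: upt_Suc)
    have y: "cdiff \<kappa> (\<lambda>q. e q ([1..<Suc DIM('a)] ! i)) q"
      by (rule cdiff_e[OF q]) (use i in \<open>simp del: upt_Suc\<close>)
    have z: "cdiff \<kappa> (\<lambda>q. (map (e q) I @ vs) ! \<sigma> i) q"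
    proof (cases "\<sigma> i < k")
      case True
      then have "I ! \<sigma> i \<in> {1..DIM('a)}" using I nth_mem[of "\<sigma> i" I] by blast
      from cdiff_e[OF q this] show ?thesis using True I by (simp add: nth_append)
    next
      case False
      then show ?thesis using I by (simp add: nth_append cderiv_const(1))
    qed
    show "cdiff \<kappa> (\<lambda>q. gq q (e q ([1..<Suc DIM('a)] ! i)) ((map (e q) I @ vs) ! \<sigma> i)) q" by (rule gg[OF y z])
  qed
  have h: "cdiff \<kappa> (\<lambda>q. S \<kappa> q (map (e q) I) * cof (gq q) (e q) [1..<Suc DIM('a)] (map (e q) I @ vs)) q"
    if I: "I \<in> {I. length I = k \<and> set I \<subseteq> {1..DIM('a)}}" for I
    by (rule cderiv_bilinear(1)[OF bounded_bilinear_mult nab_frame(1)[OF q Sf(3) Sf(5)[OF q]] c Vk[OF q] chart_props(3)])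
      (use I in auto)
  show ?thesis unfolding hodge_def by (rule cderiv_cmult(1), rule cderiv_sum[THEN conjunct1], rule h)
qed

context
  fixes \<phi> \<Theta>
  assumes n7: "DIM('a) = 7" and s: "smooth_fun \<A> UNIV \<phi>" and S: "smooth_form \<A> 3 \<Theta>"
    and ad: "\<And>q vs. q \<in> V \<Longrightarrow> length vs = 3 \<Longrightarrow> \<Theta> \<kappa> q vs = G2_form (gq q) (e q) vs"
    and dW: "\<And>q vs. q \<in> V \<Longrightarrow> length vs = 5 \<Longrightarrow> ext_d \<kappa> (\<lambda>q. hodge (gq q) (e q) 3 (\<Theta> \<kappa> q)) q vs =
             wedge 1 4 (Lee7 g \<Theta> \<kappa> e q) (hodge (gq q) (e q) 3 (\<Theta> \<kappa> q)) vs"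
    and dTh: "\<And>q vs. q \<in> V \<Longrightarrow> length vs = 7 \<Longrightarrow> wedge 4 3 (ext_d \<kappa> (\<Theta> \<kappa>) q) (\<Theta> \<kappa> q) vs = 0"
    and Lee: "\<And>q vs. q \<in> V \<Longrightarrow> length vs = 1 \<Longrightarrow> Lee7 g \<Theta> \<kappa> e q vs = 2 * d_fun \<kappa> \<phi> q vs"
    and HK: "\<And>q vs. q \<in> V \<Longrightarrow> length vs = 3 \<Longrightarrow> H \<kappa> q vs = - hodge (gq q) (e q) 4 (ext_d \<kappa> (\<Theta> \<kappa>) q) vs
             + 2 * hodge (gq q) (e q) 4 (wedge 1 3 (d_fun \<kappa> \<phi> q) (\<Theta> \<kappa> q)) vs"
begin

lemma g2_comp:
  assumes q: "q \<in> V" and K: "length K = 3" "set K \<subseteq> {1..7}"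
  shows "\<Theta> \<kappa> q (map (e q) K) = Th K"
proof -
  interpret fr: frame "gq q" "e q" by (rule hodge_frame_at[OF q])
  show ?thesis using K by (simp add: ad[OF q] G2_form_def Th_def fr.cof_frame n7)
qed

lemma g2_star3:
  assumes q: "q \<in> V" and L: "length L = 4" "set L \<subseteq> {1..7}"
  shows "hodge (gq q) (e q) 3 (\<Theta> \<kappa> q) (map (e q) L) = W7 L"
proof -
  interpret fr: frame "gq q" "e q" by (rule hodge_frame_at[OF q])
  show ?thesis
    by (rule fr.hodge_star_eqI[where \<beta> = Th and \<delta> = W7 and l = 4, unfolded n7, OF _ Th_skew g2_comp[OF q] W7_skew W7_complement L]) simp_all
qed

lemma g2_star4:
  assumes q: "q \<in> V" and L: "length L = 3" "set L \<subseteq> {1..7}"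
  shows "hodge (gq q) (e q) 4 (hodge (gq q) (e q) 3 (\<Theta> \<kappa> q)) (map (e q) L) = Th L"
proof -
  interpret fr: frame "gq q" "e q" by (rule hodge_frame_at[OF q])
  show ?thesis
    by (rule fr.hodge_star_eqI[where \<beta> = W7 and \<delta> = Th and l = 3, unfolded n7, OF _ W7_skew g2_star3[OF q] Th_skew Th_complement L]) simp_all
qed

lemma g2_H:
  assumes q: "q \<in> V" and K: "length K = 3" "set K \<subseteq> {1..7}"
  shows "H \<kappa> q (map (e q) K) = - hodge (gq q) (e q) 4 (ext_d \<kappa> (\<Theta> \<kappa>) q) (map (e q) K)
    - 2 * (\<Sum>x=1..7. cderiv \<kappa> \<phi> q (e q x) * W7 (x # K))"
proof -
  interpret fr: frame "gq q" "e q" by (rule hodge_frame_at[OF q])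
  have "hodge (gq q) (e q) 4 (wedge 1 3 (d_fun \<kappa> \<phi> q) (\<Theta> \<kappa> q)) (map (e q) K) =
      (-1) ^ 3 * (\<Sum>x=1..7. d_fun \<kappa> \<phi> q [e q x] * hodge (gq q) (e q) 3 (\<Theta> \<kappa> q) (map (e q) (x # K)))"
    by (rule fr.hodge_wedge1[unfolded n7]) (use K in simp_all)
  also have "(\<Sum>x=1..7. d_fun \<kappa> \<phi> q [e q x] * hodge (gq q) (e q) 3 (\<Theta> \<kappa> q) (map (e q) (x # K))) =
      (\<Sum>x=1..7. cderiv \<kappa> \<phi> q (e q x) * W7 (x # K))"
  proof (rule sum.cong[OF refl])
    fix x :: nat assume "x \<in> {1..7}"
    then have "hodge (gq q) (e q) 3 (\<Theta> \<kappa> q) (map (e q) (x # K)) = W7 (x # K)"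
      by (intro g2_star3[OF q]) (use K in simp_all)
    then show "d_fun \<kappa> \<phi> q [e q x] * hodge (gq q) (e q) 3 (\<Theta> \<kappa> q) (map (e q) (x # K)) = cderiv \<kappa> \<phi> q (e q x) * W7 (x # K)"
      by (simp add: d_fun_def)
  qed
  finally show ?thesis using HK[OF q, of "map (e q) K"] K by simp
qed

text \<open>As in \<open>spin7_lee\<close>, with the sign (-1)^9 from the wedge product: 2 d phi =
  1/18 (48 d phi - S), where 48 = 2 times 24, hence again S = 12 d phi.\<close>

lemma g2_lee:
  assumes q: "q \<in> V" and n: "n \<in> {1..7}"
  shows "S3 {1..7} (\<lambda>a b c. W7 [a,b,c,n]) (\<lambda>a b c. H \<kappa> q [e q a, e q b, e q c]) = 12 * cderiv \<kappa> \<phi> q (e q n)"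
proof -
  interpret fr: frame "gq q" "e q" by (rule hodge_frame_at[OF q])
  let ?f = "\<lambda>x. cderiv \<kappa> \<phi> q (e q x)" and ?G = "\<lambda>a b c. H \<kappa> q [e q a, e q b, e q c]"
  let ?\<gamma> = "hodge (gq q) (e q) 4 (ext_d \<kappa> (\<Theta> \<kappa>) q)"
  have g: "?\<gamma> [e q a, e q b, e q c] * hodge (gq q) (e q) 3 (\<Theta> \<kappa> q) (map (e q) (a # b # c # [n])) =
      - (?G a b c * W7 [a,b,c,n]) - (\<Sum>x=1..7. 2 * ?f x * (W7 [x,a,b,c] * W7 [a,b,c,n]))"
    if abc: "a \<in> {1..7}" "b \<in> {1..7}" "c \<in> {1..7}" for a b c
  proof -
    have "hodge (gq q) (e q) 3 (\<Theta> \<kappa> q) (map (e q) (a # b # c # [n])) = W7 [a,b,c,n]"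
      by (rule g2_star3[OF q]) (use abc n in simp_all)
    moreover have "?\<gamma> [e q a, e q b, e q c] = - ?G a b c - 2 * (\<Sum>x=1..7. ?f x * W7 [x,a,b,c])"
      using g2_H[OF q, of "[a,b,c]"] abc by simp
    ultimately show ?thesis by (simp only: left_diff_distrib sum_distrib_left sum_distrib_right mult.assoc mult_minus_left)
  qed
  have "2 * ?f n = Lee7 g \<Theta> \<kappa> e q (map (e q) [n])" using Lee[OF q, of "[e q n]"] by (simp add: d_fun_def)
  also have "\<dots> = - (1/3) * ((-1) ^ (3 * 3) / 6 * (\<Sum>a=1..7. \<Sum>b=1..7. \<Sum>c=1..7.
      ?\<gamma> [e q a, e q b, e q c] * hodge (gq q) (e q) 3 (\<Theta> \<kappa> q) (map (e q) (a # b # c # [n]))))"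
    unfolding Lee7_def by (subst fr.hodge_wedge3[unfolded n7]) (use n in simp_all)
  also have "(\<Sum>a=1..7. \<Sum>b=1..7. \<Sum>c=1..7. ?\<gamma> [e q a, e q b, e q c] * hodge (gq q) (e q) 3 (\<Theta> \<kappa> q) (map (e q) (a # b # c # [n]))) =
      (\<Sum>a=1..7. \<Sum>b=1..7. \<Sum>c=1..7. - (?G a b c * W7 [a,b,c,n]) - (\<Sum>x=1..7. 2 * ?f x * (W7 [x,a,b,c] * W7 [a,b,c,n])))"
    by (rule sum.cong[OF refl], rule sum.cong[OF refl], rule sum.cong[OF refl], rule g)
  also have "\<dots> = - S3 {1..7} (\<lambda>a b c. W7 [a,b,c,n]) ?G -
      (\<Sum>a=1..7. \<Sum>b=1..7. \<Sum>c=1..7. \<Sum>x=1..7. 2 * ?f x * (W7 [x,a,b,c] * W7 [a,b,c,n]))"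
    by (simp only: sum_subtractf sum_negf S3_def)
  also have "(\<Sum>a=1..7. \<Sum>b=1..7. \<Sum>c=1..7. \<Sum>x=1..7. 2 * ?f x * (W7 [x,a,b,c] * W7 [a,b,c,n])) =
      (\<Sum>x=1..7. \<Sum>a=1..7. \<Sum>b=1..7. \<Sum>c=1..7. 2 * ?f x * (W7 [x,a,b,c] * W7 [a,b,c,n]))"
    by (subst sum_rotate3[symmetric], rule sum.swap)
  also have "\<dots> = (\<Sum>x=1..7. 2 * ?f x * S3 {1..7} (\<lambda>a b c. W7 [a,b,c,n]) (\<lambda>a b c. W7 [x,a,b,c]))"
    by (simp only: S3_def sum_distrib_left)
  also have "\<dots> = (\<Sum>x=1..7. if x = n then - 48 * ?f n else 0)"
  proof (rule sum.cong[OF refl])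
    fix x :: nat assume x: "x \<in> {1..7}"
    show "2 * ?f x * S3 {1..7} (\<lambda>a b c. W7 [a,b,c,n]) (\<lambda>a b c. W7 [x,a,b,c]) = (if x = n then - 48 * ?f n else 0)"
      unfolding W7_square[OF x n] by simp
  qed
  also have "\<dots> = - 48 * ?f n" using n by simp
  finally have "2 * ?f n = - (1/3) * (- 1 / 6 * (- S3 {1..7} (\<lambda>a b c. W7 [a,b,c,n]) ?G - - 48 * ?f n))"
    by (simp del: One_nat_def)
  then show ?thesis by argo
qed

text \<open>By \<open>hodge_pairing\<close>, dTheta ^ Theta = 0 says that the star of dTheta is
  orthogonal to Theta. The d phi part of H is orthogonal to Theta by
  \<open>W7_Th_contraction\<close>.\<close>

lemma g2_HTh:
  assumes q: "q \<in> V"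
  shows "S3 {1..7} (\<lambda>a b c. Th [a,b,c]) (\<lambda>a b c. H \<kappa> q [e q a, e q b, e q c]) = 0"
proof -
  interpret fr: frame "gq q" "e q" by (rule hodge_frame_at[OF q])
  let ?f = "\<lambda>x. cderiv \<kappa> \<phi> q (e q x)" and ?G = "\<lambda>a b c. H \<kappa> q [e q a, e q b, e q c]"
  let ?\<gamma> = "hodge (gq q) (e q) 4 (ext_d \<kappa> (\<Theta> \<kappa>) q)"
  have "hodge (gq q) (e q) (4 + 3) (wedge 4 3 (ext_d \<kappa> (\<Theta> \<kappa>) q) (\<Theta> \<kappa> q)) [] = 0"
    unfolding hodge_def by (simp add: dTh[OF q])
  then have "(\<Sum>K\<in>idx 7 3. ?\<gamma> (map (e q) K) * \<Theta> \<kappa> q (map (e q) K)) = 0"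
    using fr.hodge_pairing[of 4 3 "ext_d \<kappa> (\<Theta> \<kappa>) q" "\<Theta> \<kappa> q"] n7 by simp
  then have 0: "(\<Sum>a=1..7. \<Sum>b=1..7. \<Sum>c=1..7. ?\<gamma> [e q a, e q b, e q c] * \<Theta> \<kappa> q (map (e q) [a,b,c])) = 0"
    by (simp add: sum_idx3)
  have "?\<gamma> [e q a, e q b, e q c] * \<Theta> \<kappa> q (map (e q) [a,b,c]) =
      - (?G a b c * Th [a,b,c]) - (\<Sum>x=1..7. 2 * ?f x * (W7 [x,a,b,c] * Th [a,b,c]))"
    if abc: "a \<in> {1..7}" "b \<in> {1..7}" "c \<in> {1..7}" for a b c
  proof -
    have "\<Theta> \<kappa> q (map (e q) [a,b,c]) = Th [a,b,c]" by (rule g2_comp[OF q]) (use abc in simp_all)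
    moreover have "?\<gamma> [e q a, e q b, e q c] = - ?G a b c - 2 * (\<Sum>x=1..7. ?f x * W7 [x,a,b,c])"
      using g2_H[OF q, of "[a,b,c]"] abc by simp
    ultimately show ?thesis by (simp only: left_diff_distrib sum_distrib_left sum_distrib_right mult.assoc mult_minus_left)
  qed
  then have "(\<Sum>a=1..7. \<Sum>b=1..7. \<Sum>c=1..7. ?\<gamma> [e q a, e q b, e q c] * \<Theta> \<kappa> q (map (e q) [a,b,c])) =
      (\<Sum>a=1..7. \<Sum>b=1..7. \<Sum>c=1..7. - (?G a b c * Th [a,b,c]) - (\<Sum>x=1..7. 2 * ?f x * (W7 [x,a,b,c] * Th [a,b,c])))"
    by (intro sum.cong[OF refl])
  also have "\<dots> = - S3 {1..7} (\<lambda>a b c. Th [a,b,c]) ?G -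
      (\<Sum>a=1..7. \<Sum>b=1..7. \<Sum>c=1..7. \<Sum>x=1..7. 2 * ?f x * (W7 [x,a,b,c] * Th [a,b,c]))"
    by (simp only: sum_subtractf sum_negf S3_def)
  also have "(\<Sum>a=1..7. \<Sum>b=1..7. \<Sum>c=1..7. \<Sum>x=1..7. 2 * ?f x * (W7 [x,a,b,c] * Th [a,b,c])) =
      (\<Sum>x=1..7. \<Sum>a=1..7. \<Sum>b=1..7. \<Sum>c=1..7. 2 * ?f x * (W7 [x,a,b,c] * Th [a,b,c]))"
    by (subst sum_rotate3[symmetric], rule sum.swap)
  also have "\<dots> = (\<Sum>x=1..7. 2 * ?f x * S3 {1..7} (\<lambda>a b c. Th [a,b,c]) (\<lambda>a b c. W7 [x,a,b,c]))"
    by (simp only: S3_def sum_distrib_left)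
  also have "\<dots> = 0" by (intro sum.neutral ballI) (simp only: W7_Th_contraction mult_zero_right)
  finally show ?thesis using 0 by simp
qed

text \<open>The hypotheses of \<open>g2_torsion\<close> come from H, from the derivative of the star
  of Theta, from the Lee form and from dTheta ^ Theta = 0, with exterior derivatives written as
  \<open>dform\<close>. Its conclusion puts omega + H/2 in the stabiliser of both forms.\<close>

lemma g2_parallel:
  assumes q: "q \<in> V"
  shows "length K = 3 \<Longrightarrow> set K \<subseteq> {1..7} \<Longrightarrow> act 7 (omp q u) Th K = 0"
    "length K = 4 \<Longrightarrow> set K \<subseteq> {1..7} \<Longrightarrow> act 7 (omp q u) W7 K = 0"
proof -
  interpret fr: frame "gq q" "e q" by (rule hodge_frame_at[OF q])
  define oA where "oA v i j = (om q (e q v) i j - om q (e q v) j i) / 2" for v i j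
  note oA = om_skew_part[OF q, folded oA_def, unfolded n7]
  let ?f = "\<lambda>x. cderiv \<kappa> \<phi> q (e q x)" and ?W = "\<lambda>q. hodge (gq q) (e q) 3 (\<Theta> \<kappa> q)"
  note Sf = form_facts[OF S]
  have ext: "ext_d \<kappa> (\<Theta> \<kappa>) q (map (e q) J) = dform 7 oA Th J" if J: "length J = 4" "set J \<subseteq> {1..7}" for J
  proof -
    have "ext_d \<kappa> (\<Theta> \<kappa>) q (map (e q) J) = dform 7 (\<lambda>v. om q (e q v)) Th J"
      by (rule ext_d_frame4[OF q, unfolded n7, OF Sf(3) Sf(5)[OF q] Sf(4)[OF q] g2_comp J])
    also have "\<dots> = dform 7 oA Th J" by (rule dform_cong[OF oA(2) J(2)])
    finally show ?thesis .
  qed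
  have extW: "ext_d \<kappa> ?W q (map (e q) J) = dform 7 oA W7 J" if J: "length J = 5" "set J \<subseteq> {1..7}" for J
  proof -
    have "ext_d \<kappa> ?W q (map (e q) J) = dform 7 (\<lambda>v. om q (e q v)) W7 J"
    proof (rule ext_d_frame5[OF q, unfolded n7, OF _ _ _ _ J])
      show "multilin 4 (?W q)" if "q \<in> V" for q by (rule hodge_multilin[OF g_bil[OF that]]) (simp add: n7)
      show "cdiff \<kappa> (\<lambda>q. ?W q vs) q" if "length vs = 4" for vs by (rule cdiff_hodge[OF q S]) (simp add: n7 that)
      show "skew 4 (?W q)" by (rule fr.hodge_skew) (simp add: n7)
      show "?W q (map (e q) K) = W7 K" if "q \<in> V" "length K = 4" "set K \<subseteq> {1..7}" for q K by (rule g2_star3[OF that])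
    qed
    also have "\<dots> = dform 7 oA W7 J" by (rule dform_cong[OF oA(2) J(2)])
    finally show ?thesis .
  qed
  have full: "set (J @ K) \<subseteq> {1..7}" "set (J @ K) = {1..7}"
    if "length (J @ K) = 7" "distinct (J @ K)" "list_all (\<lambda>x. 1 \<le> x \<and> x \<le> 7) (J @ K)" for J K :: "nat list"
  proof -
    show sub: "set (J @ K) \<subseteq> {1..7}" using that(3) by (auto simp: list_all_iff)
    show "set (J @ K) = {1..7}"
      by (rule card_subset_eq[OF _ sub]) (use that(1) distinct_card[OF that(2)] in simp_all)
  qed
  have eqs: "g2_eqs (\<lambda>a b. oA v a b + H \<kappa> q [e q v, e q a, e q b] / 2) n" if v: "v \<in> {1..7}" and n: "n \<in> {1..7}" for v n
  proof (rule g2_torsion[where H = "\<lambda>a b c. H \<kappa> q [e q a, e q b, e q c]" and f = ?f, OF _ _ _ _ H_alt(1,2)[OF q] oA(1) v n])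
    fix J and a b c :: nat
    assume J: "length J = 4" "distinct (J @ [a,b,c])" "list_all (\<lambda>x. 1 \<le> x \<and> x \<le> 7) (J @ [a,b,c])"
    have s: "set (J @ [a,b,c]) \<subseteq> {1..7}" "set (J @ [a,b,c]) = {1..7}" by (rule full; use J in simp)+
    have "hodge (gq q) (e q) 4 (ext_d \<kappa> (\<Theta> \<kappa>) q) (map (e q) [a,b,c]) = eps 7 (J @ [a,b,c]) * dform 7 oA Th J"
      by (rule fr.hodge_complement[unfolded n7, OF dform_skew4[OF Th_skew] ext J(1) s(2)]) simp_all
    then show "H \<kappa> q [e q a, e q b, e q c] = - (eps 7 (J @ [a,b,c]) * dform 7 oA Th J) - 2 * (\<Sum>x=1..7. ?f x * W7 [x,a,b,c])"
      using g2_H[OF q, of "[a,b,c]"] s(1) by simp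
  next
    fix J and a b :: nat
    assume J: "length J = 5" "distinct (J @ [a,b])" "list_all (\<lambda>x. 1 \<le> x \<and> x \<le> 7) (J @ [a,b])"
    have s: "set (J @ [a,b]) \<subseteq> {1..7}" "set (J @ [a,b]) = {1..7}" by (rule full; use J in simp)+
    have "eps 7 (J @ [a,b]) * dform 7 oA W7 J = hodge (gq q) (e q) 5 (ext_d \<kappa> ?W q) (map (e q) [a,b])"
      by (rule fr.hodge_complement[unfolded n7, OF dform_skew5[OF W7_skew] extW J(1) s(2), symmetric]) simp_all
    also have "\<dots> = hodge (gq q) (e q) 5 (wedge 1 4 (Lee7 g \<Theta> \<kappa> e q) (?W q)) (map (e q) [a,b])"
      unfolding hodge_def[of _ _ 5] by (intro arg_cong2[where f = "(*)"] refl sum.cong) (simp add: dW[OF q])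
    \<comment> \<open>Applying the star twice returns Theta, so the star of the wedge product is the
      Lee form, that is 2 d phi, contracted with Theta.\<close>
    also have "\<dots> = (-1) ^ 4 * (\<Sum>x=1..7. Lee7 g \<Theta> \<kappa> e q [e q x] * hodge (gq q) (e q) 4 (?W q) (map (e q) (x # [a,b])))"
      by (rule fr.hodge_wedge1[unfolded n7]) (use s(1) in simp_all)
    also have "(\<Sum>x=1..7. Lee7 g \<Theta> \<kappa> e q [e q x] * hodge (gq q) (e q) 4 (?W q) (map (e q) (x # [a,b]))) =
        (\<Sum>x=1..7. 2 * (?f x * Th [x,a,b]))"
    proof (rule sum.cong[OF refl])
      fix x :: nat assume "x \<in> {1..7}"
      then have "hodge (gq q) (e q) 4 (?W q) (map (e q) (x # [a,b])) = Th (x # [a,b])"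
        by (intro g2_star4[OF q]) (use s(1) in simp_all)
      then show "Lee7 g \<Theta> \<kappa> e q [e q x] * hodge (gq q) (e q) 4 (?W q) (map (e q) (x # [a,b])) = 2 * (?f x * Th [x,a,b])"
        using Lee[OF q, of "[e q x]"] by (simp add: d_fun_def)
    qed
    finally show "eps 7 (J @ [a,b]) * dform 7 oA W7 J = 2 * (\<Sum>x=1..7. ?f x * Th [x,a,b])"
      by (simp add: sum_distrib_left)
  next
    fix n :: nat assume "n \<in> {1..7}"
    from g2_lee[OF q this] show "(\<Sum>a=1..7. \<Sum>b=1..7. \<Sum>c=1..7. H \<kappa> q [e q a, e q b, e q c] * W7 [a,b,c,n]) = 12 * ?f n"
      by (simp only: S3_def)
  next
    show "(\<Sum>a=1..7. \<Sum>b=1..7. \<Sum>c=1..7. H \<kappa> q [e q a, e q b, e q c] * Th [a,b,c]) = 0"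
      using g2_HTh[OF q] by (simp only: S3_def)
  qed
  have as: "oA v b a + H \<kappa> q [e q v, e q b, e q a] / 2 = - (oA v a b + H \<kappa> q [e q v, e q a, e q b] / 2)" for v a b
    unfolding oA(1)[of v b a] H_alt(2)[OF q, of "e q v" "e q a" "e q b"] by simp
  have c: "act 7 (omp q (e q v)) C K = act 7 (\<lambda>a b. oA v a b + H \<kappa> q [e q v, e q a, e q b] / 2) C K"
    if "set K \<subseteq> {1..7}" "v \<in> {1..7}" for v C K
    by (rule act_cong[OF _ that(1)]) (simp only: omp_def oA(2))
  show "act 7 (omp q u) Th K = 0" if K: "length K = 3" "set K \<subseteq> {1..7}" for K
    by (rule act_omp_zero[OF q, unfolded n7, OF _ K(2)]) (simp only: c[OF K(2)] g2_eqs_stabilizer(1)[OF as eqs K])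
  show "act 7 (omp q u) W7 K = 0" if K: "length K = 4" "set K \<subseteq> {1..7}" for K
    by (rule act_omp_zero[OF q, unfolded n7, OF _ K(2)]) (simp only: c[OF K(2)] g2_eqs_stabilizer(2)[OF as eqs K])
qed

lemma g2_stab:
  assumes q: "q \<in> V" and K: "length K = 3" "set K \<subseteq> {1..7}"
  shows "act 7 (\<lambda>a b. gq q (curvature \<kappa> Gp q u v (e q a)) (e q b)) Th K = 0"
  by (rule curvature_plus_stab[OF q S, unfolded n7, OF g2_comp g2_parallel(1) K])

lemma g2_heterotic_point:
  assumes q: "q \<in> V"
  shows "heterotic_point DIM('a) W7 (\<lambda>a b c. H \<kappa> q [e q a, e q b, e q c])
    (\<lambda>u a b c. nab \<kappa> \<Gamma> (H \<kappa>) q (e q u) [e q a, e q b, e q c])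
    (\<lambda>i j k l. gq q (curvature \<kappa> \<Gamma> q (e q i) (e q j) (e q k)) (e q l))
    (\<lambda>i j k l. gq q (curvature \<kappa> Gp q (e q i) (e q j) (e q k)) (e q l))
    (\<lambda>i. cderiv \<kappa> \<phi> q (e q i)) (\<lambda>i j. hessian \<kappa> \<Gamma> \<phi> q (e q i) (e q j))"
proof (rule heterotic_pointI[OF q s W7_skew], unfold n7)
  show "act 7 (omp q u) W7 K = 0" if "length K = 4" "set K \<subseteq> {1..7}" for u K by (rule g2_parallel(2)[OF q that])
  show "S3 {1..7} (\<lambda>v w x. W7 [v,w,x,k]) (\<lambda>v w x. H \<kappa> q [e q v, e q w, e q x]) = 12 * cderiv \<kappa> \<phi> q (e q k)"
    if "q \<in> V" "k \<in> {1..7}" for q k by (rule g2_lee[OF that])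
  show "(\<Sum>w\<in>{1..7}. \<Sum>x\<in>{1..7}. W7 [w,x,a,b] * gq q (curvature \<kappa> Gp q u v (e q w)) (e q x))
      = - 2 * gq q (curvature \<kappa> Gp q u v (e q a)) (e q b)" if "a \<in> {1..7}" "b \<in> {1..7}" for u v a b
    by (rule g2_stabilizer_instanton(1)[OF curvature_plus_skew[OF q] g2_stab[OF q] that])
qed

text \<open>The antisymmetric part is the image under Theta of the contraction of dH with Theta,
  which vanishes because the curvature of nabla^+ takes values in the Lie algebra of G_2.\<close>

lemma g2_dH_symmetric:
  assumes q: "q \<in> V" and b: "b \<in> {1..7}" and c: "c \<in> {1..7}"
  shows "S3 {1..7} (\<lambda>v w x. W7 [v,w,x,b]) (\<lambda>v w x. ext_d \<kappa> (H \<kappa>) q [e q c, e q v, e q w, e q x]) =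
    S3 {1..7} (\<lambda>v w x. W7 [v,w,x,c]) (\<lambda>v w x. ext_d \<kappa> (H \<kappa>) q [e q b, e q v, e q w, e q x])"
proof -
  have z: "S3 {1..7} (\<lambda>v w x. Th [v,w,x]) (\<lambda>v w x. ext_d \<kappa> (H \<kappa>) q [e q i, e q v, e q w, e q x]) = 0" if i: "i \<in> {1..7}" for i
    unfolding ext_d_H[OF q]
  proof (rule heterotic_point.dH_contraction_zero[OF g2_heterotic_point[OF q], unfolded n7, OF Th_skew i])
    fix v :: nat assume v: "v \<in> {1..7}"
    show "(\<Sum>w\<in>{1..7}. \<Sum>x\<in>{1..7}. Th [w,x,v] * gq q (curvature \<kappa> Gp q (e q i) (e q v) (e q w)) (e q x)) = 0"
      by (rule g2_stabilizer_instanton(2)[OF curvature_plus_skew[OF q] g2_stab[OF q] v])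
  next
    show "S3 {1..7} (\<lambda>v w x. Th [v,w,x]) (\<lambda>v w x. nab \<kappa> \<Gamma> (H \<kappa>) q (e q i) [e q v, e q w, e q x])
      - 3/2 * S3 {1..7} (\<lambda>v w x. Th [v,w,x]) (\<lambda>v w x. \<Sum>s\<in>{1..7}. H \<kappa> q [e q i, e q v, e q s] * H \<kappa> q [e q w, e q x, e q s]) = 0"
      by (rule no_dilaton[OF q Th_skew, unfolded n7, OF g2_parallel(1)[OF q] g2_HTh i])
  qed
  have sk: "skew 4 (\<lambda>K. ext_d \<kappa> (H \<kappa>) q (map (e q) K))"
  proof (rule skewI_adjacent)
    fix xs zs :: "nat list" and y x assume l: "Suc (Suc (length xs + length zs)) = 4"
    have n1: "nab \<kappa> \<Gamma> (H \<kappa>) q u [v,w,z] = - nab \<kappa> \<Gamma> (H \<kappa>) q u [w,v,z]" for u v w z by (rule nab_H_alt(1)[OF q])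
    have n2: "nab \<kappa> \<Gamma> (H \<kappa>) q u [v,w,z] = - nab \<kappa> \<Gamma> (H \<kappa>) q u [v,z,w]" for u v w z by (rule nab_H_alt(2)[OF q])
    consider a b where "xs = []" "zs = [a,b]" | a b where "xs = [a]" "zs = [b]" | a b where "xs = [a,b]" "zs = []"
    proof -
      have "length xs \<le> 2" using l by linarith
      then consider "length xs = 0" "length zs = 2" | "length xs = 1" "length zs = 1" | "length xs = 2" "length zs = 0"
        using l by linarith
      then show ?thesis by cases (auto simp: numeral_2_eq_2 length_Suc_conv intro: that)
    qed
    then show "ext_d \<kappa> (H \<kappa>) q (map (e q) (xs @ y # x # zs)) = - ext_d \<kappa> (H \<kappa>) q (map (e q) (xs @ x # y # zs))"
    proof cases
      case (1 a b)
      then show ?thesis using n1[of "e q a" "e q y" "e q x" "e q b"] n1[of "e q b" "e q y" "e q x" "e q a"]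
        by (simp add: ext_d_H[OF q])
    next
      case (2 a b)
      then show ?thesis using n1[of "e q a" "e q y" "e q x" "e q b"] n2[of "e q b" "e q a" "e q y" "e q x"]
        by (simp add: ext_d_H[OF q])
    next
      case (3 a b)
      then show ?thesis using n2[of "e q a" "e q b" "e q y" "e q x"] n2[of "e q b" "e q a" "e q y" "e q x"]
        by (simp add: ext_d_H[OF q])
    qed
  qed
  have "S3 {1..7} (\<lambda>v w x. W7 [v,w,x,c]) (\<lambda>v w x. ext_d \<kappa> (H \<kappa>) q (map (e q) [b,v,w,x]))
      - S3 {1..7} (\<lambda>v w x. W7 [v,w,x,b]) (\<lambda>v w x. ext_d \<kappa> (H \<kappa>) q (map (e q) [c,v,w,x]))
    = (\<Sum>i=1..7. S3 {1..7} (\<lambda>v w x. Th [v,w,x]) (\<lambda>v w x. ext_d \<kappa> (H \<kappa>) q (map (e q) [i,v,w,x])) * Th [i,b,c])"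
    by (rule contraction_antisym_part[OF sk b c])
  also have "\<dots> = 0" by (intro sum.neutral ballI) (simp only: list.map z mult_zero_left)
  finally show ?thesis by simp
qed

end

end

section \<open>The equivalence in dimensions 7 and 8\<close>

theorem theorem4p1:
  fixes \<A> :: "('m::{t2_space, second_countable_topology}, 'a::euclidean_space) chart set"
    and g :: "('m, 'a) chart \<Rightarrow> 'm \<Rightarrow> 'a \<Rightarrow> 'a \<Rightarrow> real"
    and \<Theta> \<Phi> H :: "('m, 'a) chart \<Rightarrow> 'm \<Rightarrow> 'a list \<Rightarrow> real"
    and \<phi> :: "'m \<Rightarrow> real"
    and J :: "'j set" and U :: "'j \<Rightarrow> 'm set"
    and t :: "'j \<Rightarrow> 'j \<Rightarrow> 'm \<Rightarrow> 'f \<Rightarrow> 'f::euclidean_space"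
    and h :: "'j \<Rightarrow> 'm \<Rightarrow> 'f \<Rightarrow> 'f \<Rightarrow> real"
    and A :: "('m, 'a) chart \<Rightarrow> 'j \<Rightarrow> 'm \<Rightarrow> 'a \<Rightarrow> 'f \<Rightarrow> 'f"
    and LC N :: "('m, 'a) chart \<Rightarrow> ('m, 'a) chart \<Rightarrow> 'm \<Rightarrow> 'a \<Rightarrow> 'a \<Rightarrow> 'a"
    and \<alpha>' :: real
  assumes "smooth_atlas \<A>"
    and "levi_civita \<A> g LC"
    and "smooth_fun \<A> UNIV \<phi>"
    and "smooth_form \<A> 3 H"
    and "vector_bundle \<A> J U t"
    and "fibre_metric \<A> J U t h"
    and "metric_connection \<A> J U t h A"
    and "metric_connection_TM \<A> g N"
    and "\<alpha>' > 0"
    and "anomaly_cancellation \<A> g H N J U h A \<alpha>'"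
  shows
    "(DIM('a) = 7 \<and> G2_structure \<A> g \<Theta> \<and> G2_Killing_spinor_equations \<A> g \<Theta> \<phi> H J U A \<longrightarrow>
        (Einstein_equation \<A> g LC \<phi> H N J U h A \<alpha>' \<longleftrightarrow> G2_curvature_identity \<A> g \<Theta> N) \<and>
        (G2_instanton_TM \<A> g \<Theta> N \<longrightarrow> G2_curvature_identity \<A> g \<Theta> N)) \<and>
     (DIM('a) = 8 \<and> Spin7_structure \<A> g \<Phi> \<and> Spin7_Killing_spinor_equations \<A> g \<Phi> \<phi> H J U A \<longrightarrow>
        (Einstein_equation \<A> g LC \<phi> H N J U h A \<alpha>' \<longleftrightarrow> Spin7_curvature_identity \<A> g \<Phi> N) \<and>
        (Spin7_instanton_TM \<A> g \<Phi> N \<longrightarrow> Spin7_curvature_identity \<A> g \<Phi> N))"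
proof -
  note a = assms
  have core: "heterotic \<A> g H \<phi> J U t h A LC N \<alpha>'" if "riemannian_metric \<A> g"
    using a that by (simp add: heterotic_def)
  show ?thesis
  proof (intro conjI impI)
    assume G: "DIM('a) = 7 \<and> G2_structure \<A> g \<Theta> \<and> G2_Killing_spinor_equations \<A> g \<Theta> \<phi> H J U A"
    then have n7: "DIM('a) = 7" and GS: "G2_structure \<A> g \<Theta>" and K: "G2_Killing_spinor_equations \<A> g \<Theta> \<phi> H J U A" by simp_all
    from GS have metric: "riemannian_metric \<A> g" and S: "smooth_form \<A> 3 \<Theta>" by (simp_all add: G2_structure_def)
    interpret heterotic \<A> g H \<phi> J U t h A LC N \<alpha>' by (rule core[OF metric])
    let ?w = "\<lambda>\<kappa> e q. hodge (g \<kappa> q) (e q) 3 (\<Theta> \<kappa> q)"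
    have cover: "\<exists>V e. p \<in> V \<and> G2_frame \<A> g \<Theta> \<kappa> V e" if "\<kappa> \<in> \<A>" "p \<in> fst \<kappa>" for \<kappa> p
      using GS that unfolding G2_structure_def by blast
    note fr = riem_frameI[of G2_form 3 \<Theta>]
    have ad: "\<Theta> \<kappa> q vs = G2_form (g \<kappa> q) (e q) vs" if "G2_frame \<A> g \<Theta> \<kappa> V e" "q \<in> V" "length vs = 3" for \<kappa> V e q vs
      using that unfolding adapted_frame_def by blast
    have K1: "length vs = 5 \<Longrightarrow> ext_d \<kappa> (\<lambda>q. hodge (g \<kappa> q) (e q) 3 (\<Theta> \<kappa> q)) q vs =
             wedge 1 4 (Lee7 g \<Theta> \<kappa> e q) (hodge (g \<kappa> q) (e q) 3 (\<Theta> \<kappa> q)) vs"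
      and K2: "length vs = 7 \<Longrightarrow> wedge 4 3 (ext_d \<kappa> (\<Theta> \<kappa>) q) (\<Theta> \<kappa> q) vs = 0"
      and K3: "length vs = 1 \<Longrightarrow> Lee7 g \<Theta> \<kappa> e q vs = 2 * d_fun \<kappa> \<phi> q vs"
      and K4: "length vs = 3 \<Longrightarrow> H \<kappa> q vs = - hodge (g \<kappa> q) (e q) 4 (ext_d \<kappa> (\<Theta> \<kappa>) q) vs
             + 2 * hodge (g \<kappa> q) (e q) 4 (wedge 1 3 (d_fun \<kappa> \<phi> q) (\<Theta> \<kappa> q)) vs"
      if "G2_frame \<A> g \<Theta> \<kappa> V e" "q \<in> V" for \<kappa> V e q vs
      using K[unfolded G2_Killing_spinor_equations_def, THEN conjunct1, rule_format, OF that] by blast+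
    have GI: "instanton_at (?w \<kappa> e q) (e q) (curvature \<kappa> (A \<kappa> j) q)"
      if "G2_frame \<A> g \<Theta> \<kappa> V e" "j \<in> J" "q \<in> V \<inter> U j" for \<kappa> V e j q
      using K[unfolded G2_Killing_spinor_equations_def, THEN conjunct2] that unfolding G2_instanton_def by blast
    have w: "?w \<kappa> e q (map (e q) K) = W7 K" if F: "G2_frame \<A> g \<Theta> \<kappa> V e" and "q \<in> V" "length K = 4" "set K \<subseteq> {1..DIM('a)}" for \<kappa> V e q K
      by (rule riem_frame.g2_star3[OF fr[OF F] n7 phi S ad[OF F] K1[OF F] K2[OF F] K3[OF F] K4[OF F]]) (use that n7 in simp_all)
    have hp: "\<exists>R. heterotic_point DIM('a) W7 (\<lambda>a b c. H \<kappa> q [e q a, e q b, e q c])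
      (\<lambda>u a b c. nab \<kappa> (LC \<kappa> \<kappa>) (H \<kappa>) q (e q u) [e q a, e q b, e q c])
      (\<lambda>i j k l. g \<kappa> q (curvature \<kappa> (LC \<kappa> \<kappa>) q (e q i) (e q j) (e q k)) (e q l)) R (\<lambda>i. cderiv \<kappa> \<phi> q (e q i))
      (\<lambda>i j. hessian \<kappa> (LC \<kappa> \<kappa>) \<phi> q (e q i) (e q j))" if F: "G2_frame \<A> g \<Theta> \<kappa> V e" and q: "q \<in> V" for \<kappa> V e q
      by (rule exI, rule riem_frame.g2_heterotic_point[OF fr[OF F] n7 phi S ad[OF F] K1[OF F] K2[OF F] K3[OF F] K4[OF F] q])
    have hsym: "S3 {1..DIM('a)} (\<lambda>v w x. W7 [v,w,x,b]) (\<lambda>v w x. ext_d \<kappa> (H \<kappa>) q [e q c, e q v, e q w, e q x]) =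
      S3 {1..DIM('a)} (\<lambda>v w x. W7 [v,w,x,c]) (\<lambda>v w x. ext_d \<kappa> (H \<kappa>) q [e q b, e q v, e q w, e q x])"
      if F: "G2_frame \<A> g \<Theta> \<kappa> V e" and q: "q \<in> V" and bc: "b \<in> {1..DIM('a)}" "c \<in> {1..DIM('a)}" for \<kappa> V e q b c
      using riem_frame.g2_dH_symmetric[OF fr[OF F] n7 phi S ad[OF F] K1[OF F] K2[OF F] K3[OF F] K4[OF F] q] bc unfolding n7 by blast
    show "Einstein_equation \<A> g LC \<phi> H N J U h A \<alpha>' \<longleftrightarrow> G2_curvature_identity \<A> g \<Theta> N"
      unfolding G2_curvature_identity_def
      by (rule heterotic_equivalence[where Fr = "G2_frame \<A> g \<Theta>" and w = ?w and W = W7])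
        (fact cover fr w W7_skew GI hp hsym)+
    assume I: "G2_instanton_TM \<A> g \<Theta> N"
    have RI: "instanton_at (?w \<kappa> e p) (e p) (curvature \<kappa> (N \<kappa> \<kappa>) p)" if F: "G2_frame \<A> g \<Theta> \<kappa> V e" and "p \<in> V" for \<kappa> V e p
    proof -
      \<comment> \<open>The trivialisations of the tangent bundle are the charts, so
        \<open>\<kappa>\<close> itself serves as the trivialisation.\<close>
      have "\<kappa> \<in> \<A>" "p \<in> V \<inter> fst \<kappa>" using that by (auto simp: adapted_frame_def)
      then show ?thesis using I F unfolding G2_instanton_def by blast
    qed
    show "G2_curvature_identity \<A> g \<Theta> N"
      unfolding G2_curvature_identity_def
    proof (intro allI impI ballI)
      fix \<kappa> V e p assume F: "G2_frame \<A> g \<Theta> \<kappa> V e" and p: "p \<in> V"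
      show "curvature_identity_at (g \<kappa> p) (\<lambda>vs. - ?w \<kappa> e p vs) (e p) (curvature \<kappa> (N \<kappa> \<kappa>) p)"
        by (rule instanton_curvature_identity[where Fr = "G2_frame \<A> g \<Theta>" and w = ?w and W = W7 and V = V])
          (fact cover fr w W7_skew GI hp hsym RI F p)+
    qed
  next
    assume G: "DIM('a) = 8 \<and> Spin7_structure \<A> g \<Phi> \<and> Spin7_Killing_spinor_equations \<A> g \<Phi> \<phi> H J U A"
    then have n8: "DIM('a) = 8" and GS: "Spin7_structure \<A> g \<Phi>" and K: "Spin7_Killing_spinor_equations \<A> g \<Phi> \<phi> H J U A" by simp_all
    from GS have metric: "riemannian_metric \<A> g" and S: "smooth_form \<A> 4 \<Phi>" by (simp_all add: Spin7_structure_def)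
    interpret heterotic \<A> g H \<phi> J U t h A LC N \<alpha>' by (rule core[OF metric])
    let ?w = "\<lambda>\<kappa> (e :: 'm \<Rightarrow> nat \<Rightarrow> 'a) q. \<Phi> \<kappa> q"
    have cover: "\<exists>V e. p \<in> V \<and> Spin7_frame \<A> g \<Phi> \<kappa> V e" if "\<kappa> \<in> \<A>" "p \<in> fst \<kappa>" for \<kappa> p
      using GS that unfolding Spin7_structure_def by blast
    note fr = riem_frameI[of Spin7_form 4 \<Phi>]
    have ad: "\<Phi> \<kappa> q vs = Spin7_form (g \<kappa> q) (e q) vs" if "Spin7_frame \<A> g \<Phi> \<kappa> V e" "q \<in> V" "length vs = 4" for \<kappa> V e q vs
      using that unfolding adapted_frame_def by blast
    have K1: "length vs = 1 \<Longrightarrow> Lee8 g \<Phi> \<kappa> e q vs = 12/7 * d_fun \<kappa> \<phi> q vs"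
      and K2: "length vs = 3 \<Longrightarrow> H \<kappa> q vs = hodge (g \<kappa> q) (e q) 5 (ext_d \<kappa> (\<Phi> \<kappa>) q) vs
             - 2 * hodge (g \<kappa> q) (e q) 5 (wedge 1 4 (d_fun \<kappa> \<phi> q) (\<Phi> \<kappa> q)) vs"
      if "Spin7_frame \<A> g \<Phi> \<kappa> V e" "q \<in> V" for \<kappa> V e q vs
      using K[unfolded Spin7_Killing_spinor_equations_def, THEN conjunct1, rule_format, OF that] by blast+
    have GI: "instanton_at (?w \<kappa> e q) (e q) (curvature \<kappa> (A \<kappa> j) q)"
      if "Spin7_frame \<A> g \<Phi> \<kappa> V e" "j \<in> J" "q \<in> V \<inter> U j" for \<kappa> V e j q
      using K[unfolded Spin7_Killing_spinor_equations_def, THEN conjunct2] that unfolding Spin7_instanton_def by blast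
    have w: "?w \<kappa> e q (map (e q) K) = Phi K" if F: "Spin7_frame \<A> g \<Phi> \<kappa> V e" and "q \<in> V" "length K = 4" "set K \<subseteq> {1..DIM('a)}" for \<kappa> V e q K
      by (rule riem_frame.spin7_comp[OF fr[OF F] n8 phi S ad[OF F] K1[OF F] K2[OF F]]) (use that n8 in simp_all)
    have hp: "\<exists>R. heterotic_point DIM('a) Phi (\<lambda>a b c. H \<kappa> q [e q a, e q b, e q c])
      (\<lambda>u a b c. nab \<kappa> (LC \<kappa> \<kappa>) (H \<kappa>) q (e q u) [e q a, e q b, e q c])
      (\<lambda>i j k l. g \<kappa> q (curvature \<kappa> (LC \<kappa> \<kappa>) q (e q i) (e q j) (e q k)) (e q l)) R (\<lambda>i. cderiv \<kappa> \<phi> q (e q i))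
      (\<lambda>i j. hessian \<kappa> (LC \<kappa> \<kappa>) \<phi> q (e q i) (e q j))" if F: "Spin7_frame \<A> g \<Phi> \<kappa> V e" and q: "q \<in> V" for \<kappa> V e q
      by (rule exI, rule riem_frame.spin7_heterotic_point[OF fr[OF F] n8 phi S ad[OF F] K1[OF F] K2[OF F] q])
    have hsym: "S3 {1..DIM('a)} (\<lambda>v w x. Phi [v,w,x,b]) (\<lambda>v w x. ext_d \<kappa> (H \<kappa>) q [e q c, e q v, e q w, e q x]) =
      S3 {1..DIM('a)} (\<lambda>v w x. Phi [v,w,x,c]) (\<lambda>v w x. ext_d \<kappa> (H \<kappa>) q [e q b, e q v, e q w, e q x])"
      if F: "Spin7_frame \<A> g \<Phi> \<kappa> V e" and q: "q \<in> V" and bc: "b \<in> {1..DIM('a)}" "c \<in> {1..DIM('a)}" for \<kappa> V e q b c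
      using riem_frame.spin7_dH_symmetric[OF fr[OF F] n8 phi S ad[OF F] K1[OF F] K2[OF F] q] bc unfolding n8 by blast
    show "Einstein_equation \<A> g LC \<phi> H N J U h A \<alpha>' \<longleftrightarrow> Spin7_curvature_identity \<A> g \<Phi> N"
      unfolding Spin7_curvature_identity_def
      by (rule heterotic_equivalence[where Fr = "Spin7_frame \<A> g \<Phi>" and w = ?w and W = Phi])
        (fact cover fr w Phi_skew GI hp hsym)+
    assume I: "Spin7_instanton_TM \<A> g \<Phi> N"
    have RI: "instanton_at (?w \<kappa> e p) (e p) (curvature \<kappa> (N \<kappa> \<kappa>) p)" if F: "Spin7_frame \<A> g \<Phi> \<kappa> V e" and "p \<in> V" for \<kappa> V e p
    proof -
      have "\<kappa> \<in> \<A>" "p \<in> V \<inter> fst \<kappa>" using that by (auto simp: adapted_frame_def)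
      then show ?thesis using I F unfolding Spin7_instanton_def by blast
    qed
    show "Spin7_curvature_identity \<A> g \<Phi> N"
      unfolding Spin7_curvature_identity_def
    proof (intro allI impI ballI)
      fix \<kappa> V e p assume F: "Spin7_frame \<A> g \<Phi> \<kappa> V e" and p: "p \<in> V"
      show "curvature_identity_at (g \<kappa> p) (\<lambda>vs. - ?w \<kappa> e p vs) (e p) (curvature \<kappa> (N \<kappa> \<kappa>) p)"
        by (rule instanton_curvature_identity[where Fr = "Spin7_frame \<A> g \<Phi>" and w = ?w and W = Phi and V = V])
          (fact cover fr w Phi_skew GI hp hsym RI F p)+
    qed
  qed
qed

end
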